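(* Let $X$ be either $\mathcal C(K)$ for a scattered compact Hausdorff space $K$, or a closed linear subspace of $c_0(\Gamma)$ for an arbitrary set $\Gamma$. Then for every Banach space $Y$ with the Radon–Nikod\'ym property and every Lipschitz mapping $f:X\to Y$, the set of points at which $f$ is not Fr\'echet differentiable is $\Gamma$-null in $X$.
   Context: A compact space $K$ is scattered if every nonempty subset of $K$ has an isolated point (in the relative topology). A Banach space $Y$ has the Radon–Nikod\'ym property if every Lipschitz function $\mathbb R\to Y$ is differentiable almost everywhere. Let $T=[0,1]^{\mathbb N}$ with the product topology and product Lebesgue measure $\mathscr L^{\mathbb N}$. $\Gamma(X)$ is the space of continuous $\gamma:T\to X$ having continuous partial derivatives $D_j\gamma$ (one-sided at points whose $j$-th coordinate is $0$ or $1$), with the topology generated by the seminorms $\|\gamma\|_\infty=\sup_{t}\|\gamma(t)\|$ and $\|\gamma\|_k=\sup_t\|D_k\gamma(t)\|$, $k\ge1$. A Borel set $A\subseteq X$ is $\Gamma$-null if $\{\gamma\in\Gamma(X):\mathscr L^{\mathbb N}(\gamma^{-1}(A))=0\}$ is residual in $\Gamma(X)$. (The set of non-differentiability points of $f$ is Borel.) *)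

theory Defs
  imports "HOL-Analysis.Analysis" "HOL-Probability.Probability"
begin

definition scattered_space :: "'k::topological_space itself \<Rightarrow> bool" where
  "scattered_space _ \<longleftrightarrow>
     (\<forall>S::'k set. S \<noteq> {} \<longrightarrow> (\<exists>x\<in>S. \<exists>U. open U \<and> U \<inter> S = {x}))"

definition c0_space :: "('g \<Rightarrow> real) set" where
  "c0_space = {g. \<forall>e>0. finite {i. \<bar>g i\<bar> \<ge> e}}"

definition c0_norm :: "('g \<Rightarrow> real) \<Rightarrow> real" where
  "c0_norm g = (SUP i. \<bar>g i\<bar>)"

definition is_CK_space :: "'x::real_normed_vector itself \<Rightarrow> 'k::t2_space itself \<Rightarrow> bool" where
  "is_CK_space _ _ \<longleftrightarrow>
     (\<exists>J :: 'x \<Rightarrow> ('k \<Rightarrow>\<^sub>C real). linear J \<and> bij J \<and> (\<forall>x. norm (J x) = norm x))"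

text \<open>X is (linearly isometric to) a closed linear subspace of c_0(G), G = UNIV :: 'g set.
  (For a Banach space X the image of a linear isometry is automatically closed.)\<close>
definition is_c0_subspace :: "'x::real_normed_vector itself \<Rightarrow> 'g itself \<Rightarrow> bool" where
  "is_c0_subspace _ _ \<longleftrightarrow>
     (\<exists>J :: 'x \<Rightarrow> ('g \<Rightarrow> real).
        (\<forall>x y i. J (x + y) i = J x i + J y i) \<and> (\<forall>c x i. J (c *\<^sub>R x) i = c * J x i) \<and> (\<forall>x. J x \<in> c0_space)
        \<and> (\<forall>x. c0_norm (J x) = norm x))"

definition RNP :: "'y::banach itself \<Rightarrow> bool" where
  "RNP _ \<longleftrightarrow> (\<forall>f :: real \<Rightarrow> 'y. (\<exists>C. C-lipschitz_on UNIV f) \<longrightarrow>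
                  (AE t in lborel. f differentiable (at t)))"

definition cubeT :: "(nat \<Rightarrow> real) set" where
  "cubeT = {t. \<forall>i. t i \<in> {0..1}}"

definition lebN :: "(nat \<Rightarrow> real) measure" where
  "lebN = (\<Pi>\<^sub>M i\<in>(UNIV::nat set). restrict_space lborel {0..1::real})"

definition pderiv :: "((nat \<Rightarrow> real) \<Rightarrow> 'x::real_normed_vector) \<Rightarrow> nat \<Rightarrow> (nat \<Rightarrow> real) \<Rightarrow> 'x" where
  "pderiv \<gamma> j t = vector_derivative (\<lambda>s. \<gamma> (t(j := s))) (at (t j) within {0..1})"

definition GammaX :: "((nat \<Rightarrow> real) \<Rightarrow> 'x::real_normed_vector) set" where
  "GammaX = {\<gamma>. continuous_on cubeT \<gamma> \<and> (\<forall>t. t \<notin> cubeT \<longrightarrow> \<gamma> t = 0) \<and>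
     (\<forall>j. (\<forall>t\<in>cubeT. ((\<lambda>s. \<gamma> (t(j := s))) has_vector_derivative pderiv \<gamma> j t)
                         (at (t j) within {0..1}))
          \<and> continuous_on cubeT (pderiv \<gamma> j))}"

definition sup_sn :: "((nat \<Rightarrow> real) \<Rightarrow> 'x::real_normed_vector) \<Rightarrow> real" where
  "sup_sn \<gamma> = (SUP t\<in>cubeT. norm (\<gamma> t))"

definition der_sn :: "nat \<Rightarrow> ((nat \<Rightarrow> real) \<Rightarrow> 'x::real_normed_vector) \<Rightarrow> real" where
  "der_sn j \<gamma> = (SUP t\<in>cubeT. norm (pderiv \<gamma> j t))"

definition gnbhd :: "((nat \<Rightarrow> real) \<Rightarrow> 'x::real_normed_vector) \<Rightarrow> nat \<Rightarrow> real
                      \<Rightarrow> ((nat \<Rightarrow> real) \<Rightarrow> 'x) set" where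
  "gnbhd \<gamma> n e = {\<eta>\<in>GammaX. sup_sn (\<eta> - \<gamma>) < e \<and> (\<forall>j<n. der_sn j (\<eta> - \<gamma>) < e)}"

definition gamma_open :: "((nat \<Rightarrow> real) \<Rightarrow> 'x::real_normed_vector) set \<Rightarrow> bool" where
  "gamma_open U \<longleftrightarrow> U \<subseteq> GammaX \<and> (\<forall>\<gamma>\<in>U. \<exists>n e. e > 0 \<and> gnbhd \<gamma> n e \<subseteq> U)"

definition gamma_dense :: "((nat \<Rightarrow> real) \<Rightarrow> 'x::real_normed_vector) set \<Rightarrow> bool" where
  "gamma_dense D \<longleftrightarrow> D \<subseteq> GammaX \<and>
     (\<forall>\<gamma>\<in>GammaX. \<forall>n e. e > 0 \<longrightarrow> gnbhd \<gamma> n e \<inter> D \<noteq> {})"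

definition gamma_residual :: "((nat \<Rightarrow> real) \<Rightarrow> 'x::real_normed_vector) set \<Rightarrow> bool" where
  "gamma_residual S \<longleftrightarrow> S \<subseteq> GammaX \<and>
     (\<exists>U :: nat \<Rightarrow> ((nat \<Rightarrow> real) \<Rightarrow> 'x) set.
        (\<forall>k. gamma_open (U k) \<and> gamma_dense (U k)) \<and> \<Inter>(range U) \<subseteq> S)"

definition gamma_null :: "'x::real_normed_vector set \<Rightarrow> bool" where
  "gamma_null A \<longleftrightarrow> A \<in> sets borel \<and>
     gamma_residual {\<gamma>\<in>(GammaX :: ((nat \<Rightarrow> real) \<Rightarrow> 'x) set).
                       {t\<in>space lebN. \<gamma> t \<in> A} \<in> null_sets lebN}"

end

(* A set Q of directions is "small" if sets that are porous along Q are Gamma-null; given that the unit ball is small, Q is "good" if Lipschitz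
   maps are Gamma-almost everywhere differentiable, uniformly along Q and regularly. Segments are small and good by
   Fubini and the one-dimensional case on coordinate lines, and both classes are stable under sums and under
   approximation modulo "tails", i.e. directions that are small on a given set of functionals and vanish at infinity
   of the norming set. For tails one adds to a typical surface many disjoint bumps in new coordinates: a functional
   sees at most one family of them with full strength, so the perturbation stays small, while the surface avoids a
   porous set on a set of fixed measure, respectively acquires large derivatives in infinitely many directions spanning
   a copy of c_0, which the Radon-Nikodym property of Y forbids. In C(K) with K scattered (by isolated points and
   compactness) and in subspaces of c_0 (by finite nets), sums and tails lead from segments to the unit ball. *)
theory Submission
 imports Defs
begin


section \<open>The function space over the Hilbert cube\<close>

text \<open>The obstacle is accumulation: a perturbation has to be small in \<open>n\<close> partial
  derivatives, yet many are needed to treat a set of prescribed measure. Two devices bound the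
  total. The share of the cube reached by one round is \<open>stage_ratio\<close>, which depends
  only on \<open>n\<close>, a slope bound and tolerances, so the number of rounds is known in
  advance. And measured by a norming set of functionals, successive displacements behave like
  disjoint blocks of c_0. For porosity the contradiction is finite: the treated set would exceed
  measure 1. For differentiability no finite stage is contradictory; a limit surface is needed,
  generic for every direction used on the way, with a point at which infinitely many of these
  directions have derivatives bounded below while all signed sums stay bounded. Regularity
  accompanies differentiability because derivatives along single directions need not add up. Neither
  separability of the spaces nor measurability of the sets is available. Hence outer measure, a
  local form of the category theorem, and thresholds made uniform by exhausting with increasing
  unions.\<close>

lemma cubeT_D: "t \<in> cubeT \<Longrightarrow> 0 \<le> t i \<and> t i \<le> 1"
 by (auto simp: cubeT_def)

lemma cubeT_upd: "t \<in> cubeT \<Longrightarrow> 0 \<le> s \<Longrightarrow> s \<le> 1 \<Longrightarrow> t(j := s) \<in> cubeT"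
 by (auto simp: cubeT_def)

lemma zero_in_cubeT: "(\<lambda>_. 0) \<in> cubeT"
 by (auto simp: cubeT_def)

lemma cubeT_eq_PiE: "cubeT = (\<Pi>\<^sub>E i\<in>UNIV. {0..1})"
 by (auto simp: cubeT_def PiE_def)

lemma compact_cubeT: "compact cubeT"
proof -
 have "compactin (product_topology (\<lambda>i::nat. euclidean) UNIV) (\<Pi>\<^sub>E i\<in>UNIV. {0..1::real})"
  by (subst compactin_PiE) auto
 then show ?thesis
  by (simp add: cubeT_eq_PiE euclidean_product_topology)
qed

text \<open>\<open>GammaX\<close> asks surfaces to vanish off the cube, so that a surface is
  determined by its values there; \<open>ext\<close> brings formulas into this normal form.\<close>

definition ext :: "((nat \<Rightarrow> real) \<Rightarrow> 'x::real_normed_vector) \<Rightarrow> (nat \<Rightarrow> real) \<Rightarrow> 'x" where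
 "ext g t = (if t \<in> cubeT then g t else 0)"

section \<open>Calculus of surfaces\<close>

lemma pderiv_eqI:
 assumes "t \<in> cubeT" "((\<lambda>s. g (t(j := s))) has_vector_derivative d) (at (t j) within {0..1})"
 shows "pderiv g j t = d"
 unfolding pderiv_def using assms cubeT_D[of t j]
 using vector_derivative_within_cbox[of 0 1 "t j" "\<lambda>s. g (t(j := s))" d] by simp

lemma GammaX_I:
 assumes "continuous_on cubeT g" "\<And>t. t \<notin> cubeT \<Longrightarrow> g t = 0"
  "\<And>j. continuous_on cubeT (D j)"
  "\<And>t j. t \<in> cubeT \<Longrightarrow> ((\<lambda>s. g (t(j := s))) has_vector_derivative D j t) (at (t j) within {0..1})"
 shows "g \<in> GammaX" and "\<And>t j. t \<in> cubeT \<Longrightarrow> pderiv g j t = D j t"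
proof -
 show eq: "\<And>t j. t \<in> cubeT \<Longrightarrow> pderiv g j t = D j t"
  by (rule pderiv_eqI[OF _ assms(4)])
 show "g \<in> GammaX"
  unfolding GammaX_def using assms eq by (auto cong: continuous_on_cong)
qed

lemma GammaX_D:
 assumes "g \<in> GammaX"
 shows "continuous_on cubeT g" "\<And>t. t \<notin> cubeT \<Longrightarrow> g t = 0" "continuous_on cubeT (pderiv g j)"
  "t \<in> cubeT \<Longrightarrow> ((\<lambda>s. g (t(j := s))) has_vector_derivative pderiv g j t) (at (t j) within {0..1})"
 using assms unfolding GammaX_def by auto

lemma GammaX_D_at:
 assumes "g \<in> GammaX" "t \<in> cubeT" "s \<in> {0..1}"
 shows "((\<lambda>s. g (t(j := s))) has_vector_derivative pderiv g j (t(j := s))) (at s within {0..1})"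
 using GammaX_D(4)[OF assms(1) cubeT_upd, of t s j j] assms by simp

lemma GammaX_ext:
 assumes "continuous_on cubeT g" "\<And>j. continuous_on cubeT (D j)"
  "\<And>t j. t \<in> cubeT \<Longrightarrow> ((\<lambda>s. g (t(j := s))) has_vector_derivative D j t) (at (t j) within {0..1})"
 shows "ext g \<in> GammaX" and "\<And>t j. t \<in> cubeT \<Longrightarrow> pderiv (ext g) j t = D j t"
proof -
 have *: "((\<lambda>s. ext g (t(j := s))) has_vector_derivative D j t) (at (t j) within {0..1})"
  if "t \<in> cubeT" for t j
  by (rule has_vector_derivative_transform[OF _ _ assms(3)[OF that]])
   (use that cubeT_D[OF that, of j] in \<open>auto simp: ext_def cubeT_upd\<close>)
 have c: "continuous_on cubeT (ext g)"
  using assms(1) by (rule continuous_on_eq) (auto simp: ext_def)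
 show "ext g \<in> GammaX" "\<And>t j. t \<in> cubeT \<Longrightarrow> pderiv (ext g) j t = D j t"
  by (rule GammaX_I[OF c _ assms(2) *]; simp add: ext_def)+
qed

lemma GammaX_zero: "(\<lambda>_. 0) \<in> GammaX" "t \<in> cubeT \<Longrightarrow> pderiv (\<lambda>_. 0) j t = 0"
 by (rule GammaX_I[where D = "\<lambda>_ _. 0"]; simp)+

lemma GammaX_bounded_linear:
 assumes L: "bounded_linear L" and g: "g \<in> GammaX"
 shows "(\<lambda>t. L (g t)) \<in> GammaX" "t \<in> cubeT \<Longrightarrow> pderiv (\<lambda>t. L (g t)) j t = L (pderiv g j t)"
proof -
 have 1: "continuous_on cubeT (\<lambda>t. L (g t))" "\<And>j. continuous_on cubeT (\<lambda>t. L (pderiv g j t))"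
  by (rule bounded_linear.continuous_on[OF L] GammaX_D(1,3)[OF g])+
 have 2: "\<And>t. t \<notin> cubeT \<Longrightarrow> L (g t) = 0"
  using GammaX_D(2)[OF g] linear_0[OF bounded_linear.linear[OF L]] by simp
 have 3: "\<And>t j. t \<in> cubeT \<Longrightarrow> ((\<lambda>s. L (g (t(j := s)))) has_vector_derivative L (pderiv g j t)) (at (t j) within {0..1})"
  by (rule bounded_linear.has_vector_derivative[OF L GammaX_D(4)[OF g]])
 show "(\<lambda>t. L (g t)) \<in> GammaX" "t \<in> cubeT \<Longrightarrow> pderiv (\<lambda>t. L (g t)) j t = L (pderiv g j t)"
  by (rule GammaX_I[OF 1(1) 2 1(2) 3]; assumption)+
qed

lemmas GammaX_scaleR = GammaX_bounded_linear[OF bounded_linear_scaleR_right]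
lemmas GammaX_scaleR_const = GammaX_bounded_linear[OF bounded_linear_scaleR_left]

lemma GammaX_add:
 assumes g: "g \<in> GammaX" and h: "h \<in> GammaX"
 shows "(\<lambda>t. g t + h t) \<in> GammaX"
  "t \<in> cubeT \<Longrightarrow> pderiv (\<lambda>t. g t + h t) j t = pderiv g j t + pderiv h j t"
proof -
 have 1: "continuous_on cubeT (\<lambda>t. g t + h t)" "\<And>j. continuous_on cubeT (\<lambda>t. pderiv g j t + pderiv h j t)"
  by (rule continuous_on_add GammaX_D(1,3)[OF g] GammaX_D(1,3)[OF h])+
 have 2: "\<And>t. t \<notin> cubeT \<Longrightarrow> g t + h t = 0"
  using GammaX_D(2)[OF g] GammaX_D(2)[OF h] by simp
 have 3: "\<And>t j. t \<in> cubeT \<Longrightarrow> ((\<lambda>s. g (t(j := s)) + h (t(j := s))) has_vector_derivative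
   pderiv g j t + pderiv h j t) (at (t j) within {0..1})"
  by (rule has_vector_derivative_add GammaX_D(4)[OF g] GammaX_D(4)[OF h] | assumption)+
 show "(\<lambda>t. g t + h t) \<in> GammaX"
  "t \<in> cubeT \<Longrightarrow> pderiv (\<lambda>t. g t + h t) j t = pderiv g j t + pderiv h j t"
  by (rule GammaX_I[OF 1(1) 2 1(2) 3]; assumption)+
qed

lemma GammaX_diff:
 assumes g: "g \<in> GammaX" and h: "h \<in> GammaX"
 shows "(\<lambda>t. g t - h t) \<in> GammaX"
  "t \<in> cubeT \<Longrightarrow> pderiv (\<lambda>t. g t - h t) j t = pderiv g j t - pderiv h j t"
 using GammaX_add[OF g GammaX_scaleR(1)[OF h, of "-1"]] GammaX_scaleR(2)[OF h, of t "-1"] by auto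

lemma GammaX_mult:
 fixes g h :: "(nat \<Rightarrow> real) \<Rightarrow> real"
 assumes g: "g \<in> GammaX" and h: "h \<in> GammaX"
 shows "(\<lambda>t. g t * h t) \<in> GammaX"
  "t \<in> cubeT \<Longrightarrow> pderiv (\<lambda>t. g t * h t) j t = g t * pderiv h j t + pderiv g j t * h t"
proof -
 have 1: "continuous_on cubeT (\<lambda>t. g t * h t)"
   "\<And>j. continuous_on cubeT (\<lambda>t. g t * pderiv h j t + pderiv g j t * h t)"
  by (rule continuous_on_add continuous_on_mult GammaX_D(1,3)[OF g] GammaX_D(1,3)[OF h])+
 have 2: "\<And>t. t \<notin> cubeT \<Longrightarrow> g t * h t = 0"
  using GammaX_D(2)[OF g] by simp
 have 3: "((\<lambda>s. g (t(j := s)) * h (t(j := s))) has_vector_derivative g t * pderiv h j t + pderiv g j t * h t)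
   (at (t j) within {0..1})" if "t \<in> cubeT" for t j
  using has_vector_derivative_mult[OF GammaX_D(4)[OF g that, of j] GammaX_D(4)[OF h that, of j]]
  by simp
 show "(\<lambda>t. g t * h t) \<in> GammaX"
  "t \<in> cubeT \<Longrightarrow> pderiv (\<lambda>t. g t * h t) j t = g t * pderiv h j t + pderiv g j t * h t"
  by (rule GammaX_I[OF 1(1) 2 1(2) 3]; assumption)+
qed

lemma GammaX_sum:
 assumes "finite F" "\<And>q. q \<in> F \<Longrightarrow> g q \<in> GammaX"
 shows "(\<lambda>t. \<Sum>q\<in>F. g q t) \<in> GammaX \<and>
  (\<forall>t\<in>cubeT. \<forall>j. pderiv (\<lambda>t. \<Sum>q\<in>F. g q t) j t = (\<Sum>q\<in>F. pderiv (g q) j t))"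
 using assms
 by (induction F rule: finite_induct) (auto simp: GammaX_zero GammaX_add)

lemma continuous_on_coord: "continuous_on S (\<lambda>t. (t::nat \<Rightarrow> real) i)"
 by (rule continuous_on_subset[OF continuous_on_product_coordinates]) simp

lemma GammaX_coord:
 assumes "\<And>x. (p has_real_derivative p' x) (at x)" "continuous_on UNIV p'"
 shows "ext (\<lambda>t. p (t i)) \<in> GammaX"
  "t \<in> cubeT \<Longrightarrow> pderiv (ext (\<lambda>t. p (t i))) j t = (if j = i then p' (t i) else 0)"
proof -
 have "continuous_on UNIV p"
  using assms(1) by (meson DERIV_isCont continuous_at_imp_continuous_on)
 then have c: "continuous_on cubeT (\<lambda>t. p (t i))"
  by (rule continuous_on_compose2) (auto intro: continuous_on_coord)
 have d: "continuous_on cubeT (\<lambda>t. if j = i then p' (t i) else 0)" for j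
  by (cases "j = i") (auto intro!: continuous_on_compose2[OF assms(2)] continuous_on_coord)
 have e: "((\<lambda>s. p ((t(j := s)) i)) has_vector_derivative (if j = i then p' (t i) else 0)) (at (t j) within {0..1})"
  for t j
  using has_field_derivative_at_within[OF assms(1)[of "t i"]]
  by (cases "j = i") (auto simp: has_real_derivative_iff_has_vector_derivative)
 show "ext (\<lambda>t. p (t i)) \<in> GammaX"
  "t \<in> cubeT \<Longrightarrow> pderiv (ext (\<lambda>t. p (t i))) j t = (if j = i then p' (t i) else 0)"
  by (rule GammaX_ext[OF c d e]; assumption)+
qed

section \<open>The topology of the function space and Baire category in it\<close>

lemma GammaX_bounded:
 assumes "g \<in> GammaX"
 shows "bdd_above ((\<lambda>t. norm (g t)) ` cubeT)" "bdd_above ((\<lambda>t. norm (pderiv g j t)) ` cubeT)"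
 by (intro bounded_imp_bdd_above compact_imp_bounded compact_continuous_image
   continuous_on_norm GammaX_D assms compact_cubeT)+

lemma sup_sn_bound:
 assumes "g \<in> GammaX" "t \<in> cubeT"
 shows "norm (g t) \<le> sup_sn g" "norm (pderiv g j t) \<le> der_sn j g"
 unfolding sup_sn_def der_sn_def
 using GammaX_bounded[OF assms(1)] by (auto intro!: cSUP_upper simp: assms(2))

lemma sup_sn_least:
 "(\<And>t. t \<in> cubeT \<Longrightarrow> norm (g t) \<le> b) \<Longrightarrow> sup_sn g \<le> b"
 "(\<And>t. t \<in> cubeT \<Longrightarrow> norm (pderiv g j t) \<le> b) \<Longrightarrow> der_sn j g \<le> b"
 unfolding sup_sn_def der_sn_def
 by (rule cSUP_least; use zero_in_cubeT in auto)+

text \<open>A pointwise, non-strict form of the basic neighbourhoods \<open>gnbhd\<close>: it adds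
  up under the triangle inequality, passes to limits and avoids suprema. By
  \<open>gamma_open_iff\<close> it describes the same topology.\<close>

definition close :: "nat \<Rightarrow> real \<Rightarrow> ((nat \<Rightarrow> real) \<Rightarrow> 'x::real_normed_vector) \<Rightarrow> ((nat \<Rightarrow> real) \<Rightarrow> 'x) \<Rightarrow> bool" where
 "close n e g h \<longleftrightarrow> (\<forall>t\<in>cubeT. norm (h t - g t) \<le> e \<and> (\<forall>j<n. norm (pderiv h j t - pderiv g j t) \<le> e))"

lemma close_refl: "e \<ge> 0 \<Longrightarrow> close n e g g"
 by (auto simp: close_def)

lemma close_mono: "close n e g h \<Longrightarrow> n' \<le> n \<Longrightarrow> e \<le> e' \<Longrightarrow> close n' e' g h"
 unfolding close_def by (meson less_le_trans order_trans)

lemma close_trans: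
 assumes "close n e g h" "close n e' h k"
 shows "close n (e + e') g k"
 unfolding close_def
proof (intro ballI conjI allI impI)
 fix t :: "nat \<Rightarrow> real" assume t: "t \<in> cubeT"
 have "norm (h t - g t) \<le> e" "norm (k t - h t) \<le> e'"
  using assms t by (auto simp: close_def)
 then show "norm (k t - g t) \<le> e + e'"
  using norm_triangle_ineq[of "k t - h t" "h t - g t"] by simp
 fix j assume "j < n"
 then have "norm (pderiv h j t - pderiv g j t) \<le> e" "norm (pderiv k j t - pderiv h j t) \<le> e'"
  using assms t by (auto simp: close_def)
 then show "norm (pderiv k j t - pderiv g j t) \<le> e + e'"
  using norm_triangle_ineq[of "pderiv k j t - pderiv h j t" "pderiv h j t - pderiv g j t"] by simp
qed

lemma fun_diff_eq: "g - h = (\<lambda>t. g t - h t)"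
 by auto

lemma gnbhd_imp_close:
 assumes "g \<in> GammaX" "h \<in> gnbhd g n e"
 shows "\<exists>e'<e. close n e' g h"
proof -
 have h: "h \<in> GammaX" and s: "sup_sn (h - g) < e" and d: "\<forall>j<n. der_sn j (h - g) < e"
  using assms(2) by (auto simp: gnbhd_def)
 have hg: "h - g \<in> GammaX"
  unfolding fun_diff_eq by (rule GammaX_diff(1)[OF h assms(1)])
 \<comment> \<open>Finitely many strict inequalities have a common bound still below
   \<open>e\<close>; this slack makes \<open>gball\<close> open.\<close>
 define e' where "e' = Max (insert (sup_sn (h - g)) ((\<lambda>j. der_sn j (h - g)) ` {..<n}))"
 have "e' < e"
  unfolding e'_def using s d by (subst Max_less_iff) auto
 moreover have "sup_sn (h - g) \<le> e'" "\<forall>j<n. der_sn j (h - g) \<le> e'"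
  unfolding e'_def by auto
 then have "close n e' g h"
  unfolding close_def
 proof (intro ballI conjI allI impI)
  fix t :: "nat \<Rightarrow> real" assume t: "t \<in> cubeT"
  show "norm (h t - g t) \<le> e'"
   using sup_sn_bound(1)[OF hg t] \<open>sup_sn (h - g) \<le> e'\<close> by simp
  fix j assume "j < n"
  then show "norm (pderiv h j t - pderiv g j t) \<le> e'"
   using sup_sn_bound(2)[OF hg t, of j] \<open>\<forall>j<n. der_sn j (h - g) \<le> e'\<close>
    GammaX_diff(2)[OF h assms(1) t, of j] by (fastforce simp: fun_diff_eq)
 qed
 ultimately show ?thesis by blast
qed

lemma close_imp_gnbhd:
 assumes "g \<in> GammaX" "h \<in> GammaX" "close n e' g h" "e' < e"
 shows "h \<in> gnbhd g n e"
proof -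
 have "sup_sn (h - g) \<le> e'"
  using assms(3) by (intro sup_sn_least) (auto simp: close_def)
 moreover have "der_sn j (h - g) \<le> e'" if "j < n" for j
  using assms(3) GammaX_diff(2)[OF assms(2,1)] that
  by (intro sup_sn_least) (auto simp: close_def fun_diff_eq)
 ultimately show ?thesis
  using assms by (force simp: gnbhd_def)
qed

definition gball :: "((nat \<Rightarrow> real) \<Rightarrow> 'x::real_normed_vector) \<Rightarrow> nat \<Rightarrow> real \<Rightarrow> ((nat \<Rightarrow> real) \<Rightarrow> 'x) set" where
 "gball g n e = {h\<in>GammaX. \<exists>e'<e. close n e' g h}"

lemma gnbhd_eq_gball: "g \<in> GammaX \<Longrightarrow> gnbhd g n e = gball g n e"
 unfolding gball_def using gnbhd_imp_close[of g _ n e] close_imp_gnbhd[of g _ n _ e]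
 by (auto simp: gnbhd_def)

lemma gamma_open_iff:
 "gamma_open U \<longleftrightarrow> U \<subseteq> GammaX \<and> (\<forall>g\<in>U. \<exists>n e. e > 0 \<and> (\<forall>h\<in>GammaX. close n e g h \<longrightarrow> h \<in> U))"
proof
 assume U: "gamma_open U"
 show "U \<subseteq> GammaX \<and> (\<forall>g\<in>U. \<exists>n e. e > 0 \<and> (\<forall>h\<in>GammaX. close n e g h \<longrightarrow> h \<in> U))"
 proof (intro conjI ballI)
  show "U \<subseteq> GammaX" using U by (auto simp: gamma_open_def)
  fix g assume "g \<in> U"
  then obtain n e where "e > 0" "gnbhd g n e \<subseteq> U" "g \<in> GammaX"
   using U unfolding gamma_open_def by blast
  then have "e / 2 > 0 \<and> (\<forall>h\<in>GammaX. close n (e/2) g h \<longrightarrow> h \<in> U)"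
   using close_imp_gnbhd[of g _ n "e/2" e] by force
  then show "\<exists>n e. e > 0 \<and> (\<forall>h\<in>GammaX. close n e g h \<longrightarrow> h \<in> U)" by blast
 qed
next
 assume U: "U \<subseteq> GammaX \<and> (\<forall>g\<in>U. \<exists>n e. e > 0 \<and> (\<forall>h\<in>GammaX. close n e g h \<longrightarrow> h \<in> U))"
 show "gamma_open U"
  unfolding gamma_open_def
 proof (intro conjI ballI)
  show "U \<subseteq> GammaX" using U by auto
  fix g assume g: "g \<in> U"
  then obtain n e where e: "e > 0" "\<forall>h\<in>GammaX. close n e g h \<longrightarrow> h \<in> U"
   using U by blast
  have "gnbhd g n e \<subseteq> U"
  proof
   fix h assume h: "h \<in> gnbhd g n e"
   then obtain e' where "e' < e" "close n e' g h"
    using gnbhd_imp_close g U by blast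
   then have "close n e g h" by (auto intro: close_mono)
   then show "h \<in> U" using e h by (auto simp: gnbhd_def)
  qed
  with e show "\<exists>n e. e > 0 \<and> gnbhd g n e \<subseteq> U" by blast
 qed
qed

lemma gamma_open_gball: "gamma_open (gball g n e)"
 unfolding gamma_open_iff
proof (intro conjI ballI)
 show "gball g n e \<subseteq> GammaX" by (auto simp: gball_def)
 fix h assume "h \<in> gball g n e"
 then obtain e' where e': "e' < e" "close n e' g h" "h \<in> GammaX" by (auto simp: gball_def)
 have "k \<in> gball g n e" if k: "k \<in> GammaX" "close n ((e - e')/2) h k" for k
 proof -
  have "close n (e' + (e - e')/2) g k" by (rule close_trans[OF e'(2) k(2)])
  moreover have "e' + (e - e')/2 < e" using e'(1) by (simp add: field_simps)
  ultimately show ?thesis using k by (auto simp: gball_def)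
 qed
 then show "\<exists>n' ea. ea > 0 \<and> (\<forall>k\<in>GammaX. close n' ea h k \<longrightarrow> k \<in> gball g n e)"
  using e'(1) by (intro exI[of _ n] exI[of _ "(e - e')/2"]) auto
qed

lemma center_gball: "g \<in> GammaX \<Longrightarrow> e > 0 \<Longrightarrow> g \<in> gball g n e"
 unfolding gball_def using close_refl[of "e/2" n g] by (auto intro!: exI[of _ "e/2"])

lemma gamma_open_Int: "gamma_open U \<Longrightarrow> gamma_open V \<Longrightarrow> gamma_open (U \<inter> V)"
proof -
 assume U: "gamma_open U" and V: "gamma_open V"
 show "gamma_open (U \<inter> V)"
  unfolding gamma_open_iff
 proof (intro conjI ballI)
  show "U \<inter> V \<subseteq> GammaX" using U by (auto simp: gamma_open_def)
  fix g assume g: "g \<in> U \<inter> V"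
  obtain n e where 1: "e > 0" "\<forall>h\<in>GammaX. close n e g h \<longrightarrow> h \<in> U"
   using U g unfolding gamma_open_iff by blast
  obtain n' e' where 2: "e' > 0" "\<forall>h\<in>GammaX. close n' e' g h \<longrightarrow> h \<in> V"
   using V g unfolding gamma_open_iff by blast
  show "\<exists>n e. e > 0 \<and> (\<forall>h\<in>GammaX. close n e g h \<longrightarrow> h \<in> U \<inter> V)"
   using 1 2 close_mono[of "max n n'" "min e e'" g _ n e] close_mono[of "max n n'" "min e e'" g _ n' e']
   by (intro exI[of _ "max n n'"] exI[of _ "min e e'"]) simp
 qed
qed

lemma gamma_open_Union: "(\<And>U. U \<in> \<U> \<Longrightarrow> gamma_open U) \<Longrightarrow> gamma_open (\<Union>\<U>)"
 unfolding gamma_open_iff by (meson Sup_le_iff UnionE UnionI)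

lemma gamma_open_UNIV: "gamma_open GammaX"
 unfolding gamma_open_iff by (auto intro: zero_less_one)

lemma gamma_dense_iff:
 "gamma_dense D \<longleftrightarrow> D \<subseteq> GammaX \<and> (\<forall>U. gamma_open U \<longrightarrow> U \<noteq> {} \<longrightarrow> U \<inter> D \<noteq> {})"
proof (intro iffI conjI allI impI)
 fix U :: "((nat \<Rightarrow> real) \<Rightarrow> 'a) set"
 assume D: "gamma_dense D" and U: "gamma_open U" "U \<noteq> {}"
 then obtain g where g: "g \<in> U" "g \<in> GammaX" by (auto simp: gamma_open_def)
 then obtain n e where "e > 0" "gnbhd g n e \<subseteq> U" using U unfolding gamma_open_def by blast
 then show "U \<inter> D \<noteq> {}" using D g unfolding gamma_dense_def by blast
next
 assume D: "D \<subseteq> GammaX \<and> (\<forall>U. gamma_open U \<longrightarrow> U \<noteq> {} \<longrightarrow> U \<inter> D \<noteq> {})"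
 show "gamma_dense D"
  unfolding gamma_dense_def
 proof (intro conjI ballI allI impI)
  show "D \<subseteq> GammaX" using D by auto
  fix g :: "(nat \<Rightarrow> real) \<Rightarrow> 'a" and n and e :: real
  assume "g \<in> GammaX" "0 < e"
  then show "gnbhd g n e \<inter> D \<noteq> {}"
   using D gamma_open_gball[of g n e] center_gball[of g e n]
   by (simp add: gnbhd_eq_gball) blast
 qed
qed (auto simp: gamma_dense_def)

lemma gamma_residual_mono: "gamma_residual S \<Longrightarrow> S \<subseteq> S' \<Longrightarrow> S' \<subseteq> GammaX \<Longrightarrow> gamma_residual S'"
 unfolding gamma_residual_def by blast

lemma gamma_residual_Inter:
 fixes S :: "nat \<Rightarrow> ((nat \<Rightarrow> real) \<Rightarrow> 'x::real_normed_vector) set"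
 assumes "\<And>k. gamma_residual (S k)"
 shows "gamma_residual (\<Inter>k. S k)"
proof -
 obtain U :: "nat \<Rightarrow> nat \<Rightarrow> ((nat \<Rightarrow> real) \<Rightarrow> 'x) set"
  where U: "\<And>i k. gamma_open (U i k)" "\<And>i k. gamma_dense (U i k)" "\<And>i. \<Inter>(range (U i)) \<subseteq> S i"
  using assms unfolding gamma_residual_def by metis
 have "S k \<subseteq> GammaX" for k using assms by (auto simp: gamma_residual_def)
 moreover have "\<Inter>(range (\<lambda>k. U (fst (prod_decode k)) (snd (prod_decode k)))) \<subseteq> (\<Inter>k. S k)"
 proof
  fix g assume g: "g \<in> \<Inter>(range (\<lambda>k. U (fst (prod_decode k)) (snd (prod_decode k))))"
  have "g \<in> U i k" for i k
   using g by (metis (no_types, lifting) INT_E UNIV_I fst_conv prod_encode_inverse snd_conv)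
  then show "g \<in> (\<Inter>k. S k)" using U(3) by blast
 qed
 ultimately show ?thesis
  unfolding gamma_residual_def using U(1,2)
  by (intro conjI exI[of _ "\<lambda>k. U (fst (prod_decode k)) (snd (prod_decode k))"]) blast+
qed

lemma gamma_residual_open: "gamma_open U \<Longrightarrow> gamma_dense U \<Longrightarrow> gamma_residual U"
 unfolding gamma_residual_def by (auto simp: gamma_open_def intro!: exI[of _ "\<lambda>_. U"])

lemma gamma_residual_Int:
 assumes "gamma_residual S" "gamma_residual S'" shows "gamma_residual (S \<inter> S')"
proof -
 have "gamma_residual (\<Inter>k::nat. if k = 0 then S else S')"
  by (rule gamma_residual_Inter) (use assms in auto)
 moreover have "(\<Inter>k::nat. if k = 0 then S else S') = S \<inter> S'"
  by (auto split: if_splits)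
 ultimately show ?thesis by simp
qed

lemma gamma_residual_UNIV: "gamma_residual GammaX"
 by (intro gamma_residual_open gamma_open_UNIV) (auto simp: gamma_dense_iff gamma_open_def)

text \<open>The Banach category theorem.\<close>

lemma gamma_residual_local:
 fixes S :: "((nat \<Rightarrow> real) \<Rightarrow> 'x::real_normed_vector) set"
 assumes S: "S \<subseteq> GammaX"
  and loc: "\<And>W. gamma_open W \<Longrightarrow> W \<noteq> {} \<Longrightarrow>
   \<exists>W' G. gamma_open W' \<and> W' \<noteq> {} \<and> W' \<subseteq> W \<and> gamma_residual G \<and> W' \<inter> G \<subseteq> S"
 shows "gamma_residual S"
proof -
 define good where "good W \<longleftrightarrow> gamma_open W \<and> W \<noteq> {} \<and> (\<exists>G. gamma_residual G \<and> W \<inter> G \<subseteq> S)" for W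
 define A where "A = {\<W>. (\<forall>W\<in>\<W>. good W) \<and> disjoint \<W>}"
 \<comment> \<open>Zorn: a maximal disjoint family of open sets on which \<open>S\<close> is
   residual. Disjointness is what permits gluing countably many conditions over an arbitrarily large
   family.\<close>
 have "\<exists>M\<in>A. \<forall>X\<in>A. M \<subseteq> X \<longrightarrow> X = M"
 proof (rule subset_Zorn_nonempty)
  show "A \<noteq> {}" by (auto simp: A_def intro: exI[of _ "{}"])
  fix C assume C: "C \<noteq> {}" "subset.chain A C"
  show "\<Union>C \<in> A"
   unfolding A_def disjoint_def
  proof (intro CollectI conjI ballI impI)
   fix W assume "W \<in> \<Union>C" then show "good W" using C by (auto simp: subset.chain_def A_def)
  next
   fix W V assume W: "W \<in> \<Union>C" "V \<in> \<Union>C" "W \<noteq> V"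
   then obtain X Y where "W \<in> X" "V \<in> Y" "X \<in> C" "Y \<in> C" by auto
   moreover from this C(2) have "X \<subseteq> Y \<or> Y \<subseteq> X" by (auto simp: subset.chain_def)
   moreover have "disjoint X" "disjoint Y"
    using C(2) \<open>X \<in> C\<close> \<open>Y \<in> C\<close> by (auto simp: subset.chain_def A_def)
   ultimately show "W \<inter> V = {}"
    using W(3) unfolding disjoint_def by blast
  qed
 qed
 then obtain M where M: "M \<in> A" and max: "\<And>X. X \<in> A \<Longrightarrow> M \<subseteq> X \<Longrightarrow> X = M" by metis
 have good: "\<And>W. W \<in> M \<Longrightarrow> good W" and disj: "disjoint M" using M by (auto simp: A_def)
 obtain G where G: "\<And>W. W \<in> M \<Longrightarrow> gamma_residual (G W)" "\<And>W. W \<in> M \<Longrightarrow> W \<inter> G W \<subseteq> S"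
  using good unfolding good_def by metis
 have "\<exists>U :: nat \<Rightarrow> _. (\<forall>k. gamma_open (U k) \<and> gamma_dense (U k)) \<and> \<Inter>(range U) \<subseteq> G W" if "W \<in> M" for W
  using G(1)[OF that] by (simp add: gamma_residual_def)
 then obtain U :: "_ \<Rightarrow> nat \<Rightarrow> _" where U: "\<And>W k. W \<in> M \<Longrightarrow> gamma_open (U W k)" "\<And>W k. W \<in> M \<Longrightarrow> gamma_dense (U W k)"
   "\<And>W. W \<in> M \<Longrightarrow> \<Inter>(range (U W)) \<subseteq> G W"
  by metis
 define V where "V k = (\<Union>W\<in>M. W \<inter> U W k)" for k
 have "gamma_open (V k)" for k
  unfolding V_def using good U by (intro gamma_open_Union) (auto simp: good_def intro!: gamma_open_Int)
 moreover have "gamma_dense (V k)" for k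
  unfolding gamma_dense_iff
 proof (intro conjI allI impI)
  show "V k \<subseteq> GammaX" using \<open>gamma_open (V k)\<close> by (auto simp: gamma_open_def)
  fix O' :: "((nat \<Rightarrow> real) \<Rightarrow> 'x) set" assume O': "gamma_open O'" "O' \<noteq> {}"
  have "\<exists>W\<in>M. O' \<inter> W \<noteq> {}"
  proof (rule ccontr)
   \<comment> \<open>An open set missed by the whole family would contain, by the local hypothesis,
     one more good set, against maximality.\<close>
   assume no: "\<not> (\<exists>W\<in>M. O' \<inter> W \<noteq> {})"
   obtain W' where W': "good W'" "W' \<subseteq> O'" using loc[OF O'] unfolding good_def by blast
   have "insert W' M \<in> A"
    using W' no good disj by (auto simp: A_def disjoint_def)
   then have "W' \<in> M" using max by blast
   then show False using no W' by (auto simp: good_def)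
  qed
  then obtain W where W: "W \<in> M" "O' \<inter> W \<noteq> {}" by blast
  then have "gamma_open (O' \<inter> W)" using O' good by (auto simp: good_def intro: gamma_open_Int)
  then have "(O' \<inter> W) \<inter> U W k \<noteq> {}" using U(2)[OF W(1), of k] W(2) unfolding gamma_dense_iff by blast
  then show "O' \<inter> V k \<noteq> {}" using W(1) unfolding V_def by blast
 qed
 moreover have "\<Inter>(range V) \<subseteq> S"
 proof
  fix g assume g: "g \<in> \<Inter>(range V)"
  then have "g \<in> V 0" by blast
  then obtain W where W: "W \<in> M" "g \<in> W" by (auto simp: V_def)
  \<comment> \<open>Since the members are disjoint, the member containing \<open>g\<close> is the
    same for every \<open>k\<close>.\<close>
  have "g \<in> U W k" for k
  proof -
   have "g \<in> V k" using g by blast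
   then obtain W' where "W' \<in> M" "g \<in> W'" "g \<in> U W' k" by (auto simp: V_def)
   moreover have "W' = W" using disj W \<open>W' \<in> M\<close> \<open>g \<in> W'\<close> by (auto simp: disjoint_def)
   ultimately show ?thesis by simp
  qed
  then show "g \<in> S" using U(3)[OF W(1)] G(2)[OF W(1)] W by blast
 qed
 ultimately show ?thesis unfolding gamma_residual_def using S by blast
qed


section \<open>Measure on the cube and the ideal of null sets\<close>

abbreviation unitI :: "real measure" where "unitI \<equiv> restrict_space lborel {0..1}"

lemma prob_space_unitI: "prob_space unitI"
 by (rule prob_spaceI) (simp add: space_restrict_space emeasure_restrict_space)

lemma prob_space_lebN: "prob_space lebN"
 unfolding lebN_def by (rule prob_space_PiM) (rule prob_space_unitI)

interpretation lebN: prob_space lebN by (rule prob_space_lebN)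

lemma space_lebN [simp]: "space lebN = cubeT"
 by (simp add: lebN_def space_PiM space_restrict_space cubeT_eq_PiE)

lemma measurable_id_lebN: "(\<lambda>t. t) \<in> measurable lebN borel"
proof -
 have "(\<lambda>t. t) \<in> measurable lebN (PiM UNIV (\<lambda>_. borel))"
 proof (rule measurable_PiM_single')
  fix i :: nat
  have "(\<lambda>t. t i) \<in> measurable lebN unitI"
   unfolding lebN_def by (rule measurable_component_singleton) simp
  moreover have "(\<lambda>x. x) \<in> measurable unitI borel"
   by (rule measurable_restrict_space1) simp
  ultimately show "(\<lambda>t. t i) \<in> measurable lebN borel"
   by (rule measurable_compose)
 qed auto
 then show ?thesis
  by (simp add: measurable_cong_sets[OF refl sets_PiM_equal_borel])
qed

lemma sets_lebN_borel: "A \<in> sets borel \<Longrightarrow> A \<inter> cubeT \<in> sets lebN"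
 using measurable_sets[OF measurable_id_lebN, of A] by (simp add: vimage_def Int_def)

lemma sets_lebN_openin:
 assumes "openin (top_of_set cubeT) A" shows "A \<in> sets lebN"
 using assms sets_lebN_borel[OF borel_open] by (auto simp: openin_open Int_commute)

lemma GammaX_vimage_sets:
 assumes "g \<in> GammaX" "open U"
 shows "{t\<in>cubeT. g t \<in> U} \<in> sets lebN"
proof (rule sets_lebN_openin)
 show "openin (top_of_set cubeT) {t \<in> cubeT. g t \<in> U}"
  using GammaX_D(1)[OF assms(1)] assms(2)
  using continuous_openin_preimage_gen[of cubeT g U] by (simp add: vimage_def Int_def)
qed

lemma emeasure_lebN_box:
 assumes "finite J" "\<And>i. i \<in> J \<Longrightarrow> A i \<in> sets borel" "\<And>i. i \<in> J \<Longrightarrow> A i \<subseteq> {0..1}"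
 shows "{t\<in>cubeT. \<forall>i\<in>J. t i \<in> A i} \<in> sets lebN"
  "emeasure lebN {t\<in>cubeT. \<forall>i\<in>J. t i \<in> A i} = (\<Prod>i\<in>J. emeasure lborel (A i))"
  "measure lebN {t\<in>cubeT. \<forall>i\<in>J. t i \<in> A i} = (\<Prod>i\<in>J. measure lborel (A i))"
proof -
 interpret P: product_prob_space "\<lambda>_. unitI" UNIV
  by (intro product_prob_spaceI prob_space_unitI)
 have A: "A i \<in> sets unitI" if "i \<in> J" for i
  using assms(2,3)[OF that] by (auto simp: sets_restrict_space_iff)
 have eq: "{t\<in>cubeT. \<forall>i\<in>J. t i \<in> A i} = {x\<in>space (PiM UNIV (\<lambda>_::nat. unitI)). \<forall>i\<in>J. x i \<in> A i}"
  using space_lebN by (simp add: lebN_def)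
 show 1: "emeasure lebN {t\<in>cubeT. \<forall>i\<in>J. t i \<in> A i} = (\<Prod>i\<in>J. emeasure lborel (A i))"
  unfolding eq lebN_def using A assms
  by (subst P.emeasure_PiM_Collect) (auto simp: emeasure_restrict_space intro!: prod.cong)
 show "{t\<in>cubeT. \<forall>i\<in>J. t i \<in> A i} \<in> sets lebN"
  unfolding eq unfolding lebN_def using A assms(1)
  by (intro sets.sets_Collect_finite_All) (auto intro!: measurable_sets_Collect[OF measurable_component_singleton] )
 have fin: "emeasure lborel (A i) = ennreal (measure lborel (A i))" if "i \<in> J" for i
 proof (rule emeasure_eq_ennreal_measure)
  have "emeasure lborel (A i) \<le> emeasure lborel {0..1::real}"
   using assms(3)[OF that] by (intro emeasure_mono) auto
  then show "emeasure lborel (A i) \<noteq> top" by (auto simp: top_unique)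
 qed
 show "measure lebN {t\<in>cubeT. \<forall>i\<in>J. t i \<in> A i} = (\<Prod>i\<in>J. measure lborel (A i))"
  unfolding measure_def[of lebN] 1 using fin by (simp add: prod_ennreal prod_nonneg cong: prod.cong)
qed

lemma sets_lebN_compact:
 assumes "compact C" "C \<subseteq> cubeT" shows "C \<in> sets lebN"
 using sets_lebN_borel[OF borel_closed[OF compact_imp_closed[OF assms(1)]]] assms(2) by (simp add: Int_absorb2)

text \<open>Continuity from above along the tails of the sequence. A point of the limit set lies in
  infinitely many \<open>E n\<close>; this is how infinitely many scales, and later infinitely many
  directions, are met at one point.\<close>

lemma measure_limsup_ge:
 assumes E: "\<And>n :: nat. E n \<in> sets lebN" "\<And>n. \<sigma> \<le> measure lebN (E n)"
 shows "\<sigma> \<le> measure lebN (\<Inter>n. \<Union>i\<in>{n..}. E i)"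
proof (rule LIMSEQ_le_const)
 have B: "(\<Union>i\<in>{n..}. E i) \<in> sets lebN" for n using E(1) by (intro sets.countable_UN'') auto
 show "(\<lambda>n. measure lebN (\<Union>i\<in>{n..}. E i)) \<longlonglongrightarrow> measure lebN (\<Inter>n. \<Union>i\<in>{n..}. E i)"
 proof (intro lebN.finite_Lim_measure_decseq)
  show "decseq (\<lambda>n. \<Union>i\<in>{n..}. E i)" unfolding decseq_def by (meson UN_mono atLeast_subset_iff subset_refl)
 qed (use B in auto)
 have "measure lebN (E n) \<le> measure lebN (\<Union>i\<in>{n..}. E i)" for n using B by (intro lebN.finite_measure_mono) auto
 then show "\<exists>N. \<forall>n\<ge>N. \<sigma> \<le> measure lebN (\<Union>i\<in>{n..}. E i)" using E(2) order_trans by blast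
qed

text \<open>Fubini for one coordinate: inserting the \<open>j\<close>-th coordinate carries the
  product of \<open>unitI\<close> and the remaining product measure onto \<open>lebN\<close>. The
  factor \<open>c\<close> is 0 where null sections are to give a null set, and positive where a
  proportion is to be transferred.\<close>

lemma emeasure_lebN_sections:
 assumes S: "S \<in> sets lebN" and K: "K \<in> sets lebN"
  and le: "\<And>t. t \<in> cubeT \<Longrightarrow>
   emeasure lborel {s\<in>{0..1}. t(j := s) \<in> S} \<le> c * emeasure lborel {s\<in>{0..1}. t(j := s) \<in> K}"
 shows "emeasure lebN S \<le> c * emeasure lebN K"
proof -
 let ?R = "PiM (UNIV - {j}) (\<lambda>_. unitI)"
 let ?f = "\<lambda>(x, X). X(j := x)"
 interpret R: prob_space ?R by (rule prob_space_PiM) (rule prob_space_unitI)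
 interpret I: prob_space unitI by (rule prob_space_unitI)
 interpret PR: pair_sigma_finite unitI ?R ..
 have ins: "insert j (UNIV - {j}) = UNIV" by auto
 have leb: "distr (unitI \<Otimes>\<^sub>M ?R) lebN ?f = lebN"
  unfolding lebN_def using distr_pair_PiM_eq_PiM[of "UNIV - {j}" "\<lambda>_. unitI" j] prob_space_unitI
  by (simp add: ins)
 have f: "?f \<in> measurable (unitI \<Otimes>\<^sub>M ?R) lebN"
  unfolding lebN_def
  using measurable_add_dim[of j "UNIV - {j}" "\<lambda>_. unitI"]
  by (subst measurable_pair_swap_iff) (simp add: ins split_beta')
 \<comment> \<open>Points of \<open>?R\<close> are undefined at \<open>j\<close>. The 0 written
   there is overwritten by \<open>s\<close> and only places the point in the cube.\<close>
 have main: "emeasure lebN A = (\<integral>\<^sup>+ X. emeasure lborel {s\<in>{0..1}. (X(j := 0))(j := s) \<in> A} \<partial>?R)"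
   and meas: "(\<lambda>X. emeasure lborel {s\<in>{0..1}. (X(j := 0))(j := s) \<in> A}) \<in> borel_measurable ?R"
  if A: "A \<in> sets lebN" for A
 proof -
  define B where "B = ?f -` A \<inter> space (unitI \<Otimes>\<^sub>M ?R)"
  have B: "B \<in> sets (unitI \<Otimes>\<^sub>M ?R)" unfolding B_def by (rule measurable_sets[OF f A])
  have sec: "emeasure unitI ((\<lambda>x. (x, X)) -` B) = emeasure lborel {s\<in>{0..1}. (X(j := 0))(j := s) \<in> A}"
   if X: "X \<in> space ?R" for X
  proof -
   have "(\<lambda>x. (x, X)) -` B = {s\<in>{0..1}. (X(j := 0))(j := s) \<in> A}"
    using X unfolding B_def by (auto simp: space_pair_measure space_restrict_space)
   then show ?thesis by (simp only:) (subst emeasure_restrict_space; auto)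
  qed
  have "emeasure lebN A = emeasure (unitI \<Otimes>\<^sub>M ?R) B"
   unfolding B_def using emeasure_distr[OF f A] leb by simp
  also have "\<dots> = (\<integral>\<^sup>+ X. emeasure unitI ((\<lambda>x. (x, X)) -` B) \<partial>?R)"
   by (rule PR.emeasure_pair_measure_alt2[OF B])
  also have "\<dots> = (\<integral>\<^sup>+ X. emeasure lborel {s\<in>{0..1}. (X(j := 0))(j := s) \<in> A} \<partial>?R)"
   by (intro nn_integral_cong sec)
  finally show "emeasure lebN A = (\<integral>\<^sup>+ X. emeasure lborel {s\<in>{0..1}. (X(j := 0))(j := s) \<in> A} \<partial>?R)" .
  have "(\<lambda>X. emeasure unitI ((\<lambda>x. (x, X)) -` B)) \<in> borel_measurable ?R"
   by (rule PR.measurable_emeasure_Pair2[OF B])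
  then show "(\<lambda>X. emeasure lborel {s\<in>{0..1}. (X(j := 0))(j := s) \<in> A}) \<in> borel_measurable ?R"
   using sec by (simp cong: measurable_cong)
 qed
 have X: "X(j := 0) \<in> cubeT" if "X \<in> space ?R" for X
  using that by (auto simp: space_PiM space_restrict_space cubeT_def PiE_def Pi_def)
 show ?thesis
  unfolding main[OF S] main[OF K] nn_integral_cmult[OF meas[OF K], symmetric]
  by (intro nn_integral_mono le X)
qed

text \<open>Outer measure as a real number: preimages of the exceptional sets need not be
  measurable, and cutting with the cube lets arbitrary sets be inserted.\<close>

definition oT :: "(nat \<Rightarrow> real) set \<Rightarrow> real" where
 "oT A = enn2real (outer_measure_of lebN (A \<inter> cubeT))"

lemma outer_le_1: "outer_measure_of lebN (A \<inter> cubeT) \<le> 1"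
proof -
 have "outer_measure_of lebN (A \<inter> cubeT) \<le> outer_measure_of lebN cubeT"
  by (rule outer_measure_of_mono) auto
 also have "\<dots> = 1"
  using lebN.emeasure_space_1 sets.top[of lebN] by simp
 finally show ?thesis .
qed

lemma outer_eq_oT: "outer_measure_of lebN (A \<inter> cubeT) = ennreal (oT A)"
 unfolding oT_def using le_less_trans[OF outer_le_1[of A] ennreal_one_less_top] by simp

lemma oT_nonneg: "0 \<le> oT A" by (simp add: oT_def)

lemma oT_mono: "A \<inter> cubeT \<subseteq> B \<Longrightarrow> oT A \<le> oT B"
 using outer_measure_of_mono[of "A \<inter> cubeT" "B \<inter> cubeT" lebN]
 by (simp add: outer_eq_oT oT_nonneg)

lemma oT_measure: "A \<in> sets lebN \<Longrightarrow> oT A = measure lebN A"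
 using sets.sets_into_space[of A lebN] by (simp add: oT_def measure_def Int_absorb2)

lemma oT_attain: "\<exists>E\<in>sets lebN. A \<inter> cubeT \<subseteq> E \<and> oT A = measure lebN E"
 using outer_measure_of_attain[of "A \<inter> cubeT" lebN] by (auto simp: oT_def measure_def)

lemma oT_Un: "oT (A \<union> B) \<le> oT A + oT B"
proof -
 obtain E F where "E \<in> sets lebN" "A \<inter> cubeT \<subseteq> E" "oT A = measure lebN E"
   and "F \<in> sets lebN" "B \<inter> cubeT \<subseteq> F" "oT B = measure lebN F"
  using oT_attain by metis
 moreover from this have "(A \<union> B) \<inter> cubeT \<subseteq> E \<union> F" by blast
 ultimately show ?thesis
  using oT_mono[of "A \<union> B" "E \<union> F"] measure_Un_le[of E lebN F] oT_measure[of "E \<union> F"] by auto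
qed

lemma oT_UN_finite:
 "finite F \<Longrightarrow> oT (\<Union>q\<in>F. A q) \<le> (\<Sum>q\<in>F. oT (A q))"
proof (induction F rule: finite_induct)
 case empty
 have "oT {} = 0" by (simp add: oT_measure)
 then show ?case by simp
next
 case (insert x F)
 then show ?case using oT_Un[of "A x" "\<Union>q\<in>F. A q"] by simp
qed

text \<open>Outer measure is continuous along increasing sequences even of non-measurable sets. This
  device turns thresholds that depend on the point into one threshold valid on a set still of outer
  measure above \<open>\<tau>\<close>.\<close>

lemma oT_incseq:
 assumes "incseq A" "\<tau> < oT (\<Union>n. A n)"
 shows "\<exists>n. \<tau> < oT (A n)"
proof (rule ccontr)
 assume "\<not> ?thesis"
 then have le: "oT (A n) \<le> \<tau>" for n by (simp add: not_less)
 have "(SUP n. outer_measure_of lebN (A n \<inter> cubeT)) = outer_measure_of lebN (\<Union>n. A n \<inter> cubeT)"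
  using assms(1) by (intro SUP_outer_measure_of_incseq) (auto simp: incseq_def)
 moreover have "(SUP n. outer_measure_of lebN (A n \<inter> cubeT)) \<le> ennreal \<tau>"
  unfolding outer_eq_oT by (intro SUP_least ennreal_leI le)
 moreover have "(\<Union>n. A n \<inter> cubeT) = (\<Union>n. A n) \<inter> cubeT" by auto
 ultimately have "ennreal (oT (\<Union>n. A n)) \<le> ennreal \<tau>" by (simp add: outer_eq_oT)
 then show False using assms(2) le[of 0] oT_nonneg[of "A 0"]
  by (simp add: ennreal_le_iff)
qed

lemma oT_eq_0_iff: "oT A = 0 \<longleftrightarrow> (\<exists>N\<in>null_sets lebN. A \<inter> cubeT \<subseteq> N)"
proof
 assume "oT A = 0"
 then obtain E where "E \<in> sets lebN" "A \<inter> cubeT \<subseteq> E" "measure lebN E = 0" using oT_attain[of A] by auto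
 then show "\<exists>N\<in>null_sets lebN. A \<inter> cubeT \<subseteq> N"
  by (auto simp: null_sets_def lebN.emeasure_eq_measure)
next
 assume "\<exists>N\<in>null_sets lebN. A \<inter> cubeT \<subseteq> N"
 then obtain N where "N \<in> null_sets lebN" "A \<inter> cubeT \<subseteq> N" by auto
 then show "oT A = 0"
  using oT_mono[of A N] oT_measure[of N] oT_nonneg[of A] by (auto simp: null_sets_def measure_def)
qed

lemma oT_UN_zero:
 assumes "\<And>n::nat. oT (A n) = 0" shows "oT (\<Union>n. A n) = 0"
proof -
 obtain N where N: "\<And>n. N n \<in> null_sets lebN" "\<And>n. A n \<inter> cubeT \<subseteq> N n"
  using assms unfolding oT_eq_0_iff by metis
 have "(\<Union>n. N n) \<in> null_sets lebN" using N(1) by (rule null_sets_UN)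
 moreover have "(\<Union>n. A n) \<inter> cubeT \<subseteq> (\<Union>n. N n)" using N(2) by blast
 ultimately show ?thesis unfolding oT_eq_0_iff by blast
qed

lemma oT_diff_null: "oT B = 0 \<Longrightarrow> \<tau> < oT A \<Longrightarrow> A \<subseteq> A' \<union> B \<Longrightarrow> \<tau> < oT A'"
 using oT_Un[of A' B] oT_mono[of A "A' \<union> B"] by (auto simp: le_infI1)

abbreviation om :: "((nat \<Rightarrow> real) \<Rightarrow> 'x) \<Rightarrow> 'x set \<Rightarrow> real" where
 "om g E \<equiv> oT (g -` E)"

text \<open>\<open>gamma_null\<close> without the Borel requirement, so that subsets are allowed;
  for Borel sets \<open>gamma_null_iff_Gnull\<close> leads back.\<close>

definition Gnull :: "'x::real_normed_vector set \<Rightarrow> bool" where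
 "Gnull E \<longleftrightarrow> gamma_residual {g\<in>(GammaX :: ((nat \<Rightarrow> real) \<Rightarrow> 'x) set). om g E = 0}"

lemma Gnull_mono:
 assumes "Gnull E" "E' \<subseteq> E" shows "Gnull E'"
proof -
 have "om g E' = 0" if "om g E = 0" for g :: "(nat \<Rightarrow> real) \<Rightarrow> 'a"
  using oT_mono[of "g -` E'" "g -` E"] oT_nonneg[of "g -` E'"] that assms(2) by force
 then show ?thesis
  using assms(1) unfolding Gnull_def by (auto elim!: gamma_residual_mono)
qed

lemma Gnull_UN:
 fixes E :: "nat \<Rightarrow> 'x::real_normed_vector set"
 assumes "\<And>n. Gnull (E n)" shows "Gnull (\<Union>n. E n)"
proof -
 have "gamma_residual (\<Inter>n. {g\<in>(GammaX :: ((nat \<Rightarrow> real) \<Rightarrow> 'x) set). om g (E n) = 0})"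
  using assms by (intro gamma_residual_Inter) (simp add: Gnull_def)
 moreover have "om g (\<Union>n. E n) = 0" if "\<And>n. om g (E n) = 0" for g :: "(nat \<Rightarrow> real) \<Rightarrow> 'x"
  using oT_UN_zero[OF that] by (simp add: vimage_UN)
 ultimately show ?thesis
  unfolding Gnull_def by (auto elim!: gamma_residual_mono)
qed

lemma Gnull_Un:
 assumes "Gnull E" "Gnull E'" shows "Gnull (E \<union> E')"
proof -
 have "Gnull (\<Union>n::nat. if n = 0 then E else E')"
  by (rule Gnull_UN) (use assms in auto)
 then show ?thesis by (rule Gnull_mono) (auto split: if_splits)
qed

text \<open>Nullity is a countable intersection of conditions with thresholds 1/(n+1), so one of
  these fails to be residual, and by the local category theorem it fails in every open subset of
  some \<open>W\<close>. The indirect proofs below start here, since the conclusion survives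
  shrinking the open set and adding residual conditions.\<close>

lemma not_Gnull_imp:
 fixes E :: "'x::real_normed_vector set"
 assumes "\<not> Gnull E"
 obtains \<tau> W where "\<tau> > 0" "gamma_open W" "W \<noteq> {}"
  "\<And>W' G. gamma_open W' \<Longrightarrow> W' \<noteq> {} \<Longrightarrow> W' \<subseteq> W \<Longrightarrow> gamma_residual G \<Longrightarrow> \<exists>g\<in>W' \<inter> G. om g E > \<tau>"
proof -
 have "\<exists>n::nat. \<not> gamma_residual {g\<in>(GammaX :: ((nat \<Rightarrow> real) \<Rightarrow> 'x) set). om g E \<le> inverse (Suc n)}"
 proof (rule ccontr)
  assume "\<not> ?thesis"
  then have "gamma_residual (\<Inter>n::nat. {g\<in>(GammaX :: ((nat \<Rightarrow> real) \<Rightarrow> 'x) set). om g E \<le> inverse (Suc n)})"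
   by (intro gamma_residual_Inter) simp
  moreover have "om g E = 0" if "\<And>n::nat. om g E \<le> inverse (Suc n)" for g :: "(nat \<Rightarrow> real) \<Rightarrow> 'x"
   using that reals_Archimedean[of "om g E"] oT_nonneg[of "g -` E"] by (meson antisym_conv1 not_less)
  ultimately have "Gnull E" unfolding Gnull_def by (auto elim!: gamma_residual_mono)
  then show False using assms by simp
 qed
 then obtain n :: nat where n: "\<not> gamma_residual {g\<in>(GammaX :: ((nat \<Rightarrow> real) \<Rightarrow> 'x) set). om g E \<le> inverse (Suc n)}" ..
 have "\<exists>W. gamma_open W \<and> W \<noteq> {} \<and> \<not> (\<exists>W' G. gamma_open W' \<and> W' \<noteq> {} \<and> W' \<subseteq> W \<and> gamma_residual G \<and>
   W' \<inter> G \<subseteq> {g\<in>(GammaX :: ((nat \<Rightarrow> real) \<Rightarrow> 'x) set). om g E \<le> inverse (Suc n)})"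
  using n gamma_residual_local[of "{g\<in>(GammaX :: ((nat \<Rightarrow> real) \<Rightarrow> 'x) set). om g E \<le> inverse (Suc n)}"]
  by blast
 then obtain W where W: "gamma_open W" "W \<noteq> {}"
  "\<And>W' G. gamma_open W' \<Longrightarrow> W' \<noteq> {} \<Longrightarrow> W' \<subseteq> W \<Longrightarrow> gamma_residual G \<Longrightarrow>
   \<not> W' \<inter> G \<subseteq> {g\<in>(GammaX :: ((nat \<Rightarrow> real) \<Rightarrow> 'x) set). om g E \<le> inverse (Suc n)}"
  by blast
 show thesis
 proof (rule that[of "inverse (Suc n)" W])
  fix W' G :: "((nat \<Rightarrow> real) \<Rightarrow> 'x) set"
  assume *: "gamma_open W'" "W' \<noteq> {}" "W' \<subseteq> W" "gamma_residual G"
  from W(3)[OF *] * show "\<exists>g\<in>W' \<inter> G. om g E > inverse (real (Suc n))"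
   by (auto simp: gamma_open_def not_le)
 qed (use W in auto)
qed

text \<open>The points of \<open>O'\<close> with a margin \<open>inverse (Suc n)\<close> to the
  complement increase to \<open>O'\<close>. One margin already carries outer measure above
  \<open>\<tau>\<close>, and a surface uniformly within this margin cannot leave \<open>O'\<close>
  there.\<close>

lemma gamma_open_om_gt:
 fixes O' :: "'x::real_normed_vector set"
 assumes "open O'"
 shows "gamma_open {g\<in>GammaX. om g O' > \<tau>}"
 unfolding gamma_open_iff
proof (intro conjI ballI)
 fix g assume g: "g \<in> {g\<in>GammaX. om g O' > \<tau>}"
 define A where "A n = {x. \<forall>y. dist x y \<le> inverse (Suc n) \<longrightarrow> y \<in> O'}" for n :: nat
 have "(\<Union>n. A n) = O'"
 proof (intro equalityI subsetI)
  fix x assume "x \<in> O'"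
  then obtain e where e: "e > 0" "cball x e \<subseteq> O'" using assms open_contains_cball by blast
  then obtain n where "inverse (Suc n) < e" using reals_Archimedean by blast
  then show "x \<in> (\<Union>n. A n)" using e unfolding A_def by (intro UN_I[of n]) (auto simp: subset_eq)
 qed (force simp: A_def intro: zero_le_dist)
 then have "\<tau> < oT (\<Union>n. g -` A n)" using g by (simp add: vimage_UN[symmetric])
 moreover have "incseq (\<lambda>n. g -` A n)"
 proof (rule incseq_SucI)
  fix n :: nat
  have "inverse (real (Suc (Suc n))) \<le> inverse (real (Suc n))" by (intro le_imp_inverse_le) auto
  then have "y \<in> O'" if "\<forall>y. dist x y \<le> inverse (real (Suc n)) \<longrightarrow> y \<in> O'" "dist x y \<le> inverse (real (Suc (Suc n)))" for x y
   using that by (meson order_trans)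
  then show "g -` A n \<subseteq> g -` A (Suc n)" unfolding A_def vimage_def by blast
 qed
 ultimately obtain n where n: "\<tau> < oT (g -` A n)" using oT_incseq by blast
 have "h \<in> {g\<in>GammaX. om g O' > \<tau>}" if h: "h \<in> GammaX" "close 0 (inverse (Suc n)) g h" for h
 proof -
  have "g -` A n \<inter> cubeT \<subseteq> h -` O'"
   using h(2) by (auto simp: A_def close_def dist_norm norm_minus_commute)
  then show ?thesis using n oT_mono[of "g -` A n" "h -` O'"] h by auto
 qed
 then show "\<exists>n e. e > 0 \<and> (\<forall>h\<in>GammaX. close n e g h \<longrightarrow> h \<in> {g\<in>GammaX. om g O' > \<tau>})"
  by (intro exI[of _ 0] exI[of _ "inverse (real (Suc n))"]) auto
qed auto

text \<open>A Baire argument that replaces a null intersection by a single \<open>m\<close>: if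
  measure above \<open>\<tau>\<close> could be reached everywhere in \<open>W\<close> for every
  \<open>m\<close>, a generic surface would reach it for all \<open>m\<close> together, and by
  continuity from above the intersection would not be null for it.\<close>

lemma Gnull_INT_open_uniform:
 fixes O' :: "nat \<Rightarrow> 'x::real_normed_vector set" and E :: "'x set"
 assumes op: "\<And>m. open (O' m)" and dec: "decseq O'" and null: "Gnull (\<Inter>m. O' m)"
  and \<tau>: "\<tau> > 0" and W: "gamma_open W" "W \<noteq> {}"
  and nonmeager: "\<And>W' G. gamma_open W' \<Longrightarrow> W' \<noteq> {} \<Longrightarrow> W' \<subseteq> W \<Longrightarrow> gamma_residual G \<Longrightarrow> W' \<inter> G \<noteq> {}"
 shows "\<exists>m W'. gamma_open W' \<and> W' \<noteq> {} \<and> W' \<subseteq> W \<and> (\<forall>g\<in>W'. om g (O' m) \<le> \<tau>)"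
proof (rule ccontr)
 assume no: "\<not> ?thesis"
 define U where "U m = {g\<in>GammaX. om g (O' m) > \<tau>}" for m
 \<comment> \<open>\<open>V\<close> is the exterior of \<open>W\<close>; it makes up for
   \<open>U m\<close> being dense in \<open>W\<close> only.\<close>
 define V where "V = \<Union>{V. gamma_open V \<and> V \<inter> W = {}}"
 have oU: "gamma_open (U m)" for m unfolding U_def by (rule gamma_open_om_gt[OF op])
 have oV: "gamma_open V" unfolding V_def by (rule gamma_open_Union) auto
 have res: "gamma_residual (U m \<union> V)" for m
 proof (rule gamma_residual_open)
  show o: "gamma_open (U m \<union> V)" using gamma_open_Union[of "{U m, V}"] oU oV by auto
  show "gamma_dense (U m \<union> V)"
   unfolding gamma_dense_iff
  proof (intro conjI allI impI)
   show "U m \<union> V \<subseteq> GammaX" using o by (auto simp: gamma_open_def)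
   fix Z :: "((nat \<Rightarrow> real) \<Rightarrow> 'x) set" assume Z: "gamma_open Z" "Z \<noteq> {}"
   show "Z \<inter> (U m \<union> V) \<noteq> {}"
   proof (cases "Z \<inter> W = {}")
    case True
    then show ?thesis using Z by (auto simp: V_def)
   next
    case False
    have oZ: "gamma_open (Z \<inter> W)" by (rule gamma_open_Int[OF Z(1) W(1)])
    with no False have "\<exists>g\<in>Z \<inter> W. \<not> om g (O' m) \<le> \<tau>" by blast
    then show ?thesis using oZ unfolding U_def gamma_open_def by force
   qed
  qed
 qed
 have "gamma_residual ((\<Inter>m. U m \<union> V) \<inter> {g\<in>GammaX. om g (\<Inter>m. O' m) = 0})"
  by (rule gamma_residual_Int[OF gamma_residual_Inter[OF res] null[unfolded Gnull_def]])
 from nonmeager[OF W order_refl this]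
 obtain g where "g \<in> W \<inter> ((\<Inter>m. U m \<union> V) \<inter> {g\<in>GammaX. om g (\<Inter>m. O' m) = 0})"
  by (meson ex_in_conv)
 then have g: "g \<in> W" "g \<in> GammaX" "\<And>m. g \<in> U m \<union> V" "om g (\<Inter>m. O' m) = 0" by blast+
 have "g \<notin> V" using g(1) unfolding V_def by blast
 then have gt: "om g (O' m) > \<tau>" for m using g(3)[of m] by (auto simp: U_def)
 define B where "B m = {t\<in>cubeT. g t \<in> O' m}" for m
 have Bm: "B m \<in> sets lebN" for m unfolding B_def by (rule GammaX_vimage_sets[OF g(2) op])
 have "decseq B" using dec by (auto simp: B_def decseq_def)
 then have "(\<lambda>m. measure lebN (B m)) \<longlonglongrightarrow> measure lebN (\<Inter>m. B m)"
  using Bm by (intro lebN.finite_Lim_measure_decseq) auto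
 moreover have "measure lebN (B m) = om g (O' m)" for m
  unfolding oT_measure[OF Bm, symmetric] by (rule antisym; rule oT_mono) (auto simp: B_def)
 then have "measure lebN (B m) \<ge> \<tau>" for m using gt[of m] by simp
 ultimately have "\<tau> \<le> measure lebN (\<Inter>m. B m)" by (intro LIMSEQ_le_const) auto
 also have "\<dots> = oT (\<Inter>m. B m)" using Bm by (intro oT_measure[symmetric]) auto
 also have "\<dots> \<le> om g (\<Inter>m. O' m)" by (rule oT_mono) (auto simp: B_def)
 finally show False using g(4) \<tau> by simp
qed


section \<open>Truncation of surfaces and generic tangents\<close>

lemma box_dist:
 assumes "d > 0"
 shows "\<exists>N \<delta>. \<delta> > 0 \<and> (\<forall>x y :: nat \<Rightarrow> real. (\<forall>i<N. \<bar>x i - y i\<bar> \<le> \<delta>) \<longrightarrow> dist x y < d)"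
proof -
 obtain N where N: "(1/2::real)^N < d/2" using assms real_arch_pow_inv[of "d/2" "1/2"] by auto
 \<comment> \<open>The metric on functions enumerates the coordinates by \<open>from_nat\<close>, so
   \<open>M\<close> must exceed the images of the first indices.\<close>
 define M where "M = Suc (Max (from_nat ` {..N}))"
 show ?thesis
 proof (intro exI conjI allI impI)
  show "d/8 > 0" using assms by simp
  fix x y :: "nat \<Rightarrow> real" assume xy: "\<forall>i<M. \<bar>x i - y i\<bar> \<le> d/8"
  have "dist (x (from_nat n)) (y (from_nat n)) \<le> d/8" if "n \<le> N" for n
   using xy that by (auto simp: M_def dist_real_def less_Suc_eq_le)
  moreover have "{dist (x (from_nat n)) (y (from_nat n)) |n. n \<le> N} = (\<lambda>n. dist (x (from_nat n)) (y (from_nat n))) ` {..N}"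
   by auto
  ultimately have "Max {dist (x (from_nat n)) (y (from_nat n)) |n. n \<le> N} \<le> d/8"
   by (simp only:) (subst Max_le_iff; auto)
  then show "dist x y < d"
   using dist_fun_le_dist_first_terms[of x y N] N assms by linarith
 qed
qed

lemma cubeT_modulus:
 fixes h :: "(nat \<Rightarrow> real) \<Rightarrow> 'a::metric_space"
 assumes "continuous_on cubeT h" "e > 0"
 shows "\<exists>N \<delta>. \<delta> > 0 \<and> (\<forall>t\<in>cubeT. \<forall>t'\<in>cubeT. (\<forall>i<N. \<bar>t i - t' i\<bar> \<le> \<delta>) \<longrightarrow> dist (h t) (h t') < e)"
proof -
 have "uniformly_continuous_on cubeT h"
  by (rule compact_uniformly_continuous[OF assms(1) compact_cubeT])
 then obtain d where d: "d > 0" "\<And>t t'. t \<in> cubeT \<Longrightarrow> t' \<in> cubeT \<Longrightarrow> dist t' t < d \<Longrightarrow> dist (h t') (h t) < e"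
  using assms(2) unfolding uniformly_continuous_on_def by metis
 obtain N \<delta> where "\<delta> > 0" "\<And>x y :: nat \<Rightarrow> real. (\<forall>i<N. \<bar>x i - y i\<bar> \<le> \<delta>) \<Longrightarrow> dist x y < d"
  using box_dist[OF d(1)] by blast
 then show ?thesis using d(2) by blast
qed

definition cut :: "nat \<Rightarrow> (nat \<Rightarrow> real) \<Rightarrow> nat \<Rightarrow> real" where
 "cut m t = (\<lambda>i. if i < m then t i else 0)"

lemma cut_in_cubeT: "t \<in> cubeT \<Longrightarrow> cut m t \<in> cubeT"
 by (auto simp: cut_def cubeT_def)

lemma continuous_on_cut: "continuous_on S (cut m)"
 unfolding cut_def
proof (rule continuous_on_coordinatewise_then_product)
 fix i show "continuous_on S (\<lambda>x. if i < m then x i else 0)"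
  by (cases "i < m") (auto intro: continuous_on_coord)
qed

text \<open>Freezing the coordinates from \<open>m\<close> on frees them for new terms: derivatives
  in them vanish, while by compactness of the cube the values and finitely many derivatives hardly
  change once \<open>m\<close> is large.\<close>

definition trunc :: "nat \<Rightarrow> ((nat \<Rightarrow> real) \<Rightarrow> 'x::real_normed_vector) \<Rightarrow> (nat \<Rightarrow> real) \<Rightarrow> 'x" where
 "trunc m g = ext (\<lambda>t. g (cut m t))"

lemma trunc_eq: "t \<in> cubeT \<Longrightarrow> trunc m g t = g (cut m t)"
 by (simp add: trunc_def ext_def)

lemma trunc_GammaX:
 assumes g: "g \<in> GammaX"
 shows "trunc m g \<in> GammaX"
  "t \<in> cubeT \<Longrightarrow> pderiv (trunc m g) j t = (if j < m then pderiv g j (cut m t) else 0)"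
proof -
 have 1: "continuous_on cubeT (\<lambda>t. g (cut m t))"
  by (rule continuous_on_compose2[OF GammaX_D(1)[OF g] continuous_on_cut]) (auto intro: cut_in_cubeT)
 have 2: "continuous_on cubeT (\<lambda>t. if j < m then pderiv g j (cut m t) else 0)" for j
  by (cases "j < m") (auto intro!: continuous_on_compose2[OF GammaX_D(3)[OF g] continuous_on_cut] cut_in_cubeT)
 have 3: "((\<lambda>s. g (cut m (t(j := s)))) has_vector_derivative (if j < m then pderiv g j (cut m t) else 0))
   (at (t j) within {0..1})" if "t \<in> cubeT" for t j
 proof (cases "j < m")
  case True
  then have "cut m (t(j := s)) = (cut m t)(j := s)" "cut m t j = t j" for s
   by (auto simp: cut_def)
  then show ?thesis using GammaX_D(4)[OF g cut_in_cubeT[OF that], of m j] True by simp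
 next
  case False
  then have "cut m (t(j := s)) = cut m t" for s by (auto simp: cut_def)
  then show ?thesis using False by simp
 qed
 show "trunc m g \<in> GammaX"
  "t \<in> cubeT \<Longrightarrow> pderiv (trunc m g) j t = (if j < m then pderiv g j (cut m t) else 0)"
  unfolding trunc_def by (rule GammaX_ext[OF 1 2 3]; assumption)+
qed

lemma cut_close:
 fixes h :: "(nat \<Rightarrow> real) \<Rightarrow> 'a::metric_space"
 assumes "continuous_on cubeT h" "e > 0"
 shows "\<exists>N. \<forall>m\<ge>N. \<forall>t\<in>cubeT. dist (h (cut m t)) (h t) < e"
proof -
 obtain N \<delta> where *: "\<delta> > 0" "\<And>t t'. t \<in> cubeT \<Longrightarrow> t' \<in> cubeT \<Longrightarrow> (\<forall>i<N. \<bar>t i - t' i\<bar> \<le> \<delta>) \<Longrightarrow> dist (h t) (h t') < e"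
  using cubeT_modulus[OF assms] by blast
 show ?thesis
 proof (intro exI[of _ N] allI impI ballI)
  fix m t assume "N \<le> m" "t \<in> cubeT"
  then show "dist (h (cut m t)) (h t) < e"
   using *(1) by (intro *(2) cut_in_cubeT) (auto simp: cut_def)
 qed
qed

lemma trunc_close:
 assumes g: "g \<in> GammaX" and e: "e > 0"
 shows "\<exists>N. \<forall>m\<ge>N. close n e g (trunc m g)"
proof -
 obtain N0 where N0: "\<And>m t. m \<ge> N0 \<Longrightarrow> t \<in> cubeT \<Longrightarrow> dist (g (cut m t)) (g t) < e"
  using cut_close[OF GammaX_D(1)[OF g] e] by blast
 have "\<forall>j. \<exists>N. \<forall>m\<ge>N. \<forall>t\<in>cubeT. dist (pderiv g j (cut m t)) (pderiv g j t) < e"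
  using cut_close[OF GammaX_D(3)[OF g] e] by blast
 then obtain N1 where N1: "\<And>j m t. m \<ge> N1 j \<Longrightarrow> t \<in> cubeT \<Longrightarrow> dist (pderiv g j (cut m t)) (pderiv g j t) < e"
  by metis
 define N where "N = Max (insert N0 (insert n (N1 ` {..<n})))"
 have N: "N0 \<le> N" "n \<le> N" "\<And>j. j < n \<Longrightarrow> N1 j \<le> N" unfolding N_def by (rule Max_ge; simp)+
 show ?thesis
 proof (intro exI[of _ N] allI impI)
  fix m assume m: "N \<le> m"
  show "close n e g (trunc m g)"
   unfolding close_def
  proof (intro ballI conjI allI impI)
   fix t :: "nat \<Rightarrow> real" assume t: "t \<in> cubeT"
   show "norm (trunc m g t - g t) \<le> e"
    using N0[of m t] t m N(1) by (simp add: trunc_eq dist_norm)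
   fix j assume "j < n"
   then show "norm (pderiv (trunc m g) j t - pderiv g j t) \<le> e"
    using N1[of j m t] t m N(2) N(3)[of j] by (simp add: trunc_GammaX(2)[OF g] dist_norm)
  qed
 qed
qed

lemma GammaX_coord_scaleR:
 fixes v :: "'x::real_normed_vector"
 shows "ext (\<lambda>t. t i *\<^sub>R v) \<in> GammaX"
  "t \<in> cubeT \<Longrightarrow> pderiv (ext (\<lambda>t. t i *\<^sub>R v)) j t = (if j = i then v else 0)"
proof -
 have d: "\<And>x. ((\<lambda>x. x) has_real_derivative 1) (at x)" by (rule DERIV_ident)
 note c = GammaX_coord[where p = "\<lambda>x. x" and p' = "\<lambda>_. 1", OF d continuous_on_const]
 have eq: "ext (\<lambda>t. t i *\<^sub>R v) = (\<lambda>t. ext (\<lambda>t. t i) t *\<^sub>R v)"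
  by (auto simp: ext_def)
 show "ext (\<lambda>t. t i *\<^sub>R v) \<in> GammaX"
  unfolding eq by (rule GammaX_scaleR_const(1)[OF c(1)])
 show "t \<in> cubeT \<Longrightarrow> pderiv (ext (\<lambda>t. t i *\<^sub>R v)) j t = (if j = i then v else 0)"
  unfolding eq by (simp add: GammaX_scaleR_const(2)[OF c(1)] c(2))
qed

text \<open>Up to a scalar \<open>b\<close>, one partial derivative is nearly the constant
  \<open>v\<close> on the whole cube, so that all lines in this coordinate run almost in the
  direction \<open>v\<close>.\<close>

definition Gtan :: "'x::real_normed_vector \<Rightarrow> ((nat \<Rightarrow> real) \<Rightarrow> 'x) set" where
 "Gtan v = {g\<in>GammaX. \<forall>e>0. \<exists>j b. \<forall>t\<in>cubeT. norm (v - b *\<^sub>R pderiv g j t) \<le> e}"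

text \<open>A term \<open>t m *\<^sub>R (\<sigma> *\<^sub>R v)\<close> with \<open>m \<ge> n\<close>
  is small in every seminorm being watched, yet it makes the \<open>m\<close>-th derivative of a
  truncated surface equal to \<open>\<sigma> *\<^sub>R v\<close>. The factor
  \<open>1 / \<sigma>\<close> is absorbed by the free scalar \<open>b\<close>.\<close>

lemma Gtan_residual:
 fixes v :: "'x::real_normed_vector"
 shows "gamma_residual (Gtan v)"
proof -
 define U where "U e = {g\<in>GammaX. \<exists>j b e'. e' < e \<and> (\<forall>t\<in>cubeT. norm (v - b *\<^sub>R pderiv g j t) \<le> e')}" for e :: real
 have open_U: "gamma_open (U e)" for e
  unfolding gamma_open_iff
 proof (intro conjI ballI)
  fix g assume "g \<in> U e"
  then obtain j b e' where g: "g \<in> GammaX" and e': "e' < e" "\<And>t. t \<in> cubeT \<Longrightarrow> norm (v - b *\<^sub>R pderiv g j t) \<le> e'"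
   unfolding U_def by blast
  define d where "d = (e - e') / (2 * (\<bar>b\<bar> + 1))"
  have d: "d > 0" using e'(1) by (simp add: d_def)
  have bd: "\<bar>b\<bar> * d \<le> (e - e') / 2"
   using e'(1) by (simp add: d_def divide_simps)
  have "h \<in> U e" if h: "h \<in> GammaX" "close (Suc j) d g h" for h
  proof -
   have "norm (v - b *\<^sub>R pderiv h j t) \<le> e' + (e - e')/2" if t: "t \<in> cubeT" for t
   proof -
    have "norm (v - b *\<^sub>R pderiv h j t) = norm ((v - b *\<^sub>R pderiv g j t) - b *\<^sub>R (pderiv h j t - pderiv g j t))"
     by (simp add: algebra_simps)
    also have "\<dots> \<le> norm (v - b *\<^sub>R pderiv g j t) + \<bar>b\<bar> * norm (pderiv h j t - pderiv g j t)"
     using norm_triangle_ineq4 norm_scaleR by metis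
    also have "\<bar>b\<bar> * norm (pderiv h j t - pderiv g j t) \<le> \<bar>b\<bar> * d"
     using h(2) t by (intro mult_left_mono) (auto simp: close_def)
    finally show ?thesis using e'(2)[OF t] bd by linarith
   qed
   moreover have "e' + (e - e')/2 < e" using e'(1) by (simp add: field_simps)
   ultimately show ?thesis unfolding U_def using h(1) by blast
  qed
  then show "\<exists>n e'. e' > 0 \<and> (\<forall>h\<in>GammaX. close n e' g h \<longrightarrow> h \<in> U e)" using d by blast
 qed (auto simp: U_def)
 have dense_U: "gamma_dense (U e)" if e: "e > 0" for e
  unfolding gamma_dense_iff
 proof (intro conjI allI impI)
  show "U e \<subseteq> GammaX" by (auto simp: U_def)
  fix W :: "((nat \<Rightarrow> real) \<Rightarrow> 'x) set" assume W: "gamma_open W" "W \<noteq> {}"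
  then obtain g where g: "g \<in> W" by blast
  then obtain n d where d: "d > 0" "\<And>h. h \<in> GammaX \<Longrightarrow> close n d g h \<Longrightarrow> h \<in> W"
   using W(1) unfolding gamma_open_iff by metis
  have gG: "g \<in> GammaX" using g W(1) by (auto simp: gamma_open_def)
  obtain N where N: "\<And>m. m \<ge> N \<Longrightarrow> close n (d/2) g (trunc m g)"
   using trunc_close[OF gG, of "d/2" n] d(1) by auto
  define m where "m = max N n"
  define \<sigma> where "\<sigma> = d / (2 * (norm v + 1))"
  have \<sigma>: "\<sigma> > 0" "\<sigma> * norm v \<le> d/2"
  proof -
   have pos: "norm v + 1 > 0" using norm_ge_zero[of v] by linarith
   then show "\<sigma> > 0" using d(1) by (simp add: \<sigma>_def)
   have "norm v \<le> norm v + 1" by simp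
   then have "d * norm v \<le> d * (norm v + 1)" using d(1) by simp
   then show "\<sigma> * norm v \<le> d/2" using pos by (simp add: \<sigma>_def field_simps)
  qed
  define h where "h = (\<lambda>t. trunc m g t + ext (\<lambda>t. t m *\<^sub>R (\<sigma> *\<^sub>R v)) t)"
  have hG: "h \<in> GammaX" unfolding h_def
   by (intro GammaX_add(1) trunc_GammaX(1) gG GammaX_coord_scaleR(1))
  have hd: "pderiv h j t = pderiv (trunc m g) j t + (if j = m then \<sigma> *\<^sub>R v else 0)" if "t \<in> cubeT" for j t
   unfolding h_def
   by (subst GammaX_add(2)[OF trunc_GammaX(1)[OF gG] GammaX_coord_scaleR(1) that])
    (simp only: GammaX_coord_scaleR(2)[OF that])
  have "close n (d/2) (trunc m g) h"
   unfolding close_def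
  proof (intro ballI conjI allI impI)
   fix t :: "nat \<Rightarrow> real" assume t: "t \<in> cubeT"
   have "norm (h t - trunc m g t) = t m * (\<sigma> * norm v)"
    using t \<sigma>(1) cubeT_D[OF t, of m] by (simp add: h_def ext_def)
   also have "\<dots> \<le> 1 * (\<sigma> * norm v)" using cubeT_D[OF t, of m] \<sigma>(1) by (intro mult_right_mono) auto
   finally show "norm (h t - trunc m g t) \<le> d/2" using \<sigma>(2) by simp
   fix j assume "j < n"
   then have "j \<noteq> m" by (simp add: m_def)
   then show "norm (pderiv h j t - pderiv (trunc m g) j t) \<le> d/2"
    using d(1) t by (simp add: hd)
  qed
  then have "close n (d/2 + d/2) g h" using N[of m] close_trans[of n "d/2" g "trunc m g" "d/2" h] by (simp add: m_def)
  then have "h \<in> W" using d(2) hG by simp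
  moreover have "h \<in> U e"
  proof -
   have "norm (v - (1/\<sigma>) *\<^sub>R pderiv h m t) \<le> 0" if "t \<in> cubeT" for t
    using that \<sigma>(1) by (simp add: hd trunc_GammaX(2)[OF gG])
   then show ?thesis unfolding U_def using hG e by blast
  qed
  ultimately show "W \<inter> U e \<noteq> {}" by blast
 qed
 have "gamma_residual (\<Inter>k. U (inverse (Suc k)))"
  by (intro gamma_residual_Inter gamma_residual_open open_U dense_U) simp
 moreover have "(\<Inter>k. U (inverse (Suc k))) \<subseteq> Gtan v"
 proof
  fix g assume g: "g \<in> (\<Inter>k. U (inverse (Suc k)))"
  have "\<exists>j b. \<forall>t\<in>cubeT. norm (v - b *\<^sub>R pderiv g j t) \<le> e" if e: "e > 0" for e
  proof -
   obtain k where k: "inverse (real (Suc k)) < e" using reals_Archimedean[OF e] by blast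
   have "g \<in> U (inverse (Suc k))" by (rule INT_D[OF g UNIV_I])
   then obtain j b e' where "e' < inverse (real (Suc k))" "\<forall>t\<in>cubeT. norm (v - b *\<^sub>R pderiv g j t) \<le> e'"
    unfolding U_def by blast
   then show ?thesis using k by (meson less_imp_le order_trans)
  qed
  moreover have "g \<in> GammaX" using g by (auto simp: U_def)
  ultimately show "g \<in> Gtan v" by (auto simp: Gtan_def)
 qed
 ultimately show ?thesis by (rule gamma_residual_mono) (auto simp: Gtan_def)
qed

section \<open>Porosity in given directions\<close>

text \<open>The hole size is tied to the scale \<open>r\<close>, not to the distance
  \<open>norm (r *\<^sub>R u)\<close>, and only the directions of the centres are restricted. Thus a
  larger \<open>Q\<close> makes porosity easier and \<open>porous_null\<close> harder.\<close>

definition porous :: "real \<Rightarrow> 'x::real_normed_vector set \<Rightarrow> 'x set \<Rightarrow> 'x \<Rightarrow> bool" where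
 "porous c Q E x \<longleftrightarrow> (\<forall>d>0. \<exists>u\<in>Q. \<exists>r. 0 < r \<and> r < d \<and> ball (x + r *\<^sub>R u) (c * r) \<inter> E = {})"

definition porous_null :: "'x::real_normed_vector set \<Rightarrow> bool" where
 "porous_null Q \<longleftrightarrow> (\<forall>c>0. \<forall>E. (\<forall>x\<in>E. porous c Q E x) \<longrightarrow> Gnull E)"

lemma porous_mono: "porous c Q E x \<Longrightarrow> Q \<subseteq> Q' \<Longrightarrow> E' \<subseteq> E \<Longrightarrow> porous c Q' E' x"
 unfolding porous_def by (meson disjoint_iff subsetD)

lemma porous_null_mono: "porous_null Q \<Longrightarrow> Q' \<subseteq> Q \<Longrightarrow> porous_null Q'"
 unfolding porous_null_def by (meson order_refl porous_mono)

text \<open>Points of a set that is porous along \<open>Q1 + Q2\<close> are, up to a null set, porous along \<open>Q2\<close>: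
 if the set has no holes along \<open>Q2\<close> at small scales near some of its points,
 then at these points there must already be holes along \<open>Q1\<close>.\<close>

lemma porous_decompose:
 assumes Q1: "porous_null Q1" and c: "c > 0"
  and E: "\<And>x. x \<in> E \<Longrightarrow> porous c Q E x"
  and Q: "\<And>u. u \<in> Q \<Longrightarrow> \<exists>z\<in>Q1. u - z \<in> Q2"
 shows "Gnull {x\<in>E. \<not> porous (c/2) Q2 E x}"
proof -
 define F where "F m = {x\<in>E. \<forall>u\<in>Q2. \<forall>r. 0 < r \<and> r < inverse (Suc m) \<longrightarrow> ball (x + r *\<^sub>R u) (c/2 * r) \<inter> E \<noteq> {}}" for m :: nat
 have "Gnull (F m)" for m
 proof -
  have "porous (c/2) Q1 (F m) x" if x: "x \<in> F m" for x
   unfolding porous_def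
  proof (intro allI impI)
   fix d :: real assume d: "d > 0"
   then have "min d (inverse (Suc m)) > 0" by simp
   then obtain u r where u: "u \<in> Q" "0 < r" "r < d" "r < inverse (Suc m)" "ball (x + r *\<^sub>R u) (c * r) \<inter> E = {}"
    using E[of x] x unfolding F_def porous_def by (metis (no_types, lifting) mem_Collect_eq min_less_iff_conj)
   obtain z where z: "z \<in> Q1" "u - z \<in> Q2" using Q[OF u(1)] by blast
   \<comment> \<open>A point \<open>e\<close> of \<open>F m\<close> in this ball would have no hole
     in the direction \<open>u - z\<close> at scale \<open>r\<close>, and the point of
     \<open>E\<close> found there would lie in the hole of \<open>x\<close>.\<close>
   have "ball (x + r *\<^sub>R z) (c/2 * r) \<inter> F m = {}"
   proof (rule ccontr)
    assume "ball (x + r *\<^sub>R z) (c/2 * r) \<inter> F m \<noteq> {}"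
    then obtain e where e: "e \<in> F m" "dist (x + r *\<^sub>R z) e < c/2 * r" by auto
    then have "ball (e + r *\<^sub>R (u - z)) (c/2 * r) \<inter> E \<noteq> {}"
     using z(2) u(2,4) unfolding F_def by blast
    then obtain e' where e': "e' \<in> E" "dist (e + r *\<^sub>R (u - z)) e' < c/2 * r"
     by auto
    have "dist (x + r *\<^sub>R u) (e + r *\<^sub>R (u - z)) = dist (x + r *\<^sub>R z) e"
     by (simp add: dist_norm algebra_simps)
    then have "dist (x + r *\<^sub>R u) e' < c/2 * r + c/2 * r"
     using e(2) e'(2) dist_triangle[of "x + r *\<^sub>R u" e' "e + r *\<^sub>R (u - z)"] by linarith
    then have "e' \<in> ball (x + r *\<^sub>R u) (c * r)" by (simp add: mem_ball)
    then show False using u(5) e'(1) by blast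
   qed
   then show "\<exists>u\<in>Q1. \<exists>r>0. r < d \<and> ball (x + r *\<^sub>R u) (c/2 * r) \<inter> F m = {}"
    using z(1) u(2,3) by blast
  qed
  then show ?thesis using Q1 c unfolding porous_null_def by (meson half_gt_zero)
 qed
 then have "Gnull (\<Union>m. F m)" by (rule Gnull_UN)
 moreover have "{x\<in>E. \<not> porous (c/2) Q2 E x} \<subseteq> (\<Union>m. F m)"
 proof
  fix x assume "x \<in> {x\<in>E. \<not> porous (c/2) Q2 E x}"
  then obtain d where x: "x \<in> E" "d > 0" "\<And>u r. u \<in> Q2 \<Longrightarrow> 0 < r \<Longrightarrow> r < d \<Longrightarrow> ball (x + r *\<^sub>R u) (c/2 * r) \<inter> E \<noteq> {}"
   unfolding porous_def by blast
  obtain m where m: "inverse (real (Suc m)) < d" using x(2) reals_Archimedean by blast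
  have "x \<in> F m"
   unfolding F_def using x(1) x(3) order.strict_trans[OF _ m] by blast
  then show "x \<in> (\<Union>m. F m)" by blast
 qed
 ultimately show ?thesis by (rule Gnull_mono)
qed

text \<open>Apart from the null part split off by \<open>porous_decompose\<close>, the set is porous
  along \<open>Q2\<close>; porosity passes to this subset because holes only grow.\<close>

lemma porous_null_sum:
 assumes "porous_null Q1" "porous_null Q2" and Q: "\<And>u. u \<in> Q \<Longrightarrow> \<exists>z\<in>Q1. u - z \<in> Q2"
 shows "porous_null Q"
 unfolding porous_null_def
proof (intro allI impI)
 fix c :: real and E :: "'a set" assume c: "c > 0" and E: "\<forall>x\<in>E. porous c Q E x"
 define E' where "E' = {x\<in>E. porous (c/2) Q2 E x}"
 have "Gnull {x\<in>E. \<not> porous (c/2) Q2 E x}"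
  by (rule porous_decompose[OF assms(1) c _ Q]) (use E in auto)
 moreover have "Gnull E'"
 proof -
  have "porous (c/2) Q2 E' x" if "x \<in> E'" for x
   using that by (auto simp: E'_def elim!: porous_mono)
  then show ?thesis using assms(2) c unfolding porous_null_def by (meson half_gt_zero)
 qed
 ultimately have "Gnull ({x\<in>E. \<not> porous (c/2) Q2 E x} \<union> E')" by (rule Gnull_Un)
 then show "Gnull E" by (rule Gnull_mono) (auto simp: E'_def)
qed

section \<open>Null sets from one-dimensional sections\<close>

lemma section_sets:
 assumes "t \<in> cubeT" "S \<in> sets lebN"
 shows "{s\<in>{0..1}. t(j := s) \<in> S} \<in> sets borel"
proof -
 have "(\<lambda>s. t(j := s)) \<in> measurable unitI lebN"
  unfolding lebN_def
 proof (rule measurable_PiM_single')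
  fix i :: nat
  show "(\<lambda>s. (t(j := s)) i) \<in> measurable unitI unitI"
   using cubeT_D[OF assms(1), of i] by (cases "i = j") (auto intro!: measurable_const simp: space_restrict_space)
 qed (use assms(1) in \<open>auto simp: space_restrict_space cubeT_def PiE_def\<close>)
 from measurable_sets[OF this assms(2)]
 have "{s\<in>{0..1}. t(j := s) \<in> S} \<in> sets unitI"
  by (simp add: space_restrict_space vimage_def Int_def conj_commute)
 then show ?thesis by (simp add: sets_restrict_space_iff)
qed

lemma null_by_sections:
 assumes "S \<in> sets lebN" "\<And>t. t \<in> cubeT \<Longrightarrow> emeasure lborel {s\<in>{0..1}. t(j := s) \<in> S} = 0"
 shows "oT S = 0"
proof -
 have "emeasure lebN S \<le> 0 * emeasure lebN cubeT"
  by (rule emeasure_lebN_sections[where j = j]) (use assms sets.top[of lebN] in auto)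
 then show ?thesis using assms(1) by (simp add: oT_measure measure_def)
qed

lemma oT_face: "oT {t. t j = 0 \<or> t j = 1} = 0"
proof -
 have *: "oT {t\<in>cubeT. \<forall>i\<in>{j}. t i \<in> {a}} = 0" if "a \<in> {0, 1::real}" for a
  using emeasure_lebN_box[of "{j}" "\<lambda>_. {a}"] that by (auto simp: oT_measure)
 have "oT {t. t j = 0 \<or> t j = 1} \<le> oT ({t\<in>cubeT. \<forall>i\<in>{j}. t i \<in> {0}} \<union> {t\<in>cubeT. \<forall>i\<in>{j}. t i \<in> {1}})"
  by (rule oT_mono) auto
 also have "\<dots> \<le> 0"
  using oT_Un[of "{t\<in>cubeT. \<forall>i\<in>{j}. t i \<in> {0}}" "{t\<in>cubeT. \<forall>i\<in>{j}. t i \<in> {1}}"] *[of 0] *[of 1] by simp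
 finally show ?thesis using oT_nonneg by (simp add: antisym)
qed

text \<open>The classical fact that porous sets of reals are null, with holes displaced by up to
  \<open>K * r\<close>. A Vitali covering inside an open set of almost the measure of
  \<open>P\<close> is used: every covering interval loses the proportion \<open>q\<close> to its
  hole, whence |P| \<le> (1 - q) (|P| + e).\<close>

lemma porous_real_null:
 fixes P :: "real set"
 assumes P: "P \<in> sets borel" "P \<subseteq> {0..1}" and K: "K \<ge> 0" "\<kappa> > 0"
  and hole: "\<And>x d. x \<in> P \<Longrightarrow> d > 0 \<Longrightarrow> \<exists>r \<sigma>. 0 < r \<and> r < d \<and> \<bar>\<sigma>\<bar> \<le> K * r \<and> {x + \<sigma> - \<kappa> * r .. x + \<sigma> + \<kappa> * r} \<inter> P = {}"
 shows "emeasure lborel P = 0"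
proof -
 have "emeasure lborel P \<le> emeasure lborel {0..1::real}" using P by (intro emeasure_mono) auto
 then have finP: "emeasure lborel P < top" by (auto simp: less_top[symmetric] top_unique)
 \<comment> \<open>The hole has length \<open>2 * \<kappa> * r\<close>, the interval around
   \<open>x\<close> that surely contains it has length
   \<open>2 * (K + \<kappa>) * r\<close>.\<close>
 define q where "q = \<kappa> / (K + \<kappa>)"
 have q: "0 < q" "q \<le> 1" using K by (auto simp: q_def)
 have main: "emeasure lborel P \<le> ennreal (1 - q) * (emeasure lborel P + ennreal e)" if e: "e > 0" for e
 proof -
  have PL: "P \<in> sets lebesgue" using P(1) by simp
  obtain U where U: "open U" "P \<subseteq> U" "emeasure lebesgue (U - P) < ennreal e"
   using sets_lebesgue_outer_open[OF PL e] by metis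
  define I where "I = {(x, r, \<sigma>). x \<in> P \<and> 0 < r \<and> \<bar>\<sigma>\<bar> \<le> K * r \<and> {x + \<sigma> - \<kappa> * r .. x + \<sigma> + \<kappa> * r} \<inter> P = {} \<and>
    cball x ((K + \<kappa>) * r) \<subseteq> U}"
  define a where "a = (\<lambda>(x::real, r::real, \<sigma>::real). x)"
  define R where "R = (\<lambda>(x::real, r::real, \<sigma>::real). (K + \<kappa>) * r)"
  have Rpos: "0 < R i" if "i \<in> I" for i using that K by (auto simp: I_def R_def)
  have cov: "\<exists>i. i \<in> I \<and> x \<in> cball (a i) (R i) \<and> R i < d" if x: "x \<in> P" and d: "0 < d" for x d
  proof -
   obtain d' where d': "d' > 0" "cball x d' \<subseteq> U" using U x open_contains_cball by blast
   define d'' where "d'' = min d d' / (K + \<kappa>)"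
   have d'': "d'' > 0" using d d' K by (simp add: d''_def)
   then obtain r \<sigma> where r: "0 < r" "r < d''" "\<bar>\<sigma>\<bar> \<le> K * r" "{x + \<sigma> - \<kappa> * r .. x + \<sigma> + \<kappa> * r} \<inter> P = {}"
    using hole[OF x] by blast
   have lt: "(K + \<kappa>) * r < min d d'"
    using r(2) K by (simp add: d''_def field_simps pos_less_divide_eq)
   then have "cball x ((K + \<kappa>) * r) \<subseteq> U" using d'(2) by (auto simp: subset_eq)
   then have "(x, r, \<sigma>) \<in> I" using r x by (auto simp: I_def)
   then show ?thesis using lt r(1) K by (intro exI[of _ "(x, r, \<sigma>)"]) (auto simp: a_def R_def)
  qed
  obtain C where C: "countable C" "C \<subseteq> I"
   and disj: "pairwise (\<lambda>i j. disjnt (cball (a i) (R i)) (cball (a j) (R j))) C"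
   and neg: "negligible (P - (\<Union>i\<in>C. cball (a i) (R i)))"
   by (rule Vitali_covering_theorem_cballs[OF Rpos cov]; assumption?)
  have dC: "disjoint_family_on (\<lambda>i. cball (a i) (R i)) C"
   using disj by (auto simp: disjoint_family_on_def pairwise_def disjnt_def)
  have each: "emeasure lborel (P \<inter> cball (a i) (R i)) \<le> ennreal (1 - q) * emeasure lborel (cball (a i) (R i))"
   if "i \<in> C" for i
  proof -
   obtain x r \<sigma> where i: "i = (x, r, \<sigma>)" using prod_cases3 by blast
   then have r: "0 < r" "\<bar>\<sigma>\<bar> \<le> K * r" "{x + \<sigma> - \<kappa> * r .. x + \<sigma> + \<kappa> * r} \<inter> P = {}"
    using that C(2) by (auto simp: I_def)
   define H where "H = {x + \<sigma> - \<kappa> * r .. x + \<sigma> + \<kappa> * r}"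
   have ball: "cball (a i) (R i) = {x - (K + \<kappa>) * r .. x + (K + \<kappa>) * r}"
    by (simp add: i a_def R_def cball_eq_atLeastAtMost)
   have H: "H \<subseteq> cball (a i) (R i)" using r(2) unfolding H_def ball by (auto simp: algebra_simps abs_le_iff)
   have "emeasure lborel (P \<inter> cball (a i) (R i)) \<le> emeasure lborel (cball (a i) (R i) - H)"
    using r(3) P(1) by (intro emeasure_mono) (auto simp: H_def)
   also have "\<dots> = emeasure lborel (cball (a i) (R i)) - emeasure lborel H"
    using H r(1) K by (intro emeasure_Diff) (auto simp: H_def)
   also have "\<dots> = ennreal (2 * (K + \<kappa>) * r - 2 * \<kappa> * r)"
    using r(1) K by (simp add: ball H_def algebra_simps ennreal_minus)
   also have "2 * (K + \<kappa>) * r - 2 * \<kappa> * r = (1 - q) * (2 * (K + \<kappa>) * r)"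
    using K by (simp add: q_def field_simps)
   also have "ennreal ((1 - q) * (2 * (K + \<kappa>) * r)) = ennreal (1 - q) * emeasure lborel (cball (a i) (R i))"
    using r(1) K q by (subst ennreal_mult) (auto simp: ball algebra_simps)
   finally show ?thesis .
  qed
  have Usets: "(\<Union>i\<in>C. cball (a i) (R i)) \<in> sets borel" using C(1) by (intro sets.countable_UN') auto
  have "emeasure lborel P \<le> emeasure lborel (P - (\<Union>i\<in>C. cball (a i) (R i))) + emeasure lborel (\<Union>i\<in>C. P \<inter> cball (a i) (R i))"
   using P(1) Usets by (intro order_trans[OF emeasure_mono emeasure_subadditive]) (auto intro!: sets.countable_UN' C(1))
  also have "emeasure lborel (P - (\<Union>i\<in>C. cball (a i) (R i))) = 0"
   using neg P(1) Usets by (simp add: negligible_iff_null_sets null_sets_def)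
  also have "emeasure lborel (\<Union>i\<in>C. P \<inter> cball (a i) (R i)) = (\<integral>\<^sup>+i. emeasure lborel (P \<inter> cball (a i) (R i)) \<partial>count_space C)"
  proof (rule emeasure_UN_countable[OF _ C(1)])
   show "disjoint_family_on (\<lambda>i. P \<inter> cball (a i) (R i)) C"
    by (rule disjoint_family_on_bisimulation[OF dC]) auto
  qed (use P(1) in auto)
  also have "\<dots> \<le> (\<integral>\<^sup>+i. ennreal (1 - q) * emeasure lborel (cball (a i) (R i)) \<partial>count_space C)"
   by (intro nn_integral_mono each) simp
  also have "\<dots> = ennreal (1 - q) * (\<integral>\<^sup>+i. emeasure lborel (cball (a i) (R i)) \<partial>count_space C)"
   by (simp add: nn_integral_cmult)
  also have "(\<integral>\<^sup>+i. emeasure lborel (cball (a i) (R i)) \<partial>count_space C) = emeasure lborel (\<Union>i\<in>C. cball (a i) (R i))"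
   using dC by (intro emeasure_UN_countable[symmetric] C(1)) auto
  also have "\<dots> \<le> emeasure lborel U"
   using C(2) U(1) by (intro emeasure_mono) (auto simp: I_def a_def R_def subset_eq)
  also have "emeasure lborel U \<le> emeasure lborel P + emeasure lborel (U - P)"
   using U(1) P(1) by (intro order_trans[OF emeasure_mono emeasure_subadditive]) auto
  also have "emeasure lborel (U - P) \<le> ennreal e"
   using U(1,3) P(1) by simp
  finally show ?thesis by (simp add: mult_left_mono)
 qed
 obtain p where p: "emeasure lborel P = ennreal p" "p \<ge> 0" using finP by (cases "emeasure lborel P") auto
 have "p \<le> (1 - q) * (p + e)" if "e > 0" for e
  using main[OF that] q p that by (simp add: ennreal_plus[symmetric] ennreal_mult[symmetric] del: ennreal_plus)
 then have "p \<le> (1 - q) * (p + e)" if "e > 0" for e using that .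
 then have "q * p \<le> 0"
 proof -
  assume le: "\<And>e. e > 0 \<Longrightarrow> p \<le> (1 - q) * (p + e)"
  have "q * p \<le> e" if "e > 0" for e
  proof -
   have "(1 - q) * e \<le> e" using q that by (simp add: mult_left_le_one_le)
   then show ?thesis using le[OF that] by (simp add: algebra_simps)
  qed
  then show ?thesis by (meson field_le_epsilon dense_ge)
 qed
 then have "p = 0" using q(1) p(2) by (simp add: mult_le_0_iff)
 then show ?thesis using p by simp
qed


section \<open>Lines\<close>

definition seg :: "'x::real_normed_vector \<Rightarrow> 'x set" where
 "seg v = {a *\<^sub>R v |a. \<bar>a\<bar> \<le> 1}"

text \<open>Surfaces are 0 off the cube, so a coordinate moved out of the unit interval could make
  them jump; clamping keeps the composed maps continuous on the whole line.\<close>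

abbreviation clamp01 :: "real \<Rightarrow> real" where "clamp01 s \<equiv> max 0 (min 1 s)"

lemma continuous_on_upd_pair:
 "continuous_on S (\<lambda>p. (fst p)(j := clamp01 (fst p j + snd p)) :: nat \<Rightarrow> real)"
proof (rule continuous_on_coordinatewise_then_product)
 fix i
 have 1: "continuous_on S (\<lambda>p. fst p k)" for k :: nat
  by (rule continuous_on_compose2[OF continuous_on_coord[of UNIV k] continuous_on_fst[OF continuous_on_id]]) auto
 show "continuous_on S (\<lambda>p. ((fst p)(j := clamp01 (fst p j + snd p))) i)"
  by (cases "i = j") (auto intro!: continuous_intros 1)
qed

lemma pderiv_expansion:
 assumes g: "g \<in> GammaX" and t: "t \<in> cubeT" "0 < t j" "t j < 1" and e: "e > 0"
 shows "\<exists>d>0. \<forall>\<sigma>. \<bar>\<sigma>\<bar> < d \<longrightarrow> 0 < t j + \<sigma> \<and> t j + \<sigma> < 1 \<and>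
  norm (g (t(j := t j + \<sigma>)) - g t - \<sigma> *\<^sub>R pderiv g j t) \<le> e * \<bar>\<sigma>\<bar>"
proof -
 have "((\<lambda>s. g (t(j := s))) has_derivative (\<lambda>h. h *\<^sub>R pderiv g j t)) (at (t j) within {0..1})"
  using GammaX_D(4)[OF g t(1), of j] by (simp add: has_vector_derivative_def)
 then obtain d where d: "d > 0" "\<And>y. y \<in> {0..1} \<Longrightarrow> norm (y - t j) < d \<Longrightarrow>
   norm (g (t(j := y)) - g (t(j := t j)) - (y - t j) *\<^sub>R pderiv g j t) \<le> e * norm (y - t j)"
  unfolding has_derivative_within_alt using e by blast
 show ?thesis
 proof (intro exI[of _ "min d (min (t j) (1 - t j))"] conjI allI impI)
  fix \<sigma> assume s: "\<bar>\<sigma>\<bar> < min d (min (t j) (1 - t j))"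
  then show 1: "0 < t j + \<sigma>" "t j + \<sigma> < 1" by auto
  show "norm (g (t(j := t j + \<sigma>)) - g t - \<sigma> *\<^sub>R pderiv g j t) \<le> e * \<bar>\<sigma>\<bar>"
   using d(2)[of "t j + \<sigma>"] s 1 by simp
 qed (use d t in auto)
qed

text \<open>For a surface with tangent \<open>v\<close> along the coordinate \<open>j\<close>, a
  hole in the direction \<open>a *\<^sub>R v\<close> at scale \<open>r\<close> is crossed by the
  coordinate line near the parameter shift \<open>a * b * r\<close>. Hence sections of the preimage
  are porous sets of reals, and Fubini applies.\<close>

lemma porous_null_seg:
 fixes v :: "'x::real_normed_vector"
 shows "porous_null (seg v)"
 unfolding porous_null_def
proof (intro allI impI)
 fix c :: real and E :: "'x set" assume c: "c > 0" and E: "\<forall>x\<in>E. porous c (seg v) E x"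
 have "om g E = 0" if gt: "g \<in> Gtan v" for g
 proof -
  have g: "g \<in> GammaX" using gt by (simp add: Gtan_def)
  obtain j b where b: "\<And>t. t \<in> cubeT \<Longrightarrow> norm (v - b *\<^sub>R pderiv g j t) \<le> c/8"
  proof -
   have "c/8 > 0" using c by simp
   then have "\<exists>j b. \<forall>t\<in>cubeT. norm (v - b *\<^sub>R pderiv g j t) \<le> c/8"
    using gt unfolding Gtan_def by blast
   then show thesis using that by blast
  qed
  define D where "D = der_sn j g + 1"
  have D: "D > 0" "\<And>t. t \<in> cubeT \<Longrightarrow> norm (pderiv g j t) \<le> D"
  proof -
   have "0 \<le> der_sn j g" using sup_sn_bound(2)[OF g zero_in_cubeT, of j] norm_ge_zero order_trans by blast
   then show "D > 0" by (simp add: D_def)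
   show "\<And>t. t \<in> cubeT \<Longrightarrow> norm (pderiv g j t) \<le> D"
    using sup_sn_bound(2)[OF g, of _ j] by (force simp: D_def)
  qed
  \<comment> \<open>Shifting the parameter by \<open>\<kappa> * r\<close> moves the surface by at
    most \<open>c * r / 8\<close>; with equal errors from the tangent and from the expansion this
    stays within the hole radius \<open>c * r\<close>.\<close>
  define \<kappa> where "\<kappa> = c / (8 * D)"
  have \<kappa>: "\<kappa> > 0" using c D(1) by (simp add: \<kappa>_def)
  \<comment> \<open>Open holes miss the closure as well, and for the closed set \<open>F\<close> the
    bad set \<open>S\<close> below is measurable.\<close>
  define F where "F = closure E"
  \<comment> \<open>Parameters for which the interval of the would-be hole still meets
    \<open>F\<close>; a closed set, being the projection of a compact one.\<close>
  define H where "H a r = {t\<in>cubeT. \<exists>\<sigma>\<in>{a * b * r - \<kappa> * r .. a * b * r + \<kappa> * r}. g (t(j := clamp01 (t j + \<sigma>))) \<in> F}" for a r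
  have H_closed: "closed (H a r)" for a r
  proof -
   let ?I = "{a * b * r - \<kappa> * r .. a * b * r + \<kappa> * r}"
   have 1: "continuous_on (cubeT \<times> ?I) (\<lambda>p. g ((fst p)(j := clamp01 (fst p j + snd p))))"
    by (rule continuous_on_compose2[OF GammaX_D(1)[OF g] continuous_on_upd_pair])
     (auto intro!: cubeT_upd)
   have "closed ((cubeT \<times> ?I) \<inter> (\<lambda>p. g ((fst p)(j := clamp01 (fst p j + snd p)))) -` F)"
    by (rule continuous_closed_preimage[OF 1]) (auto simp: F_def closed_Times compact_imp_closed[OF compact_cubeT])
   then have "compact ((cubeT \<times> ?I) \<inter> ((cubeT \<times> ?I) \<inter> (\<lambda>p. g ((fst p)(j := clamp01 (fst p j + snd p)))) -` F))"
    by (intro compact_Int_closed compact_Times compact_cubeT compact_Icc)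
   then have "compact (fst ` ((cubeT \<times> ?I) \<inter> ((cubeT \<times> ?I) \<inter> (\<lambda>p. g ((fst p)(j := clamp01 (fst p j + snd p)))) -` F)))"
    by (rule compact_continuous_image[rotated]) (intro continuous_intros)
   moreover have "fst ` ((cubeT \<times> ?I) \<inter> ((cubeT \<times> ?I) \<inter> (\<lambda>p. g ((fst p)(j := clamp01 (fst p j + snd p)))) -` F)) = H a r"
    unfolding H_def by force
   ultimately show ?thesis using compact_imp_closed by metis
  qed
  define S where "S = {t\<in>cubeT. g t \<in> F} \<inter> (\<Inter>k::nat. cubeT \<inter> (\<Union>(a, r)\<in>{(a, r). \<bar>a\<bar> \<le> 1 \<and> 0 < r \<and> r < inverse (Suc k)}. - H a r))"
  have S1: "{t\<in>cubeT. g t \<in> F} = cubeT - {t\<in>cubeT. g t \<in> - F}" by auto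
  have "{t\<in>cubeT. g t \<in> F} \<in> sets lebN"
   unfolding S1 using sets.top[of lebN] by (intro sets.Diff GammaX_vimage_sets g) (auto simp: F_def)
  moreover have "cubeT \<inter> (\<Union>(a, r)\<in>{(a, r). \<bar>a\<bar> \<le> 1 \<and> 0 < r \<and> r < inverse (Suc k)}. - H a r) \<in> sets lebN" for k :: nat
  proof -
   have "open (\<Union>(a, r)\<in>{(a, r). \<bar>a\<bar> \<le> 1 \<and> 0 < r \<and> r < inverse (Suc k)}. - H a r)"
    using H_closed by (intro open_UN) auto
   from sets_lebN_borel[OF borel_open[OF this]] show ?thesis by (subst Int_commute)
  qed
  ultimately have S: "S \<in> sets lebN"
   unfolding S_def by (intro sets.Int[OF _ sets.countable_INT] image_subsetI UNIV_not_empty) blast+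
  have "oT S = 0"
  proof (rule null_by_sections[OF S])
   fix t :: "nat \<Rightarrow> real" assume t: "t \<in> cubeT"
   show "emeasure lborel {s\<in>{0..1}. t(j := s) \<in> S} = 0"
   proof (rule porous_real_null[of _ "\<bar>b\<bar>" \<kappa>])
    show "{s\<in>{0..1}. t(j := s) \<in> S} \<in> sets borel" by (rule section_sets[OF t S])
    fix x d :: real assume x: "x \<in> {s\<in>{0..1}. t(j := s) \<in> S}" and d: "d > 0"
    obtain k where k: "inverse (real (Suc k)) < d" using d reals_Archimedean by blast
    have "t(j := x) \<in> (\<Union>(a, r)\<in>{(a, r). \<bar>a\<bar> \<le> 1 \<and> 0 < r \<and> r < inverse (Suc k)}. - H a r)"
     using x unfolding S_def by blast
    then obtain a r where ar: "\<bar>a\<bar> \<le> 1" "0 < r" "r < inverse (Suc k)" "t(j := x) \<notin> H a r" by blast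
    have tx: "t(j := x) \<in> cubeT" using x t by (auto intro: cubeT_upd)
    have "{x + a * b * r - \<kappa> * r .. x + a * b * r + \<kappa> * r} \<inter> {s\<in>{0..1}. t(j := s) \<in> S} = {}"
    proof (rule ccontr)
     assume "\<not> ?thesis"
     then obtain s where "s \<in> {x + a * b * r - \<kappa> * r .. x + a * b * r + \<kappa> * r}" "s \<in> {s\<in>{0..1}. t(j := s) \<in> S}" by blast
     then have s: "x + a * b * r - \<kappa> * r \<le> s" "s \<le> x + a * b * r + \<kappa> * r" "s \<in> {0..1}" "t(j := s) \<in> S" by simp_all
     have "g (t(j := s)) \<in> F" using s(4) by (simp add: S_def)
     moreover have "(t(j := x))(j := clamp01 ((t(j := x)) j + (s - x))) = t(j := s)" using s(3) by auto
     ultimately show False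
      using ar(4) tx s(1,2) unfolding H_def
      by (auto dest!: bspec[where x = "s - x"] simp del: fun_upd_apply fun_upd_upd)
    qed
    moreover have "\<bar>a * b * r\<bar> \<le> \<bar>b\<bar> * r"
     using ar(1,2) by (auto simp: abs_mult mult_left_le_one_le intro!: mult_right_mono)
    ultimately show "\<exists>r \<sigma>. 0 < r \<and> r < d \<and> \<bar>\<sigma>\<bar> \<le> \<bar>b\<bar> * r \<and> {x + \<sigma> - \<kappa> * r .. x + \<sigma> + \<kappa> * r} \<inter> {s\<in>{0..1}. t(j := s) \<in> S} = {}"
     using ar k by (intro exI[of _ r] exI[of _ "a * b * r"]) auto
   qed (use \<kappa> in auto)
  qed
  moreover have "g -` E \<inter> cubeT \<subseteq> S \<union> {t. t j = 0 \<or> t j = 1}"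
  proof
   fix t assume t: "t \<in> g -` E \<inter> cubeT"
   then have tc: "t \<in> cubeT" and gE: "g t \<in> E" by auto
   show "t \<in> S \<union> {t. t j = 0 \<or> t j = 1}"
   proof (cases "t j = 0 \<or> t j = 1")
    case False
    then have tj: "0 < t j" "t j < 1" using cubeT_D[OF tc, of j] by auto
    define B where "B = \<bar>b\<bar> + \<kappa>"
    have B: "B > 0" using \<kappa> by (simp add: B_def)
    obtain d where d: "d > 0" "\<And>\<sigma>. \<bar>\<sigma>\<bar> < d \<Longrightarrow> 0 < t j + \<sigma> \<and> t j + \<sigma> < 1 \<and>
      norm (g (t(j := t j + \<sigma>)) - g t - \<sigma> *\<^sub>R pderiv g j t) \<le> c / (8 * B) * \<bar>\<sigma>\<bar>"
     using pderiv_expansion[OF g tc tj, of "c / (8 * B)"] c B by auto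
    have "t \<in> (\<Union>(a, r)\<in>{(a, r). \<bar>a\<bar> \<le> 1 \<and> 0 < r \<and> r < inverse (Suc k)}. - H a r)" for k :: nat
    proof -
     have "porous c (seg v) E (g t)" using E gE by blast
     moreover have "min (d / B) (inverse (Suc k)) > 0" using d(1) B by simp
     ultimately obtain u r where u: "u \<in> seg v" "0 < r" "r < min (d / B) (inverse (Suc k))" "ball (g t + r *\<^sub>R u) (c * r) \<inter> E = {}"
      unfolding porous_def by blast
     then obtain a where a: "\<bar>a\<bar> \<le> 1" "u = a *\<^sub>R v" by (auto simp: seg_def)
     have "ball (g t + r *\<^sub>R u) (c * r) \<inter> F = {}"
      using u(4) unfolding F_def by (simp add: open_Int_closure_eq_empty)
     have "t \<notin> H a r"
     proof
      assume "t \<in> H a r"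
      then obtain \<sigma> where "\<sigma> \<in> {a * b * r - \<kappa> * r .. a * b * r + \<kappa> * r}"
       and F: "g (t(j := clamp01 (t j + \<sigma>))) \<in> F"
       unfolding H_def by blast
      then have \<sigma>: "\<bar>\<sigma> - a * b * r\<bar> \<le> \<kappa> * r" by (simp add: abs_le_iff)
      have "\<bar>\<sigma>\<bar> \<le> \<bar>\<sigma> - a * b * r\<bar> + \<bar>a * b * r\<bar>" by simp
      also have "\<bar>a * b * r\<bar> \<le> \<bar>b\<bar> * r"
       using a(1) u(2) by (auto simp: abs_mult mult_left_le_one_le intro!: mult_right_mono)
      finally have \<sigma>B: "\<bar>\<sigma>\<bar> \<le> B * r" using \<sigma> by (simp add: B_def algebra_simps)
      also have "B * r < d" using u(3) B by (simp add: field_simps)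
      finally have "\<bar>\<sigma>\<bar> < d" .
      note d2 = d(2)[OF this]
      have "norm (g (t(j := t j + \<sigma>)) - (g t + r *\<^sub>R u)) =
       norm ((g (t(j := t j + \<sigma>)) - g t - \<sigma> *\<^sub>R pderiv g j t) + (\<sigma> - a * b * r) *\<^sub>R pderiv g j t - (r * a) *\<^sub>R (v - b *\<^sub>R pderiv g j t))"
       by (simp add: a(2) algebra_simps)
      also have "\<dots> \<le> norm (g (t(j := t j + \<sigma>)) - g t - \<sigma> *\<^sub>R pderiv g j t) + norm ((\<sigma> - a * b * r) *\<^sub>R pderiv g j t)
        + norm ((r * a) *\<^sub>R (v - b *\<^sub>R pderiv g j t))"
       by (meson norm_triangle_ineq norm_triangle_ineq4 order_trans add_right_mono)
      finally have le: "norm (g (t(j := t j + \<sigma>)) - (g t + r *\<^sub>R u)) \<le> norm (g (t(j := t j + \<sigma>)) - g t - \<sigma> *\<^sub>R pderiv g j t) + norm ((\<sigma> - a * b * r) *\<^sub>R pderiv g j t)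
        + norm ((r * a) *\<^sub>R (v - b *\<^sub>R pderiv g j t))" .
      have l1: "norm (g (t(j := t j + \<sigma>)) - g t - \<sigma> *\<^sub>R pderiv g j t) \<le> c * r / 8"
      proof -
       have "c / (8 * B) * \<bar>\<sigma>\<bar> \<le> c / (8 * B) * (B * r)" using \<sigma>B c B by (intro mult_left_mono) auto
       then show ?thesis using d2 B by simp
      qed
      have l2: "norm ((\<sigma> - a * b * r) *\<^sub>R pderiv g j t) \<le> \<kappa> * r * D"
       using \<sigma> D(2)[OF tc] \<kappa> u(2) by (auto intro!: mult_mono)
      have l3: "\<kappa> * r * D = c * r / 8" using D(1) by (simp add: \<kappa>_def)
      have l4: "norm ((r * a) *\<^sub>R (v - b *\<^sub>R pderiv g j t)) \<le> r * 1 * (c / 8)"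
       unfolding norm_scaleR using a(1) u(2) b[OF tc] by (intro mult_mono) (auto simp: abs_mult)
      have "norm (g (t(j := t j + \<sigma>)) - (g t + r *\<^sub>R u)) \<le> c * r / 8 + c * r / 8 + r * 1 * (c / 8)"
       using le l1 l2 l3 l4 by linarith
      moreover have "c * r / 8 + c * r / 8 + r * 1 * (c / 8) = 3/8 * (c * r)" by simp
      moreover have "c * r > 0" using c u(2) by simp
      ultimately have "norm (g (t(j := t j + \<sigma>)) - (g t + r *\<^sub>R u)) < c * r"
       by linarith
      moreover have "clamp01 (t j + \<sigma>) = t j + \<sigma>" using d2 by auto
      ultimately have "g (t(j := clamp01 (t j + \<sigma>))) \<in> ball (g t + r *\<^sub>R u) (c * r)"
       by (simp add: dist_norm norm_minus_commute)
      then show False using F \<open>ball (g t + r *\<^sub>R u) (c * r) \<inter> F = {}\<close> by blast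
     qed
     then show ?thesis using a(1) u(2,3) by auto
    qed
    moreover have "g t \<in> F" using gE closure_subset by (auto simp: F_def)
    ultimately show ?thesis using tc by (auto simp: S_def)
   qed simp
  qed
  ultimately show ?thesis
   using oT_mono[of "g -` E" "S \<union> {t. t j = 0 \<or> t j = 1}"] oT_Un[of S "{t. t j = 0 \<or> t j = 1}"] oT_face[of j] oT_nonneg[of "g -` E"]
   by simp
 qed
 then show "Gnull E"
  unfolding Gnull_def by (intro gamma_residual_mono[OF Gtan_residual[of v]]) (auto simp: Gtan_def)
qed

section \<open>Uniform and regular differentiability along a set of directions\<close>

definition quot :: "('x::real_normed_vector \<Rightarrow> 'y::real_normed_vector) \<Rightarrow> 'x \<Rightarrow> 'x \<Rightarrow> real \<Rightarrow> 'y" where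
 "quot f x u s = (f (x + s *\<^sub>R u) - f x) /\<^sub>R s"

text \<open>A Cauchy condition in the scale, uniform over \<open>Q\<close>. No derivative is
  mentioned, so that for fixed scales failure is an open condition on the point.\<close>

definition fdq :: "('x::real_normed_vector \<Rightarrow> 'y::real_normed_vector) \<Rightarrow> 'x set \<Rightarrow> real \<Rightarrow> 'x \<Rightarrow> bool" where
 "fdq f Q e x \<longleftrightarrow> (\<exists>d>0. \<forall>s s'. 0 < s \<and> s < d \<and> 0 < s' \<and> s' < d \<longrightarrow>
   (\<forall>u\<in>Q. norm (quot f x u s - quot f x u s') \<le> e))"

text \<open>Increments along \<open>Q\<close> hardly change when the base point moves by
  \<open>w\<close>, measured against \<open>s + norm w\<close>. This is what makes directional
  derivatives additive and lets two families of directions be combined.\<close>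

definition regq :: "('x::real_normed_vector \<Rightarrow> 'y::real_normed_vector) \<Rightarrow> 'x set \<Rightarrow> real \<Rightarrow> 'x \<Rightarrow> bool" where
 "regq f Q e x \<longleftrightarrow> (\<exists>d>0. \<forall>s w. 0 < s \<and> s < d \<and> norm w < d \<longrightarrow>
   (\<forall>u\<in>Q. norm (f (x + w + s *\<^sub>R u) - f (x + w) - (f (x + s *\<^sub>R u) - f x)) \<le> e * (s + norm w)))"

definition Fd :: "('x::real_normed_vector \<Rightarrow> 'y::real_normed_vector) \<Rightarrow> 'x set \<Rightarrow> 'x set" where
 "Fd f Q = {x. \<forall>e>0. fdq f Q e x}"

definition Reg :: "('x::real_normed_vector \<Rightarrow> 'y::real_normed_vector) \<Rightarrow> 'x set \<Rightarrow> 'x set" where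
 "Reg f Q = {x. \<forall>e>0. fdq f Q e x \<and> regq f Q e x}"

lemma quot_zero: "quot f x 0 s = 0"
 by (simp add: quot_def)

text \<open>Along a coordinate with tangent \<open>v\<close>, the map \<open>f\<close> composed with
  the surface is a Lipschitz curve, differentiable almost everywhere by \<open>RNP\<close>. The
  Lipschitz condition transfers its difference quotients, rescaled by \<open>a * b\<close>, to those
  of \<open>f\<close> in the direction \<open>a *\<^sub>R v\<close>.\<close>

lemma Gnull_Fd_seg:
 fixes f :: "'x::banach \<Rightarrow> 'y::banach"
 assumes f: "C-lipschitz_on UNIV f" and Y: "RNP TYPE('y)"
 shows "Gnull (- Fd f (seg v))"
proof -
 have C: "C \<ge> 0" using f lipschitz_on_nonneg by blast
 have lip: "norm (f x - f y) \<le> C * norm (x - y)" for x y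
  using lipschitz_onD[OF f, of x y] by (simp add: dist_norm)
 have fc: "continuous_on UNIV f" by (rule lipschitz_on_continuous_on[OF f])
 have "om g (- Fd f (seg v)) = 0" if gt: "g \<in> Gtan v" for g
 proof -
  have g: "g \<in> GammaX" using gt by (simp add: Gtan_def)
  define h where "h j t s = f (g (t(j := clamp01 s)))" for j t s
  \<comment> \<open>Quotients at scales below \<open>inverse (Suc m)\<close> that oscillate by more
    than \<open>inverse (Suc k)\<close>. The strict inequality makes the set relatively open, hence
    measurable.\<close>
  define A where "A j k m = {t\<in>cubeT. \<exists>s s'. s \<noteq> 0 \<and> s' \<noteq> 0 \<and> \<bar>s\<bar> < inverse (Suc m) \<and> \<bar>s'\<bar> < inverse (Suc m) \<and>
    norm ((h j t (t j + s) - h j t (t j)) /\<^sub>R s - (h j t (t j + s') - h j t (t j)) /\<^sub>R s') > inverse (Suc k)}" for j :: nat and k m :: nat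
  define N where "N = (\<Union>j. \<Union>k. \<Inter>m. A j k m)"
  have hc: "continuous_on cubeT (\<lambda>t. h j t (t j + s))" for j s
  proof -
   have "continuous_on cubeT (\<lambda>t::nat \<Rightarrow> real. (t, s))" by (intro continuous_intros)
   then have "continuous_on cubeT (\<lambda>t. (fst (t, s))(j := clamp01 (fst (t, s) j + snd (t, s))))"
    using continuous_on_compose2[OF continuous_on_upd_pair[of UNIV j]] by blast
   then have "continuous_on cubeT (\<lambda>t. t(j := clamp01 (t j + s)))" by simp
   then have "continuous_on cubeT (\<lambda>t. g (t(j := clamp01 (t j + s))))"
    by (rule continuous_on_compose2[OF GammaX_D(1)[OF g]]) (auto intro!: cubeT_upd)
   then show ?thesis unfolding h_def by (rule continuous_on_compose2[OF fc]) auto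
  qed
  have "A j k m \<in> sets lebN" for j k m
  proof -
   define Z where "Z s s' = cubeT \<inter> (\<lambda>t. norm ((h j t (t j + s) - h j t (t j + 0)) /\<^sub>R s - (h j t (t j + s') - h j t (t j + 0)) /\<^sub>R s')) -` {inverse (Suc k)<..}" for s s'
   have "openin (top_of_set cubeT) (Z s s')" for s s'
    unfolding Z_def by (intro continuous_openin_preimage_gen continuous_intros hc)
   then have "openin (top_of_set cubeT) (\<Union>(s, s')\<in>{(s, s'). s \<noteq> 0 \<and> s' \<noteq> 0 \<and> \<bar>s\<bar> < inverse (Suc m) \<and> \<bar>s'\<bar> < inverse (Suc m)}. Z s s')"
    by (intro openin_Union) auto
   moreover have "A j k m = (\<Union>(s, s')\<in>{(s, s'). s \<noteq> 0 \<and> s' \<noteq> 0 \<and> \<bar>s\<bar> < inverse (Suc m) \<and> \<bar>s'\<bar> < inverse (Suc m)}. Z s s')"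
    unfolding A_def Z_def by auto
   ultimately show ?thesis using sets_lebN_openin by metis
  qed
  then have Ak: "(\<Inter>m. A j k m) \<in> sets lebN" for j k by auto
  have "oT (\<Inter>m. A j k m) = 0" for j k
  proof (rule null_by_sections[where j = j, OF Ak])
   fix t :: "nat \<Rightarrow> real" assume t: "t \<in> cubeT"
   have lipg: "\<exists>L. L-lipschitz_on {0..1} (\<lambda>s. g (t(j := s)))"
   proof -
    have "((\<lambda>s. g (t(j := s))) has_derivative (\<lambda>d. d *\<^sub>R pderiv g j (t(j := s)))) (at s within {0..1})"
     if "s \<in> {0..1}" for s
     using GammaX_D_at[OF g t that, of j] by (simp add: has_vector_derivative_def)
    moreover have "onorm (\<lambda>d. d *\<^sub>R pderiv g j (t(j := s))) \<le> der_sn j g" if "s \<in> {0..1}" for s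
    proof (rule onorm_le)
     fix d :: real
     have "norm (pderiv g j (t(j := s))) \<le> der_sn j g"
      using that by (intro sup_sn_bound(2)[OF g] cubeT_upd[OF t]) auto
     then show "norm (d *\<^sub>R pderiv g j (t(j := s))) \<le> der_sn j g * norm d"
      by (simp add: mult.commute mult_left_mono)
    qed
    moreover have "0 \<le> der_sn j g" using sup_sn_bound(2)[OF g zero_in_cubeT, of j] norm_ge_zero order_trans by blast
    ultimately have "(der_sn j g)-lipschitz_on {0..1} (\<lambda>s. g (t(j := s)))"
     by (intro bounded_derivative_imp_lipschitz[where f' = "\<lambda>s d. d *\<^sub>R pderiv g j (t(j := s))"]) auto
    then show ?thesis by blast
   qed
   then obtain L where L: "L-lipschitz_on {0..1} (\<lambda>s. g (t(j := s)))" by blast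
   have "(C * L)-lipschitz_on UNIV (h j t)"
   proof (rule lipschitz_onI)
    fix s s' :: real
    have "dist (h j t s) (h j t s') \<le> C * dist (g (t(j := clamp01 s))) (g (t(j := clamp01 s')))"
     unfolding h_def using lipschitz_onD[OF f] by auto
    also have "dist (g (t(j := clamp01 s))) (g (t(j := clamp01 s'))) \<le> L * dist (clamp01 s) (clamp01 s')"
     using lipschitz_onD[OF L, of "clamp01 s" "clamp01 s'"] by auto
    also have "dist (clamp01 s) (clamp01 s') \<le> dist s s'" by (auto simp: dist_real_def)
    finally show "dist (h j t s) (h j t s') \<le> C * L * dist s s'"
     using C lipschitz_on_nonneg[OF L] by (simp add: mult_left_mono mult.assoc)
   qed (use C lipschitz_on_nonneg[OF L] in simp)
   then have "AE s in lborel. h j t differentiable (at s)"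
    using Y unfolding RNP_def by blast
   moreover have "s \<notin> {s\<in>{0..1}. t(j := s) \<in> (\<Inter>m. A j k m)}" if df: "h j t differentiable (at s)" for s
   proof
    assume "s \<in> {s\<in>{0..1}. t(j := s) \<in> (\<Inter>m. A j k m)}"
    then have As: "\<And>m. t(j := s) \<in> A j k m" by auto
    have hh: "h j (t(j := s)) = h j t" by (auto simp: h_def)
    obtain y where "(h j t has_vector_derivative y) (at s)"
     using df vector_derivative_works by blast
    then have "(h j t has_derivative (\<lambda>d. d *\<^sub>R y)) (at s)" by (simp add: has_vector_derivative_def)
    then obtain d where d: "d > 0" "\<And>z. norm (z - s) < d \<Longrightarrow> norm (h j t z - h j t s - (z - s) *\<^sub>R y) \<le> inverse (Suc k) / 2 * norm (z - s)"
     unfolding has_derivative_at_alt by (metis inverse_positive_iff_positive half_gt_zero of_nat_0_less_iff zero_less_Suc)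
    obtain m where m: "inverse (real (Suc m)) < d" using d(1) reals_Archimedean by blast
    have q: "norm ((h j t (s + z) - h j t s) /\<^sub>R z - y) \<le> inverse (Suc k) / 2" if "z \<noteq> 0" "\<bar>z\<bar> < inverse (Suc m)" for z
    proof -
     have "norm ((h j t (s + z) - h j t s) /\<^sub>R z - y) = norm ((h j t (s + z) - h j t s - z *\<^sub>R y) /\<^sub>R z)"
      using that(1) by (simp add: scaleR_diff_right)
     also have "\<dots> = norm (h j t (s + z) - h j t s - z *\<^sub>R y) / \<bar>z\<bar>"
      by (simp add: divide_inverse mult.commute)
     also have "\<dots> \<le> (inverse (Suc k) / 2 * \<bar>z\<bar>) / \<bar>z\<bar>"
      using d(2)[of "s + z"] that m by (intro divide_right_mono) auto
     finally show ?thesis using that(1) by simp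
    qed
    obtain z z' where z: "z \<noteq> 0" "z' \<noteq> 0" "\<bar>z\<bar> < inverse (Suc m)" "\<bar>z'\<bar> < inverse (Suc m)"
      "norm ((h j t (s + z) - h j t s) /\<^sub>R z - (h j t (s + z') - h j t s) /\<^sub>R z') > inverse (Suc k)"
     using As[of m] unfolding A_def by (auto simp: hh)
    have "norm ((h j t (s + z) - h j t s) /\<^sub>R z - (h j t (s + z') - h j t s) /\<^sub>R z') \<le> inverse (Suc k) / 2 + inverse (Suc k) / 2"
     using q[OF z(1,3)] q[OF z(2,4)] by (intro norm_diff_triangle_le[where y = y]) (auto simp: norm_minus_commute)
    then show False using z(5) by simp
   qed
   ultimately have "AE s in lborel. s \<notin> {s\<in>{0..1}. t(j := s) \<in> (\<Inter>m. A j k m)}"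
    by (auto elim: eventually_mono)
   then show "emeasure lborel {s\<in>{0..1}. t(j := s) \<in> (\<Inter>m. A j k m)} = 0"
    using section_sets[OF t Ak] by (subst (asm) AE_iff_measurable) auto
  qed
  then have N0: "oT N = 0" unfolding N_def by (intro oT_UN_zero)
  define B where "B = (\<Union>j. {t :: nat \<Rightarrow> real. t j = 0 \<or> t j = 1})"
  have B0: "oT B = 0" unfolding B_def by (intro oT_UN_zero oT_face)
  have "g -` (- Fd f (seg v)) \<inter> cubeT \<subseteq> N \<union> B"
  proof (rule ccontr)
   assume "\<not> ?thesis"
   then obtain t where t: "t \<in> cubeT" "g t \<notin> Fd f (seg v)" "t \<notin> N" "t \<notin> B" by blast
   have "fdq f (seg v) e (g t)" if e: "e > 0" for e
   proof -
    \<comment> \<open>\<open>e1\<close> bounds both the tangent error and the expansion error per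
      unit of \<open>s\<close>; the Lipschitz constant turns the two into
      \<open>2 * (C * e1) \<le> e / 4\<close>.\<close>
    define e1 where "e1 = e / (8 * (C + 1))"
    have e1: "e1 > 0" "C * e1 \<le> e / 8" using e C by (auto simp: e1_def field_simps)
    obtain j b where b: "norm (v - b *\<^sub>R pderiv g j t) \<le> e1"
     using gt e1(1) t(1) unfolding Gtan_def by blast
    \<comment> \<open>Adding 1 permits \<open>b = 0\<close>. \<open>B'\<close> converts the scale
      \<open>s\<close> in the space into the parameter step \<open>s * a * b\<close>.\<close>
    define B' where "B' = \<bar>b\<bar> + 1"
    have B': "B' > 0" "\<bar>b\<bar> \<le> B'" by (auto simp: B'_def)
    obtain k where k: "inverse (real (Suc k)) < e / (4 * B')" using reals_Archimedean[of "e / (4 * B')"] e B' by auto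
    obtain m where m: "t \<notin> A j k m" using t(3) unfolding N_def by blast
    have tj: "0 < t j" "t j < 1" using t(1,4) cubeT_D[OF t(1), of j] by (auto simp: B_def less_le)
    obtain d where d: "d > 0" "\<And>\<sigma>. \<bar>\<sigma>\<bar> < d \<Longrightarrow> 0 < t j + \<sigma> \<and> t j + \<sigma> < 1 \<and>
      norm (g (t(j := t j + \<sigma>)) - g t - \<sigma> *\<^sub>R pderiv g j t) \<le> e1 / B' * \<bar>\<sigma>\<bar>"
     using pderiv_expansion[OF g t(1) tj, of "e1 / B'"] e1 B' by auto
    define d1 where "d1 = min d (inverse (Suc m)) / B'"
    have d1: "d1 > 0" using d(1) B' by (simp add: d1_def)
    define q where "q \<sigma> = (h j t (t j + \<sigma>) - h j t (t j)) /\<^sub>R \<sigma>" for \<sigma>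
    have approx: "norm (quot f (g t) (a *\<^sub>R v) s - (a * b) *\<^sub>R q (s * a * b)) \<le> e/4" if a: "\<bar>a\<bar> \<le> 1" and s: "0 < s" "s < d1" for a s
    proof -
     define \<sigma> where "\<sigma> = s * a * b"
     have "\<bar>\<sigma>\<bar> = s * (\<bar>a\<bar> * \<bar>b\<bar>)" using s by (simp add: \<sigma>_def abs_mult)
     also have "\<dots> \<le> s * (1 * B')" using a s B' by (intro mult_left_mono mult_mono) auto
     finally have \<sigma>: "\<bar>\<sigma>\<bar> \<le> s * B'" by simp
     also have "s * B' < min d (inverse (Suc m))" using s(2) B' by (simp add: d1_def pos_less_divide_eq)
     finally have \<sigma>d: "\<bar>\<sigma>\<bar> < d" by simp
     note d2 = d(2)[OF \<sigma>d]
     have cl: "clamp01 (t j + \<sigma>) = t j + \<sigma>" "clamp01 (t j) = t j" using d2 tj by auto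
     have "(a * b) *\<^sub>R q \<sigma> = (h j t (t j + \<sigma>) - h j t (t j)) /\<^sub>R s"
     proof (cases "\<sigma> = 0")
      case True then show ?thesis by (simp add: q_def)
     next
      case False then show ?thesis using s by (simp add: q_def \<sigma>_def divide_simps)
     qed
     also have "\<dots> = (f (g (t(j := t j + \<sigma>))) - f (g t)) /\<^sub>R s"
      by (simp add: h_def cl)
     finally have "quot f (g t) (a *\<^sub>R v) s - (a * b) *\<^sub>R q \<sigma> = (f (g t + s *\<^sub>R a *\<^sub>R v) - f (g (t(j := t j + \<sigma>)))) /\<^sub>R s"
      by (simp add: quot_def algebra_simps)
     then have "norm (quot f (g t) (a *\<^sub>R v) s - (a * b) *\<^sub>R q \<sigma>) = norm (f (g t + s *\<^sub>R a *\<^sub>R v) - f (g (t(j := t j + \<sigma>)))) / s"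
      using s by (simp add: divide_inverse mult.commute)
     also have "\<dots> \<le> C * norm (g t + s *\<^sub>R a *\<^sub>R v - g (t(j := t j + \<sigma>))) / s"
      using s by (intro divide_right_mono lip) auto
     also have "norm (g t + s *\<^sub>R a *\<^sub>R v - g (t(j := t j + \<sigma>))) \<le> e1 * s + e1 * s"
     proof -
      have "g t + s *\<^sub>R a *\<^sub>R v - g (t(j := t j + \<sigma>)) = (s * a) *\<^sub>R (v - b *\<^sub>R pderiv g j t) - (g (t(j := t j + \<sigma>)) - g t - \<sigma> *\<^sub>R pderiv g j t)"
       by (simp add: \<sigma>_def algebra_simps)
      also have "norm \<dots> \<le> norm ((s * a) *\<^sub>R (v - b *\<^sub>R pderiv g j t)) + norm (g (t(j := t j + \<sigma>)) - g t - \<sigma> *\<^sub>R pderiv g j t)"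
       by (rule norm_triangle_ineq4)
      also have "norm ((s * a) *\<^sub>R (v - b *\<^sub>R pderiv g j t)) \<le> (s * 1) * e1"
       unfolding norm_scaleR using a s b by (intro mult_mono) (auto simp: abs_mult)
      also have "norm (g (t(j := t j + \<sigma>)) - g t - \<sigma> *\<^sub>R pderiv g j t) \<le> e1 / B' * (s * B')"
       using d2 \<sigma> e1 B' by (meson order_trans mult_left_mono divide_nonneg_pos less_imp_le)
      finally show ?thesis using B' by (simp add: mult.commute)
     qed
     finally have "norm (quot f (g t) (a *\<^sub>R v) s - (a * b) *\<^sub>R q \<sigma>) \<le> C * (e1 * s + e1 * s) / s"
      using C s by (simp add: divide_right_mono mult_left_mono)
     also have "\<dots> = 2 * (C * e1)" using s by (simp add: field_simps)
     finally show ?thesis using e1(2) unfolding \<sigma>_def by simp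
    qed
    have "norm (quot f (g t) u s - quot f (g t) u s') \<le> e" if u: "u \<in> seg v" and s: "0 < s" "s < d1" "0 < s'" "s' < d1" for u s s'
    proof -
     obtain a where a: "\<bar>a\<bar> \<le> 1" "u = a *\<^sub>R v" using u by (auto simp: seg_def)
     have "norm ((a * b) *\<^sub>R q (s * a * b) - (a * b) *\<^sub>R q (s' * a * b)) \<le> e/4"
     proof (cases "a * b = 0")
      case True then show ?thesis using e by auto
     next
      case False
      have small: "\<bar>s * a * b\<bar> < inverse (Suc m)" if "0 < s" "s < d1" for s
      proof -
       have "\<bar>s * a * b\<bar> = s * (\<bar>a\<bar> * \<bar>b\<bar>)" using that by (simp add: abs_mult)
       also have "\<dots> \<le> s * (1 * B')" using a that B' by (intro mult_left_mono mult_mono) auto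
       also have "\<dots> < min d (inverse (Suc m))" using that(2) B' by (simp add: d1_def pos_less_divide_eq)
       finally show ?thesis by simp
      qed
      have "norm (q z - q z') \<le> inverse (Suc k)"
       if "z \<noteq> 0" "z' \<noteq> 0" "\<bar>z\<bar> < inverse (Suc m)" "\<bar>z'\<bar> < inverse (Suc m)" for z z'
      proof (rule ccontr)
       assume "\<not> ?thesis"
       then have "t \<in> A j k m"
        using t(1) that unfolding A_def q_def
        by (intro CollectI conjI exI[of _ z] exI[of _ z']) (auto simp: not_le)
       then show False using m by simp
      qed
      then have "norm (q (s * a * b) - q (s' * a * b)) \<le> inverse (Suc k)"
       using False s small[of s] small[of s'] by simp
      then have "\<bar>a * b\<bar> * norm (q (s * a * b) - q (s' * a * b)) \<le> B' * (e / (4 * B'))"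
       using k a(1) B' mult_mono[of "\<bar>a\<bar>" 1 "\<bar>b\<bar>" B'] by (intro mult_mono) (auto simp: abs_mult)
      then show ?thesis using B' by (simp add: scaleR_diff_right[symmetric])
     qed
     then have "norm (quot f (g t) u s - quot f (g t) u s') \<le> e/4 + (e/4 + e/4)"
      using approx[OF a(1) s(1,2)] approx[OF a(1) s(3,4)] unfolding a(2)
      by (intro norm_diff_triangle_le[where y = "(a * b) *\<^sub>R q (s * a * b)"] norm_diff_triangle_le[where y = "(a * b) *\<^sub>R q (s' * a * b)"])
       (auto simp: norm_minus_commute)
     then show ?thesis using e by simp
    qed
    then show ?thesis unfolding fdq_def using d1 by blast
   qed
   then show False using t(2) by (simp add: Fd_def)
  qed
  then show ?thesis
   using oT_mono[of "g -` (- Fd f (seg v))" "N \<union> B"] oT_Un[of N B] N0 B0 oT_nonneg[of "g -` (- Fd f (seg v))"] by simp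
 qed
 then show ?thesis
  unfolding Gnull_def by (intro gamma_residual_mono[OF Gtan_residual[of v]]) (auto simp: Gtan_def)
qed


section \<open>From uniform differentiability to regularity\<close>

lemma norm_diff_add_le:
 fixes a :: "'a::real_normed_vector"
 assumes "norm a \<le> A" "norm b \<le> B" "norm c \<le> D"
 shows "norm (a - b + c) \<le> A + B + D"
 using norm_triangle_ineq[of "a - b" c] norm_triangle_ineq4[of a b] assms by linarith

lemma Fd_subset_fdq: "x \<in> Fd f Q \<Longrightarrow> e > 0 \<Longrightarrow> fdq f Q e x"
 by (simp add: Fd_def)

lemma Reg_Fd: "Reg f Q \<subseteq> Fd f Q"
 by (auto simp: Reg_def Fd_def)

lemma fdqE:
 assumes "fdq f Q e x"
 obtains d where "d > 0" "\<And>s s' u. 0 < s \<Longrightarrow> s < d \<Longrightarrow> 0 < s' \<Longrightarrow> s' < d \<Longrightarrow> u \<in> Q \<Longrightarrow>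
  norm (quot f x u s - quot f x u s') \<le> e"
 using assms unfolding fdq_def by blast

lemma regqE:
 assumes "regq f Q e x"
 obtains d where "d > 0" "\<And>s w u. 0 < s \<Longrightarrow> s < d \<Longrightarrow> norm w < d \<Longrightarrow> u \<in> Q \<Longrightarrow>
  norm (f (x + w + s *\<^sub>R u) - f (x + w) - (f (x + s *\<^sub>R u) - f x)) \<le> e * (s + norm w)"
 using assms unfolding regq_def by blast

lemma fdq_antimono: "fdq f Q e x \<Longrightarrow> Q' \<subseteq> Q \<Longrightarrow> fdq f Q' e x"
 unfolding fdq_def by (meson subsetD)

lemma regq_antimono: "regq f Q e x \<Longrightarrow> Q' \<subseteq> Q \<Longrightarrow> regq f Q' e x"
 unfolding regq_def by (meson subsetD)

lemma Reg_antimono: "Q' \<subseteq> Q \<Longrightarrow> Reg f Q \<subseteq> Reg f Q'"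
 using fdq_antimono[of f Q _ _ Q'] regq_antimono[of f Q _ _ Q'] by (auto simp: Reg_def)

lemma open_quot_gt:
 fixes f :: "'x::real_normed_vector \<Rightarrow> 'y::real_normed_vector"
 assumes fc: "continuous_on UNIV f"
 shows "open {x. \<exists>s s'. 0 < s \<and> s < d \<and> 0 < s' \<and> s' < d \<and> (\<exists>u\<in>Q. norm (quot f x u s - quot f x u s') > e)}"
proof -
 define Z where "Z s s' u = {x. norm (quot f x u s - quot f x u s') > e}" for s s' u
 have "open (Z s s' u)" for s s' u
  unfolding Z_def quot_def
  by (intro open_Collect_less continuous_intros continuous_on_compose2[OF fc]) auto
 then have "open (\<Union>s\<in>{0<..<d}. \<Union>s'\<in>{0<..<d}. \<Union>u\<in>Q. Z s s' u)" by (intro open_UN ballI)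
 moreover have "(\<Union>s\<in>{0<..<d}. \<Union>s'\<in>{0<..<d}. \<Union>u\<in>Q. Z s s' u) =
   {x. \<exists>s s'. 0 < s \<and> s < d \<and> 0 < s' \<and> s' < d \<and> (\<exists>u\<in>Q. norm (quot f x u s - quot f x u s') > e)}"
  unfolding Z_def by (simp add: set_eq_iff Bex_def)
 ultimately show ?thesis by simp
qed

lemma Gnull_diff_residual:
 fixes E :: "'x::real_normed_vector set"
 assumes "\<And>W' G. gamma_open W' \<Longrightarrow> W' \<noteq> {} \<Longrightarrow> W' \<subseteq> W \<Longrightarrow> gamma_residual G \<Longrightarrow> \<exists>g\<in>W' \<inter> G. om g E > \<tau>"
  and "Gnull N" and "gamma_open W'" "W' \<noteq> {}" "W' \<subseteq> W" "gamma_residual G"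
 shows "\<exists>g\<in>W' \<inter> G. om g (E - N) > \<tau>"
proof -
 have "gamma_residual (G \<inter> {g\<in>GammaX. om g N = 0})"
  using assms(2,6) unfolding Gnull_def by (rule gamma_residual_Int[rotated])
 then obtain g where g: "g \<in> W'" "g \<in> G" "om g N = 0" "om g E > \<tau>" using assms(1)[OF assms(3-5)] by blast
 have "om g (E - N) > \<tau>" by (rule oT_diff_null[OF g(3,4)]) auto
 then show ?thesis using g by blast
qed

text \<open>At the points of a small ball, outside an open set whose preimages are uniformly small,
 difference quotients at all small scales are close to one fixed operator. This makes the
 irregular points there porous, so that no separability of the target is needed.\<close>

lemma Gnull_Reg:
 fixes f :: "'x::banach \<Rightarrow> 'y::banach"
 assumes f: "C-lipschitz_on UNIV f" and PN: "porous_null (cball (0::'x) 1)"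
  and Fd: "Gnull (- Fd f Q)"
 shows "Gnull (- Reg f Q)"
proof -
 have C: "C \<ge> 0" using f lipschitz_on_nonneg by blast
 have lip: "norm (f x - f y) \<le> C * norm (x - y)" for x y
  using lipschitz_onD[OF f, of x y] by (simp add: dist_norm)
 have fc: "continuous_on UNIV f" by (rule lipschitz_on_continuous_on[OF f])
 have main: "Gnull {x \<in> Fd f Q. \<not> regq f Q e x}" if e: "e > 0" for e
 proof (rule ccontr)
  define A where "A = {x \<in> Fd f Q. \<not> regq f Q e x}"
  assume "\<not> Gnull {x \<in> Fd f Q. \<not> regq f Q e x}"
  then have "\<not> Gnull A" by (simp add: A_def)
  from not_Gnull_imp[OF this] obtain \<tau> W where \<tau>: "\<tau> > 0" and W: "gamma_open W" "W \<noteq> {}"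
   and nm: "\<And>W' G. gamma_open W' \<Longrightarrow> W' \<noteq> {} \<Longrightarrow> W' \<subseteq> W \<Longrightarrow> gamma_residual G \<Longrightarrow> \<exists>g\<in>W' \<inter> G. om g A > \<tau>"
   by blast
  \<comment> \<open>The comparison of increments below costs \<open>6 * (e1 * r)\<close>, which must
    stay under \<open>e * r = 16 * (e1 * r)\<close>.\<close>
  define e1 where "e1 = e / 16"
  have e1: "e1 > 0" using e by (simp add: e1_def)
  \<comment> \<open>Decreasing open sets whose intersection lies outside \<open>Fd f Q\<close>; one
    of them will have preimages of outer measure at most \<open>\<tau>\<close> for all surfaces of
    some open set.\<close>
  define O' where "O' m = {x. \<exists>s s'. 0 < s \<and> s < inverse (Suc m) \<and> 0 < s' \<and> s' < inverse (Suc m) \<and> (\<exists>u\<in>Q. norm (quot f x u s - quot f x u s') > e1)}" for m :: nat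
  have O_open: "open (O' m)" for m unfolding O'_def by (rule open_quot_gt[OF fc])
  have O_dec: "decseq O'"
  proof (rule decseq_SucI)
   fix m
   have "inverse (real (Suc (Suc m))) \<le> inverse (real (Suc m))" by (intro le_imp_inverse_le) auto
   then show "O' (Suc m) \<subseteq> O' m" unfolding O'_def by (intro Collect_mono) (meson order.strict_trans2)
  qed
  have "(\<Inter>m. O' m) \<subseteq> - Fd f Q"
  proof (intro subsetI ComplI)
   fix x assume x: "x \<in> (\<Inter>m. O' m)" "x \<in> Fd f Q"
   then obtain d where d: "d > 0" "\<And>s s' u. 0 < s \<Longrightarrow> s < d \<Longrightarrow> 0 < s' \<Longrightarrow> s' < d \<Longrightarrow> u \<in> Q \<Longrightarrow> norm (quot f x u s - quot f x u s') \<le> e1"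
    using Fd_subset_fdq[OF _ e1] unfolding fdq_def by metis
   obtain m where m: "inverse (real (Suc m)) < d" using reals_Archimedean[OF d(1)] by blast
   have "x \<in> O' m" using x(1) by blast
   then obtain s s' u where "0 < s" "s < inverse (real (Suc m))" "0 < s'" "s' < inverse (real (Suc m))" "u \<in> Q" "norm (quot f x u s - quot f x u s') > e1"
    unfolding O'_def by blast
   then show False using d(2)[of s s' u] m by linarith
  qed
  then have "Gnull (\<Inter>m. O' m)" by (rule Gnull_mono[OF Fd])
  moreover have "W' \<inter> G \<noteq> {}" if "gamma_open W'" "W' \<noteq> {}" "W' \<subseteq> W" "gamma_residual G" for W' G
   using nm[OF that] by blast
  ultimately have "\<exists>m W'. gamma_open W' \<and> W' \<noteq> {} \<and> W' \<subseteq> W \<and> (\<forall>g\<in>W'. om g (O' m) \<le> \<tau>)"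
   by (rule Gnull_INT_open_uniform[OF O_open O_dec _ \<tau> W])
  then obtain m W' where W': "gamma_open W'" "W' \<noteq> {}" "W' \<subseteq> W" and small: "\<And>g. g \<in> W' \<Longrightarrow> om g (O' m) \<le> \<tau>"
   by blast
  obtain g0 where g0: "g0 \<in> W'" using W' by blast
  have g0G: "g0 \<in> GammaX" using g0 W'(1) by (auto simp: gamma_open_def)
  \<comment> \<open>A reference scale: off \<open>O' m\<close>, every quotient at an admissible
    scale is \<open>e1\<close>-close to the one at \<open>s0\<close>.\<close>
  define s0 where "s0 = inverse (real (Suc (Suc m)))"
  have s0: "0 < s0" "s0 < inverse (real (Suc m))" by (auto simp: s0_def)
  \<comment> \<open>At the fixed scale \<open>s0\<close> a quotient changes by at most
    \<open>2 * e1\<close> when the base point moves by \<open>4 * \<rho>\<close>, by the Lipschitz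
    condition alone.\<close>
  define \<rho> where "\<rho> = e1 * s0 / (8 * (C + 1))"
  have \<rho>: "\<rho> > 0" "4 * C * \<rho> / s0 \<le> e1"
  proof -
   show "\<rho> > 0" using e1 s0 C by (simp add: \<rho>_def)
   have C1: "C + 1 \<noteq> 0" using C by simp
   have "4 * C * \<rho> / s0 = (C / (C + 1)) * (e1 / 2)"
    unfolding \<rho>_def using s0(1) C1 by (simp add: divide_simps)
   also have "\<dots> \<le> 1 * (e1 / 2)" using C e1 by (intro mult_right_mono) auto
   finally show "4 * C * \<rho> / s0 \<le> e1" using e1 by simp
  qed
  have "compact (g0 ` cubeT)" by (rule compact_continuous_image[OF GammaX_D(1)[OF g0G] compact_cubeT])
  \<comment> \<open>Compactness of one surface leaves finitely many balls, hence finitely many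
    porous pieces \<open>E x\<close>, for all surfaces uniformly close to \<open>g0\<close>.\<close>
  then obtain X where X: "finite X" "g0 ` cubeT \<subseteq> (\<Union>x\<in>X. ball x \<rho>)"
   using \<rho>(1) unfolding compact_eq_totally_bounded by blast
  define E where "E x = A \<inter> ball x (2 * \<rho>) - O' m" for x
  have E_por: "porous (e1 / (C + 1)) (cball 0 1) (E x0) x" if x: "x \<in> E x0" for x x0
   unfolding porous_def
  proof (intro allI impI)
   fix d :: real assume d: "d > 0"
   have near: "norm (quot f y u s - quot f z u s) \<le> 4 * e1"
    if "y \<in> E x0" "z \<in> E x0" "u \<in> Q" "0 < s" "s < inverse (Suc m)" for y z u s
   proof -
    have yz: "dist y z < 4 * \<rho>"
     using that(1,2) dist_triangle_less_add[of y x0 "2 * \<rho>" z "2 * \<rho>"] by (auto simp: E_def dist_commute)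
    have "norm (quot f y u s0 - quot f z u s0) = norm ((f (y + s0 *\<^sub>R u) - f (z + s0 *\<^sub>R u)) - (f y - f z)) / s0"
    proof -
     have "quot f y u s0 - quot f z u s0 = ((f (y + s0 *\<^sub>R u) - f (z + s0 *\<^sub>R u)) - (f y - f z)) /\<^sub>R s0"
      unfolding quot_def scaleR_diff_right[symmetric] by (simp add: algebra_simps)
     then show ?thesis using s0(1) by (simp add: divide_inverse mult.commute)
    qed
    also have "\<dots> \<le> (C * norm (y - z) + C * norm (y - z)) / s0"
     using lip[of "y + s0 *\<^sub>R u" "z + s0 *\<^sub>R u"] lip[of y z] s0(1)
     by (intro divide_right_mono order_trans[OF norm_triangle_ineq4 add_mono]) auto
    also have "\<dots> \<le> (C * (4 * \<rho>) + C * (4 * \<rho>)) / s0"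
     using yz C s0(1) by (intro divide_right_mono add_mono mult_left_mono) (auto simp: dist_norm)
    also have "(C * (4 * \<rho>) + C * (4 * \<rho>)) / s0 = 2 * (4 * C * \<rho> / s0)" by simp
    finally have 1: "norm (quot f y u s0 - quot f z u s0) \<le> 2 * e1" using \<rho>(2) by linarith
    have 2: "norm (quot f y' u s - quot f y' u s0) \<le> e1" if "y' \<in> E x0" for y'
    proof (rule ccontr)
     assume "\<not> ?thesis"
     then have "y' \<in> O' m" using \<open>u \<in> Q\<close> \<open>0 < s\<close> \<open>s < inverse (Suc m)\<close> s0 unfolding O'_def
      by (intro CollectI exI[of _ s] exI[of _ s0]) (auto simp: not_le)
     then show False using that by (simp add: E_def)
    qed
    have "norm (quot f y u s - quot f z u s) \<le> e1 + (2 * e1 + e1)"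
     using 1 2[OF that(1)] 2[OF that(2)]
     by (intro norm_diff_triangle_le[where y = "quot f y u s0"] norm_diff_triangle_le[where y = "quot f z u s0"])
      (auto simp: norm_minus_commute)
    then show ?thesis by simp
   qed
   have "\<not> regq f Q e x" using x by (simp add: E_def A_def)
   moreover have "min (d/2) (inverse (Suc m)) > 0" using d by simp
   ultimately obtain s w u where sw: "0 < s" "s < min (d/2) (inverse (Suc m))" "norm w < min (d/2) (inverse (Suc m))" "u \<in> Q"
    and gt: "norm (f (x + w + s *\<^sub>R u) - f (x + w) - (f (x + s *\<^sub>R u) - f x)) > e * (s + norm w)"
    unfolding regq_def by (meson not_le)
   define r where "r = s + norm w"
   have r: "r > 0" "r < d" "s \<le> r" using sw norm_ge_zero[of w] unfolding r_def by linarith+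
   \<comment> \<open>Failure of regularity at \<open>x\<close> with displacement \<open>w\<close>
     forces a hole around \<open>x + w\<close>: a point \<open>x'\<close> of \<open>E x0\<close> in
     it would have almost the same increment along \<open>u\<close> as both \<open>x\<close> and
     \<open>x + w\<close>.\<close>
   have "ball (x + w) (e1 / (C + 1) * r) \<inter> E x0 = {}"
   proof (rule ccontr)
    assume "\<not> ?thesis"
    then obtain x' where x': "x' \<in> E x0" "norm (x + w - x') < e1 / (C + 1) * r" by (auto simp: dist_norm)
    have "C * norm (x + w - x') \<le> C * (e1 / (C + 1) * r)" using x'(2) C by (intro mult_left_mono) auto
    also have "\<dots> = (C / (C + 1)) * (e1 * r)" by simp
    also have "\<dots> \<le> 1 * (e1 * r)" using C e1 r(1) by (intro mult_right_mono) auto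
    finally have Cx: "C * norm (x + w - x') \<le> e1 * r" by simp
    have q: "f (y + s *\<^sub>R u) - f y = s *\<^sub>R quot f y u s" for y using sw(1) by (simp add: quot_def)
    have "norm ((f (x' + s *\<^sub>R u) - f x') - (f (x + s *\<^sub>R u) - f x)) = s * norm (quot f x' u s - quot f x u s)"
     unfolding q scaleR_diff_right[symmetric] using sw(1) by simp
    also have "\<dots> \<le> r * (4 * e1)"
     using near[OF x'(1) x sw(4) sw(1)] sw(1,2) r by (intro mult_mono) auto
    also have "r * (4 * e1) = 4 * (e1 * r)" by (simp add: mult.commute mult.left_commute)
    finally have a: "norm ((f (x' + s *\<^sub>R u) - f x') - (f (x + s *\<^sub>R u) - f x)) \<le> 4 * (e1 * r)" .
    have b: "norm (f (x + w + s *\<^sub>R u) - f (x' + s *\<^sub>R u)) \<le> e1 * r"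
     using lip[of "x + w + s *\<^sub>R u" "x' + s *\<^sub>R u"] Cx by simp
    have c: "norm (f (x + w) - f x') \<le> e1 * r" using lip[of "x + w" x'] Cx by simp
    have "f (x + w + s *\<^sub>R u) - f (x + w) - (f (x + s *\<^sub>R u) - f x) =
      (f (x + w + s *\<^sub>R u) - f (x' + s *\<^sub>R u)) - (f (x + w) - f x') + ((f (x' + s *\<^sub>R u) - f x') - (f (x + s *\<^sub>R u) - f x))"
     by simp
    also have "norm \<dots> \<le> (e1 * r + e1 * r) + 4 * (e1 * r)"
     by (rule norm_diff_add_le[OF b c a])
    finally have "norm (f (x + w + s *\<^sub>R u) - f (x + w) - (f (x + s *\<^sub>R u) - f x)) \<le> 6 * (e1 * r)" by simp
    moreover have "e * (s + norm w) = 16 * (e1 * r)" by (simp add: e1_def r_def)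
    moreover have "e1 * r > 0" using e1 r by simp
    ultimately show False using gt by linarith
   qed
   moreover have "x + w = x + r *\<^sub>R (w /\<^sub>R r)" using r by simp
   moreover have "w /\<^sub>R r \<in> cball 0 1" using r sw(1) by (simp add: r_def field_simps)
   ultimately show "\<exists>u\<in>cball 0 1. \<exists>r>0. r < d \<and> ball (x + r *\<^sub>R u) (e1 / (C + 1) * r) \<inter> E x0 = {}"
    using r by metis
  qed
  have "Gnull (E x0)" for x0
   using PN E_por e1 C unfolding porous_null_def by (meson add_nonneg_pos divide_pos_pos zero_less_one)
  then have res: "gamma_residual {g\<in>GammaX. om g (E x0) = 0}" for x0 by (simp add: Gnull_def)
  have "gamma_residual ({g. \<forall>x\<in>X. om g (E x) = 0} \<inter> GammaX)"
   using X(1)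
  proof (induction X rule: finite_induct)
   case empty then show ?case by (simp add: gamma_residual_UNIV)
  next
   case (insert x X)
   have "{g. \<forall>y\<in>insert x X. om g (E y) = 0} \<inter> GammaX = ({g. \<forall>y\<in>X. om g (E y) = 0} \<inter> GammaX) \<inter> {g\<in>GammaX. om g (E x) = 0}"
    by auto
   then show ?case using gamma_residual_Int[OF insert.IH res[of x]] by simp
  qed
  moreover have "gamma_open (W' \<inter> gball g0 0 \<rho>)" by (intro gamma_open_Int W'(1) gamma_open_gball)
  moreover have "W' \<inter> gball g0 0 \<rho> \<noteq> {}" using g0 center_gball[OF g0G \<rho>(1)] by blast
  moreover have "W' \<inter> gball g0 0 \<rho> \<subseteq> W" using W'(3) by blast
  ultimately obtain g where g: "g \<in> W'" "g \<in> gball g0 0 \<rho>" "\<forall>x\<in>X. om g (E x) = 0" "om g A > \<tau>"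
   using nm by blast
  have "g -` A \<inter> cubeT \<subseteq> (g -` O' m) \<union> (\<Union>x\<in>X. g -` E x)"
  proof
   fix t assume t: "t \<in> g -` A \<inter> cubeT"
   obtain x where x: "x \<in> X" "dist x (g0 t) < \<rho>" using X(2) t by auto
   have "dist (g t) (g0 t) < \<rho>" using g(2) t by (auto simp: gball_def close_def dist_norm)
   then have "dist x (g t) < 2 * \<rho>" using x(2) dist_triangle_less_add[of x "g0 t" \<rho> "g t" \<rho>] by (simp add: dist_commute)
   then show "t \<in> (g -` O' m) \<union> (\<Union>x\<in>X. g -` E x)" using t x(1) by (auto simp: E_def)
  qed
  then have "om g A \<le> oT ((g -` O' m) \<union> (\<Union>x\<in>X. g -` E x))" by (rule oT_mono)
  also have "\<dots> \<le> om g (O' m) + oT (\<Union>x\<in>X. g -` E x)" by (rule oT_Un)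
  also have "oT (\<Union>x\<in>X. g -` E x) \<le> (\<Sum>x\<in>X. om g (E x))" by (rule oT_UN_finite[OF X(1)])
  also have "(\<Sum>x\<in>X. om g (E x)) = 0" using g(3) by simp
  finally show False using small[OF g(1)] g(4) by simp
 qed
 have "Gnull (- Fd f Q \<union> (\<Union>n::nat. {x \<in> Fd f Q. \<not> regq f Q (inverse (Suc n)) x}))"
  by (intro Gnull_Un Fd Gnull_UN main) simp
 moreover have "- Reg f Q \<subseteq> - Fd f Q \<union> (\<Union>n::nat. {x \<in> Fd f Q. \<not> regq f Q (inverse (Suc n)) x})"
 proof
  fix x assume x: "x \<in> - Reg f Q"
  show "x \<in> - Fd f Q \<union> (\<Union>n::nat. {x \<in> Fd f Q. \<not> regq f Q (inverse (Suc n)) x})"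
  proof (cases "x \<in> Fd f Q")
   case True
   then obtain e where e: "e > 0" "\<not> regq f Q e x" using x by (auto simp: Reg_def Fd_def)
   obtain n where n: "inverse (real (Suc n)) < e" using reals_Archimedean[OF e(1)] by blast
   have "inverse (real (Suc n)) * (s + norm w) \<le> e * (s + norm w)" if "0 < s" for s and w :: 'x
    using n that by (intro mult_right_mono) auto
   then have "\<not> regq f Q (inverse (real (Suc n))) x"
    using e(2) unfolding regq_def by (meson order_trans)
   then show ?thesis using True by blast
  qed simp
 qed
 ultimately show ?thesis by (rule Gnull_mono)
qed

text \<open>The increment along \<open>u\<close> is that along \<open>z\<close> followed by that
  along \<open>u - z\<close> from the base point \<open>x + s *\<^sub>R z\<close>, and regularity
  along \<open>Q2\<close> moves this base point back to \<open>x\<close>. The bound \<open>M\<close>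
  enters because the displacement \<open>s *\<^sub>R z\<close> contributes to the error.\<close>

lemma Reg_sum:
 fixes f :: "'x::banach \<Rightarrow> 'y::banach"
 assumes Q: "\<And>u. u \<in> Q \<Longrightarrow> \<exists>z\<in>Q1. u - z \<in> Q2"
  and bd: "\<And>z. z \<in> Q1 \<Longrightarrow> norm z \<le> M"
  and x: "x \<in> Reg f Q1" "x \<in> Reg f Q2"
 shows "x \<in> Reg f Q"
proof -
 define M' where "M' = max M 0"
 have M': "M' \<ge> 0" "\<And>z. z \<in> Q1 \<Longrightarrow> norm z \<le> M'" using bd by (auto simp: M'_def intro: max.coboundedI1)
 have "fdq f Q e x" if e: "e > 0" for e
 proof -
  define e1 where "e1 = e / (4 * (M' + 1))"
  have e1: "e1 > 0" "e1 * (1 + M') = e / 4" using e M' by (auto simp: e1_def field_simps)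
  have e4: "e/4 > 0" using e by simp
  obtain d1 where d1: "d1 > 0" "\<And>s s' u. 0 < s \<Longrightarrow> s < d1 \<Longrightarrow> 0 < s' \<Longrightarrow> s' < d1 \<Longrightarrow> u \<in> Q1 \<Longrightarrow> norm (quot f x u s - quot f x u s') \<le> e/4"
  proof -
   have "fdq f Q1 (e/4) x" using x(1) e4 by (simp add: Reg_def)
   then show thesis by (rule fdqE) (rule that)
  qed
  obtain d2 where d2: "d2 > 0" "\<And>s s' u. 0 < s \<Longrightarrow> s < d2 \<Longrightarrow> 0 < s' \<Longrightarrow> s' < d2 \<Longrightarrow> u \<in> Q2 \<Longrightarrow> norm (quot f x u s - quot f x u s') \<le> e/4"
  proof -
   have "fdq f Q2 (e/4) x" using x(2) e4 by (simp add: Reg_def)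
   then show thesis by (rule fdqE) (rule that)
  qed
  obtain d3 where d3: "d3 > 0" "\<And>s w u. 0 < s \<Longrightarrow> s < d3 \<Longrightarrow> norm w < d3 \<Longrightarrow> u \<in> Q2 \<Longrightarrow>
    norm (f (x + w + s *\<^sub>R u) - f (x + w) - (f (x + s *\<^sub>R u) - f x)) \<le> e1 * (s + norm w)"
  proof -
   have "regq f Q2 e1 x" using x(2) e1(1) by (simp add: Reg_def)
   then show thesis by (rule regqE) (rule that)
  qed
  define d where "d = Min {d1, d2, d3, d3 / (M' + 1)}"
  have d: "d > 0" "d \<le> d1" "d \<le> d2" "d \<le> d3" "d \<le> d3 / (M' + 1)"
   using d1(1) d2(1) d3(1) M' by (auto simp: d_def)
  have split: "norm (quot f x u s - (quot f x z s + quot f x (u - z) s)) \<le> e/4"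
   if z: "z \<in> Q1" "u - z \<in> Q2" and s: "0 < s" "s < d" for u z s
  proof -
   have nw: "norm (s *\<^sub>R z) \<le> s * M'" using s M'(2)[OF z(1)] by (simp add: mult_left_mono)
   also have "s * M' \<le> s * (M' + 1)" using s by simp
   also have "\<dots> < d3" using s d(5) M' by (simp add: pos_le_divide_eq) (metis add_nonneg_pos less_le_trans mult_strict_right_mono zero_less_one)
   finally have nw3: "norm (s *\<^sub>R z) < d3" .
   have "quot f x u s - (quot f x z s + quot f x (u - z) s) =
    (f (x + s *\<^sub>R z + s *\<^sub>R (u - z)) - f (x + s *\<^sub>R z) - (f (x + s *\<^sub>R (u - z)) - f x)) /\<^sub>R s"
    by (simp add: quot_def algebra_simps)
   also have "norm \<dots> = norm (f (x + s *\<^sub>R z + s *\<^sub>R (u - z)) - f (x + s *\<^sub>R z) - (f (x + s *\<^sub>R (u - z)) - f x)) / s"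
    using s by (simp add: divide_inverse mult.commute)
   also have "\<dots> \<le> e1 * (s + s * M') / s"
    using d3(2)[OF s(1) _ nw3 z(2)] s d(4) nw e1
    by (intro divide_right_mono) (auto intro!: order_trans[OF d3(2)[OF s(1) _ nw3 z(2)]] mult_left_mono)
   also have "\<dots> = e1 * (1 + M')" using s by (simp add: field_simps)
   also have "\<dots> = e / 4" by (rule e1(2))
   finally show ?thesis .
  qed
  have "norm (quot f x u s - quot f x u s') \<le> e"
   if u: "u \<in> Q" and s: "0 < s" "s < d" "0 < s'" "s' < d" for u s s'
  proof -
   obtain z where z: "z \<in> Q1" "u - z \<in> Q2" using Q[OF u] by blast
   have "norm ((quot f x z s + quot f x (u - z) s) - (quot f x z s' + quot f x (u - z) s')) \<le> e/4 + e/4"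
    using d1(2)[of s s' z] d2(2)[of s s' "u - z"] s d z
    by (intro order_trans[OF norm_diff_triangle_ineq] add_mono) auto
   then have "norm (quot f x u s - quot f x u s') \<le> e/4 + ((e/4 + e/4) + e/4)"
    using split[OF z s(1,2)] split[OF z s(3,4)]
    by (intro norm_diff_triangle_le[where y = "quot f x z s + quot f x (u - z) s", OF _ norm_diff_triangle_le[where y = "quot f x z s' + quot f x (u - z) s'"]])
     (auto simp: norm_minus_commute)
   then show ?thesis by simp
  qed
  then show ?thesis unfolding fdq_def using d(1) by blast
 qed
 moreover have "regq f Q e x" if e: "e > 0" for e
 proof -
  define e1 where "e1 = e / (4 * (M' + 1))"
  have e1: "e1 > 0" "4 * e1 * (1 + M') = e" using e M' by (auto simp: e1_def field_simps)
  obtain d1 where d1: "d1 > 0" "\<And>s w u. 0 < s \<Longrightarrow> s < d1 \<Longrightarrow> norm w < d1 \<Longrightarrow> u \<in> Q1 \<Longrightarrow>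
    norm (f (x + w + s *\<^sub>R u) - f (x + w) - (f (x + s *\<^sub>R u) - f x)) \<le> e1 * (s + norm w)"
  proof -
   have "regq f Q1 e1 x" using x(1) e1(1) by (simp add: Reg_def)
   then show thesis by (rule regqE) (rule that)
  qed
  obtain d2 where d2: "d2 > 0" "\<And>s w u. 0 < s \<Longrightarrow> s < d2 \<Longrightarrow> norm w < d2 \<Longrightarrow> u \<in> Q2 \<Longrightarrow>
    norm (f (x + w + s *\<^sub>R u) - f (x + w) - (f (x + s *\<^sub>R u) - f x)) \<le> e1 * (s + norm w)"
  proof -
   have "regq f Q2 e1 x" using x(2) e1(1) by (simp add: Reg_def)
   then show thesis by (rule regqE) (rule that)
  qed
  define d where "d = min d1 d2 / (2 * (M' + 1))"
  have d: "d > 0" using d1(1) d2(1) M' by (simp add: d_def)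
  have dM: "d * (M' + 1) = min d1 d2 / 2" using M' by (simp add: d_def field_simps)
  have "d * 1 \<le> d * (M' + 1)" using d M' by (intro mult_left_mono) auto
  then have dd: "d \<le> min d1 d2 / 2" using dM by simp
  have "norm (f (x + w + s *\<^sub>R u) - f (x + w) - (f (x + s *\<^sub>R u) - f x)) \<le> e * (s + norm w)"
   if u: "u \<in> Q" and s: "0 < s" "s < d" "norm w < d" for u s w
  proof -
   obtain z where z: "z \<in> Q1" "u - z \<in> Q2" using Q[OF u] by blast
   have nz: "norm (s *\<^sub>R z) \<le> s * M'" using s M'(2)[OF z(1)] by (simp add: mult_left_mono)
   have "s * M' \<le> d * M'" using s M' by (intro mult_right_mono) auto
   moreover have "d * (M' + 1) = d * M' + d" by (simp add: algebra_simps)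
   ultimately have nz2: "norm (s *\<^sub>R z) + d \<le> min d1 d2 / 2" using nz dM by linarith
   have nw: "norm (w + s *\<^sub>R z) \<le> norm w + s * M'" using nz norm_triangle_ineq[of w "s *\<^sub>R z"] by linarith
   have lt: "norm w < d1" "s < d1" "s < d2" "norm (w + s *\<^sub>R z) < d2" "norm (s *\<^sub>R z) < d2"
    using s dd nz2 d1(1) d2(1) norm_triangle_ineq[of w "s *\<^sub>R z"] d by auto
   define W where "W = s + norm w"
   have W: "s + norm w = W" "s \<le> W" "norm w \<le> W" using s by (auto simp: W_def)
   have sM: "s * M' \<le> W * M'" using W M' by (intro mult_right_mono) auto
   have A: "norm (f (x + w + s *\<^sub>R z) - f (x + w) - (f (x + s *\<^sub>R z) - f x)) \<le> e1 * W"
    using d1(2)[OF s(1) lt(2,1) z(1)] by (simp add: W)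
   have B: "norm (f (x + (w + s *\<^sub>R z) + s *\<^sub>R (u - z)) - f (x + (w + s *\<^sub>R z)) - (f (x + s *\<^sub>R (u - z)) - f x)) \<le> e1 * (W + W * M')"
    using nw sM e1(1) W_def
    by (intro order_trans[OF d2(2)[OF s(1) lt(3,4) z(2)]] mult_left_mono) linarith+
   have D: "norm (f (x + s *\<^sub>R z + s *\<^sub>R (u - z)) - f (x + s *\<^sub>R z) - (f (x + s *\<^sub>R (u - z)) - f x)) \<le> e1 * (W + W * M')"
    using nz sM e1(1) W(2)
    by (intro order_trans[OF d2(2)[OF s(1) lt(3,5) z(2)]] mult_left_mono) linarith+
   \<comment> \<open>Telescoping through \<open>x + w + s *\<^sub>R z\<close>; the two increments
     along \<open>u - z\<close> are both compared with the one at \<open>x\<close>.\<close>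
   have "f (x + w + s *\<^sub>R u) - f (x + w) - (f (x + s *\<^sub>R u) - f x) =
     (f (x + w + s *\<^sub>R z) - f (x + w) - (f (x + s *\<^sub>R z) - f x)) +
     ((f (x + (w + s *\<^sub>R z) + s *\<^sub>R (u - z)) - f (x + (w + s *\<^sub>R z)) - (f (x + s *\<^sub>R (u - z)) - f x)) -
     (f (x + s *\<^sub>R z + s *\<^sub>R (u - z)) - f (x + s *\<^sub>R z) - (f (x + s *\<^sub>R (u - z)) - f x)))"
    by (simp add: algebra_simps)
   also have "norm \<dots> \<le> e1 * W + (e1 * (W + W * M') + e1 * (W + W * M'))"
    using norm_diff_add_le[OF B D A] by (simp only: add.commute add.left_commute)
   also have "\<dots> \<le> 4 * e1 * (1 + M') * W"
    using e1(1) M' W s(1) by (simp add: algebra_simps)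
   finally show ?thesis by (simp add: e1(2) W)
  qed
  then show ?thesis unfolding regq_def using d by blast
 qed
 ultimately show ?thesis by (simp add: Reg_def)
qed


section \<open>Bumps\<close>

definition pos_sq :: "real \<Rightarrow> real" where "pos_sq x = (max 0 x)\<^sup>2"

lemma pos_sq_deriv: "(pos_sq has_real_derivative 2 * max 0 x) (at x)"
proof -
 consider "x < 0" | "x > 0" | "x = 0" by linarith
 then show ?thesis
 proof cases
  case 1
  have "((\<lambda>_. 0) has_real_derivative 0) (at x)" by simp
  moreover have "eventually (\<lambda>y. y \<in> {..<0}) (nhds x)" using 1 by (intro eventually_nhds_in_open) auto
  then have "eventually (\<lambda>y. 0 = pos_sq y) (nhds x)" by eventually_elim (simp add: pos_sq_def)
  ultimately show ?thesis using 1 by (subst (asm) DERIV_cong_ev) auto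
 next
  case 2
  have "((\<lambda>y. y\<^sup>2) has_real_derivative 2 * x) (at x)" by (auto intro!: derivative_eq_intros)
  moreover have "eventually (\<lambda>y. y \<in> {0<..}) (nhds x)" using 2 by (intro eventually_nhds_in_open) auto
  then have "eventually (\<lambda>y. y\<^sup>2 = pos_sq y) (nhds x)" by eventually_elim (simp add: pos_sq_def)
  ultimately show ?thesis using 2 by (subst (asm) DERIV_cong_ev) auto
 next
  case 3
  have "((\<lambda>h. (pos_sq (0 + h) - pos_sq 0) / h) \<longlongrightarrow> 0) (at 0)"
  proof (rule Lim_null_comparison)
   show "eventually (\<lambda>h. norm ((pos_sq (0 + h) - pos_sq 0) / h) \<le> \<bar>h\<bar>) (at 0)"
    by (rule eventuallyI) (auto simp: pos_sq_def power2_eq_square max_def)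
   show "((\<lambda>h::real. \<bar>h\<bar>) \<longlongrightarrow> 0) (at 0)" by (rule tendsto_rabs_zero) simp
  qed
  then show ?thesis using 3 by (simp add: DERIV_def)
 qed
qed

text \<open>A continuously differentiable spline from 0 to 1 over the unit interval:
  \<open>2 * x^2\<close> up to 1/2, then \<open>1 - 2 * (1 - x)^2\<close>, with slope at most
  2.\<close>

definition ramp :: "real \<Rightarrow> real" where
 "ramp x = 2 * pos_sq x - 4 * pos_sq (x - 1/2) + 2 * pos_sq (x - 1)"

definition ramp' :: "real \<Rightarrow> real" where
 "ramp' x = 4 * max 0 x - 8 * max 0 (x - 1/2) + 4 * max 0 (x - 1)"

lemma ramp_deriv: "(ramp has_real_derivative ramp' x) (at x)"
 unfolding ramp_def ramp'_def
 by (rule derivative_eq_intros DERIV_chain2[OF pos_sq_deriv] refl | simp)+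

lemma ramp_props:
 "x \<le> 0 \<Longrightarrow> ramp x = 0" "x \<ge> 1 \<Longrightarrow> ramp x = 1" "0 \<le> ramp x" "ramp x \<le> 1"
 "x \<le> 0 \<Longrightarrow> ramp' x = 0" "\<bar>ramp' x\<bar> \<le> 2"
proof -
 show 1: "x \<le> 0 \<Longrightarrow> ramp x = 0" "x \<ge> 1 \<Longrightarrow> ramp x = 1" for x
  by (auto simp: ramp_def pos_sq_def power2_eq_square algebra_simps)
 have a: "ramp x = 2 * x\<^sup>2" if "0 \<le> x" "x \<le> 1/2" using that by (auto simp: ramp_def pos_sq_def)
 have b: "ramp x = 1 - 2 * (1 - x)\<^sup>2" if "1/2 \<le> x" "x \<le> 1"
  using that by (auto simp: ramp_def pos_sq_def power2_eq_square algebra_simps)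
 have c: "2 * y\<^sup>2 \<le> 1/2" "0 \<le> y\<^sup>2" if "0 \<le> y" "y \<le> 1/2" for y :: real
  using power_mono[of y "1/2" 2] that by (auto simp: power2_eq_square)
 consider "x \<le> 0" | "0 \<le> x" "x \<le> 1/2" | "1/2 \<le> x" "x \<le> 1" | "1 \<le> x" by linarith
 then have "0 \<le> ramp x \<and> ramp x \<le> 1"
 proof cases
  case 2 then show ?thesis using a c[of x] by simp
 next
  case 3 then show ?thesis using b c[of "1 - x"] by simp
 qed (auto simp: 1)
 then show "0 \<le> ramp x" "ramp x \<le> 1" by auto
 show "x \<le> 0 \<Longrightarrow> ramp' x = 0" "\<bar>ramp' x\<bar> \<le> 2" by (auto simp: ramp'_def max_def)
qed

text \<open>A plateau: 1 on \<open>[a + w, b - w]\<close> and 0 off \<open>(a, b)\<close>. The bound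
  \<open>4 / w\<close> for its slope in \<open>plat_props\<close> collects \<open>2 / w\<close> from
  each factor.\<close>

definition plat :: "real \<Rightarrow> real \<Rightarrow> real \<Rightarrow> real \<Rightarrow> real" where
 "plat a b w x = ramp ((x - a) / w) * ramp ((b - x) / w)"

definition plat' :: "real \<Rightarrow> real \<Rightarrow> real \<Rightarrow> real \<Rightarrow> real" where
 "plat' a b w x = ramp' ((x - a) / w) / w * ramp ((b - x) / w) - ramp ((x - a) / w) * (ramp' ((b - x) / w) / w)"

lemma plat_deriv:
 assumes "w > 0" shows "(plat a b w has_real_derivative plat' a b w x) (at x)"
proof -
 have 1: "((\<lambda>x. ramp ((x - a) / w)) has_real_derivative ramp' ((x - a) / w) * (1 / w)) (at x)"
  using assms by (intro DERIV_chain2[OF ramp_deriv]) (auto intro!: derivative_eq_intros)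
 have 2: "((\<lambda>x. ramp ((b - x) / w)) has_real_derivative ramp' ((b - x) / w) * (- 1 / w)) (at x)"
  using assms by (intro DERIV_chain2[OF ramp_deriv]) (auto intro!: derivative_eq_intros)
 show ?thesis
  using DERIV_mult[OF 1 2] unfolding plat_def[abs_def] plat'_def by (simp add: algebra_simps)
qed

lemma plat'_cont: "w > 0 \<Longrightarrow> continuous_on UNIV (plat' a b w)"
proof -
 assume w: "w > 0"
 have r: "continuous_on UNIV ramp"
  using ramp_deriv by (meson DERIV_isCont continuous_at_imp_continuous_on)
 have r': "continuous_on UNIV ramp'" unfolding ramp'_def by (intro continuous_intros)
 show ?thesis unfolding plat'_def[abs_def] using w
  by (intro continuous_intros continuous_on_compose2[OF r] continuous_on_compose2[OF r']) auto
qed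

lemma plat_props:
 assumes w: "w > 0"
 shows "0 \<le> plat a b w x" "plat a b w x \<le> 1" "a + w \<le> x \<Longrightarrow> x \<le> b - w \<Longrightarrow> plat a b w x = 1"
  "x \<le> a \<or> b \<le> x \<Longrightarrow> plat a b w x = 0" "x \<le> a \<or> b \<le> x \<Longrightarrow> plat' a b w x = 0" "\<bar>plat' a b w x\<bar> \<le> 4 / w"
proof -
 show "0 \<le> plat a b w x" "plat a b w x \<le> 1"
  unfolding plat_def using ramp_props(3,4) by (auto intro!: mult_nonneg_nonneg mult_le_one)
 show "a + w \<le> x \<Longrightarrow> x \<le> b - w \<Longrightarrow> plat a b w x = 1"
  unfolding plat_def using w by (simp add: ramp_props(2) pos_le_divide_eq)
 show "x \<le> a \<or> b \<le> x \<Longrightarrow> plat a b w x = 0"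
  unfolding plat_def using w by (auto simp: ramp_props(1) divide_nonpos_pos)
 show "x \<le> a \<or> b \<le> x \<Longrightarrow> plat' a b w x = 0"
  unfolding plat'_def using w by (auto simp: ramp_props(1,5) divide_nonpos_pos)
 have "\<bar>ramp' ((x - a) / w) / w * ramp ((b - x) / w)\<bar> \<le> 2 / w * 1"
  unfolding abs_mult using w ramp_props(3,4,6) by (intro mult_mono) (auto simp: divide_right_mono)
 moreover have "\<bar>ramp ((x - a) / w) * (ramp' ((b - x) / w) / w)\<bar> \<le> 1 * (2 / w)"
  unfolding abs_mult using w ramp_props(3,4,6) by (intro mult_mono) (auto simp: divide_right_mono)
 ultimately have "\<bar>plat' a b w x\<bar> \<le> 2 / w * 1 + 1 * (2 / w)"
  unfolding plat'_def by (rule order_trans[OF abs_triangle_ineq4 add_mono])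
 then show "\<bar>plat' a b w x\<bar> \<le> 4 / w" by simp
qed

text \<open>The derivative in a coordinate \<open>j\<close> is governed by the width
  \<open>w j\<close> of that coordinate alone, which allows steep edges in late coordinates without
  harm to the early ones.\<close>

fun bump :: "(nat \<Rightarrow> real) \<Rightarrow> (nat \<Rightarrow> real) \<Rightarrow> (nat \<Rightarrow> real) \<Rightarrow> nat \<Rightarrow> (nat \<Rightarrow> real) \<Rightarrow> real" where
 "bump a b w 0 = ext (\<lambda>t. 1)"
| "bump a b w (Suc m) = (\<lambda>t. bump a b w m t * ext (\<lambda>t. plat (a m) (b m) (w m) (t m)) t)"

lemma GammaX_const: "ext (\<lambda>t. c) \<in> GammaX" "t \<in> cubeT \<Longrightarrow> pderiv (ext (\<lambda>t. c)) j t = 0"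
 by (rule GammaX_ext[where D = "\<lambda>_ _. 0"]; simp)+

lemma bump_props:
 assumes w: "\<And>i. w i > 0"
 shows "bump a b w m \<in> GammaX \<and>
  (\<forall>t\<in>cubeT. 0 \<le> bump a b w m t \<and> bump a b w m t \<le> 1 \<and>
    (\<forall>j. \<bar>pderiv (bump a b w m) j t\<bar> \<le> (if j < m then 4 / w j else 0)) \<and>
    ((\<exists>i<m. t i \<le> a i \<or> b i \<le> t i) \<longrightarrow> bump a b w m t = 0 \<and> (\<forall>j. pderiv (bump a b w m) j t = 0)) \<and>
    ((\<forall>i<m. a i + w i \<le> t i \<and> t i \<le> b i - w i) \<longrightarrow> bump a b w m t = 1))"
proof (induction m)
 case 0
 then show ?case by (auto simp: GammaX_const) (auto simp: ext_def)
next
 case (Suc m)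
 let ?c = "ext (\<lambda>t. plat (a m) (b m) (w m) (t m))"
 note c = GammaX_coord[where p = "plat (a m) (b m) (w m)" and p' = "plat' (a m) (b m) (w m)" and i = m,
   OF plat_deriv[OF w] plat'_cont[OF w]]
 have ce: "?c t = plat (a m) (b m) (w m) (t m)" if "t \<in> cubeT" for t using that by (simp add: ext_def)
 note pl = plat_props[OF w[of m], where a = "a m" and b = "b m"]
 have bG: "bump a b w m \<in> GammaX" using Suc by blast
 have G: "bump a b w (Suc m) \<in> GammaX" using GammaX_mult(1)[OF bG c(1)] by simp
 have d: "pderiv (bump a b w (Suc m)) j t = bump a b w m t * pderiv ?c j t + pderiv (bump a b w m) j t * ?c t"
  if "t \<in> cubeT" for j t
  using GammaX_mult(2)[OF bG c(1) that] by simp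
 show ?case
 proof (intro conjI ballI G)
  fix t :: "nat \<Rightarrow> real" assume t: "t \<in> cubeT"
  note IH = Suc.IH[THEN conjunct2, rule_format, OF t]
  have b01: "0 \<le> bump a b w m t" "bump a b w m t \<le> 1" using IH by auto
  have bd: "\<bar>pderiv (bump a b w m) j t\<bar> \<le> (if j < m then 4 / w j else 0)" for j using IH by blast
  have cd: "pderiv ?c j t = (if j = m then plat' (a m) (b m) (w m) (t m) else 0)" for j
   using GammaX_coord(2)[OF plat_deriv[OF w] plat'_cont[OF w] t] by simp
  show "0 \<le> bump a b w (Suc m) t" "bump a b w (Suc m) t \<le> 1"
   using b01 pl(1,2) by (auto simp: ce[OF t] intro!: mult_nonneg_nonneg mult_le_one)
  show "\<forall>j. \<bar>pderiv (bump a b w (Suc m)) j t\<bar> \<le> (if j < Suc m then 4 / w j else 0)"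
  proof
   fix j
   consider "j < m" | "j = m" | "j > m" by linarith
   then show "\<bar>pderiv (bump a b w (Suc m)) j t\<bar> \<le> (if j < Suc m then 4 / w j else 0)"
   proof cases
    case 1
    have "\<bar>pderiv (bump a b w m) j t * ?c t\<bar> \<le> 4 / w j * 1"
     unfolding abs_mult using bd[of j] 1 pl(1,2) w[of j] by (intro mult_mono) (auto simp: ce[OF t])
    then show ?thesis using 1 unfolding d[OF t] by (simp add: cd)
   next
    case 2
    have "\<bar>bump a b w m t * plat' (a m) (b m) (w m) (t m)\<bar> \<le> 1 * (4 / w m)"
     unfolding abs_mult using b01 pl(6) by (intro mult_mono) auto
    then show ?thesis using 2 bd[of m] unfolding d[OF t] by (simp add: cd)
   next
    case 3
    then show ?thesis using bd[of j] unfolding d[OF t] by (simp add: cd)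
   qed
  qed
  show "(\<exists>i<Suc m. t i \<le> a i \<or> b i \<le> t i) \<longrightarrow> bump a b w (Suc m) t = 0 \<and> (\<forall>j. pderiv (bump a b w (Suc m)) j t = 0)"
  proof
   assume ex: "\<exists>i<Suc m. t i \<le> a i \<or> b i \<le> t i"
   show "bump a b w (Suc m) t = 0 \<and> (\<forall>j. pderiv (bump a b w (Suc m)) j t = 0)"
   proof (cases "\<exists>i<m. t i \<le> a i \<or> b i \<le> t i")
    case True
    then show ?thesis using IH unfolding d[OF t] by simp
   next
    case False
    then have "t m \<le> a m \<or> b m \<le> t m" using ex by (auto simp: less_Suc_eq)
    then show ?thesis using pl(4,5)[where x = "t m"] unfolding d[OF t] by (simp add: cd ce[OF t])
   qed
  qed
  show "(\<forall>i<Suc m. a i + w i \<le> t i \<and> t i \<le> b i - w i) \<longrightarrow> bump a b w (Suc m) t = 1"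
   using IH pl(3)[where x = "t m"] by (simp add: ce[OF t])
 qed
qed

lemma bump_cong:
 "t \<in> cubeT \<Longrightarrow> t' \<in> cubeT \<Longrightarrow> (\<And>i. i < m \<Longrightarrow> t i = t' i) \<Longrightarrow> bump a b w m t = bump a b w m t'"
 by (induction m) (auto simp: ext_def)

section \<open>A finite covering lemma\<close>

text \<open>Selection in the manner of Vitali: take a point whose radius exceeds half the supremum,
  discard all points in conflict with it, and continue. Discarded points have at most twice its
  radius, and the bound \<open>N\<close> on conflict-free sets drops by one, so the induction
  ends.\<close>

lemma greedy_cover:
 fixes R :: "'a \<Rightarrow> real"
 assumes refl: "\<And>t. t \<in> B \<Longrightarrow> conf t t" and sym: "\<And>t q. conf t q \<Longrightarrow> conf q t"
  and R: "\<And>t. t \<in> B \<Longrightarrow> 0 < R t \<and> R t \<le> Rmax"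
  and N: "\<And>F. finite F \<Longrightarrow> F \<subseteq> B \<Longrightarrow> (\<And>t q. t \<in> F \<Longrightarrow> q \<in> F \<Longrightarrow> t \<noteq> q \<Longrightarrow> \<not> conf t q) \<Longrightarrow> card F \<le> N"
 shows "\<exists>F. finite F \<and> F \<subseteq> B \<and> (\<forall>t\<in>F. \<forall>q\<in>F. t \<noteq> q \<longrightarrow> \<not> conf t q) \<and>
  (\<forall>t\<in>B. \<exists>q\<in>F. conf q t \<and> R t \<le> 2 * R q)"
 using assms
proof (induction N arbitrary: B)
 case 0
 have "B = {}"
 proof (rule ccontr)
  assume "B \<noteq> {}"
  then obtain q where "q \<in> B" by blast
  then show False using "0.prems"(4)[of "{q}"] by simp
 qed
 then show ?case by (intro exI[of _ "{}"]) simp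
next
 case (Suc N)
 show ?case
 proof (cases "B = {}")
  case True
  then show ?thesis by (intro exI[of _ "{}"]) simp
 next
  case False
  have bdd: "bdd_above (R ` B)" using Suc.prems(3) by (auto simp: bdd_above_def)
  have S: "R t \<le> Sup (R ` B)" if "t \<in> B" for t using bdd that by (intro cSup_upper) auto
  have Spos: "Sup (R ` B) > 0" using False Suc.prems(3) S by (metis all_not_in_conv less_le_trans)
  then have "Sup (R ` B) / 2 < Sup (R ` B)" by simp
  then obtain q where q: "q \<in> B" "Sup (R ` B) / 2 < R q"
   using less_cSupE[of "Sup (R ` B) / 2" "R ` B"] False by auto
  have big: "R t \<le> 2 * R q" if "t \<in> B" for t using S[OF that] q(2) by simp
  define B' where "B' = {t\<in>B. \<not> conf q t}"
  have "\<exists>F. finite F \<and> F \<subseteq> B' \<and> (\<forall>t\<in>F. \<forall>q\<in>F. t \<noteq> q \<longrightarrow> \<not> conf t q) \<and>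
   (\<forall>t\<in>B'. \<exists>q\<in>F. conf q t \<and> R t \<le> 2 * R q)"
  proof (rule Suc.IH)
   fix F assume F: "finite F" "F \<subseteq> B'" "\<And>t q. t \<in> F \<Longrightarrow> q \<in> F \<Longrightarrow> t \<noteq> q \<Longrightarrow> \<not> conf t q"
   have "q \<notin> F" using F(2) Suc.prems(1)[OF q(1)] by (auto simp: B'_def)
   moreover have "card (insert q F) \<le> Suc N"
    using F q(1) Suc.prems(2) by (intro Suc.prems(4)) (auto simp: B'_def)
   ultimately show "card F \<le> N" using F(1) by simp
  qed (use Suc.prems in \<open>auto simp: B'_def\<close>)
  then obtain F where F: "finite F" "F \<subseteq> B'" "\<forall>t\<in>F. \<forall>q\<in>F. t \<noteq> q \<longrightarrow> \<not> conf t q"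
   "\<forall>t\<in>B'. \<exists>q\<in>F. conf q t \<and> R t \<le> 2 * R q" by blast
  show ?thesis
  proof (intro exI[of _ "insert q F"] conjI ballI impI)
   fix t assume "t \<in> B"
   then show "\<exists>q\<in>insert q F. conf q t \<and> R t \<le> 2 * R q"
    using F(4) big by (cases "conf q t") (auto simp: B'_def)
  next
   fix t q' assume "t \<in> insert q F" "q' \<in> insert q F" "t \<noteq> q'"
   then show "\<not> conf t q'" using F(2,3) Suc.prems(2) by (auto simp: B'_def)
  qed (use F q(1) in \<open>auto simp: B'_def\<close>)
 qed
qed

section \<open>Oscillation of surfaces and the coordinate grid\<close>

lemma GammaX_coord_lipschitz:
 assumes g: "g \<in> GammaX" and t: "t \<in> cubeT" and s: "s \<in> {0..1}" "s' \<in> {0..1}"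
  and L: "\<And>t. t \<in> cubeT \<Longrightarrow> norm (pderiv g j t) \<le> L"
 shows "norm (g (t(j := s)) - g (t(j := s'))) \<le> L * \<bar>s - s'\<bar>"
proof -
 have L0: "0 \<le> L" using L[OF zero_in_cubeT] norm_ge_zero order_trans by blast
 have "L-lipschitz_on {0..1} (\<lambda>s. g (t(j := s)))"
 proof (rule bounded_derivative_imp_lipschitz[where f' = "\<lambda>s d. d *\<^sub>R pderiv g j (t(j := s))"])
  fix s :: real assume s: "s \<in> {0..1}"
  show "((\<lambda>s. g (t(j := s))) has_derivative (\<lambda>d. d *\<^sub>R pderiv g j (t(j := s)))) (at s within {0..1})"
   using GammaX_D_at[OF g t s, of j] by (simp add: has_vector_derivative_def)
  show "onorm (\<lambda>d. d *\<^sub>R pderiv g j (t(j := s))) \<le> L"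
  proof (rule onorm_le)
   fix d :: real
   have "norm (pderiv g j (t(j := s))) \<le> L" using s by (intro L cubeT_upd[OF t]) auto
   then show "norm (d *\<^sub>R pderiv g j (t(j := s))) \<le> L * norm d"
    using mult_right_mono[OF _ abs_ge_zero[of d], of "norm (pderiv g j (t(j := s)))" L]
    by (simp add: mult.commute)
  qed
 qed (use L0 in auto)
 from lipschitz_onD[OF this s] show ?thesis by (simp add: dist_norm)
qed

lemma GammaX_lipschitz:
 assumes g: "g \<in> GammaX" and t: "t \<in> cubeT" "t' \<in> cubeT"
  and L: "\<And>t j. t \<in> cubeT \<Longrightarrow> j < n \<Longrightarrow> norm (pderiv g j t) \<le> L"
  and d: "\<And>i. i < n \<Longrightarrow> \<bar>t i - t' i\<bar> \<le> d" and eq: "\<And>i. i \<ge> n \<Longrightarrow> t i = t' i"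
 shows "norm (g t - g t') \<le> real n * (L * d)"
proof -
 \<comment> \<open>Walk from \<open>t\<close> to \<open>t'\<close> changing one coordinate at a
   time.\<close>
 define z where "z k = (\<lambda>i. if i < k then t' i else t i)" for k
 have zc: "z k \<in> cubeT" for k using t by (auto simp: z_def cubeT_def)
 have step: "norm (g (z k) - g (z (Suc k))) \<le> L * d" if k: "k < n" for k
 proof -
  have L0: "0 \<le> L" using L[OF zero_in_cubeT k] norm_ge_zero order_trans by blast
  have "z k = (z k)(k := t k)" "z (Suc k) = (z k)(k := t' k)" by (auto simp: z_def less_Suc_eq)
  then have "norm (g (z k) - g (z (Suc k))) \<le> L * \<bar>t k - t' k\<bar>"
   using GammaX_coord_lipschitz[OF g zc, of "t k" "t' k" k L k] cubeT_D[OF t(1), of k] cubeT_D[OF t(2), of k] L k by auto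
  also have "\<dots> \<le> L * d" using d[OF k] L0 by (rule mult_left_mono)
  finally show ?thesis .
 qed
 have "norm (g (z 0) - g (z k)) \<le> real k * (L * d)" if "k \<le> n" for k
  using that
 proof (induction k)
  case (Suc k)
  then have "norm (g (z 0) - g (z (Suc k))) \<le> real k * (L * d) + L * d"
   using step[of k] by (intro norm_diff_triangle_le[where y = "g (z k)"]) auto
  then show ?case by (simp add: algebra_simps)
 qed simp
 moreover have "z 0 = t" "z n = t'" using eq by (auto simp: z_def not_less)
 ultimately show ?thesis by (metis order_refl)
qed

text \<open>The minimum puts the right end point 1 into the last cell instead of a cell of its
  own.\<close>

definition cell :: "nat \<Rightarrow> real \<Rightarrow> nat" where
 "cell N x = min (N - 1) (nat \<lfloor>real N * x\<rfloor>)"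

lemma cell_bounds:
 assumes "0 \<le> x" "x \<le> 1" "N > 0"
 shows "cell N x < N" "real (cell N x) / N \<le> x" "x \<le> (real (cell N x) + 1) / N"
proof -
 show "cell N x < N" using assms(3) by (auto simp: cell_def min_def)
 have f: "0 \<le> \<lfloor>real N * x\<rfloor>" using assms by simp
 have "real (cell N x) \<le> real (nat \<lfloor>real N * x\<rfloor>)" by (simp add: cell_def)
 also have "\<dots> \<le> real N * x" using f by (simp add: of_nat_nat)
 finally show "real (cell N x) / N \<le> x" using assms(3) by (simp add: field_simps)
 show "x \<le> (real (cell N x) + 1) / N"
 proof (cases "nat \<lfloor>real N * x\<rfloor> \<le> N - 1")
  case True
  then have "cell N x = nat \<lfloor>real N * x\<rfloor>" by (simp add: cell_def)
  then have "real N * x \<le> real (cell N x) + 1" using f by (simp add: of_nat_nat)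
  then show ?thesis using assms(3) by (simp add: field_simps)
 next
  case False
  then have "cell N x = N - 1" by (simp add: cell_def)
  then show ?thesis using assms by (simp add: of_nat_diff)
 qed
qed

text \<open>Here \<open>8 / \<eta>\<close> and the minimum are the numbers \<open>\<beta>\<close>
  and \<open>\<theta>\<close> of \<open>stage\<close>. In each of the first \<open>n\<close>
  coordinates a core of length at least \<open>\<theta> * r\<close> is kept out of an enlarged side
  of at most \<open>6 * \<beta> * r\<close>; the remaining coordinates together lose at most a
  factor 2.\<close>

definition stage_ratio :: "nat \<Rightarrow> real \<Rightarrow> real \<Rightarrow> real \<Rightarrow> real" where
 "stage_ratio n L \<kappa> \<eta> = 1 / (2 * (6 * (8 / \<eta>) / min (4 / \<eta>) (\<kappa> / (2 * (real n + 1) * (L + 1)))) ^ n)"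

lemma stage_ratio_pos: "L \<ge> 0 \<Longrightarrow> \<kappa> > 0 \<Longrightarrow> \<eta> > 0 \<Longrightarrow> stage_ratio n L \<kappa> \<eta> > 0"
 unfolding stage_ratio_def by (intro divide_pos_pos mult_pos_pos zero_less_power) (auto simp: min_def)


lemma measure_lborel_Icc_max: "measure lborel {a..b::real} = max 0 (b - a)"
 by (cases "a \<le> b") auto

text \<open>One round of bumps: centres \<open>F\<close> with directions \<open>v\<close> and scales
  \<open>r\<close> provided by \<open>P\<close>, bumps \<open>\<phi>\<close> living on disjoint
  boxes \<open>S\<close>, and cores \<open>K\<close> where the bump is 1. Bumps and cores depend on
  the first \<open>M\<close> coordinates only, the surface does so up to
  \<open>\<kappa> * r\<close>. \<open>P\<close> stays abstract because the same round serves
  porosity and differentiability.\<close>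

definition stage_data :: "((nat \<Rightarrow> real) \<Rightarrow> 'x::real_normed_vector) \<Rightarrow> nat \<Rightarrow> (nat \<Rightarrow> real) set \<Rightarrow> (nat \<Rightarrow> real) set
  \<Rightarrow> ((nat \<Rightarrow> real) \<Rightarrow> 'v \<Rightarrow> real \<Rightarrow> bool) \<Rightarrow> real \<Rightarrow> real \<Rightarrow> real \<Rightarrow> real \<Rightarrow> (nat \<Rightarrow> real) set \<Rightarrow> ((nat \<Rightarrow> real) \<Rightarrow> 'v)
  \<Rightarrow> ((nat \<Rightarrow> real) \<Rightarrow> real) \<Rightarrow> ((nat \<Rightarrow> real) \<Rightarrow> (nat \<Rightarrow> real) \<Rightarrow> real) \<Rightarrow> ((nat \<Rightarrow> real) \<Rightarrow> (nat \<Rightarrow> real) set)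
  \<Rightarrow> ((nat \<Rightarrow> real) \<Rightarrow> (nat \<Rightarrow> real) set) \<Rightarrow> nat \<Rightarrow> bool" where
 "stage_data g n B C P \<kappa> \<eta> \<epsilon> \<mu> F v r \<phi> K S M \<longleftrightarrow> finite F \<and> F \<subseteq> B \<and>
  (\<forall>q\<in>F. P q (v q) (r q) \<and> 0 < r q \<and> r q < \<epsilon> \<and> \<phi> q \<in> GammaX \<and>
    K q \<in> sets lebN \<and> closed (K q) \<and> K q \<subseteq> S q \<inter> cubeT \<and> S q \<inter> C = {}) \<and>
  (\<forall>q\<in>F. \<forall>s\<in>cubeT. 0 \<le> \<phi> q s \<and> \<phi> q s \<le> 1 \<and> (\<forall>j<n. \<bar>pderiv (\<phi> q) j s\<bar> * r q \<le> \<eta>) \<and>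
    (\<forall>j\<ge>M. pderiv (\<phi> q) j s = 0) \<and> (s \<notin> S q \<longrightarrow> \<phi> q s = 0 \<and> (\<forall>j. pderiv (\<phi> q) j s = 0))) \<and>
  (\<forall>q\<in>F. \<forall>s\<in>K q. \<phi> q s = 1 \<and> norm (g s - g q) \<le> \<kappa> * r q) \<and>
  (\<forall>q\<in>F. \<forall>q'\<in>F. q \<noteq> q' \<longrightarrow> S q \<inter> S q' = {}) \<and>
  (\<Sum>q\<in>F. measure lebN (K q)) \<ge> \<mu> \<and>
  (\<forall>q\<in>F. \<forall>s\<in>cubeT. \<forall>s'\<in>cubeT. (\<forall>i<M. s i = s' i) \<longrightarrow>
    norm (g s - g s') \<le> \<kappa> * r q \<and> (s \<in> K q \<longrightarrow> s' \<in> K q) \<and> \<phi> q s = \<phi> q s')"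

lemma stage_dataD:
 assumes "stage_data g n B C P \<kappa> \<eta> \<epsilon> \<mu> F v r \<phi> K S M"
 shows "finite F" "F \<subseteq> B" "\<mu> \<le> (\<Sum>q\<in>F. measure lebN (K q))"
  "\<And>q. q \<in> F \<Longrightarrow> P q (v q) (r q)" "\<And>q. q \<in> F \<Longrightarrow> 0 < r q" "\<And>q. q \<in> F \<Longrightarrow> r q < \<epsilon>"
  "\<And>q. q \<in> F \<Longrightarrow> \<phi> q \<in> GammaX" "\<And>q. q \<in> F \<Longrightarrow> K q \<in> sets lebN" "\<And>q. q \<in> F \<Longrightarrow> closed (K q)"
  "\<And>q. q \<in> F \<Longrightarrow> K q \<subseteq> S q" "\<And>q. q \<in> F \<Longrightarrow> K q \<subseteq> cubeT" "\<And>q. q \<in> F \<Longrightarrow> S q \<inter> C = {}"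
  "\<And>q s. q \<in> F \<Longrightarrow> s \<in> cubeT \<Longrightarrow> 0 \<le> \<phi> q s" "\<And>q s. q \<in> F \<Longrightarrow> s \<in> cubeT \<Longrightarrow> \<phi> q s \<le> 1"
  "\<And>q s j. q \<in> F \<Longrightarrow> s \<in> cubeT \<Longrightarrow> j < n \<Longrightarrow> \<bar>pderiv (\<phi> q) j s\<bar> * r q \<le> \<eta>"
  "\<And>q s j. q \<in> F \<Longrightarrow> s \<in> cubeT \<Longrightarrow> j \<ge> M \<Longrightarrow> pderiv (\<phi> q) j s = 0"
  "\<And>q s. q \<in> F \<Longrightarrow> s \<in> cubeT \<Longrightarrow> s \<notin> S q \<Longrightarrow> \<phi> q s = 0 \<and> (\<forall>j. pderiv (\<phi> q) j s = 0)"
  "\<And>q s. q \<in> F \<Longrightarrow> s \<in> K q \<Longrightarrow> \<phi> q s = 1" "\<And>q s. q \<in> F \<Longrightarrow> s \<in> K q \<Longrightarrow> norm (g s - g q) \<le> \<kappa> * r q"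
  "\<And>q q'. q \<in> F \<Longrightarrow> q' \<in> F \<Longrightarrow> q \<noteq> q' \<Longrightarrow> S q \<inter> S q' = {}"
  "\<And>q s s'. q \<in> F \<Longrightarrow> s \<in> cubeT \<Longrightarrow> s' \<in> cubeT \<Longrightarrow> (\<And>i. i < M \<Longrightarrow> s i = s' i) \<Longrightarrow> norm (g s - g s') \<le> \<kappa> * r q"
  "\<And>q s s'. q \<in> F \<Longrightarrow> s \<in> cubeT \<Longrightarrow> s' \<in> cubeT \<Longrightarrow> (\<And>i. i < M \<Longrightarrow> s i = s' i) \<Longrightarrow> s \<in> K q \<Longrightarrow> s' \<in> K q"
proof -
 note a = assms[unfolded stage_data_def]
 note c1 = a[THEN conjunct1] and b2 = a[THEN conjunct2]
 note c2 = b2[THEN conjunct1] and b3 = b2[THEN conjunct2]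
 note c3 = b3[THEN conjunct1] and b4 = b3[THEN conjunct2]
 note c4 = b4[THEN conjunct1] and b5 = b4[THEN conjunct2]
 note c5 = b5[THEN conjunct1] and b6 = b5[THEN conjunct2]
 note c6 = b6[THEN conjunct1] and b7 = b6[THEN conjunct2]
 note c7 = b7[THEN conjunct1] and c8 = b7[THEN conjunct2]
 show "finite F"
  using c1 by blast+
 show "F \<subseteq> B"
  using c2 by blast+
 show "\<mu> \<le> (\<Sum>q\<in>F. measure lebN (K q))"
  using c7 by blast+
 show "\<And>q. q \<in> F \<Longrightarrow> P q (v q) (r q)"
  "\<And>q. q \<in> F \<Longrightarrow> 0 < r q"
  "\<And>q. q \<in> F \<Longrightarrow> r q < \<epsilon>"
  "\<And>q. q \<in> F \<Longrightarrow> \<phi> q \<in> GammaX"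
  "\<And>q. q \<in> F \<Longrightarrow> K q \<in> sets lebN"
  "\<And>q. q \<in> F \<Longrightarrow> closed (K q)"
  "\<And>q. q \<in> F \<Longrightarrow> K q \<subseteq> S q"
  "\<And>q. q \<in> F \<Longrightarrow> K q \<subseteq> cubeT"
  "\<And>q. q \<in> F \<Longrightarrow> S q \<inter> C = {}"
  using c3 by blast+
 show "\<And>q s. q \<in> F \<Longrightarrow> s \<in> cubeT \<Longrightarrow> 0 \<le> \<phi> q s"
  "\<And>q s. q \<in> F \<Longrightarrow> s \<in> cubeT \<Longrightarrow> \<phi> q s \<le> 1"
  "\<And>q s j. q \<in> F \<Longrightarrow> s \<in> cubeT \<Longrightarrow> j < n \<Longrightarrow> \<bar>pderiv (\<phi> q) j s\<bar> * r q \<le> \<eta>"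
  "\<And>q s j. q \<in> F \<Longrightarrow> s \<in> cubeT \<Longrightarrow> j \<ge> M \<Longrightarrow> pderiv (\<phi> q) j s = 0"
  "\<And>q s. q \<in> F \<Longrightarrow> s \<in> cubeT \<Longrightarrow> s \<notin> S q \<Longrightarrow> \<phi> q s = 0 \<and> (\<forall>j. pderiv (\<phi> q) j s = 0)"
  using c4 by blast+
 show "\<And>q s. q \<in> F \<Longrightarrow> s \<in> K q \<Longrightarrow> \<phi> q s = 1"
  "\<And>q s. q \<in> F \<Longrightarrow> s \<in> K q \<Longrightarrow> norm (g s - g q) \<le> \<kappa> * r q"
  using c5 by blast+
 show "\<And>q q'. q \<in> F \<Longrightarrow> q' \<in> F \<Longrightarrow> q \<noteq> q' \<Longrightarrow> S q \<inter> S q' = {}"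
  using c6 by blast+
 show "\<And>q s s'. q \<in> F \<Longrightarrow> s \<in> cubeT \<Longrightarrow> s' \<in> cubeT \<Longrightarrow> (\<And>i. i < M \<Longrightarrow> s i = s' i) \<Longrightarrow> norm (g s - g s') \<le> \<kappa> * r q"
  "\<And>q s s'. q \<in> F \<Longrightarrow> s \<in> cubeT \<Longrightarrow> s' \<in> cubeT \<Longrightarrow> (\<And>i. i < M \<Longrightarrow> s i = s' i) \<Longrightarrow> s \<in> K q \<Longrightarrow> s' \<in> K q"
  using c8 by blast+
qed

text \<open>The first \<open>n\<close> coordinates are those in which the slope of the bumps has to be small, hence the
 covering argument takes place there. In the remaining coordinates a fine grid is used and
 the slopes are irrelevant. This is why the proportion of the cube that is covered does not depend on
 the number of coordinates the surface depends on.\<close>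

lemma stage:
 fixes g :: "(nat \<Rightarrow> real) \<Rightarrow> 'x::real_normed_vector" and P :: "(nat \<Rightarrow> real) \<Rightarrow> 'v \<Rightarrow> real \<Rightarrow> bool"
 assumes g: "g \<in> GammaX" and L: "\<And>t j. t \<in> cubeT \<Longrightarrow> j < n \<Longrightarrow> norm (pderiv g j t) \<le> L" and L0: "L \<ge> 0"
  and B: "B \<subseteq> cubeT" "\<tau> < oT B" and C: "closed C" "B \<inter> C = {}"
  and P: "\<And>t d. t \<in> B \<Longrightarrow> d > 0 \<Longrightarrow> \<exists>r v. 0 < r \<and> r < d \<and> P t v r"
  and \<kappa>: "\<kappa> > 0" and \<eta>: "\<eta> > 0" and \<epsilon>: "\<epsilon> > 0"
 shows "\<exists>F v r \<phi> K S M. stage_data g n B C P \<kappa> \<eta> \<epsilon> (stage_ratio n L \<kappa> \<eta> * \<tau>) F v r \<phi> K S M"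
proof -
 \<comment> \<open>A margin to \<open>C\<close>, measured in the first \<open>p\<close> coordinates.
   It depends on the point, and \<open>oT_incseq\<close> selects one \<open>p\<close>.\<close>
 define Bp where "Bp p = {t\<in>B. \<forall>s\<in>C. \<not> (\<forall>i<p. \<bar>s i - t i\<bar> \<le> inverse (Suc p))}" for p :: nat
 have "(\<Union>p. Bp p) = B"
 proof (intro equalityI subsetI)
  fix t assume t: "t \<in> B"
  then have "t \<in> - C" "open (- C)" using C by auto
  then obtain d where d: "d > 0" "ball t d \<subseteq> - C" using open_contains_ball by blast
  obtain N \<delta> where N: "\<delta> > 0" "\<And>x y :: nat \<Rightarrow> real. (\<forall>i<N. \<bar>x i - y i\<bar> \<le> \<delta>) \<Longrightarrow> dist x y < d"
   using box_dist[OF d(1)] by blast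
  obtain k where k: "inverse (real (Suc k)) < \<delta>" using reals_Archimedean[OF N(1)] by blast
  define p where "p = max N k"
  have pk: "inverse (real (Suc p)) \<le> inverse (real (Suc k))" by (intro le_imp_inverse_le) (auto simp: p_def)
  have "\<not> (\<forall>i<p. \<bar>s i - t i\<bar> \<le> inverse (Suc p))" if s: "s \<in> C" for s
  proof
   assume *: "\<forall>i<p. \<bar>s i - t i\<bar> \<le> inverse (Suc p)"
   have "\<bar>t i - s i\<bar> \<le> \<delta>" if "i < N" for i
   proof -
    have "\<bar>s i - t i\<bar> \<le> inverse (Suc p)" using * that by (auto simp: p_def)
    then show ?thesis using pk k by linarith
   qed
   then have "s \<in> ball t d" using N(2)[of t s] by simp
   then show False using d(2) s by blast
  qed
  then show "t \<in> (\<Union>p. Bp p)" using t unfolding Bp_def by blast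
 qed (auto simp: Bp_def)
 moreover have "incseq Bp"
 proof (rule incseq_SucI)
  fix p :: nat
  have "inverse (real (Suc (Suc p))) \<le> inverse (real (Suc p))" by (intro le_imp_inverse_le) auto
  then show "Bp p \<subseteq> Bp (Suc p)" unfolding Bp_def by (intro Collect_mono) (meson less_SucI order_trans)
 qed
 ultimately obtain p where p: "\<tau> < oT (Bp p)" using oT_incseq B(2) by metis
 \<comment> \<open>A box of half-width \<open>\<beta> * r\<close> with edges half as wide gives
   slope at most \<open>8 / (\<beta> * r)\<close>, that is \<open>\<eta> / r\<close>.\<close>
 define \<beta> where "\<beta> = 8 / \<eta>"
 \<comment> \<open>Half-width of the core in units of \<open>r\<close>. As \<open>4 / \<eta>\<close>
   is \<open>\<beta> / 2\<close>, the core lies on the plateau; the other term limits the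
   oscillation of the surface over \<open>n\<close> coordinates to
   \<open>\<kappa> * r / 2\<close>.\<close>
 define \<theta> where "\<theta> = min (4 / \<eta>) (\<kappa> / (2 * (real n + 1) * (L + 1)))"
 have \<beta>: "\<beta> > 0" using \<eta> by (simp add: \<beta>_def)
 have \<theta>: "\<theta> > 0" "\<theta> \<le> \<beta> / 2" using \<eta> \<kappa> L0 by (auto simp: \<theta>_def \<beta>_def)
 have \<theta>L: "real n * (L * \<theta>) \<le> \<kappa> / 2"
 proof -
  have "real n * L \<le> (real n + 1) * (L + 1)" using L0 by (intro mult_mono) auto
  then have "(real n * L) * \<theta> \<le> ((real n + 1) * (L + 1)) * (\<kappa> / (2 * (real n + 1) * (L + 1)))"
   using \<theta>(1) L0 by (intro mult_mono) (auto simp: \<theta>_def)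
  also have "\<dots> = \<kappa> / 2" using L0 by (simp add: field_simps add_nonneg_eq_0_iff)
  finally show ?thesis by (simp add: mult.assoc)
 qed
 define \<epsilon>0 where "\<epsilon>0 = min \<epsilon> (inverse (Suc p) / (2 * \<beta>))"
 have \<epsilon>0: "\<epsilon>0 > 0" "\<epsilon>0 \<le> \<epsilon>" using \<epsilon> \<beta> by (auto simp: \<epsilon>0_def)
 \<comment> \<open>A lower bound on the scales, made uniform in the same way; it allows one grid to
   be fine enough for all points.\<close>
 define Bk where "Bk k = {t\<in>Bp p. \<exists>r v. inverse (Suc k) \<le> r \<and> r < \<epsilon>0 \<and> P t v r}" for k :: nat
 have "(\<Union>k. Bk k) = Bp p"
 proof (intro equalityI subsetI)
  fix t assume t: "t \<in> Bp p"
  then obtain r v where r: "0 < r" "r < \<epsilon>0" "P t v r" using P[of t \<epsilon>0] \<epsilon>0 by (auto simp: Bp_def)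
  then obtain k where "inverse (real (Suc k)) < r" using reals_Archimedean by blast
  then show "t \<in> (\<Union>k. Bk k)" using t r unfolding Bk_def by (auto intro: less_imp_le)
 qed (auto simp: Bk_def)
 moreover have "incseq Bk"
 proof (rule incseq_SucI)
  fix k :: nat
  have "inverse (real (Suc (Suc k))) \<le> inverse (real (Suc k))" by (intro le_imp_inverse_le) auto
  then show "Bk k \<subseteq> Bk (Suc k)" unfolding Bk_def by (intro Collect_mono) (meson order_trans)
 qed
 ultimately obtain k where k: "\<tau> < oT (Bk k)" using oT_incseq p by metis
 have "\<forall>t\<in>Bk k. \<exists>v r. inverse (Suc k) \<le> r \<and> r < \<epsilon>0 \<and> P t v r" unfolding Bk_def by blast
 then obtain v r where vr: "\<And>t. t \<in> Bk k \<Longrightarrow> inverse (Suc k) \<le> r t \<and> r t < \<epsilon>0 \<and> P t (v t) (r t)"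
  by metis
 define r0 where "r0 = inverse (real (Suc k))"
 have r0: "r0 > 0" by (simp add: r0_def)
 have r: "0 < r t" "r0 \<le> r t" "r t < \<epsilon>" "\<beta> * r t \<le> inverse (Suc p) / 2" "\<beta> * r t \<le> 1/2" "P t (v t) (r t)"
  if t: "t \<in> Bk k" for t
 proof -
  show "r0 \<le> r t" "r t < \<epsilon>" "P t (v t) (r t)" using vr[OF t] \<epsilon>0 by (auto simp: r0_def)
  then show "0 < r t" using r0 by simp
  have "r t \<le> inverse (Suc p) / (2 * \<beta>)" using vr[OF t] by (simp add: \<epsilon>0_def)
  then have "\<beta> * r t \<le> \<beta> * (inverse (Suc p) / (2 * \<beta>))" using \<beta> by (intro mult_left_mono) auto
  also have "\<dots> = inverse (Suc p) / 2" using \<beta> by simp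
  finally show 1: "\<beta> * r t \<le> inverse (Suc p) / 2" .
  have "inverse (real (Suc p)) \<le> 1" by (simp add: field_simps)
  then show "\<beta> * r t \<le> 1/2" using 1 by linarith
 qed
 have BkT: "t \<in> cubeT" if "t \<in> Bk k" for t using that B(1) by (auto simp: Bk_def Bp_def)
 obtain N1 \<delta> where \<delta>: "\<delta> > 0" and mod: "\<And>t t'. t \<in> cubeT \<Longrightarrow> t' \<in> cubeT \<Longrightarrow> (\<forall>i<N1. \<bar>t i - t' i\<bar> \<le> \<delta>) \<Longrightarrow> dist (g t) (g t') < \<kappa> * r0 / 2"
 proof -
  have "\<kappa> * r0 / 2 > 0" using \<kappa> r0 by simp
  from cubeT_modulus[OF GammaX_D(1)[OF g] this] show thesis using that by blast
 qed
 define m where "m = Suc (max n (max N1 p))"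
 have m: "n \<le> m" "N1 \<le> m" "p \<le> m" "m > 0" by (auto simp: m_def)
 \<comment> \<open>The grid is finer than the modulus of continuity, the margin to \<open>C\<close>,
   and the smallest box. By the last, points sharing all cells are in conflict, so conflict-free
   sets have bounded size.\<close>
 obtain N where N: "inverse (real (Suc N)) < min \<delta> (min (inverse (Suc p)) (2 * \<beta> * r0))"
  using reals_Archimedean[of "min \<delta> (min (inverse (Suc p)) (2 * \<beta> * r0))"] \<delta> \<beta> r0 by auto
 define G where "G = real (Suc N)"
 have G: "G > 0" "1 / G < \<delta>" "1 / G < inverse (Suc p)" "1 / G < 2 * \<beta> * r0"
  using N by (auto simp: G_def inverse_eq_divide)
 define c where "c q i = cell (Suc N) (q i)" for q :: "nat \<Rightarrow> real" and i
 have c: "c q i < Suc N" "real (c q i) / G \<le> q i" "q i \<le> (real (c q i) + 1) / G" if "q \<in> cubeT" for q i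
  using cell_bounds[of "q i" "Suc N"] cubeT_D[OF that, of i] unfolding c_def G_def by auto
 have ccl: "\<bar>x - y\<bar> \<le> 1 / G" if "real j / G \<le> x" "x \<le> (real j + 1) / G" "real j / G \<le> y" "y \<le> (real j + 1) / G" for x y j
  using that G(1) by (simp add: abs_le_iff field_simps)
 define R where "R q = \<beta> * r q" for q
 \<comment> \<open>A condition that holds whenever the boxes \<open>S\<close> defined below
   meet.\<close>
 define conf where "conf t q \<longleftrightarrow> (\<forall>i<n. \<bar>t i - q i\<bar> < R t + R q) \<and> (\<forall>i\<in>{n..<m}. c t i = c q i)" for t q
 have "\<exists>F. finite F \<and> F \<subseteq> Bk k \<and> (\<forall>t\<in>F. \<forall>q\<in>F. t \<noteq> q \<longrightarrow> \<not> conf t q) \<and>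
  (\<forall>t\<in>Bk k. \<exists>q\<in>F. conf q t \<and> R t \<le> 2 * R q)"
 proof (rule greedy_cover[where Rmax = 1 and N = "card (PiE {..<m} (\<lambda>_. {..<Suc N}))"])
  fix F assume F: "finite F" "F \<subseteq> Bk k" "\<And>t q. t \<in> F \<Longrightarrow> q \<in> F \<Longrightarrow> t \<noteq> q \<Longrightarrow> \<not> conf t q"
  have "inj_on (\<lambda>t. restrict (c t) {..<m}) F"
  proof (rule inj_onI, rule ccontr)
   fix t q assume tq: "t \<in> F" "q \<in> F" "restrict (c t) {..<m} = restrict (c q) {..<m}" "t \<noteq> q"
   then have ceq: "c t i = c q i" if "i < m" for i using that by (metis lessThan_iff restrict_apply')
   have "\<bar>t i - q i\<bar> < R t + R q" if "i < n" for i
   proof -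
    have tqT: "t \<in> cubeT" "q \<in> cubeT" using tq F(2) BkT by auto
    have "\<bar>t i - q i\<bar> \<le> 1 / G"
     using c(2,3)[OF tqT(1), of i] c(2,3)[OF tqT(2), of i] ceq[of i] that m(1) ccl[of "c t i" "t i" "q i"] by simp
    also have "\<dots> < 2 * \<beta> * r0" by (rule G(4))
    also have "\<dots> = \<beta> * r0 + \<beta> * r0" by simp
    also have "\<dots> \<le> R t + R q"
     unfolding R_def using r(2)[of t] r(2)[of q] tq F(2) \<beta> by (intro add_mono mult_left_mono) auto
    finally show ?thesis .
   qed
   then have "conf t q" unfolding conf_def using ceq by auto
   then show False using F(3) tq by blast
  qed
  moreover have "(\<lambda>t. restrict (c t) {..<m}) ` F \<subseteq> PiE {..<m} (\<lambda>_. {..<Suc N})"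
   using F(2) BkT c(1) by (auto simp: PiE_def)
  ultimately show "card F \<le> card (PiE {..<m} (\<lambda>_. {..<Suc N}))"
   by (metis card_inj_on_le finite_PiE finite_lessThan)
 next
  fix t assume t: "t \<in> Bk k"
  show "conf t t" unfolding conf_def using r[OF t] \<beta> by (auto simp: R_def)
  show "0 < R t \<and> R t \<le> 1" using r[OF t] \<beta> by (auto simp: R_def)
 next
  fix t q show "conf t q \<Longrightarrow> conf q t" unfolding conf_def by (auto simp: abs_minus_commute add.commute)
 qed
 then obtain F where F: "finite F" "F \<subseteq> Bk k" and F': "\<forall>t\<in>F. \<forall>q\<in>F. t \<noteq> q \<longrightarrow> \<not> conf t q"
  "\<forall>t\<in>Bk k. \<exists>q\<in>F. conf q t \<and> R t \<le> 2 * R q" by (elim exE conjE) (rule that)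
 have Fconf: "\<not> conf t q" if "t \<in> F" "q \<in> F" "t \<noteq> q" for t q using F'(1) that by blast
 have Fcov: "\<exists>q\<in>F. conf q t \<and> R t \<le> 2 * R q" if "t \<in> Bk k" for t using F'(2) that by blast
 \<comment> \<open>Edge width in the grid coordinates: a relative loss of \<open>1 / (2 * m)\<close>
   per coordinate costs at most half of the product, by Bernoulli's inequality.\<close>
 define \<omega> where "\<omega> = 1 / (4 * real m * G)"
 have \<omega>: "\<omega> > 0" using m G by (simp add: \<omega>_def)
 define a where "a q i = (if i < n then q i - R q else real (c q i) / G)" for q i
 define b where "b q i = (if i < n then q i + R q else (real (c q i) + 1) / G)" for q i
 define w where "w q i = (if i < n then R q / 2 else \<omega>)" for q and i :: nat
 define \<phi> where "\<phi> q = bump (a q) (b q) (w q) m" for q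
 define S where "S q = {s. \<forall>i<m. a q i < s i \<and> s i < b q i}" for q
 define A where "A q i = (if i < n then {max 0 (q i - \<theta> * r q) .. min 1 (q i + \<theta> * r q)}
   else {real (c q i) / G + \<omega> .. (real (c q i) + 1) / G - \<omega>})" for q i
 \<comment> \<open>Every point conflicts with a centre \<open>q\<close> whose radius is at least
   half its own, so it is within \<open>R q + 2 * R q\<close> of \<open>q\<close> in the first
   \<open>n\<close> coordinates.\<close>
 define A3 where "A3 q i = (if i < n then {max 0 (q i - 3 * R q) .. min 1 (q i + 3 * R q)}
   else {real (c q i) / G .. (real (c q i) + 1) / G})" for q i
 define K where "K q = {s\<in>cubeT. \<forall>i\<in>{..<m}. s i \<in> A q i}" for q
 define K3 where "K3 q = {s\<in>cubeT. \<forall>i\<in>{..<m}. s i \<in> A3 q i}" for q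
 have w: "w q i > 0" if "q \<in> F" for q i
  using that F(2) r(1)[of q] \<beta> \<omega> by (auto simp: w_def R_def)
 have FT: "q \<in> cubeT" and FB: "q \<in> Bk k" if "q \<in> F" for q using that F(2) BkT by auto
 have Rpos: "R q > 0" if "q \<in> F" for q using r(1)[OF FB[OF that]] \<beta> by (simp add: R_def)
 note bp = bump_props[where a = "a q" and b = "b q" and w = "w q" and m = m for q, OF w, folded \<phi>_def]
 have \<theta>R: "\<theta> * r q \<le> R q / 2" if "q \<in> F" for q
 proof -
  have "\<theta> * r q \<le> \<beta> / 2 * r q" using \<theta> r(1)[OF FB[OF that]] by (intro mult_right_mono) auto
  then show ?thesis by (simp add: R_def)
 qed
 have G4: "2 * \<omega> < 1 / G"
 proof -
  have "2 * \<omega> = (1 / G) * (1 / (2 * real m))" by (simp add: \<omega>_def)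
  also have "\<dots> < (1 / G) * 1" using G m by (intro mult_strict_left_mono) (auto simp: field_simps)
  finally show ?thesis by simp
 qed
 have cG: "(real (c q i) + 1) / G = real (c q i) / G + 1 / G" for q i by (simp add: add_divide_distrib)
 have cG1: "(real (c q i) + 1) / G \<le> 1" if "q \<in> F" for q i
 proof -
  have "c q i < Suc N" using c(1)[OF FT[OF that]] .
  then have "real (c q i) + 1 \<le> G" unfolding G_def by (metis Suc_leI of_nat_Suc of_nat_le_iff add.commute)
  then show ?thesis using G(1) by simp
 qed
 have KS: "K q \<subseteq> S q" if q: "q \<in> F" for q
 proof
  fix s assume s: "s \<in> K q"
  have "a q i < s i \<and> s i < b q i" if i: "i < m" for i
  proof (cases "i < n")
   case True
   moreover have "s i \<in> A q i" using s i by (simp add: K_def)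
   ultimately have "q i - \<theta> * r q \<le> s i" "s i \<le> q i + \<theta> * r q" by (simp_all add: A_def)
   then show ?thesis using \<theta>R[OF q] Rpos[OF q] True by (simp add: a_def b_def)
  next
   case False
   moreover have "s i \<in> A q i" using s i by (simp add: K_def)
   ultimately have "real (c q i) / G + \<omega> \<le> s i" "s i \<le> (real (c q i) + 1) / G - \<omega>" by (simp_all add: A_def)
   then show ?thesis using \<omega> False by (simp add: a_def b_def)
  qed
  then show "s \<in> S q" by (simp add: S_def)
 qed
 have K1: "\<phi> q s = 1" if q: "q \<in> F" and s: "s \<in> K q" for q s
 proof -
  have "a q i + w q i \<le> s i \<and> s i \<le> b q i - w q i" if i: "i < m" for i
  proof (cases "i < n")
   case True
   moreover have "s i \<in> A q i" using s i by (simp add: K_def)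
   ultimately have "q i - \<theta> * r q \<le> s i" "s i \<le> q i + \<theta> * r q" by (simp_all add: A_def)
   then show ?thesis using \<theta>R[OF q] True by (simp add: a_def b_def w_def)
  next
   case False
   moreover have "s i \<in> A q i" using s i by (simp add: K_def)
   ultimately have "real (c q i) / G + \<omega> \<le> s i" "s i \<le> (real (c q i) + 1) / G - \<omega>" by (simp_all add: A_def)
   then show ?thesis using False by (simp add: a_def b_def w_def)
  qed
  moreover have "s \<in> cubeT" using s by (simp add: K_def)
  ultimately show ?thesis using bp[OF q] by blast
 qed
 have near: "norm (g s - g s') \<le> \<kappa> * r0 / 2" if "s \<in> cubeT" "s' \<in> cubeT" "\<forall>i<m. \<bar>s i - s' i\<bar> \<le> 1 / G" for s s'
 proof -
  have "\<bar>s i - s' i\<bar> \<le> \<delta>" if "i < N1" for i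
   using \<open>\<forall>i<m. \<bar>s i - s' i\<bar> \<le> 1 / G\<close> m(2) G(2) that by (meson less_imp_le less_le_trans order_trans)
  then show ?thesis using mod[OF that(1,2)] by (simp add: dist_norm less_imp_le)
 qed
 have Kg: "norm (g s - g q) \<le> \<kappa> * r q" if q: "q \<in> F" and s: "s \<in> K q" for q s
 proof -
  \<comment> \<open>Two moves: the first \<open>n\<close> coordinates by the slope bound
    \<open>L\<close>, the grid coordinates by uniform continuity. Each costs at most half of
    \<open>\<kappa> * r q\<close>.\<close>
  define s' where "s' i = (if i < n then q i else s i)" for i
  have sT: "s \<in> cubeT" using s by (simp add: K_def)
  have s'T: "s' \<in> cubeT" using sT FT[OF q] by (auto simp: s'_def cubeT_def)
  have "norm (g s - g s') \<le> real n * (L * (\<theta> * r q))"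
  proof (rule GammaX_lipschitz[OF g sT s'T L])
   fix i assume i: "i < n"
   then have "s i \<in> A q i" using s m(1) by (auto simp: K_def)
   then show "\<bar>s i - s' i\<bar> \<le> \<theta> * r q" using i by (auto simp: s'_def A_def abs_le_iff)
  qed (auto simp: s'_def)
  also have "\<dots> = real n * (L * \<theta>) * r q" by simp
  also have "\<dots> \<le> \<kappa> / 2 * r q" using \<theta>L r(1)[OF FB[OF q]] by (intro mult_right_mono) auto
  finally have 1: "norm (g s - g s') \<le> \<kappa> / 2 * r q" .
  have "norm (g s' - g q) \<le> \<kappa> * r0 / 2"
  proof (rule near[OF s'T FT[OF q]], intro allI impI)
   fix i assume i: "i < m"
   show "\<bar>s' i - q i\<bar> \<le> 1 / G"
   proof (cases "i < n")
    case False
    then have "s i \<in> A q i" using s i by (auto simp: K_def)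
    then have "real (c q i) / G \<le> s i" "s i \<le> (real (c q i) + 1) / G" using False \<omega> by (auto simp: A_def)
    then show ?thesis using ccl[of "c q i" "s i" "q i"] c(2,3)[OF FT[OF q], of i] False by (simp add: s'_def)
   qed (use G in \<open>simp add: s'_def\<close>)
  qed
  moreover have "\<kappa> * r0 \<le> \<kappa> * r q" using r(2)[OF FB[OF q]] \<kappa> by (intro mult_left_mono) auto
  ultimately show ?thesis using 1 norm_diff_triangle_le[of "g s" "g s'" _ "g q"] by force
 qed
 have SC: "S q \<inter> C = {}" if q: "q \<in> F" for q
 proof (rule ccontr)
  assume "S q \<inter> C \<noteq> {}"
  then obtain s where s: "s \<in> S q" "s \<in> C" by blast
  have qB: "q \<in> Bp p" using FB[OF q] by (simp add: Bk_def)
  have "\<bar>s i - q i\<bar> \<le> inverse (Suc p)" if i: "i < p" for i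
  proof -
  have ab: "a q i < s i" "s i < b q i" using s(1) i m(3) by (auto simp: S_def)
  show ?thesis
  proof (cases "i < n")
   case True
   then have "\<bar>s i - q i\<bar> < R q" using ab by (simp add: a_def b_def abs_less_iff)
   moreover have "R q \<le> inverse (Suc p) / 2" using r(4)[OF FB[OF q]] by (simp add: R_def)
   moreover have "inverse (real (Suc p)) > 0" by simp
   ultimately show ?thesis by linarith
  next
   case False
   then have "real (c q i) / G \<le> s i" "s i \<le> (real (c q i) + 1) / G" using ab by (simp_all add: a_def b_def)
   then have "\<bar>s i - q i\<bar> \<le> 1 / G" using ccl[of "c q i" "s i" "q i"] c(2,3)[OF FT[OF q], of i] by simp
   then show ?thesis using G(3) by simp
  qed
  qed
  then show False using qB s(2) unfolding Bp_def by blast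
 qed
 have Sdisj: "S q \<inter> S q' = {}" if q: "q \<in> F" "q' \<in> F" "q \<noteq> q'" for q q'
 proof (rule ccontr)
  assume "S q \<inter> S q' \<noteq> {}"
  then obtain s where s: "s \<in> S q" "s \<in> S q'" by blast
  have "\<bar>q i - q' i\<bar> < R q + R q'" if i: "i < n" for i
  proof -
   have "a q i < s i" "s i < b q i" "a q' i < s i" "s i < b q' i" using s i m(1) by (auto simp: S_def)
   then have "\<bar>s i - q i\<bar> < R q" "\<bar>s i - q' i\<bar> < R q'"
    using i by (simp_all add: a_def b_def abs_less_iff)
   then show ?thesis by linarith
  qed
  moreover have "c q i = c q' i" if i: "i \<in> {n..<m}" for i
  proof -
   have "real (c q i) < s i * G" "s i * G < real (c q i) + 1" "real (c q' i) < s i * G" "s i * G < real (c q' i) + 1"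
    using s i G(1) by (auto simp: S_def a_def b_def field_simps)
   then show ?thesis by linarith
  qed
  ultimately show False using Fconf[OF q] unfolding conf_def by blast
 qed
 have Asets: "A q i \<in> sets borel" "A3 q i \<in> sets borel" for q i by (auto simp: A_def A3_def)
 have A01: "A q i \<subseteq> {0..1}" "A3 q i \<subseteq> {0..1}" if q: "q \<in> F" for q i
 proof -
  have "0 \<le> real (c q i) / G" using G(1) by simp
  then have "x \<in> {0..1}" if "real (c q i) / G \<le> x" "x \<le> (real (c q i) + 1) / G" for x
   using that cG1[OF q, of i] by (simp only: atLeastAtMost_iff) linarith
  then show "A q i \<subseteq> {0..1}" "A3 q i \<subseteq> {0..1}" using \<omega> by (cases "i < n"; auto simp: A_def A3_def)+
 qed
 note mK = emeasure_lebN_box[where A = "A q" for q, OF finite_lessThan[of m] Asets(1) A01(1), folded K_def]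
 note mK3 = emeasure_lebN_box[where A = "A3 q" for q, OF finite_lessThan[of m] Asets(2) A01(2), folded K3_def]
 have Kclosed: "closed (K q)" for q
 proof -
  have "closed ((\<lambda>s::nat \<Rightarrow> real. s i) -` A q i)" for i
   by (intro continuous_closed_vimage) (auto simp: A_def continuous_on_eq_continuous_within[symmetric] intro: continuous_on_coord continuous_on_interior[of UNIV])
  then have "closed (cubeT \<inter> (\<Inter>i\<in>{..<m}. (\<lambda>s::nat \<Rightarrow> real. s i) -` A q i))"
   by (intro closed_Int closed_INT compact_imp_closed[OF compact_cubeT]) auto
  moreover have "K q = cubeT \<inter> (\<Inter>i\<in>{..<m}. (\<lambda>s::nat \<Rightarrow> real. s i) -` A q i)" by (auto simp: K_def)
  ultimately show ?thesis by simp
 qed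
 have each: "measure lebN (K3 q) * stage_ratio n L \<kappa> \<eta> \<le> measure lebN (K q)" if q: "q \<in> F" for q
 proof -
  have rq: "r q > 0" "\<theta> * r q > 0" using r(1)[OF FB[OF q]] \<theta> by auto
  have split: "(\<Prod>i<m. h i) = (\<Prod>i<n. h i) * (\<Prod>i\<in>{n..<m}. h i)" for h :: "nat \<Rightarrow> real"
   using m(1) by (metis atLeast0LessThan le0 prod.atLeastLessThan_concat)
  have "measure lebN (K3 q) = (\<Prod>i<n. measure lborel (A3 q i)) * (\<Prod>i\<in>{n..<m}. measure lborel (A3 q i))"
   using mK3(3)[OF q] split by simp
  also have "\<dots> \<le> (\<Prod>i<n. 6 * R q) * (\<Prod>i\<in>{n..<m}. 1 / G)"
  proof (intro mult_mono prod_mono conjI)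
   fix i assume "i \<in> {..<n}"
   then show "measure lborel (A3 q i) \<le> 6 * R q" using Rpos[OF q] by (simp add: A3_def measure_lborel_Icc_max max_def min_def)
  next
   fix i assume "i \<in> {n..<m}"
   then show "measure lborel (A3 q i) \<le> 1 / G" using G(1) by (simp add: A3_def cG)
  qed (auto intro!: prod_nonneg simp: G(1) less_imp_le[OF Rpos[OF q]])
  finally have up: "measure lebN (K3 q) \<le> (6 * R q) ^ n * (1 / G) ^ (m - n)" by simp
  have "measure lebN (K q) = (\<Prod>i<n. measure lborel (A q i)) * (\<Prod>i\<in>{n..<m}. measure lborel (A q i))"
   using mK(3)[OF q] split by simp
  also have "\<dots> \<ge> (\<Prod>i<n. \<theta> * r q) * (\<Prod>i\<in>{n..<m}. 1 / G * (1 - 1 / (2 * real m)))"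
  proof (intro mult_mono prod_mono conjI)
   fix i assume i: "i \<in> {..<n}"
   \<comment> \<open>Even for a centre on a face of the cube one half of the interval remains, hence
     the length \<open>\<theta> * r q\<close> rather than twice that.\<close>
   have "0 \<le> q i" "q i \<le> 1" using cubeT_D[OF FT[OF q], of i] by auto
   moreover have "\<theta> * r q \<le> 1/4" using \<theta>R[OF q] r(5)[OF FB[OF q]] by (simp add: R_def)
   ultimately show "\<theta> * r q \<le> measure lborel (A q i)"
    using i rq(2) by (auto simp: A_def measure_lborel_Icc_max max_def min_def)
  next
   fix i assume i: "i \<in> {n..<m}"
   have "1 / G * (1 - 1 / (2 * real m)) = 1 / G - 2 * \<omega>" by (simp add: \<omega>_def right_diff_distrib)
   then show "1 / G * (1 - 1 / (2 * real m)) \<le> measure lborel (A q i)"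
    using i G4 by (simp add: A_def cG)
   show "0 \<le> 1 / G * (1 - 1 / (2 * real m))" using G(1) m(4) by (auto simp: field_simps)
  qed (use rq m(4) G(1) in \<open>auto intro!: prod_nonneg simp: field_simps\<close>)
  finally have "(\<theta> * r q) ^ n * ((1 / G) ^ (m - n) * (1 - 1 / (2 * real m)) ^ (m - n)) \<le> measure lebN (K q)"
   by (simp only: prod_constant card_lessThan card_atLeastLessThan power_mult_distrib)
  moreover have "(1 - 1 / (2 * real m)) ^ (m - n) \<ge> 1 / 2"
  proof -
   have "1 + real (m - n) * (- 1 / (2 * real m)) \<le> (1 + (- 1 / (2 * real m))) ^ (m - n)"
    using m(4) by (intro Bernoulli_inequality) (simp add: field_simps)
   moreover have "real (m - n) * (1 / (2 * real m)) \<le> real m * (1 / (2 * real m))" by (intro mult_right_mono) auto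
   moreover have "real m * (1 / (2 * real m)) = 1 / 2" using m(4) by simp
   ultimately show ?thesis by simp
  qed
  then have "(\<theta> * r q) ^ n * ((1 / G) ^ (m - n) * (1 / 2)) \<le> (\<theta> * r q) ^ n * ((1 / G) ^ (m - n) * (1 - 1 / (2 * real m)) ^ (m - n))"
   using rq G(1) by (intro mult_left_mono) auto
  ultimately have low: "(\<theta> * r q) ^ n * ((1 / G) ^ (m - n) * (1 / 2)) \<le> measure lebN (K q)" by linarith
  have sr: "stage_ratio n L \<kappa> \<eta> = 1 / (2 * (6 * \<beta> / \<theta>) ^ n)" by (simp add: stage_ratio_def \<beta>_def \<theta>_def)
  have "(6 * R q) ^ n * (1 / G) ^ (m - n) * stage_ratio n L \<kappa> \<eta> = (\<theta> * r q) ^ n * ((1 / G) ^ (m - n) * (1 / 2))"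
  proof -
   have "(6 * R q) ^ n = (6 * \<beta> / \<theta>) ^ n * (\<theta> * r q) ^ n"
    unfolding power_mult_distrib[symmetric] R_def using \<theta>(1) by simp
   moreover have "(6 * \<beta> / \<theta>) ^ n \<noteq> 0" using \<beta> \<theta>(1) by simp
   moreover have "X * Y * Z * (1 / (2 * X)) = Y * (Z * (1 / 2))" if "X \<noteq> 0" for X Y Z :: real
    using that by simp
   ultimately show ?thesis unfolding sr by metis
  qed
  moreover have "measure lebN (K3 q) * stage_ratio n L \<kappa> \<eta> \<le> (6 * R q) ^ n * (1 / G) ^ (m - n) * stage_ratio n L \<kappa> \<eta>"
   using up stage_ratio_pos[OF L0 \<kappa> \<eta>, of n] by (intro mult_right_mono) auto
  ultimately show ?thesis using low by linarith
 qed
 have cov: "Bk k \<inter> cubeT \<subseteq> (\<Union>q\<in>F. K3 q)"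
 proof
  fix t assume "t \<in> Bk k \<inter> cubeT"
  then have t: "t \<in> Bk k" "t \<in> cubeT" by auto
  obtain q where q: "q \<in> F" "conf q t" "R t \<le> 2 * R q" using Fcov[OF t(1)] by blast
  have "t i \<in> A3 q i" if i: "i < m" for i
  proof (cases "i < n")
   case True
   then have "\<bar>q i - t i\<bar> < 3 * R q" using q(2,3) unfolding conf_def by fastforce
   then show ?thesis using True cubeT_D[OF t(2), of i] by (auto simp: A3_def abs_less_iff)
  next
   case False
   then have "c q i = c t i" using q(2) i unfolding conf_def by auto
   then show ?thesis using False c(2,3)[OF t(2), of i] by (simp add: A3_def)
  qed
  then show "t \<in> (\<Union>q\<in>F. K3 q)" using q(1) t(2) by (auto simp: K3_def)
 qed
 \<comment> \<open>The enlarged boxes \<open>K3\<close> cover, the cores are disjoint: summing the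
   ratio transfers the outer measure of \<open>Bk k\<close> to the cores.\<close>
 have "\<tau> \<le> oT (\<Union>q\<in>F. K3 q)" using k oT_mono[OF cov] by simp
 also have "\<dots> \<le> (\<Sum>q\<in>F. oT (K3 q))" by (rule oT_UN_finite[OF F(1)])
 also have "\<dots> = (\<Sum>q\<in>F. measure lebN (K3 q))" using mK3(1) by (intro sum.cong oT_measure) auto
 finally have "stage_ratio n L \<kappa> \<eta> * \<tau> \<le> (\<Sum>q\<in>F. measure lebN (K3 q)) * stage_ratio n L \<kappa> \<eta>"
  using stage_ratio_pos[OF L0 \<kappa> \<eta>, of n] by (subst mult.commute) (intro mult_right_mono, auto)
 also have "\<dots> \<le> (\<Sum>q\<in>F. measure lebN (K q))"
  unfolding sum_distrib_right by (intro sum_mono each)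
 finally have meas: "stage_ratio n L \<kappa> \<eta> * \<tau> \<le> (\<Sum>q\<in>F. measure lebN (K q))" .
 have c0: "F \<subseteq> B" using F(2) by (auto simp: Bk_def Bp_def)
 have c1: "\<forall>q\<in>F. P q (v q) (r q) \<and> 0 < r q \<and> r q < \<epsilon> \<and> \<phi> q \<in> GammaX \<and>
    K q \<in> sets lebN \<and> closed (K q) \<and> K q \<subseteq> S q \<inter> cubeT \<and> S q \<inter> C = {}"
 proof (rule ballI)
  fix q assume q: "q \<in> F"
  have "K q \<subseteq> S q \<inter> cubeT" using KS[OF q] by (auto simp: K_def)
  then show "P q (v q) (r q) \<and> 0 < r q \<and> r q < \<epsilon> \<and> \<phi> q \<in> GammaX \<and>
    K q \<in> sets lebN \<and> closed (K q) \<and> K q \<subseteq> S q \<inter> cubeT \<and> S q \<inter> C = {}"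
   using r[OF FB[OF q]] bp[OF q] mK(1)[OF q] Kclosed[of q] SC[OF q] by blast
 qed
 have c2: "\<forall>q\<in>F. \<forall>s\<in>cubeT. 0 \<le> \<phi> q s \<and> \<phi> q s \<le> 1 \<and> (\<forall>j<n. \<bar>pderiv (\<phi> q) j s\<bar> * r q \<le> \<eta>) \<and>
    (\<forall>j\<ge>m. pderiv (\<phi> q) j s = 0) \<and> (s \<notin> S q \<longrightarrow> \<phi> q s = 0 \<and> (\<forall>j. pderiv (\<phi> q) j s = 0))"
 proof (intro ballI)
  fix q and s :: "nat \<Rightarrow> real" assume q: "q \<in> F" and s: "s \<in> cubeT"
  have dw: "\<bar>pderiv (\<phi> q) j s\<bar> \<le> (if j < m then 4 / w q j else 0)" for j using bp[OF q] s by blast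
  have "\<bar>pderiv (\<phi> q) j s\<bar> * r q \<le> \<eta>" if j: "j < n" for j
  proof -
   have "\<bar>pderiv (\<phi> q) j s\<bar> \<le> 8 / R q" using dw[of j] j m(1) by (simp add: w_def)
   then have "\<bar>pderiv (\<phi> q) j s\<bar> * r q \<le> 8 / R q * r q" using r(1)[OF FB[OF q]] by (intro mult_right_mono) auto
   also have "\<dots> = \<eta>" using r(1)[OF FB[OF q]] \<eta> by (simp add: R_def \<beta>_def)
   finally show "\<bar>pderiv (\<phi> q) j s\<bar> * r q \<le> \<eta>" .
  qed
  moreover have "pderiv (\<phi> q) j s = 0" if "j \<ge> m" for j using dw[of j] that by simp
  moreover have "\<phi> q s = 0 \<and> (\<forall>j. pderiv (\<phi> q) j s = 0)" if "s \<notin> S q"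
  proof -
   have "\<exists>i<m. s i \<le> a q i \<or> b q i \<le> s i" using that by (auto simp: S_def not_less)
   then show ?thesis using bp[OF q] s by blast
  qed
  moreover have "0 \<le> \<phi> q s" "\<phi> q s \<le> 1" using bp[OF q] s by blast+
  ultimately show "0 \<le> \<phi> q s \<and> \<phi> q s \<le> 1 \<and> (\<forall>j<n. \<bar>pderiv (\<phi> q) j s\<bar> * r q \<le> \<eta>) \<and>
    (\<forall>j\<ge>m. pderiv (\<phi> q) j s = 0) \<and> (s \<notin> S q \<longrightarrow> \<phi> q s = 0 \<and> (\<forall>j. pderiv (\<phi> q) j s = 0))"
   by blast
 qed
 have c3: "\<forall>q\<in>F. \<forall>s\<in>K q. \<phi> q s = 1 \<and> norm (g s - g q) \<le> \<kappa> * r q" using K1 Kg by blast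
 have c4: "\<forall>q\<in>F. \<forall>q'\<in>F. q \<noteq> q' \<longrightarrow> S q \<inter> S q' = {}" using Sdisj by blast
 have c5: "\<forall>q\<in>F. \<forall>s\<in>cubeT. \<forall>s'\<in>cubeT. (\<forall>i<m. s i = s' i) \<longrightarrow>
    norm (g s - g s') \<le> \<kappa> * r q \<and> (s \<in> K q \<longrightarrow> s' \<in> K q) \<and> \<phi> q s = \<phi> q s'"
 proof (intro ballI impI)
  fix q s s' assume q: "q \<in> F" and s: "s \<in> cubeT" and s': "s' \<in> cubeT" and eq: "\<forall>i<m. s i = s' i"
  have "norm (g s - g s') \<le> \<kappa> * r0 / 2" using eq G(1) by (intro near[OF s s']) auto
  moreover have "\<kappa> * r0 \<le> \<kappa> * r q" "0 \<le> \<kappa> * r0" using r(2)[OF FB[OF q]] \<kappa> r0 by (auto intro!: mult_left_mono)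
  ultimately have "norm (g s - g s') \<le> \<kappa> * r q" by linarith
  moreover have "s \<in> K q \<longrightarrow> s' \<in> K q" using eq s' by (auto simp: K_def)
  moreover have "\<phi> q s = \<phi> q s'" unfolding \<phi>_def using eq by (intro bump_cong[OF s s']) auto
  ultimately show "norm (g s - g s') \<le> \<kappa> * r q \<and> (s \<in> K q \<longrightarrow> s' \<in> K q) \<and> \<phi> q s = \<phi> q s'" by blast
 qed
 show ?thesis
  unfolding stage_data_def
  by (rule exI[of _ F], rule exI[of _ v], rule exI[of _ r], rule exI[of _ \<phi>], rule exI[of _ K], rule exI[of _ S], rule exI[of _ m])
   (intro conjI F(1) c0 c1 c2 c3 c4 meas c5)
qed


section \<open>Tails and bounded accumulation of bumps\<close>

text \<open>The bound by \<open>norm x\<close> replaces continuity, and the norm is recovered as the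
  least common bound; smallness of a perturbation may thus be checked functional by
  functional.\<close>

definition norming :: "('x::real_normed_vector \<Rightarrow> real) set \<Rightarrow> bool" where
 "norming \<Phi> \<longleftrightarrow> (\<forall>\<phi>\<in>\<Phi>. linear \<phi>) \<and> (\<forall>\<phi>\<in>\<Phi>. \<forall>x. \<bar>\<phi> x\<bar> \<le> norm x) \<and>
  (\<forall>x M. 0 \<le> M \<longrightarrow> (\<forall>\<phi>\<in>\<Phi>. \<bar>\<phi> x\<bar> \<le> M) \<longrightarrow> norm x \<le> M)"

definition directed :: "'a set set \<Rightarrow> bool" where
 "directed \<S> \<longleftrightarrow> \<S> \<noteq> {} \<and> (\<forall>S\<in>\<S>. \<forall>S'\<in>\<S>. \<exists>S''\<in>\<S>. S \<union> S' \<subseteq> S'')"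

text \<open>\<open>\<S>\<close> plays the part of the bounded subsets of \<open>\<Phi>\<close>: the
  last clause says that \<open>v\<close> vanishes at infinity of \<open>\<Phi>\<close>, as finite
  sets of coordinates express it in c_0.\<close>

definition Tail :: "('x::real_normed_vector \<Rightarrow> real) set \<Rightarrow> ('x \<Rightarrow> real) set set \<Rightarrow> ('x \<Rightarrow> real) set \<Rightarrow> real \<Rightarrow> real \<Rightarrow> 'x set" where
 "Tail \<Phi> \<S> S \<theta> M = {v. norm v \<le> M \<and> (\<forall>\<phi>\<in>S. \<bar>\<phi> v\<bar> \<le> \<theta>) \<and> (\<forall>e>0. \<exists>S'\<in>\<S>. \<forall>\<phi>\<in>\<Phi> - S'. \<bar>\<phi> v\<bar> \<le> e)}"

text \<open>Since \<open>\<S>\<close> is directed, finitely many vectors vanish at infinity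
  simultaneously; on the enlarged set the directions of the next stage will have to be
  small.\<close>

lemma Tail_absorb:
 assumes "directed \<S>" "S \<in> \<S>" "finite F" "\<And>q. q \<in> F \<Longrightarrow> v q \<in> Tail \<Phi> \<S> S \<theta> M" "\<theta>' > 0"
 shows "\<exists>S'\<in>\<S>. S \<subseteq> S' \<and> (\<forall>q\<in>F. \<forall>\<phi>\<in>\<Phi> - S'. \<bar>\<phi> (v q)\<bar> \<le> \<theta>')"
 using assms(3,4)
proof (induction F rule: finite_induct)
 case empty
 then show ?case using assms(2) by blast
next
 case (insert q F)
 then obtain S1 where S1: "S1 \<in> \<S>" "S \<subseteq> S1" "\<forall>q\<in>F. \<forall>\<phi>\<in>\<Phi> - S1. \<bar>\<phi> (v q)\<bar> \<le> \<theta>'" by auto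
 have "v q \<in> Tail \<Phi> \<S> S \<theta> M" using insert by simp
 then obtain S2 where S2: "S2 \<in> \<S>" "\<forall>\<phi>\<in>\<Phi> - S2. \<bar>\<phi> (v q)\<bar> \<le> \<theta>'" using assms(5) unfolding Tail_def by blast
 obtain S' where S': "S' \<in> \<S>" "S1 \<union> S2 \<subseteq> S'" using assms(1) S1(1) S2(1) unfolding directed_def by blast
 have "\<bar>\<phi> (v q')\<bar> \<le> \<theta>'" if "q' \<in> insert q F" "\<phi> \<in> \<Phi> - S'" for q' \<phi>
 proof (cases "q' = q")
  case True then show ?thesis using S2(2) S'(2) that(2) by blast
 next
  case False then show ?thesis using S1(3) S'(2) that by blast
 qed
 moreover have "S \<subseteq> S'" using S1(2) S'(2) by blast
 ultimately show ?case by (intro bexI[OF _ S'(1)] conjI ballI)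
qed

text \<open>Two-level bookkeeping: \<open>a\<close> is the error accumulated on every functional,
  \<open>H\<close> the single full-strength contribution, granted only to functionals already
  absorbed into \<open>S\<close>.\<close>

definition controlled :: "('x::real_normed_vector \<Rightarrow> real) set \<Rightarrow> nat \<Rightarrow> ('x \<Rightarrow> real) set \<Rightarrow> real \<Rightarrow> real
  \<Rightarrow> ((nat \<Rightarrow> real) \<Rightarrow> 'x) \<Rightarrow> ((nat \<Rightarrow> real) \<Rightarrow> 'x) \<Rightarrow> bool" where
 "controlled \<Phi> n S a H g0 g \<longleftrightarrow> (\<forall>t\<in>cubeT. \<forall>\<phi>\<in>\<Phi>.
   \<bar>\<phi> (g t - g0 t)\<bar> \<le> a + (if \<phi> \<in> S then H else 0) \<and>
   (\<forall>j<n. \<bar>\<phi> (pderiv g j t - pderiv g0 j t)\<bar> \<le> a + (if \<phi> \<in> S then H else 0)))"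

lemma controlled_refl: "norming \<Phi> \<Longrightarrow> 0 \<le> H \<Longrightarrow> controlled \<Phi> n S 0 H g g"
 unfolding controlled_def norming_def by (auto simp: linear_0)

lemma controlled_close:
 assumes "norming \<Phi>" "controlled \<Phi> n S a H g0 g" "0 \<le> H" "0 \<le> a"
 shows "close n (a + H) g0 g"
proof -
 have *: "norm x \<le> a + H" if "\<And>\<phi>. \<phi> \<in> \<Phi> \<Longrightarrow> \<bar>\<phi> x\<bar> \<le> a + (if \<phi> \<in> S then H else 0)" for x
 proof -
  have "\<bar>\<phi> x\<bar> \<le> a + H" if "\<phi> \<in> \<Phi>" for \<phi>
   using that \<open>\<And>\<phi>. \<phi> \<in> \<Phi> \<Longrightarrow> \<bar>\<phi> x\<bar> \<le> a + (if \<phi> \<in> S then H else 0)\<close>[of \<phi>] assms(3) by (auto split: if_splits)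
  then show ?thesis using assms(1,3,4) unfolding norming_def by (meson add_nonneg_nonneg)
 qed
 show ?thesis
  unfolding close_def using assms(2) unfolding controlled_def by (intro ballI conjI allI impI *) blast+
qed

lemma controlled_adjust:
 assumes \<Phi>: "norming \<Phi>" and c: "controlled \<Phi> n S a H g0 g" "close n e g h"
 shows "controlled \<Phi> n S (a + e) H g0 h"
proof -
 have *: "\<bar>\<phi> (z - x)\<bar> \<le> a + e + (if \<phi> \<in> S then H else 0)"
  if "\<phi> \<in> \<Phi>" "\<bar>\<phi> (y - x)\<bar> \<le> a + (if \<phi> \<in> S then H else 0)" "norm (z - y) \<le> e" for x y z and \<phi> :: "'a \<Rightarrow> real"
 proof -
  have lin: "linear \<phi>" and le: "\<bar>\<phi> (z - y)\<bar> \<le> norm (z - y)" using \<Phi> that(1) unfolding norming_def by auto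
  have "\<phi> (z - x) = \<phi> (y - x) + \<phi> (z - y)" by (simp add: linear_diff[OF lin])
  then show ?thesis using that(2,3) le by linarith
 qed
 show ?thesis
  unfolding controlled_def
 proof (intro ballI conjI allI impI)
  fix t :: "nat \<Rightarrow> real" and \<phi> assume t: "t \<in> cubeT" and \<phi>: "\<phi> \<in> \<Phi>"
  show "\<bar>\<phi> (h t - g0 t)\<bar> \<le> a + e + (if \<phi> \<in> S then H else 0)"
   by (rule *[OF \<phi>, of "g t"]) (use c t \<phi> in \<open>auto simp: controlled_def close_def\<close>)
  fix j assume j: "j < n"
  show "\<bar>\<phi> (pderiv h j t - pderiv g0 j t)\<bar> \<le> a + e + (if \<phi> \<in> S then H else 0)"
   by (rule *[OF \<phi>, of "pderiv g j t"]) (use c t \<phi> j in \<open>auto simp: controlled_def close_def\<close>)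
 qed
qed

lemma abs_sum_disjoint_le:
 fixes x :: "'q \<Rightarrow> real"
 assumes "finite F" "\<And>q q'. q \<in> F \<Longrightarrow> q' \<in> F \<Longrightarrow> q \<noteq> q' \<Longrightarrow> x q = 0 \<or> x q' = 0"
  "\<And>q. q \<in> F \<Longrightarrow> \<bar>x q\<bar> \<le> c" "0 \<le> c"
 shows "\<bar>sum x F\<bar> \<le> c"
proof (cases "\<exists>q\<in>F. x q \<noteq> 0")
 case True
 then obtain q where q: "q \<in> F" "x q \<noteq> 0" by blast
 have "sum x F = x q + sum x (F - {q})" by (rule sum.remove[OF assms(1) q(1)])
 also have "sum x (F - {q}) = 0" using assms(2)[OF q(1)] q(2) by (intro sum.neutral) auto
 finally show ?thesis using assms(3)[OF q(1)] by simp
qed (use assms in simp)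

lemma GammaX_add_sum:
 fixes v :: "'q \<Rightarrow> 'x::real_normed_vector"
 assumes "finite F" "\<And>q. q \<in> F \<Longrightarrow> \<psi> q \<in> GammaX" "g \<in> GammaX"
 shows "(\<lambda>t. g t + (\<Sum>q\<in>F. \<psi> q t *\<^sub>R v q)) \<in> GammaX"
  "t \<in> cubeT \<Longrightarrow> pderiv (\<lambda>t. g t + (\<Sum>q\<in>F. \<psi> q t *\<^sub>R v q)) j t = pderiv g j t + (\<Sum>q\<in>F. pderiv (\<psi> q) j t *\<^sub>R v q)"
proof -
 have 1: "(\<lambda>t. \<psi> q t *\<^sub>R v q) \<in> GammaX" if "q \<in> F" for q
  by (rule GammaX_scaleR_const(1)[OF assms(2)[OF that]])
 note S = GammaX_sum[of F "\<lambda>q t. \<psi> q t *\<^sub>R v q", OF assms(1) 1]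
 show "(\<lambda>t. g t + (\<Sum>q\<in>F. \<psi> q t *\<^sub>R v q)) \<in> GammaX"
  by (rule GammaX_add(1)[OF assms(3) S[THEN conjunct1]])
 assume t: "t \<in> cubeT"
 have "pderiv (\<lambda>t. g t + (\<Sum>q\<in>F. \<psi> q t *\<^sub>R v q)) j t = pderiv g j t + pderiv (\<lambda>t. \<Sum>q\<in>F. \<psi> q t *\<^sub>R v q) j t"
  by (rule GammaX_add(2)[OF assms(3) S[THEN conjunct1] t])
 also have "pderiv (\<lambda>t. \<Sum>q\<in>F. \<psi> q t *\<^sub>R v q) j t = (\<Sum>q\<in>F. pderiv (\<lambda>t. \<psi> q t *\<^sub>R v q) j t)"
  using S[THEN conjunct2] t by blast
 also have "\<dots> = (\<Sum>q\<in>F. pderiv (\<psi> q) j t *\<^sub>R v q)"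
  by (intro sum.cong refl GammaX_scaleR_const(2)[OF assms(2) t])
 finally show "pderiv (\<lambda>t. g t + (\<Sum>q\<in>F. \<psi> q t *\<^sub>R v q)) j t = pderiv g j t + (\<Sum>q\<in>F. pderiv (\<psi> q) j t *\<^sub>R v q)" .
qed

text \<open>A functional sees at most one family of bumps with full strength: before that family it belongs to no
 \<open>S\<close> and the earlier directions are small on it; afterwards it belongs to \<open>S\<close> and the later ones are small on it.\<close>

lemma controlled_bumps:
 fixes v :: "'q \<Rightarrow> 'x::real_normed_vector"
 assumes \<Phi>: "norming \<Phi>" and c: "controlled \<Phi> n S a H g0 g" and g: "g \<in> GammaX"
  and F: "finite F" and \<psi>: "\<And>q. q \<in> F \<Longrightarrow> \<psi> q \<in> GammaX"
  and disj: "\<And>q q' t. q \<in> F \<Longrightarrow> q' \<in> F \<Longrightarrow> q \<noteq> q' \<Longrightarrow> t \<in> cubeT \<Longrightarrow>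
   (\<psi> q t = 0 \<and> (\<forall>j. pderiv (\<psi> q) j t = 0)) \<or> (\<psi> q' t = 0 \<and> (\<forall>j. pderiv (\<psi> q') j t = 0))"
  and bd: "\<And>q t. q \<in> F \<Longrightarrow> t \<in> cubeT \<Longrightarrow> \<bar>\<psi> q t\<bar> * r q \<le> \<eta>"
   "\<And>q t j. q \<in> F \<Longrightarrow> t \<in> cubeT \<Longrightarrow> j < n \<Longrightarrow> \<bar>pderiv (\<psi> q) j t\<bar> * r q \<le> \<eta>"
  and v: "\<And>q. q \<in> F \<Longrightarrow> v q \<in> Tail \<Phi> \<S> S \<theta> M" and r: "\<And>q. q \<in> F \<Longrightarrow> 0 \<le> r q"
  and S': "S \<subseteq> S'" "\<And>q \<phi>. q \<in> F \<Longrightarrow> \<phi> \<in> \<Phi> - S' \<Longrightarrow> \<bar>\<phi> (v q)\<bar> \<le> \<theta>"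
  and H: "\<eta> * M \<le> H" "0 \<le> \<theta>" "0 \<le> \<eta>" "0 \<le> M"
 shows "controlled \<Phi> n S' (a + \<eta> * \<theta>) H g0 (\<lambda>t. g t + (\<Sum>q\<in>F. \<psi> q t *\<^sub>R (r q *\<^sub>R v q)))"
proof -
 have *: "\<bar>\<phi> (y + (\<Sum>q\<in>F. b q *\<^sub>R (r q *\<^sub>R v q)) - x)\<bar> \<le> a + \<eta> * \<theta> + (if \<phi> \<in> S' then H else 0)"
  if \<phi>: "\<phi> \<in> \<Phi>" and y: "\<bar>\<phi> (y - x)\<bar> \<le> a + (if \<phi> \<in> S then H else 0)"
   and b: "\<And>q q'. q \<in> F \<Longrightarrow> q' \<in> F \<Longrightarrow> q \<noteq> q' \<Longrightarrow> b q = 0 \<or> b q' = 0" "\<And>q. q \<in> F \<Longrightarrow> \<bar>b q\<bar> * r q \<le> \<eta>"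
  for \<phi> :: "'x \<Rightarrow> real" and x y b
 proof -
  have lin: "linear \<phi>" and le: "\<And>x. \<bar>\<phi> x\<bar> \<le> norm x" using \<Phi> \<phi> unfolding norming_def by auto
  have eq: "\<phi> (y + (\<Sum>q\<in>F. b q *\<^sub>R (r q *\<^sub>R v q)) - x) = \<phi> (y - x) + (\<Sum>q\<in>F. b q * r q * \<phi> (v q))"
   by (simp add: linear_diff[OF lin] linear_add[OF lin] linear_sum[OF lin] linear_cmul[OF lin] mult.assoc)
  have sum: "\<bar>\<Sum>q\<in>F. b q * r q * \<phi> (v q)\<bar> \<le> \<eta> * K" if K: "\<And>q. q \<in> F \<Longrightarrow> \<bar>\<phi> (v q)\<bar> \<le> K" "0 \<le> K" for K
  proof (rule abs_sum_disjoint_le[OF F])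
   fix q assume q: "q \<in> F"
   have "\<bar>b q * r q * \<phi> (v q)\<bar> = (\<bar>b q\<bar> * r q) * \<bar>\<phi> (v q)\<bar>" using r[OF q] by (simp add: abs_mult)
   also have "\<dots> \<le> \<eta> * K" using b(2)[OF q] K(1)[OF q] H(3) by (intro mult_mono) auto
   finally show "\<bar>b q * r q * \<phi> (v q)\<bar> \<le> \<eta> * K" .
  qed (use b(1) H(3) K(2) in auto)
  consider "\<phi> \<in> S" | "\<phi> \<notin> S" "\<phi> \<in> S'" | "\<phi> \<notin> S'" "\<phi> \<notin> S" using S'(1) by blast
  then show ?thesis
  proof cases
   case 1
   then have "\<bar>\<Sum>q\<in>F. b q * r q * \<phi> (v q)\<bar> \<le> \<eta> * \<theta>" using v H(2) by (intro sum) (auto simp: Tail_def)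
   then show ?thesis using 1 y S'(1) unfolding eq by (auto simp: subset_iff)
  next
   case 2
   have "\<bar>\<Sum>q\<in>F. b q * r q * \<phi> (v q)\<bar> \<le> \<eta> * M"
   proof (rule sum)
    fix q assume "q \<in> F"
    then have "norm (v q) \<le> M" using v unfolding Tail_def by blast
    then show "\<bar>\<phi> (v q)\<bar> \<le> M" using le[of "v q"] by simp
   qed (rule H(4))
   moreover have "0 \<le> \<eta> * \<theta>" using H by simp
   ultimately show ?thesis using 2 y H(1) unfolding eq by auto
  next
   case 3
   then have "\<bar>\<Sum>q\<in>F. b q * r q * \<phi> (v q)\<bar> \<le> \<eta> * \<theta>" using S'(2) \<phi> H(2) by (intro sum) auto
   then show ?thesis using 3 y unfolding eq by auto
  qed
 qed
 show ?thesis
  unfolding controlled_def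
 proof (intro ballI conjI allI impI)
  fix t :: "nat \<Rightarrow> real" and \<phi> assume t: "t \<in> cubeT" and \<phi>: "\<phi> \<in> \<Phi>"
  show "\<bar>\<phi> (g t + (\<Sum>q\<in>F. \<psi> q t *\<^sub>R (r q *\<^sub>R v q)) - g0 t)\<bar> \<le> a + \<eta> * \<theta> + (if \<phi> \<in> S' then H else 0)"
   by (rule *[OF \<phi>]) (use c t \<phi> disj bd(1) in \<open>auto simp: controlled_def; blast\<close>)+
  fix j assume j: "j < n"
  show "\<bar>\<phi> (pderiv (\<lambda>t. g t + (\<Sum>q\<in>F. \<psi> q t *\<^sub>R (r q *\<^sub>R v q))) j t - pderiv g0 j t)\<bar> \<le> a + \<eta> * \<theta> + (if \<phi> \<in> S' then H else 0)"
  proof -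
   have d: "pderiv (\<lambda>t. g t + (\<Sum>q\<in>F. \<psi> q t *\<^sub>R (r q *\<^sub>R v q))) j t = pderiv g j t + (\<Sum>q\<in>F. pderiv (\<psi> q) j t *\<^sub>R (r q *\<^sub>R v q))"
    by (rule GammaX_add_sum(2)[OF F \<psi> g t])
   show ?thesis unfolding d
  proof (rule *[OF \<phi>])
   show "\<bar>\<phi> (pderiv g j t - pderiv g0 j t)\<bar> \<le> a + (if \<phi> \<in> S then H else 0)"
    using c t \<phi> j by (auto simp: controlled_def)
   show "pderiv (\<psi> q) j t = 0 \<or> pderiv (\<psi> q') j t = 0" if "q \<in> F" "q' \<in> F" "q \<noteq> q'" for q q'
    using disj[OF that t] by blast
   show "\<bar>pderiv (\<psi> q) j t\<bar> * r q \<le> \<eta>" if "q \<in> F" for q using bd(2)[OF that t j] .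
  qed
  qed
 qed
qed

text \<open>A slope bound valid for a whole neighbourhood of \<open>g0\<close>, so that all stages
  of an iteration have the same \<open>stage_ratio\<close>.\<close>

lemma pderiv_uniform_bound:
 assumes "g0 \<in> GammaX" "e \<ge> 0"
 shows "\<exists>L\<ge>0. \<forall>g. close n e g0 g \<longrightarrow> (\<forall>t\<in>cubeT. \<forall>j<n. norm (pderiv g j t) \<le> L)"
proof (intro exI conjI allI impI ballI)
 have d: "0 \<le> der_sn j g0" for j using sup_sn_bound(2)[OF assms(1) zero_in_cubeT, of j] norm_ge_zero order_trans by blast
 show "0 \<le> (\<Sum>j<n. der_sn j g0) + e" using d assms(2) by (simp add: sum_nonneg)
 fix g :: "(nat \<Rightarrow> real) \<Rightarrow> 'a" and t :: "nat \<Rightarrow> real" and j assume cl: "close n e g0 g" and t: "t \<in> cubeT" and j: "j < n"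
 have "norm (pderiv g j t) \<le> norm (pderiv g0 j t) + norm (pderiv g j t - pderiv g0 j t)"
  using norm_triangle_ineq[of "pderiv g0 j t" "pderiv g j t - pderiv g0 j t"] by simp
 also have "norm (pderiv g0 j t) \<le> der_sn j g0" by (rule sup_sn_bound(2)[OF assms(1) t])
 also have "der_sn j g0 \<le> (\<Sum>j<n. der_sn j g0)" using d j by (intro member_le_sum) auto
 also have "norm (pderiv g j t - pderiv g0 j t) \<le> e" using cl t j by (simp add: close_def)
 finally show "norm (pderiv g j t) \<le> (\<Sum>j<n. der_sn j g0) + e" by simp
qed

lemma compact_closed_gap:
 fixes S T :: "'a::metric_space set"
 assumes "compact S" "closed T" "S \<inter> T = {}"
 shows "\<exists>d>0. \<forall>x\<in>S. \<forall>y\<in>T. d \<le> dist x y"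
proof (cases "S = {} \<or> T = {}")
 case False
 moreover have "continuous_on S (\<lambda>x. infdist x T)" by (intro continuous_intros)
 ultimately have "\<exists>x0\<in>S. \<forall>x\<in>S. infdist x0 T \<le> infdist x T"
  using continuous_attains_inf[OF assms(1)] by blast
 then obtain x0 where x0: "x0 \<in> S" "\<forall>x\<in>S. infdist x0 T \<le> infdist x T" by blast
 have "infdist x0 T \<noteq> 0" using x0(1) assms(2,3) False in_closed_iff_infdist_zero[of T x0] by auto
 then have "infdist x0 T > 0" using infdist_nonneg[of x0 T] by simp
 moreover have "infdist x0 T \<le> dist x y" if "x \<in> S" "y \<in> T" for x y
  using x0(2) that infdist_le[OF that(2), of x] by force
 ultimately show ?thesis by blast
qed (auto intro: zero_less_one)

text \<open>Each stage moves the surface, on a new set of measure at least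
  \<open>\<rho> * \<tau>\<close>, into holes of \<open>E\<close>, and the parts treated before stay
  off the closure of \<open>E\<close>. As \<open>W\<close> supplies surfaces meeting
  \<open>E\<close> in outer measure above \<open>\<tau>\<close> at every stage, the treated set
  would exceed measure 1 after \<open>I\<close> stages.\<close>

theorem porous_null_tail:
 fixes Q :: "'x::banach set"
 assumes \<Phi>: "norming \<Phi>" and \<S>: "directed \<S>" and M: "0 \<le> M"
  and Q: "\<And>S \<theta>. S \<in> \<S> \<Longrightarrow> \<theta> > 0 \<Longrightarrow> \<exists>Q'. porous_null Q' \<and> (\<forall>u\<in>Q. \<exists>z\<in>Q'. u - z \<in> Tail \<Phi> \<S> S \<theta> M)"
 shows "porous_null Q"
 unfolding porous_null_def
proof (intro allI impI, rule ccontr)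
 fix c :: real and E :: "'x set" assume c: "c > 0" and E: "\<forall>x\<in>E. porous c Q E x" and "\<not> Gnull E"
 from not_Gnull_imp[OF this(3)] obtain \<tau> W where \<tau>: "\<tau> > 0" and W: "gamma_open W" "W \<noteq> {}"
  and nm: "\<And>W' G. gamma_open W' \<Longrightarrow> W' \<noteq> {} \<Longrightarrow> W' \<subseteq> W \<Longrightarrow> gamma_residual G \<Longrightarrow> \<exists>g\<in>W' \<inter> G. om g E > \<tau>"
  by blast
 obtain g0 where g0: "g0 \<in> W" using W(2) by blast
 then have g0G: "g0 \<in> GammaX" using W(1) by (auto simp: gamma_open_def)
 obtain n e0 where e0: "e0 > 0" and inW: "\<And>h. h \<in> GammaX \<Longrightarrow> close n e0 g0 h \<Longrightarrow> h \<in> W"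
  using W(1) g0 unfolding gamma_open_iff by metis
 obtain L where L: "L \<ge> 0" "\<And>g t j. close n e0 g0 g \<Longrightarrow> t \<in> cubeT \<Longrightarrow> j < n \<Longrightarrow> norm (pderiv g j t) \<le> L"
  using pderiv_uniform_bound[OF g0G less_imp_le[OF e0], of n] by blast
 define H where "H = e0 / 4"
 define \<eta> where "\<eta> = H / (M + 1)"
 \<comment> \<open>A point within \<open>\<kappa> * r\<close> of the centre of a hole stays inside
   it, as the radius after \<open>porous_decompose\<close> is \<open>c / 2 * r\<close>.\<close>
 define \<kappa> where "\<kappa> = c / 4"
 have H: "H > 0" using e0 by (simp add: H_def)
 have \<eta>: "\<eta> > 0" "\<eta> * M \<le> H" using H M by (auto simp: \<eta>_def field_simps)
 have \<kappa>: "\<kappa> > 0" using c by (simp add: \<kappa>_def)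
 define \<rho> where "\<rho> = stage_ratio n L \<kappa> \<eta>"
 have \<rho>: "\<rho> > 0" unfolding \<rho>_def by (rule stage_ratio_pos[OF L(1) \<kappa> \<eta>(1)])
 obtain I :: nat where I: "1 < real I * (\<rho> * \<tau>)" using reals_Archimedean3[of "\<rho> * \<tau>"] \<rho> \<tau> by auto
 then have I0: "real I > 0" using \<rho> \<tau> by (cases I) auto
 \<comment> \<open>The budget \<open>H\<close> for errors is shared by \<open>I\<close> stages; in
   each, half pays for the passage to a generic surface and half for
   \<open>\<eta> * \<theta>\<close>.\<close>
 define \<delta> where "\<delta> = H / real I"
 have \<delta>: "\<delta> > 0" using H I0 by (simp add: \<delta>_def)
 define \<theta> where "\<theta> = \<delta> / (2 * \<eta>)"
 have \<theta>: "\<theta> > 0" "\<eta> * \<theta> = \<delta> / 2" using \<delta> \<eta> by (auto simp: \<theta>_def)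
 have "\<exists>g S C. g \<in> GammaX \<and> S \<in> \<S> \<and> controlled \<Phi> n S (real i * \<delta>) H g0 g \<and> compact C \<and> C \<subseteq> cubeT \<and>
   g ` C \<inter> closure E = {} \<and> real i * (\<rho> * \<tau>) \<le> measure lebN C" if "i \<le> I" for i
  using that
 proof (induction i)
  case 0
  obtain S where "S \<in> \<S>" using \<S> unfolding directed_def by blast
  then show ?case
   using g0G controlled_refl[OF \<Phi> less_imp_le[OF H], of n S g0] by (intro exI[of _ g0] exI[of _ S] exI[of _ "{}"]) auto
 next
  case (Suc i)
  then obtain g S C where g: "g \<in> GammaX" and S: "S \<in> \<S>" and con: "controlled \<Phi> n S (real i * \<delta>) H g0 g"
   and C: "compact C" "C \<subseteq> cubeT" "g ` C \<inter> closure E = {}" "real i * (\<rho> * \<tau>) \<le> measure lebN C"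
   by auto
  have i\<delta>: "real i * \<delta> + \<delta> \<le> H"
  proof -
   have "(real i + 1) * \<delta> \<le> real I * \<delta>" using Suc.prems \<delta> by (intro mult_right_mono) auto
   then show ?thesis using I0 by (simp add: \<delta>_def field_simps)
  qed
  \<comment> \<open>The compact image of the treated part has a positive distance to the closure of
    \<open>E\<close>; a generic surface nearer than that preserves the gain.\<close>
  obtain d where d: "d > 0" "\<And>x y. x \<in> g ` C \<Longrightarrow> y \<in> closure E \<Longrightarrow> d \<le> dist x y"
   using compact_closed_gap[OF compact_continuous_image[OF continuous_on_subset[OF GammaX_D(1)[OF g] C(2)] C(1)] closed_closure C(3)]
   by blast
  define \<delta>' where "\<delta>' = min (\<delta> / 2) d"
  have \<delta>': "\<delta>' > 0" "\<delta>' \<le> \<delta> / 2" "\<delta>' \<le> d" using \<delta> d by (auto simp: \<delta>'_def)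
  have cl0: "close n (real i * \<delta> + H) g0 g"
   using controlled_close[OF \<Phi> con] H \<delta> by simp
  have clh: "close n e0 g0 h" if h: "h \<in> gball g n \<delta>'" for h
  proof -
   obtain e' where e': "e' < \<delta>'" "close n e' g h" using h by (auto simp: gball_def)
   then have "close n (real i * \<delta> + H + e') g0 h" using close_trans[OF cl0] by blast
   then show ?thesis using e'(1) \<delta>' i\<delta> \<delta> e0 by (elim close_mono) (auto simp: H_def)
  qed
  then have sub: "gball g n \<delta>' \<subseteq> W" using inW by (auto simp: gball_def)
  obtain Q' where Q': "porous_null Q'" "\<And>u. u \<in> Q \<Longrightarrow> \<exists>z\<in>Q'. u - z \<in> Tail \<Phi> \<S> S \<theta> M"
   using Q[OF S \<theta>(1)] by blast
  define T where "T = Tail \<Phi> \<S> S \<theta> M"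
  define N where "N = {x\<in>E. \<not> porous (c/2) T E x}"
  have "Gnull N" unfolding N_def T_def by (rule porous_decompose[OF Q'(1) c _ Q'(2)]) (use E in blast)
  from Gnull_diff_residual[OF nm this gamma_open_gball _ sub gamma_residual_UNIV] center_gball[OF g \<delta>'(1)]
  obtain g' where g': "g' \<in> gball g n \<delta>'" "om g' (E - N) > \<tau>" by blast
  have g'G: "g' \<in> GammaX" using g' by (auto simp: gball_def)
  obtain e' where e': "e' < \<delta>'" "close n e' g g'" using g'(1) by (auto simp: gball_def)
  have con': "controlled \<Phi> n S (real i * \<delta> + \<delta> / 2) H g0 g'"
   using controlled_adjust[OF \<Phi> con close_mono[OF e'(2) order_refl]] e'(1) \<delta>'(2) by simp
  have C': "g' ` C \<inter> closure E = {}"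
  proof (rule ccontr)
   assume "\<not> ?thesis"
   then obtain t where t: "t \<in> C" "g' t \<in> closure E" by blast
   have "dist (g t) (g' t) \<le> e'" using e'(2) t(1) C(2) by (auto simp: close_def dist_norm norm_minus_commute)
   then show False using d(2)[of "g t" "g' t"] t e'(1) \<delta>'(3) by auto
  qed
  define B where "B = g' -` (E - N) \<inter> cubeT"
  have B: "B \<subseteq> cubeT" "\<tau> < oT B" using g'(2) oT_mono[of "g' -` (E - N)" B] by (auto simp: B_def)
  have BC: "B \<inter> C = {}" using C' closure_subset[of E] by (auto simp: B_def)
  have P: "\<exists>r v. 0 < r \<and> r < d \<and> (v \<in> T \<and> ball (g' t + r *\<^sub>R v) (c/2 * r) \<inter> E = {})" if "t \<in> B" "d > 0" for t d
   using that unfolding B_def N_def porous_def by blast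
  have Lg: "norm (pderiv g' j t) \<le> L" if "t \<in> cubeT" "j < n" for t j by (rule L(2)[OF clh[OF g'(1)] that])
  have "\<exists>F v r \<phi> K Sp m. stage_data g' n B C (\<lambda>t v r. v \<in> T \<and> ball (g' t + r *\<^sub>R v) (c/2 * r) \<inter> E = {}) \<kappa> \<eta> \<eta> (\<rho> * \<tau>) F v r \<phi> K Sp m"
   unfolding \<rho>_def
   by (rule stage[OF g'G Lg L(1) B compact_imp_closed[OF C(1)] BC P \<kappa> \<eta>(1) \<eta>(1)])
  then obtain F v r \<phi> K Sp m where "stage_data g' n B C (\<lambda>t v r. v \<in> T \<and> ball (g' t + r *\<^sub>R v) (c/2 * r) \<inter> E = {}) \<kappa> \<eta> \<eta> (\<rho> * \<tau>) F v r \<phi> K Sp m"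
   by blast
  note sd = stage_dataD[OF this]
  have F: "finite F" "F \<subseteq> B" by (rule sd(1), rule sd(2))
  have F1: "\<forall>q\<in>F. (v q \<in> T \<and> ball (g' q + r q *\<^sub>R v q) (c/2 * r q) \<inter> E = {}) \<and> 0 < r q \<and> r q < \<eta> \<and> \<phi> q \<in> GammaX \<and>
    K q \<in> sets lebN \<and> closed (K q) \<and> K q \<subseteq> Sp q \<inter> cubeT \<and> Sp q \<inter> C = {}"
   using sd(4-12) by blast
  have F2: "\<forall>q\<in>F. \<forall>s\<in>cubeT. 0 \<le> \<phi> q s \<and> \<phi> q s \<le> 1 \<and> (\<forall>j<n. \<bar>pderiv (\<phi> q) j s\<bar> * r q \<le> \<eta>) \<and>
    (\<forall>j\<ge>m. pderiv (\<phi> q) j s = 0) \<and> (s \<notin> Sp q \<longrightarrow> \<phi> q s = 0 \<and> (\<forall>j. pderiv (\<phi> q) j s = 0))"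
   using sd(13-17) by blast
  have F3: "\<forall>q\<in>F. \<forall>s\<in>K q. \<phi> q s = 1 \<and> norm (g' s - g' q) \<le> \<kappa> * r q" using sd(18,19) by blast
  have F4: "\<forall>q\<in>F. \<forall>q'\<in>F. q \<noteq> q' \<longrightarrow> Sp q \<inter> Sp q' = {}" using sd(20) by blast
  note F5 = sd(3)
  define h where "h = (\<lambda>t. g' t + (\<Sum>q\<in>F. \<phi> q t *\<^sub>R (r q *\<^sub>R v q)))"
  obtain S' where S': "S' \<in> \<S>" "S \<subseteq> S'" "\<And>q \<phi>. q \<in> F \<Longrightarrow> \<phi> \<in> \<Phi> - S' \<Longrightarrow> \<bar>\<phi> (v q)\<bar> \<le> \<theta>"
   using Tail_absorb[OF \<S> S F(1), of v \<Phi> \<theta> M \<theta>] F1 \<theta>(1) unfolding T_def by blast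
  have hG: "h \<in> GammaX" unfolding h_def by (rule GammaX_add_sum(1)[OF F(1) _ g'G]) (use F1 in blast)
  have zero: "\<phi> q s = 0 \<and> (\<forall>j. pderiv (\<phi> q) j s = 0)" if "q \<in> F" "s \<in> cubeT" "s \<notin> Sp q" for q s
   using F2 that by blast
  have "controlled \<Phi> n S' (real i * \<delta> + \<delta> / 2 + \<eta> * \<theta>) H g0 h"
   unfolding h_def
  proof (rule controlled_bumps[OF \<Phi> con' g'G F(1)])
   show "\<phi> q \<in> GammaX" if "q \<in> F" for q using F1 that by blast
   show "(\<phi> q t = 0 \<and> (\<forall>j. pderiv (\<phi> q) j t = 0)) \<or> (\<phi> q' t = 0 \<and> (\<forall>j. pderiv (\<phi> q') j t = 0))"
    if "q \<in> F" "q' \<in> F" "q \<noteq> q'" "t \<in> cubeT" for q q' t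
    using zero[OF that(1,4)] zero[OF that(2,4)] F4 that by blast
   show "\<bar>\<phi> q t\<bar> * r q \<le> \<eta>" if "q \<in> F" "t \<in> cubeT" for q t
   proof -
    have "0 \<le> \<phi> q t" "\<phi> q t \<le> 1" "0 < r q" "r q < \<eta>" using F1 F2 that by blast+
    then have "\<bar>\<phi> q t\<bar> * r q \<le> 1 * \<eta>" by (intro mult_mono) auto
    then show ?thesis by simp
   qed
   show "\<bar>pderiv (\<phi> q) j t\<bar> * r q \<le> \<eta>" if "q \<in> F" "t \<in> cubeT" "j < n" for q t j using F2 that by blast
   show "v q \<in> Tail \<Phi> \<S> S \<theta> M" if "q \<in> F" for q using F1 that unfolding T_def by blast
   show "0 \<le> r q" if "q \<in> F" for q using F1 that by (meson less_imp_le)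
   show "\<eta> * M \<le> H" "0 \<le> \<theta>" "0 \<le> \<eta>" "0 \<le> M" using \<eta> \<theta> M by auto
  qed (use S' in auto)
  moreover have "real i * \<delta> + \<delta> / 2 + \<eta> * \<theta> = real (Suc i) * \<delta>" by (simp add: \<theta>(2) algebra_simps)
  ultimately have conh: "controlled \<Phi> n S' (real (Suc i) * \<delta>) H g0 h" by simp
  define C'' where "C'' = C \<union> (\<Union>q\<in>F. K q)"
  have Kc: "compact (K q)" if "q \<in> F" for q
  proof -
   have "closed (K q)" "K q \<subseteq> cubeT" using F1 that by blast+
   then show ?thesis using compact_Int_closed[OF compact_cubeT, of "K q"] by (simp add: Int_absorb1)
  qed
  have "compact C''" unfolding C''_def using C(1) F(1) Kc by (intro compact_Un compact_UN) auto
  moreover have "C'' \<subseteq> cubeT" unfolding C''_def using C(2) F1 by blast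
  moreover have "h ` C'' \<inter> closure E = {}"
  proof -
   have "h t \<notin> closure E" if t: "t \<in> C" for t
   proof -
    have "\<phi> q t = 0" if "q \<in> F" for q using zero[OF that] F1 t that C(2) by blast
    then have "h t = g' t" by (simp add: h_def)
    then show ?thesis using C' t by auto
   qed
   moreover have "h t \<notin> closure E" if q: "q \<in> F" and t: "t \<in> K q" for q t
   proof -
    have tc: "t \<in> cubeT" "t \<in> Sp q" using F1 q t by blast+
    have "(\<Sum>q'\<in>F. \<phi> q' t *\<^sub>R (r q' *\<^sub>R v q')) = \<phi> q t *\<^sub>R (r q *\<^sub>R v q) + (\<Sum>q'\<in>F - {q}. \<phi> q' t *\<^sub>R (r q' *\<^sub>R v q'))"
     by (rule sum.remove[OF F(1) q])
    also have "(\<Sum>q'\<in>F - {q}. \<phi> q' t *\<^sub>R (r q' *\<^sub>R v q')) = 0"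
    proof (rule sum.neutral, rule ballI)
     fix q' assume q': "q' \<in> F - {q}"
     then have "t \<notin> Sp q'" using F4 q tc by blast
     then show "\<phi> q' t *\<^sub>R (r q' *\<^sub>R v q') = 0" using zero[of q' t] q' tc by simp
    qed
    \<comment> \<open>On a core only its own bump is active, and with full height, so the point is
      moved by \<open>r q *\<^sub>R v q\<close> into the hole found for the centre.\<close>
    finally have "h t = g' t + r q *\<^sub>R v q" using F3 q t by (simp add: h_def)
    then have "dist (g' q + r q *\<^sub>R v q) (h t) = norm (g' t - g' q)" by (simp add: dist_norm norm_minus_commute)
    also have "\<dots> \<le> \<kappa> * r q" using F3 q t by blast
    also have "\<dots> < c/2 * r q" using F1 q c by (auto simp: \<kappa>_def)
    finally have "h t \<in> ball (g' q + r q *\<^sub>R v q) (c/2 * r q)" by simp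
    moreover have "ball (g' q + r q *\<^sub>R v q) (c/2 * r q) \<inter> closure E = {}"
     using F1 q by (subst open_Int_closure_eq_empty) auto
    ultimately show ?thesis by blast
   qed
   ultimately show ?thesis unfolding C''_def by blast
  qed
  moreover have "real (Suc i) * (\<rho> * \<tau>) \<le> measure lebN C''"
  proof -
   have Cs: "C \<in> sets lebN" by (rule sets_lebN_compact[OF C(1,2)])
   have Ks: "K q \<in> sets lebN" if "q \<in> F" for q using F1 that by blast
   have "measure lebN C'' = measure lebN C + measure lebN (\<Union>q\<in>F. K q)"
    unfolding C''_def using F1 Cs Ks F(1) by (intro lebN.finite_measure_Union) auto
   also have "measure lebN (\<Union>q\<in>F. K q) = (\<Sum>q\<in>F. measure lebN (K q))"
   proof (rule lebN.finite_measure_finite_Union[OF F(1)])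
    show "K ` F \<subseteq> sets lebN" using Ks by blast
    show "disjoint_family_on K F" unfolding disjoint_family_on_def using F1 F4 by blast
   qed
   finally show ?thesis using C(4) F5 by (simp add: algebra_simps)
  qed
  ultimately show ?case using hG S'(1) conh by blast
 qed
 from this[of I] obtain C where "real I * (\<rho> * \<tau>) \<le> measure lebN C" by blast
 then show False using I lebN.prob_le_1[of C] by linarith
qed


section \<open>The Radon-Nikodym property and unconditional series\<close>

text \<open>Distance to the nearest integer, the tooth of the Takagi function.\<close>

definition dz :: "real \<Rightarrow> real" where "dz x = \<bar>x - of_int (round x)\<bar>"

lemma dz_le: "dz x \<le> \<bar>x - of_int n\<bar>"
 unfolding dz_def by (rule round_diff_minimal)

lemma dz_lipschitz: "\<bar>dz x - dz y\<bar> \<le> \<bar>x - y\<bar>"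
proof -
 have "dz x \<le> \<bar>x - y\<bar> + dz y" for x y using dz_le[of x "round y"] unfolding dz_def by linarith
 from this[of x y] this[of y x] show ?thesis by linarith
qed

lemma dz_int: "dz (of_int n) = 0" by (simp add: dz_def)

lemma dz_nonneg: "0 \<le> dz x" by (simp add: dz_def)

lemma dz_le_half: "dz x \<le> 1/2"
 unfolding dz_def using of_int_round_abs_le[of x] by (simp add: abs_minus_commute)

lemma dz_affine_even: "of_int n \<le> x \<Longrightarrow> x \<le> of_int n + 1/2 \<Longrightarrow> dz x = x - of_int n"
proof -
 assume x: "of_int n \<le> x" "x \<le> of_int n + 1/2"
 have "dz x \<le> x - of_int n" using dz_le[of x n] x by simp
 moreover have "x - of_int n \<le> \<bar>x - of_int k\<bar>" for k
 proof (cases "k \<le> n")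
  case True
  then have "real_of_int k \<le> of_int n" by simp
  then show ?thesis using x by linarith
 next
  case False
  then have "real_of_int k \<ge> of_int n + 1" by linarith
  then show ?thesis using x by linarith
 qed
 ultimately show ?thesis unfolding dz_def by (metis antisym)
qed

lemma dz_affine_odd: "of_int n - 1/2 \<le> x \<Longrightarrow> x \<le> of_int n \<Longrightarrow> dz x = of_int n - x"
proof -
 assume x: "of_int n - 1/2 \<le> x" "x \<le> of_int n"
 have "dz x \<le> of_int n - x" using dz_le[of x n] x by simp
 moreover have "of_int n - x \<le> \<bar>x - of_int k\<bar>" for k
 proof (cases "k \<ge> n")
  case True
  then have "real_of_int k \<ge> of_int n" by simp
  then show ?thesis using x by linarith
 next
  case False
  then have "real_of_int k \<le> of_int n - 1" by linarith
  then show ?thesis using x by linarith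
 qed
 ultimately show ?thesis unfolding dz_def by (metis antisym)
qed

text \<open>\<open>dz\<close> is affine between consecutive multiples of 1/2, and a dyadic interval
  of length \<open>1 / 2 ^ Suc p\<close> lies in one such interval; \<open>l\<close> is its index,
  and the parity of \<open>l\<close> decides the sign of the slope.\<close>

lemma dz_midpoint:
 fixes k :: int and p :: nat
 shows "dz ((of_int k + 1/2) / 2 ^ Suc p) = (dz (of_int k / 2 ^ Suc p) + dz ((of_int k + 1) / 2 ^ Suc p)) / 2"
proof -
 define l where "l = k div 2 ^ p"
 have l: "l * 2 ^ p \<le> k" "k + 1 \<le> (l + 1) * 2 ^ p"
 proof -
  have 1: "k = l * 2 ^ p + k mod 2 ^ p" unfolding l_def by (rule div_mult_mod_eq[symmetric])
  have 2: "0 \<le> k mod 2 ^ p" "k mod 2 ^ p < 2 ^ p" by simp_all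
  show "l * 2 ^ p \<le> k" using 1 2 by linarith
  have "(l + 1) * 2 ^ p = l * 2 ^ p + 2 ^ p" by (simp add: algebra_simps)
  then show "k + 1 \<le> (l + 1) * 2 ^ p" using 1 2 by linarith
 qed
 have r: "of_int l / 2 \<le> x \<and> x \<le> (of_int l + 1) / 2" if "of_int k / 2 ^ Suc p \<le> x" "x \<le> (of_int k + 1) / 2 ^ Suc p" for x :: real
 proof -
  have "real_of_int (l * 2 ^ p) \<le> of_int k" "real_of_int (k + 1) \<le> of_int ((l + 1) * 2 ^ p)"
   using l by (simp_all only: of_int_le_iff)
  then have a: "of_int l * 2 ^ p \<le> real_of_int k" "of_int k + 1 \<le> (real_of_int l + 1) * 2 ^ p" by simp_all
  have "of_int l / 2 = (of_int l * 2 ^ p) / (2 ^ Suc p :: real)" by simp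
  also have "\<dots> \<le> of_int k / 2 ^ Suc p" using a(1) by (intro divide_right_mono) auto
  finally have 1: "of_int l / 2 \<le> of_int k / (2 ^ Suc p :: real)" .
  have "(of_int k + 1) / 2 ^ Suc p \<le> ((of_int l + 1) * 2 ^ p) / (2 ^ Suc p :: real)" using a(2) by (intro divide_right_mono) auto
  also have "\<dots> = (of_int l + 1) / 2" by simp
  finally show ?thesis using 1 that by linarith
 qed
 define u where "u = of_int k / (2 ^ Suc p :: real)"
 define h where "h = 1 / (2 ^ Suc p :: real)"
 have h: "h > 0" by (simp add: h_def)
 have eq: "(of_int k + 1/2) / 2 ^ Suc p = u + h / 2" "of_int k / 2 ^ Suc p = u" "(of_int k + 1) / 2 ^ Suc p = u + h"
  by (simp_all add: u_def h_def add_divide_distrib)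
 have r': "of_int l / 2 \<le> x \<and> x \<le> (of_int l + 1) / 2" if "u \<le> x" "x \<le> u + h" for x
  using r[of x] that unfolding eq by blast
 show ?thesis
  unfolding eq
 proof (cases "even l")
  case True
  then obtain n where n: "l = 2 * n" by blast
  have "dz x = x - of_int n" if "u \<le> x" "x \<le> u + h" for x
   using r'[OF that] by (intro dz_affine_even) (auto simp: n)
  then show "dz (u + h / 2) = (dz u + dz (u + h)) / 2" using h by simp
 next
  case False
  then obtain n where n: "l = 2 * n + 1" using oddE by blast
  have "dz x = of_int (n + 1) - x" if "u \<le> x" "x \<le> u + h" for x
   using r'[OF that] by (intro dz_affine_odd) (auto simp: n)
  then show "dz (u + h / 2) = (dz u + dz (u + h)) / 2" using h by simp
 qed
qed

lemma average_bound:
 fixes X A B C D z :: real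
 assumes "X \<le> A + B" "B \<le> (C + D) / 2" "A \<le> z" "C \<le> z" "D \<le> z"
 shows "X \<le> 2 * z"
 using assms by argo

text \<open>The second differences at dyadic midpoints of \<open>\<Sum>j. 2^-j dz (2^j s) y_j\<close> isolate the single vectors \<open>y_m\<close>,
 hence that function is nowhere differentiable.\<close>

lemma RNP_no_c0:
 fixes y :: "nat \<Rightarrow> 'y::banach"
 assumes RNP: "RNP TYPE('y)" and e: "e > 0" "\<And>i. e \<le> norm (y i)"
  and K: "\<And>N \<sigma>. (\<And>i. \<bar>\<sigma> i\<bar> \<le> 1) \<Longrightarrow> norm (\<Sum>i<N. \<sigma> i *\<^sub>R y i) \<le> K"
 shows False
proof -
 have K0: "K \<ge> 0" using K[of "\<lambda>_. 0" 0] by simp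
 have yK: "norm (y i) \<le> K" for i
 proof -
  have "(\<Sum>j<Suc i. (if j = i then 1 else 0) *\<^sub>R y j) = y i" by simp
  then show ?thesis using K[of "\<lambda>j. if j = i then 1 else 0" "Suc i"] by (metis (mono_tags, lifting) abs_one abs_zero order_refl zero_le_one)
 qed
 define a where "a j s = (1/2) ^ j * dz (2 ^ j * s)" for j and s :: real
 have a_bd: "\<bar>a j s\<bar> \<le> (1/2) ^ j" for j s
 proof -
  have "dz (2 ^ j * s) \<le> 1" using dz_le_half[of "2 ^ j * s"] by simp
  then have "(1/2) ^ j * dz (2 ^ j * s) \<le> (1/2) ^ j * 1" by (intro mult_left_mono) auto
  then show ?thesis using dz_nonneg[of "2 ^ j * s"] by (simp add: a_def)
 qed
 have a_lip: "\<bar>a j s - a j s'\<bar> \<le> \<bar>s - s'\<bar>" for j s s'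
 proof -
  have "\<bar>a j s - a j s'\<bar> = (1/2) ^ j * \<bar>dz (2 ^ j * s) - dz (2 ^ j * s')\<bar>"
   by (simp add: a_def right_diff_distrib[symmetric] abs_mult)
  also have "\<dots> \<le> (1/2) ^ j * \<bar>2 ^ j * s - 2 ^ j * s'\<bar>" by (intro mult_left_mono dz_lipschitz) auto
  also have "\<dots> = \<bar>s - s'\<bar>" by (simp add: right_diff_distrib[symmetric] abs_mult power_one_over)
  finally show ?thesis .
 qed
 have summ: "summable (\<lambda>j. a j s *\<^sub>R y j)" for s
 proof (rule summable_comparison_test')
  show "summable (\<lambda>j. (1/2) ^ j * K)" by (intro summable_mult2 summable_geometric) simp
  show "norm (a j s *\<^sub>R y j) \<le> (1/2) ^ j * K" if "j \<ge> 0" for j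
   unfolding norm_scaleR using a_bd[of j s] yK[of j] by (intro mult_mono) auto
 qed
 define F where "F s = (\<Sum>j. a j s *\<^sub>R y j)" for s
 \<comment> \<open>The increments of the scaled teeth divided by \<open>d\<close> lie in [-1, 1], so
   the bound \<open>K\<close> on signed sums becomes a Lipschitz bound.\<close>
 have lip: "norm (F s - F s') \<le> K * \<bar>s - s'\<bar>" for s s'
 proof (cases "s = s'")
  case False
  define d where "d = \<bar>s - s'\<bar>"
  have d: "d > 0" using False by (simp add: d_def)
  have "norm (\<Sum>j<N. (a j s - a j s') *\<^sub>R y j) \<le> K * d" for N
  proof -
   have "(\<Sum>j<N. (a j s - a j s') *\<^sub>R y j) = d *\<^sub>R (\<Sum>j<N. ((a j s - a j s') / d) *\<^sub>R y j)"
    unfolding scaleR_sum_right using d by (intro sum.cong) auto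
   then have "norm (\<Sum>j<N. (a j s - a j s') *\<^sub>R y j) = d * norm (\<Sum>j<N. ((a j s - a j s') / d) *\<^sub>R y j)"
    using d by simp
   also have "\<dots> \<le> d * K" using d a_lip[of _ s s'] by (intro mult_left_mono K) (auto simp: d_def[symmetric])
   finally show ?thesis by (simp add: mult.commute)
  qed
  moreover have "(\<lambda>N. \<Sum>j<N. (a j s - a j s') *\<^sub>R y j) \<longlonglongrightarrow> F s - F s'"
  proof -
   have "(\<lambda>j. a j s *\<^sub>R y j - a j s' *\<^sub>R y j) sums (F s - F s')"
    unfolding F_def by (intro sums_diff summable_sums summ)
   then show ?thesis by (simp add: sums_def scaleR_diff_left)
  qed
  ultimately show ?thesis
   unfolding d_def by (intro LIMSEQ_le_const2[OF tendsto_norm]) auto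
 qed (use K0 in simp)
 then have "K-lipschitz_on UNIV F" using K0 by (intro lipschitz_onI) (auto simp: dist_norm)
 then have "AE s in lborel. F differentiable (at s)" using RNP unfolding RNP_def by blast
 moreover have "\<not> (AE s::real in lborel. False)"
  by (simp add: eventually_False ae_filter_eq_bot_iff emeasure_lborel_UNIV)
 ultimately obtain s where "F differentiable (at s)" by (meson eventually_mono)
 then obtain D where "(F has_derivative D) (at s)" unfolding differentiable_def by blast
 moreover have e8: "e / 8 > 0" using e by simp
 ultimately obtain d where d: "d > 0" "\<And>x. norm (x - s) < d \<Longrightarrow> norm (F x - F s - D (x - s)) \<le> e/8 * norm (x - s)"
  and lin: "linear D"
  unfolding has_derivative_at_alt by (metis bounded_linear.linear)
 obtain m where m: "(1/2::real) ^ m < d" using real_arch_pow_inv[OF d(1), of "1/2"] by auto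
 \<comment> \<open>\<open>[u, u + h]\<close> will be the dyadic interval of length \<open>h\<close>
   around the point \<open>s\<close> of differentiability.\<close>
 define k where "k = \<lfloor>2 ^ m * s\<rfloor>"
 define h where "h = (1/2::real) ^ m"
 define u where "u = of_int k * h"
 have h: "h > 0" "2 ^ m * h = 1" by (simp_all add: h_def power_one_over)
 have us: "u \<le> s" "s < u + h"
 proof -
  have 1: "of_int k \<le> 2 ^ m * s" "2 ^ m * s < of_int k + 1" unfolding k_def by linarith+
  have A: "of_int k * h \<le> (2 ^ m * s) * h" and B: "(2 ^ m * s) * h < (of_int k + 1) * h"
   using 1 h(1) by (auto intro: mult_right_mono mult_strict_right_mono)
  have sh: "(2 ^ m * s) * h = s" using h(2) by (metis mult.assoc mult.commute mult.right_neutral)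
  show "u \<le> s" using A unfolding sh u_def .
  show "s < u + h" using B unfolding sh u_def by (simp add: distrib_right)
 qed
 \<comment> \<open>For \<open>j < m\<close> the tooth is affine on this interval, for
   \<open>j > m\<close> all three points are zeros of it; only the tooth \<open>m\<close> has its
   peak at the midpoint.\<close>
 have mid: "a j (u + h/2) - (a j u + a j (u + h)) / 2 = (if j = m then h / 2 else 0)" for j
 proof -
  consider "j < m" | "j = m" | "j > m" by linarith
  then show ?thesis
  proof cases
   case 1
   define p where "p = m - j - 1"
   have mp: "m = j + Suc p" using 1 by (simp add: p_def)
   have hj: "2 ^ j * h = 1 / 2 ^ Suc p" unfolding h_def mp by (simp add: power_add power_one_over field_simps)
   have "2 ^ j * (u + h/2) = (of_int k + 1/2) * (2 ^ j * h)" "2 ^ j * u = of_int k * (2 ^ j * h)" "2 ^ j * (u + h) = (of_int k + 1) * (2 ^ j * h)"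
    by (simp_all add: u_def algebra_simps)
   then have E: "2 ^ j * (u + h/2) = (of_int k + 1/2) / 2 ^ Suc p" "2 ^ j * u = of_int k / 2 ^ Suc p" "2 ^ j * (u + h) = (of_int k + 1) / 2 ^ Suc p"
    unfolding hj by simp_all
   have "c * ((x + y) / 2) - (c * x + c * y) / 2 = 0" for c x y :: real by (simp add: field_simps)
   then show ?thesis unfolding a_def E dz_midpoint using 1 by simp
  next
   case 2
   have "2 ^ m * (u + h/2) = of_int k * (2 ^ m * h) + (2 ^ m * h) / 2" "2 ^ m * u = of_int k * (2 ^ m * h)" "2 ^ m * (u + h) = of_int k * (2 ^ m * h) + 2 ^ m * h"
    by (simp_all add: u_def algebra_simps)
   then have eq: "2 ^ m * (u + h/2) = of_int k + 1/2" "2 ^ m * u = of_int k" "2 ^ m * (u + h) = of_int (k + 1)"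
    unfolding h(2) by simp_all
   have "dz (of_int k + 1/2) = 1/2" by (subst dz_affine_even[of k]) auto
   then show ?thesis unfolding a_def 2 eq dz_int by (simp add: h_def)
  next
   case 3
   define p where "p = j - m - 1"
   have mp: "j = m + Suc p" using 3 by (simp add: p_def)
   have "2 ^ j * h = 2 ^ Suc p * (2 ^ m * h)" unfolding mp by (simp add: power_add)
   then have hj: "2 ^ j * h = 2 ^ Suc p" using h(2) by simp
   have "2 ^ j * (u + h/2) = of_int k * (2 ^ j * h) + (2 ^ j * h) / 2" "2 ^ j * u = of_int k * (2 ^ j * h)" "2 ^ j * (u + h) = of_int k * (2 ^ j * h) + 2 ^ j * h"
    by (simp_all add: u_def algebra_simps)
   then have "2 ^ j * (u + h/2) = of_int (k * 2 ^ Suc p + 2 ^ p)" "2 ^ j * u = of_int (k * 2 ^ Suc p)" "2 ^ j * (u + h) = of_int (k * 2 ^ Suc p + 2 ^ Suc p)"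
    unfolding hj by simp_all
   then show ?thesis unfolding a_def using 3 by (simp only: dz_int) simp
  qed
 qed
 have "F (u + h/2) - (1/2) *\<^sub>R (F u + F (u + h)) = (h / 2) *\<^sub>R y m"
 proof -
  have "(\<lambda>j. a j (u + h/2) *\<^sub>R y j - (1/2) *\<^sub>R (a j u *\<^sub>R y j + a j (u + h) *\<^sub>R y j)) sums (F (u + h/2) - (1/2) *\<^sub>R (F u + F (u + h)))"
   unfolding F_def by (intro sums_diff sums_add bounded_linear.sums[OF bounded_linear_scaleR_right] summable_sums summ)
  moreover have "a j (u + h/2) *\<^sub>R y j - (1/2) *\<^sub>R (a j u *\<^sub>R y j + a j (u + h) *\<^sub>R y j) = (if j = m then (h/2) *\<^sub>R y j else 0)" for j
  proof -
   have "a j (u + h/2) *\<^sub>R y j - (1/2) *\<^sub>R (a j u *\<^sub>R y j + a j (u + h) *\<^sub>R y j) = (a j (u + h/2) - (a j u + a j (u + h)) / 2) *\<^sub>R y j"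
    by (simp add: algebra_simps add_divide_distrib)
   then show ?thesis by (simp add: mid)
  qed
  ultimately have "(\<lambda>j. if j = m then (h/2) *\<^sub>R y j else 0) sums (F (u + h/2) - (1/2) *\<^sub>R (F u + F (u + h)))" by simp
  moreover have "(\<lambda>j. if j = m then (h/2) *\<^sub>R y j else 0) sums ((h/2) *\<^sub>R y m)"
   using sums_single[of m "\<lambda>j. (h/2) *\<^sub>R y j"] by simp
  ultimately show ?thesis by (rule sums_unique2)
 qed
 then have "norm (F (u + h/2) - (1/2) *\<^sub>R (F u + F (u + h))) \<ge> h / 2 * e"
  using e(2)[of m] h(1) by simp
 \<comment> \<open>Differentiability at \<open>s\<close> bounds the second difference by
   \<open>e / 4 * h\<close>, against \<open>e / 2 * h\<close> from below.\<close>
 moreover have "norm (F (u + h/2) - (1/2) *\<^sub>R (F u + F (u + h))) \<le> 2 * (e/8 * h)"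
 proof -
  define R where "R x = F x - F s - D (x - s)" for x
  have R: "norm (R x) \<le> e/8 * h" if "u \<le> x" "x \<le> u + h" for x
  proof -
   have "norm (x - s) \<le> h" using that us by (simp add: abs_le_iff)
   moreover have "h < d" using m by (simp add: h_def)
   ultimately show ?thesis using d(2)[of x] e8 unfolding R_def by (smt (verit) mult_left_mono)
  qed
  have "D (u + h/2 - s) = (1/2) *\<^sub>R (D (u - s) + D (u + h - s))"
  proof -
   have "u + h/2 - s = (1/2) *\<^sub>R ((u - s) + (u + h - s))" by simp
   then show ?thesis using linear_cmul[OF lin] linear_add[OF lin] by metis
  qed
  then have "F (u + h/2) - (1/2) *\<^sub>R (F u + F (u + h)) = R (u + h/2) - (1/2) *\<^sub>R (R u + R (u + h))"
   unfolding R_def by (simp add: algebra_simps) (simp add: scaleR_left_distrib[symmetric])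
  also have "norm \<dots> \<le> norm (R (u + h/2)) + norm ((1/2) *\<^sub>R (R u + R (u + h)))" by (rule norm_triangle_ineq4)
  finally have 1: "norm (F (u + h/2) - (1/2) *\<^sub>R (F u + F (u + h))) \<le> norm (R (u + h/2)) + norm ((1/2) *\<^sub>R (R u + R (u + h)))" .
  have 2: "norm ((1/2) *\<^sub>R (R u + R (u + h))) \<le> (norm (R u) + norm (R (u + h))) / 2"
   using norm_triangle_ineq[of "R u" "R (u + h)"] by simp
  have "norm (R (u + h/2)) \<le> e/8 * h" "norm (R u) \<le> e/8 * h" "norm (R (u + h)) \<le> e/8 * h"
   by (rule R; use h(1) in simp)+
  then show ?thesis by (rule average_bound[OF 1 2])
 qed
 ultimately have "h / 2 * e \<le> 2 * (e/8 * h)" by (rule order_trans)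
 moreover have "e * h > 0" using e h by simp
 moreover have "h / 2 * e = (e * h) / 2" "2 * (e/8 * h) = (e * h) / 4" by simp_all
 ultimately show False by linarith
qed


section \<open>Large directional difference quotients\<close>

text \<open>Largeness at arbitrarily small scales, for continuous \<open>f\<close> a G-delta
  condition on the point. A one-sided derivative along \<open>v\<close>, if it exists, then has norm
  at least \<open>\<epsilon>\<close>.\<close>

definition big :: "('x::real_normed_vector \<Rightarrow> 'y::real_normed_vector) \<Rightarrow> real \<Rightarrow> 'x \<Rightarrow> 'x set" where
 "big f \<epsilon> v = {x. \<forall>d>0. \<exists>s. 0 < s \<and> s < d \<and> norm (quot f x v s) > \<epsilon>}"

lemma big_borel:
 assumes fc: "continuous_on UNIV f" shows "\<exists>U :: nat \<Rightarrow> _. (\<forall>k. open (U k)) \<and> big f \<epsilon> v = (\<Inter>k. U k)"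
proof -
 define U where "U k = (\<Union>s\<in>{0<..<inverse (Suc k)}. {x. norm (quot f x v s) > \<epsilon>})" for k :: nat
 have "open {x. norm (quot f x v s) > \<epsilon>}" for s
  unfolding quot_def by (intro open_Collect_less continuous_intros continuous_on_compose2[OF fc]) auto
 then have "open (U k)" for k unfolding U_def by (intro open_UN ballI)
 moreover have "big f \<epsilon> v = (\<Inter>k. U k)"
 proof (intro equalityI subsetI)
  fix x assume x: "x \<in> big f \<epsilon> v"
  have "x \<in> U k" for k
  proof -
   have "inverse (real (Suc k)) > 0" by simp
   then obtain s where "0 < s" "s < inverse (real (Suc k))" "norm (quot f x v s) > \<epsilon>"
    using x unfolding big_def by blast
   then show ?thesis unfolding U_def by auto
  qed
  then show "x \<in> (\<Inter>k. U k)" by blast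
 next
  fix x assume x: "x \<in> (\<Inter>k. U k)"
  have "\<exists>s. 0 < s \<and> s < d \<and> norm (quot f x v s) > \<epsilon>" if d: "d > 0" for d
  proof -
   obtain k where k: "inverse (real (Suc k)) < d" using reals_Archimedean[OF d] by blast
   have "x \<in> U k" using x by blast
   then obtain s where "0 < s" "s < inverse (real (Suc k))" "norm (quot f x v s) > \<epsilon>" unfolding U_def by auto
   then show ?thesis using k by (meson less_trans)
  qed
  then show "x \<in> big f \<epsilon> v" unfolding big_def by blast
 qed
 ultimately show ?thesis by blast
qed

lemma big_vimage_sets:
 assumes fc: "continuous_on UNIV f" and g: "g \<in> GammaX"
 shows "{t\<in>cubeT. g t \<in> big f \<epsilon> v} \<in> sets lebN"
proof -
 obtain U :: "nat \<Rightarrow> _" where U: "\<And>k. open (U k)" "big f \<epsilon> v = (\<Inter>k. U k)" using big_borel[OF fc] by metis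
 have "{t\<in>cubeT. g t \<in> big f \<epsilon> v} = (\<Inter>k. {t\<in>cubeT. g t \<in> U k})" using U(2) by auto
 then show ?thesis using GammaX_vimage_sets[OF g U(1)] by auto
qed

text \<open>Averaging: the integral of \<open>F (s + \<sigma>) - F s\<close> is nearly
  \<open>\<sigma> *\<^sub>R (F 1 - F 0)\<close>. As the integrand is at most
  \<open>b/4 * \<sigma>\<close> off \<open>G\<close> and \<open>\<Lambda> * \<sigma>\<close> on it,
  \<open>G\<close> cannot be small. The bound does not depend on \<open>\<sigma>\<close>, which
  permits a limit over scales.\<close>

lemma lipschitz_increment_measure:
 fixes F :: "real \<Rightarrow> 'y::banach"
 assumes lip: "\<And>s s'. s \<in> {0..1} \<Longrightarrow> s' \<in> {0..1} \<Longrightarrow> norm (F s - F s') \<le> \<Lambda> * \<bar>s - s'\<bar>"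
  and b: "b > 0" "b \<le> norm (F 1 - F 0)" and \<Lambda>: "\<Lambda> > 0" and \<sigma>: "0 < \<sigma>" "\<sigma> < 1" "4 * \<Lambda> * \<sigma> \<le> b"
  and G: "G \<in> sets borel" "G \<subseteq> {0..1}" "\<And>s. 0 \<le> s \<Longrightarrow> s + \<sigma> \<le> 1 \<Longrightarrow> norm (F (s + \<sigma>) - F s) > b/4 * \<sigma> \<Longrightarrow> s \<in> G"
 shows "b / (4 * \<Lambda>) \<le> measure lborel G"
proof -
 have "\<Lambda>-lipschitz_on {0..1} F" using lip \<Lambda> by (intro lipschitz_onI) (auto simp: dist_norm)
 then have Fc: "continuous_on {0..1} F" by (rule lipschitz_on_continuous_on)
 have int: "F integrable_on {x..y}" if "0 \<le> x" "y \<le> 1" for x y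
  using that by (intro integrable_continuous_interval continuous_on_subset[OF Fc]) auto
 have c2: "continuous_on {0..1-\<sigma>} (\<lambda>s. F (s + \<sigma>))"
  using \<sigma> by (intro continuous_on_compose2[OF Fc]) (auto intro!: continuous_intros)
 have sh: "integral {0..1-\<sigma>} (\<lambda>s. F (s + \<sigma>)) = integral {\<sigma>..1} F"
  using integral_shift_Icc_real[of 0 "1-\<sigma>" F \<sigma>] by (simp add: comp_def add.commute)
 \<comment> \<open>Shifting the variable cancels everything but two end pieces of length
   \<open>\<sigma>\<close>.\<close>
 have D: "integral {0..1-\<sigma>} (\<lambda>s. F (s + \<sigma>) - F s) = integral {1-\<sigma>..1} F - integral {0..\<sigma>} F"
 proof -
  have "integral {0..1-\<sigma>} (\<lambda>s. F (s + \<sigma>) - F s) = integral {\<sigma>..1} F - integral {0..1-\<sigma>} F"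
   using int[of 0 "1-\<sigma>"] c2 \<sigma> by (subst integral_diff) (auto simp: sh intro: integrable_continuous_interval)
  moreover have "integral {0..\<sigma>} F + integral {\<sigma>..1} F = integral {0..1} F"
   using \<sigma> int[of 0 1] by (intro Henstock_Kurzweil_Integration.integral_combine) auto
  moreover have "integral {0..1-\<sigma>} F + integral {1-\<sigma>..1} F = integral {0..1} F"
   using \<sigma> int[of 0 1] by (intro Henstock_Kurzweil_Integration.integral_combine) auto
  moreover have "z = q - p" if "z = y - x" "p + y = w" "x + q = w" for p q x y z w :: 'y
  proof -
   have "y = w - p" "x = w - q" using that(2,3) by (auto simp: algebra_simps)
   then show ?thesis using that(1) by simp
  qed
  ultimately show ?thesis by blast
 qed
 have end1: "norm (integral {1-\<sigma>..1} F - \<sigma> *\<^sub>R F 1) \<le> \<Lambda> * \<sigma> * \<sigma>"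
 proof -
  have "integral {1-\<sigma>..1} (\<lambda>s. F s - F 1) = integral {1-\<sigma>..1} F - \<sigma> *\<^sub>R F 1"
   using int[of "1-\<sigma>" 1] \<sigma> by (subst integral_diff) auto
  moreover have "norm (integral {1-\<sigma>..1} (\<lambda>s. F s - F 1)) \<le> \<Lambda> * \<sigma> * (1 - (1 - \<sigma>))"
  proof (rule integral_bound)
   show "continuous_on {1-\<sigma>..1} (\<lambda>s. F s - F 1)"
    using \<sigma> by (intro continuous_intros continuous_on_subset[OF Fc]) auto
   fix s assume s: "s \<in> {1-\<sigma>..1}"
   have "norm (F s - F 1) \<le> \<Lambda> * \<bar>s - 1\<bar>" using s \<sigma> by (intro lip) auto
   also have "\<dots> \<le> \<Lambda> * \<sigma>" using s \<Lambda> by (intro mult_left_mono) auto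
   finally show "norm (F s - F 1) \<le> \<Lambda> * \<sigma>" .
  qed (use \<sigma> in auto)
  ultimately show ?thesis by simp
 qed
 have end0: "norm (integral {0..\<sigma>} F - \<sigma> *\<^sub>R F 0) \<le> \<Lambda> * \<sigma> * \<sigma>"
 proof -
  have "integral {0..\<sigma>} (\<lambda>s. F s - F 0) = integral {0..\<sigma>} F - \<sigma> *\<^sub>R F 0"
   using int[of 0 \<sigma>] \<sigma> by (subst integral_diff) auto
  moreover have "norm (integral {0..\<sigma>} (\<lambda>s. F s - F 0)) \<le> \<Lambda> * \<sigma> * (\<sigma> - 0)"
  proof (rule integral_bound)
   show "continuous_on {0..\<sigma>} (\<lambda>s. F s - F 0)"
    using \<sigma> by (intro continuous_intros continuous_on_subset[OF Fc]) auto
   fix s assume s: "s \<in> {0..\<sigma>}"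
   have "norm (F s - F 0) \<le> \<Lambda> * \<bar>s - 0\<bar>" using s \<sigma> by (intro lip) auto
   also have "\<dots> \<le> \<Lambda> * \<sigma>" using s \<Lambda> by (intro mult_left_mono) auto
   finally show "norm (F s - F 0) \<le> \<Lambda> * \<sigma>" .
  qed (use \<sigma> in auto)
  ultimately show ?thesis by simp
 qed
 have low: "\<sigma> * b - 2 * (\<Lambda> * \<sigma> * \<sigma>) \<le> norm (integral {0..1-\<sigma>} (\<lambda>s. F (s + \<sigma>) - F s))"
 proof -
  have "\<sigma> *\<^sub>R (F 1 - F 0) = (integral {1-\<sigma>..1} F - integral {0..\<sigma>} F) - (integral {1-\<sigma>..1} F - \<sigma> *\<^sub>R F 1) + (integral {0..\<sigma>} F - \<sigma> *\<^sub>R F 0)"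
   by (simp add: algebra_simps)
  then have "norm (\<sigma> *\<^sub>R (F 1 - F 0)) \<le> norm (integral {1-\<sigma>..1} F - integral {0..\<sigma>} F) + \<Lambda> * \<sigma> * \<sigma> + \<Lambda> * \<sigma> * \<sigma>"
   using norm_diff_add_le[OF order_refl end1 end0, of "integral {1-\<sigma>..1} F - integral {0..\<sigma>} F"] by simp
  moreover have "\<sigma> * b \<le> norm (\<sigma> *\<^sub>R (F 1 - F 0))" using b(2) \<sigma> by simp
  ultimately show ?thesis unfolding D by linarith
 qed
 have Gm: "G \<in> lmeasurable"
  using G(1,2) by (intro bounded_set_imp_lmeasurable) (auto intro: bounded_subset[of "{0..1}"])
 have ub: "norm (integral {0..1-\<sigma>} (\<lambda>s. F (s + \<sigma>) - F s)) \<le> integral {0..1-\<sigma>} (\<lambda>s. b/4 * \<sigma> + \<Lambda> * \<sigma> * indicator G s)"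
 proof (rule integral_norm_bound_integral)
  show "(\<lambda>s. F (s + \<sigma>) - F s) integrable_on {0..1-\<sigma>}"
   using int[of 0 "1-\<sigma>"] c2 \<sigma> by (intro integrable_diff) (auto intro: integrable_continuous_interval)
  have "(indicator G :: real \<Rightarrow> real) integrable_on {0..1-\<sigma>}"
   using Gm by (simp add: integrable_on_indicator fmeasurable.Int)
  then show "(\<lambda>s. b/4 * \<sigma> + \<Lambda> * \<sigma> * indicator G s) integrable_on {0..1-\<sigma>}"
   by (intro integrable_add integrable_on_mult_right) auto
  fix s assume s: "s \<in> {0..1-\<sigma>}"
  show "norm (F (s + \<sigma>) - F s) \<le> b/4 * \<sigma> + \<Lambda> * \<sigma> * indicator G s"
  proof (cases "s \<in> G")
   case True
   have "norm (F (s + \<sigma>) - F s) \<le> \<Lambda> * \<bar>s + \<sigma> - s\<bar>" using s \<sigma> by (intro lip) auto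
   then show ?thesis using True \<sigma> b(1) by (simp add: add_increasing)
  next
   case False
   then show ?thesis using G(3)[of s] s by (force simp: not_less)
  qed
 qed
 have "integral {0..1-\<sigma>} (\<lambda>s. b/4 * \<sigma> + \<Lambda> * \<sigma> * indicator G s) \<le> b/4 * \<sigma> + \<Lambda> * \<sigma> * measure lborel G"
 proof -
  have i: "(indicator G :: real \<Rightarrow> real) integrable_on {0..1-\<sigma>}"
   using Gm by (simp add: integrable_on_indicator fmeasurable.Int)
  have "integral {0..1-\<sigma>} (\<lambda>s. b/4 * \<sigma> + \<Lambda> * \<sigma> * indicator G s) = (1 - \<sigma>) * (b/4 * \<sigma>) + \<Lambda> * \<sigma> * integral {0..1-\<sigma>} (indicator G)"
   using i \<sigma> by (subst integral_add) (auto intro: integrable_on_mult_right)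
  also have "integral {0..1-\<sigma>} (indicator G :: real \<Rightarrow> real) = measure lebesgue (G \<inter> {0..1-\<sigma>})"
   using Gm by (subst integral_indicator) (auto intro: fmeasurable.Int)
  also have "\<dots> \<le> measure lebesgue G" using Gm by (intro measure_mono_fmeasurable) (auto intro: fmeasurableD)
  also have "measure lebesgue G = measure lborel G" using G(1) by simp
  finally have "integral {0..1-\<sigma>} (\<lambda>s. b/4 * \<sigma> + \<Lambda> * \<sigma> * indicator G s) \<le> (1 - \<sigma>) * (b/4 * \<sigma>) + \<Lambda> * \<sigma> * measure lborel G"
   using \<sigma> \<Lambda> by (simp add: mult_left_mono)
  moreover have "(1 - \<sigma>) * (b/4 * \<sigma>) \<le> 1 * (b/4 * \<sigma>)" using b \<sigma> by (intro mult_right_mono) auto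
  ultimately show ?thesis by linarith
 qed
 then have "\<sigma> * b - 2 * (\<Lambda> * \<sigma> * \<sigma>) \<le> b/4 * \<sigma> + \<Lambda> * \<sigma> * measure lborel G" using low ub by linarith
 then have "\<sigma> * (b - 2 * \<Lambda> * \<sigma> - b/4) \<le> \<sigma> * (\<Lambda> * measure lborel G)" by (simp add: algebra_simps)
 then have "b - 2 * \<Lambda> * \<sigma> - b/4 \<le> \<Lambda> * measure lborel G" using \<sigma>(1) by (simp only: mult_le_cancel_left_pos)
 \<comment> \<open>The end pieces cost \<open>2 * \<Lambda> * \<sigma> \<le> b / 2\<close> and the
   part off \<open>G\<close> costs \<open>b / 4\<close>; a quarter of \<open>b\<close>
   remains.\<close>
 then have "b / 4 \<le> \<Lambda> * measure lborel G" using \<sigma>(3) by linarith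
 then show ?thesis using \<Lambda> by (simp add: field_simps)
qed

lemma GammaX_coord_affine:
 assumes g: "g \<in> GammaX" and t: "t \<in> cubeT" and s: "s \<in> {0..1}" "s' \<in> {0..1}"
  and L: "\<And>\<tau>. \<tau> \<in> {0..1} \<Longrightarrow> norm (pderiv g j (t(j := \<tau>)) - w) \<le> L"
 shows "norm (g (t(j := s)) - g (t(j := s')) - (s - s') *\<^sub>R w) \<le> L * \<bar>s - s'\<bar>"
proof -
 have L0: "0 \<le> L" using L[OF s(1)] norm_ge_zero order_trans by blast
 have "L-lipschitz_on {0..1} (\<lambda>s. g (t(j := s)) - s *\<^sub>R w)"
 proof (rule bounded_derivative_imp_lipschitz[where f' = "\<lambda>s d. d *\<^sub>R (pderiv g j (t(j := s)) - w)"])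
  fix s :: real assume s: "s \<in> {0..1}"
  have "((\<lambda>s. g (t(j := s)) - s *\<^sub>R w) has_vector_derivative (pderiv g j (t(j := s)) - 1 *\<^sub>R w)) (at s within {0..1})"
   by (intro has_vector_derivative_diff GammaX_D_at[OF g t s] has_vector_derivative_scaleR[where g' = 0, simplified] derivative_intros)
  then show "((\<lambda>s. g (t(j := s)) - s *\<^sub>R w) has_derivative (\<lambda>d. d *\<^sub>R (pderiv g j (t(j := s)) - w))) (at s within {0..1})"
   by (simp add: has_vector_derivative_def)
  show "onorm (\<lambda>d. d *\<^sub>R (pderiv g j (t(j := s)) - w)) \<le> L"
  proof (rule onorm_le)
   fix d :: real
   show "norm (d *\<^sub>R (pderiv g j (t(j := s)) - w)) \<le> L * norm d"
    using mult_left_mono[OF L[OF s], of "\<bar>d\<bar>"] by (simp add: mult.commute)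
  qed
 qed (use L0 in auto)
 from lipschitz_onD[OF this s] have "norm ((g (t(j := s)) - s *\<^sub>R w) - (g (t(j := s')) - s' *\<^sub>R w)) \<le> L * \<bar>s - s'\<bar>"
  by (simp add: dist_norm)
 moreover have "(g (t(j := s)) - s *\<^sub>R w) - (g (t(j := s')) - s' *\<^sub>R w) = g (t(j := s)) - g (t(j := s')) - (s - s') *\<^sub>R w"
  by (simp add: scaleR_left_diff_distrib)
 ultimately show ?thesis by (simp only:)
qed

text \<open>The limit superior over \<open>\<sigma> \<rightarrow> 0\<close> of the sets where the quotient at scale \<open>\<sigma> r\<close> is
 large has at least the measure common to these sets.\<close>

lemma big_measure:
 fixes f :: "'x::real_normed_vector \<Rightarrow> 'y::banach"
 assumes f: "C-lipschitz_on UNIV f" and k: "k \<in> GammaX" and K: "K \<in> sets lebN" "K \<subseteq> cubeT"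
  and inv: "\<And>s \<tau>. s \<in> K \<Longrightarrow> \<tau> \<in> {0..1} \<Longrightarrow> s(m := \<tau>) \<in> K"
  and r: "r > 0" and b: "b > 0" and \<zeta>: "\<zeta> \<le> 1" "C * \<zeta> \<le> b / 8" and v: "norm v \<le> M"
  and inc: "\<And>s. s \<in> K \<Longrightarrow> norm (f (k (s(m := 1))) - f (k (s(m := 0)))) \<ge> b * r"
  and der: "\<And>s. s \<in> K \<Longrightarrow> norm (pderiv k m s - r *\<^sub>R v) \<le> \<zeta> * r"
 shows "b / (4 * (C * (M + 1) + 1)) * measure lebN K \<le> measure lebN {t\<in>K. k t \<in> big f (b/16) v}"
proof -
 have C: "0 \<le> C" using f by (rule lipschitz_on_nonneg)
 have M: "0 \<le> M" using v norm_ge_zero order_trans by blast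
 have fl: "norm (f x - f y) \<le> C * norm (x - y)" for x y
  using lipschitz_onD[OF f, of x y] by (simp add: dist_norm)
 have fc: "continuous_on UNIV f" using f by (rule lipschitz_on_continuous_on)
 define \<kappa> where "\<kappa> = b / (4 * (C * (M + 1) + 1))"
 define \<Lambda> where "\<Lambda> = (C * (M + 1) + 1) * r"
 have CM: "C * (M + 1) + 1 > 0" using C M by (simp add: add_nonneg_pos)
 have \<Lambda>: "\<Lambda> > 0" using CM r by (simp add: \<Lambda>_def)
 have \<kappa>: "\<kappa> > 0" using b CM by (simp add: \<kappa>_def)
 \<comment> \<open>Scales in the space are \<open>\<sigma> * r\<close>: moving the coordinate
   \<open>m\<close> by \<open>\<sigma>\<close> moves the surface nearly by
   \<open>(\<sigma> * r) *\<^sub>R v\<close>.\<close>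
 define A where "A \<sigma> = {t\<in>K. norm (quot f (k t) v (\<sigma> * r)) > b/16}" for \<sigma>
 have As: "A \<sigma> \<in> sets lebN" for \<sigma>
 proof -
  have "open {x. norm (quot f x v (\<sigma> * r)) > b/16}"
   unfolding quot_def by (intro open_Collect_less continuous_intros continuous_on_compose2[OF fc]) auto
  from sets.Int[OF K(1) GammaX_vimage_sets[OF k this]] show ?thesis
   using K(2) unfolding A_def by (elim back_subst[of "\<lambda>S. S \<in> sets lebN"]) auto
 qed
 have "\<exists>\<sigma>0>0. \<sigma>0 < 1 \<and> 4 * \<Lambda> * \<sigma>0 \<le> b * r"
 proof -
  define \<sigma>0 where "\<sigma>0 = min (1/2) (b * r / (4 * \<Lambda>))"
  have "4 * \<Lambda> * \<sigma>0 \<le> 4 * \<Lambda> * (b * r / (4 * \<Lambda>))" using \<Lambda> by (intro mult_left_mono) (auto simp: \<sigma>0_def)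
  also have "\<dots> = b * r" using \<Lambda> by simp
  finally have "4 * \<Lambda> * \<sigma>0 \<le> b * r" .
  moreover have "\<sigma>0 > 0" "\<sigma>0 < 1" using b r \<Lambda> by (auto simp: \<sigma>0_def)
  ultimately show ?thesis by blast
 qed
 then obtain \<sigma>0 where \<sigma>0: "0 < \<sigma>0" "\<sigma>0 < 1" "4 * \<Lambda> * \<sigma>0 \<le> b * r" by blast
 have Am: "\<kappa> * measure lebN K \<le> measure lebN (A \<sigma>)" if s: "0 < \<sigma>" "\<sigma> \<le> \<sigma>0" for \<sigma>
 proof -
  \<comment> \<open>\<open>K\<close> consists of full lines in the coordinate \<open>m\<close>, so
    the one-dimensional estimate holds on each section and Fubini gives the proportion
    \<open>\<kappa>\<close>.\<close>
  have "emeasure lebN K \<le> ennreal (1/\<kappa>) * emeasure lebN (A \<sigma>)"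
  proof (rule emeasure_lebN_sections[OF K(1) As, where j = m])
   fix t assume t: "t \<in> cubeT"
   show "emeasure lborel {s\<in>{0..1}. t(m := s) \<in> K} \<le> ennreal (1/\<kappa>) * emeasure lborel {s\<in>{0..1}. t(m := s) \<in> A \<sigma>}"
   proof (cases "\<exists>s\<in>{0..1}. t(m := s) \<in> K")
    case False
    then have e: "{s\<in>{0..1}. t(m := s) \<in> K} = {}" by blast
    show ?thesis unfolding e by simp
   next
    case True
    then have tK: "t(m := \<tau>) \<in> K" if "\<tau> \<in> {0..1}" for \<tau> using inv[OF _ that] by force
    define F where "F \<tau> = f (k (t(m := \<tau>)))" for \<tau>
    define G where "G = {s\<in>{0..1}. t(m := s) \<in> A \<sigma>}"
    have aff: "norm (k (t(m := s)) - k (t(m := s')) - (s - s') *\<^sub>R (r *\<^sub>R v)) \<le> \<zeta> * r * \<bar>s - s'\<bar>"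
     if "s \<in> {0..1}" "s' \<in> {0..1}" for s s'
     by (rule GammaX_coord_affine[OF k t that]) (rule der[OF tK])
    have "b * r / (4 * \<Lambda>) \<le> measure lborel G"
    proof (rule lipschitz_increment_measure[where F = F and \<sigma> = \<sigma>])
     fix s s' :: real assume ss: "s \<in> {0..1}" "s' \<in> {0..1}"
     have "norm (k (t(m := s)) - k (t(m := s'))) \<le> norm ((s - s') *\<^sub>R (r *\<^sub>R v)) + \<zeta> * r * \<bar>s - s'\<bar>"
      using norm_triangle_ineq2[of "k (t(m := s)) - k (t(m := s'))" "(s - s') *\<^sub>R (r *\<^sub>R v)"] aff[OF ss] by linarith
     also have "norm ((s - s') *\<^sub>R (r *\<^sub>R v)) = norm v * (r * \<bar>s - s'\<bar>)" using r by (simp add: mult_ac abs_mult)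
     also have "\<dots> + \<zeta> * r * \<bar>s - s'\<bar> = (norm v + \<zeta>) * (r * \<bar>s - s'\<bar>)" by (simp add: algebra_simps)
     also have "\<dots> \<le> (M + 1) * (r * \<bar>s - s'\<bar>)" using v \<zeta>(1) r by (intro mult_right_mono) auto
     finally have "C * norm (k (t(m := s)) - k (t(m := s'))) \<le> C * ((M + 1) * (r * \<bar>s - s'\<bar>))"
      using C by (rule mult_left_mono)
     then have "norm (F s - F s') \<le> (C * (M + 1)) * (r * \<bar>s - s'\<bar>)"
      unfolding F_def using fl by (metis (no_types, lifting) mult.assoc order_trans)
     also have "\<dots> \<le> (C * (M + 1) + 1) * (r * \<bar>s - s'\<bar>)" using r by (intro mult_right_mono) auto
     finally show "norm (F s - F s') \<le> \<Lambda> * \<bar>s - s'\<bar>" by (simp add: \<Lambda>_def mult.assoc)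
    next
     show "b * r \<le> norm (F 1 - F 0)" unfolding F_def using inc[OF tK[of 0]] by simp
     have "4 * \<Lambda> * \<sigma> \<le> 4 * \<Lambda> * \<sigma>0" using s \<Lambda> by (intro mult_left_mono) auto
     then show "4 * \<Lambda> * \<sigma> \<le> b * r" using \<sigma>0(3) by linarith
     show "G \<in> sets borel" unfolding G_def by (rule section_sets[OF t As])
     fix s assume s0: "0 \<le> s" "s + \<sigma> \<le> 1" and big: "norm (F (s + \<sigma>) - F s) > b * r / 4 * \<sigma>"
     have si: "s \<in> {0..1}" "s + \<sigma> \<in> {0..1}" using s0 s by auto
     let ?x = "k (t(m := s))"
     have "norm (k (t(m := s + \<sigma>)) - ?x - \<sigma> *\<^sub>R (r *\<^sub>R v)) \<le> \<zeta> * r * \<sigma>"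
      using aff[OF si(2,1)] s by simp
     then have "C * norm (k (t(m := s + \<sigma>)) - (?x + (\<sigma> * r) *\<^sub>R v)) \<le> C * (\<zeta> * r * \<sigma>)"
      using C by (intro mult_left_mono) (simp_all add: diff_diff_eq)
     also have "\<dots> = (C * \<zeta>) * (r * \<sigma>)" by (simp add: mult_ac)
     also have "\<dots> \<le> b / 8 * (r * \<sigma>)" using \<zeta>(2) r s by (intro mult_right_mono) auto
     finally have "norm (F (s + \<sigma>) - f (?x + (\<sigma> * r) *\<^sub>R v)) \<le> b / 8 * (r * \<sigma>)"
      unfolding F_def using fl order_trans by blast
     moreover have "norm (F (s + \<sigma>) - F s) \<le> norm (F (s + \<sigma>) - f (?x + (\<sigma> * r) *\<^sub>R v)) + norm (f (?x + (\<sigma> * r) *\<^sub>R v) - f ?x)"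
      unfolding F_def by (rule norm_diff_triangle_ineq[of _ _ 0, simplified] norm_diff_triangle_le[OF order_refl order_refl])
     moreover have "b * r / 4 * \<sigma> = b / 8 * (r * \<sigma>) + b / 16 * (\<sigma> * r) + b / 16 * (\<sigma> * r)" by simp
     moreover have "0 < b / 16 * (\<sigma> * r)" using b s r by simp
     ultimately have "norm (f (?x + (\<sigma> * r) *\<^sub>R v) - f ?x) > b / 16 * (\<sigma> * r)" using big by linarith
     moreover have "norm (quot f ?x v (\<sigma> * r)) = norm (f (?x + (\<sigma> * r) *\<^sub>R v) - f ?x) / (\<sigma> * r)"
      using s r unfolding quot_def by (simp add: divide_inverse mult.commute)
     ultimately have "norm (quot f ?x v (\<sigma> * r)) > b / 16"
      using s r by (simp only: pos_less_divide_eq mult_pos_pos)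
     then show "s \<in> G" unfolding G_def A_def using si tK by blast
    qed (use b r \<Lambda> s \<sigma>0 in \<open>auto simp: G_def\<close>)
    moreover have "b * r / (4 * \<Lambda>) = \<kappa>" using r by (simp add: \<kappa>_def \<Lambda>_def)
    ultimately have "\<kappa> \<le> measure lborel G" by simp
    moreover have "emeasure lborel G = ennreal (measure lborel G)"
    proof (rule emeasure_eq_ennreal_measure)
     have "emeasure lborel G \<le> emeasure lborel {0..1::real}" unfolding G_def by (intro emeasure_mono) auto
     also have "\<dots> < top" by simp
     finally show "emeasure lborel G \<noteq> top" by simp
    qed
    ultimately have "ennreal \<kappa> \<le> emeasure lborel G" by (simp add: ennreal_leI)
    then have "ennreal (1/\<kappa>) * ennreal \<kappa> \<le> ennreal (1/\<kappa>) * emeasure lborel G" by (intro mult_left_mono) auto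
    moreover have "ennreal (1/\<kappa>) * ennreal \<kappa> = 1" using \<kappa> by (simp add: ennreal_mult[symmetric])
    moreover have "{s\<in>{0..1}. t(m := s) \<in> K} = {0..1}" using tK by blast
    ultimately show ?thesis by (simp add: G_def)
   qed
  qed
  then have "measure lebN K \<le> 1/\<kappa> * measure lebN (A \<sigma>)"
   using \<kappa> by (simp add: lebN.emeasure_eq_measure ennreal_mult[symmetric])
  then have "\<kappa> * measure lebN K \<le> \<kappa> * (1/\<kappa> * measure lebN (A \<sigma>))" using \<kappa> by (intro mult_left_mono) auto
  then show ?thesis using \<kappa> by simp
 qed
 define \<sigma> where "\<sigma> n = \<sigma>0 * inverse (real (Suc n))" for n
 have \<sigma>: "0 < \<sigma> n" "\<sigma> n \<le> \<sigma>0" for n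
  using \<sigma>0(1) mult_left_mono[of "inverse (real (Suc n))" 1 \<sigma>0] by (auto simp: \<sigma>_def inverse_le_1_iff)
 define B where "B n = (\<Union>i\<in>{n..}. A (\<sigma> i))" for n
 have "\<kappa> * measure lebN K \<le> measure lebN (\<Inter>n. B n)"
  unfolding B_def by (rule measure_limsup_ge[OF As Am[OF \<sigma>]])
 also have "\<dots> \<le> measure lebN {t\<in>K. k t \<in> big f (b/16) v}"
 proof (rule lebN.finite_measure_mono)
  show "(\<Inter>n. B n) \<subseteq> {t\<in>K. k t \<in> big f (b/16) v}"
  proof
   fix t assume t: "t \<in> (\<Inter>n. B n)"
   have tK: "t \<in> K" using t unfolding B_def A_def by fastforce
   have "\<exists>s. 0 < s \<and> s < d \<and> norm (quot f (k t) v s) > b/16" if d: "d > 0" for d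
   proof -
    have "d / (\<sigma>0 * r) > 0" using d \<sigma>0 r by simp
    from reals_Archimedean[OF this] obtain n where n: "inverse (real (Suc n)) < d / (\<sigma>0 * r)" by blast
    have "t \<in> B n" using t by blast
    then obtain i where i: "i \<ge> n" "t \<in> A (\<sigma> i)" unfolding B_def by auto
    have "inverse (real (Suc i)) \<le> inverse (real (Suc n))" using i by (intro le_imp_inverse_le) auto
    then have "inverse (real (Suc i)) < d / (\<sigma>0 * r)" using n by linarith
    then have "\<sigma> i * r < d" using \<sigma>0 r unfolding \<sigma>_def by (simp only: pos_less_divide_eq mult_pos_pos) (simp add: mult_ac)
    moreover have "\<sigma> i * r > 0" using \<sigma> r by simp
    ultimately show ?thesis using i(2) unfolding A_def by blast
   qed
   then show "t \<in> {t\<in>K. k t \<in> big f (b/16) v}" using tK unfolding big_def by blast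
  qed
  from sets.Int[OF K(1) big_vimage_sets[OF fc k, where \<epsilon> = "b/16" and v = v]]
  show "{t\<in>K. k t \<in> big f (b/16) v} \<in> sets lebN"
   using K(2) by (elim back_subst[of "\<lambda>S. S \<in> sets lebN"]) auto
 qed
 finally show ?thesis by (simp add: \<kappa>_def)
qed


section \<open>Surfaces with many large difference quotients\<close>

text \<open>Regularity along \<open>Q'\<close> allows the quotient along \<open>u\<close> to be
  compared with that along \<open>z\<close>, the main error being the increment along the tail
  \<open>u - z\<close>. Were all such increments small, uniform differentiability along
  \<open>Q'\<close> would carry over to \<open>Q\<close>.\<close>

lemma fd_failure_tail:
 fixes f :: "'x::real_normed_vector \<Rightarrow> 'y::real_normed_vector"
 assumes x: "\<not> fdq f Q e x" "x \<in> Reg f Q'" and e: "e > 0" and M: "0 \<le> M"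
  and Q: "\<And>u. u \<in> Q \<Longrightarrow> \<exists>z\<in>Q'. u - z \<in> T" and T: "\<And>v. v \<in> T \<Longrightarrow> norm v \<le> M" and d: "d > 0"
 shows "\<exists>r v. 0 < r \<and> r < d \<and> v \<in> T \<and> norm (f (x + r *\<^sub>R v) - f x) \<ge> e/8 * r"
proof (rule ccontr)
 assume "\<not> ?thesis"
 then have small: "norm (f (x + r *\<^sub>R v) - f x) \<le> e/8 * r" if "0 < r" "r < d" "v \<in> T" for r v
  using that by (meson linear)
 define \<epsilon> where "\<epsilon> = e / (8 * (M + 1))"
 have \<epsilon>: "\<epsilon> > 0" "\<epsilon> * (1 + M) = e / 8" using e M by (auto simp: \<epsilon>_def field_simps)
 have "fdq f Q' (e/4) x" "regq f Q' \<epsilon> x" using x(2) e \<epsilon>(1) by (auto simp: Reg_def)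
 then obtain d1 d2 where d1: "d1 > 0" "\<And>s s' u. 0 < s \<Longrightarrow> s < d1 \<Longrightarrow> 0 < s' \<Longrightarrow> s' < d1 \<Longrightarrow> u \<in> Q' \<Longrightarrow>
    norm (quot f x u s - quot f x u s') \<le> e/4"
  and d2: "d2 > 0" "\<And>s w u. 0 < s \<Longrightarrow> s < d2 \<Longrightarrow> norm w < d2 \<Longrightarrow> u \<in> Q' \<Longrightarrow>
    norm (f (x + w + s *\<^sub>R u) - f (x + w) - (f (x + s *\<^sub>R u) - f x)) \<le> \<epsilon> * (s + norm w)"
  by (elim fdqE regqE) blast
 define d3 where "d3 = min d (min d1 (d2 / (M + 1)))"
 have d3: "d3 > 0" using d d1 d2 M by (simp add: d3_def)
 have cmp: "norm (quot f x u s - quot f x z s) \<le> e/4" if s: "0 < s" "s < d3" and z: "z \<in> Q'" "u - z \<in> T" for u z s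
 proof -
  have sd: "s * (M + 1) < d2" using s M by (simp add: d3_def pos_less_divide_eq)
  have nv: "norm (u - z) \<le> M" by (rule T[OF z(2)])
  have w1: "norm (s *\<^sub>R (u - z)) \<le> s * M" using nv s by simp
  have "s * M + s < d2" "0 \<le> s * M" using sd s M by (auto simp: distrib_left)
  then have "s < d2" "norm (s *\<^sub>R (u - z)) < d2" using w1 s by linarith+
  then have "norm (f (x + s *\<^sub>R (u - z) + s *\<^sub>R z) - f (x + s *\<^sub>R (u - z)) - (f (x + s *\<^sub>R z) - f x)) \<le> \<epsilon> * (s + norm (s *\<^sub>R (u - z)))"
   using s z by (intro d2(2)) auto
  also have "\<dots> \<le> \<epsilon> * (s + s * M)" using w1 \<epsilon>(1) by (intro mult_left_mono) auto
  also have "\<dots> = (\<epsilon> * (1 + M)) * s" by (simp add: algebra_simps)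
  finally have 1: "norm (f (x + s *\<^sub>R (u - z) + s *\<^sub>R z) - f (x + s *\<^sub>R (u - z)) - (f (x + s *\<^sub>R z) - f x)) \<le> e/8 * s"
   unfolding \<epsilon>(2) .
  have 2: "norm (f (x + s *\<^sub>R (u - z)) - f x) \<le> e/8 * s" using s z by (intro small) (auto simp: d3_def)
  have "f (x + s *\<^sub>R u) - f x - (f (x + s *\<^sub>R z) - f x)
    = (f (x + s *\<^sub>R (u - z) + s *\<^sub>R z) - f (x + s *\<^sub>R (u - z)) - (f (x + s *\<^sub>R z) - f x)) + (f (x + s *\<^sub>R (u - z)) - f x)"
   by (simp add: algebra_simps)
  then have "norm (f (x + s *\<^sub>R u) - f x - (f (x + s *\<^sub>R z) - f x)) \<le> e/8 * s + e/8 * s"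
   using norm_triangle_mono[OF 1 2] by (simp only:)
  then have "norm (f (x + s *\<^sub>R u) - f x - (f (x + s *\<^sub>R z) - f x)) / s \<le> e/4 * s / s"
   using s by (intro divide_right_mono) auto
  moreover have "quot f x u s - quot f x z s = (f (x + s *\<^sub>R u) - f x - (f (x + s *\<^sub>R z) - f x)) /\<^sub>R s"
   unfolding quot_def by (simp only: scaleR_right_diff_distrib)
  then have "norm (quot f x u s - quot f x z s) = norm (f (x + s *\<^sub>R u) - f x - (f (x + s *\<^sub>R z) - f x)) / s"
   using s by (simp only: norm_scaleR) (simp add: divide_inverse mult.commute)
  ultimately show ?thesis using s by simp
 qed
 have "fdq f Q e x"
  unfolding fdq_def
 proof (intro exI conjI allI impI ballI, rule d3)
  fix s s' u assume s: "0 < s \<and> s < d3 \<and> 0 < s' \<and> s' < d3" and "u \<in> Q"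
  then obtain z where z: "z \<in> Q'" "u - z \<in> T" using Q by blast
  have 1: "norm (quot f x u s - quot f x z s) \<le> e/4" by (rule cmp[OF _ _ z]) (use s in auto)
  have 2: "norm (quot f x u s' - quot f x z s') \<le> e/4" by (rule cmp[OF _ _ z]) (use s in auto)
  have 3: "norm (quot f x z s - quot f x z s') \<le> e/4" using s z by (intro d1(2)) (auto simp: d3_def)
  have "quot f x u s - quot f x u s' = (quot f x u s - quot f x z s) + (quot f x z s - quot f x z s') - (quot f x u s' - quot f x z s')"
   by simp
  also have "norm \<dots> \<le> e/4 + e/4 + e/4"
   by (intro order_trans[OF norm_triangle_ineq4] add_mono order_trans[OF norm_triangle_ineq] 1 2 3)
  finally show "norm (quot f x u s - quot f x u s') \<le> e" using e by linarith
 qed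
 then show False using x(1) by blast
qed

text \<open>Largeness that survives: it is asserted for all surfaces near \<open>h\<close> on
  \<open>C\<close>, in values and the first \<open>\<nu>\<close> derivatives, because
  \<open>h\<close> is still to be perturbed infinitely often. Only a proportion
  \<open>\<kappa>\<close> of \<open>C\<close> is claimed.\<close>

definition robust :: "('x::real_normed_vector \<Rightarrow> 'y::real_normed_vector) \<Rightarrow> real \<Rightarrow> real \<Rightarrow> 'x set \<Rightarrow> nat \<Rightarrow> real
  \<Rightarrow> ((nat \<Rightarrow> real) \<Rightarrow> 'x) \<Rightarrow> (nat \<Rightarrow> real) set \<Rightarrow> bool" where
 "robust f \<epsilon> \<kappa> V \<nu> \<rho> h C \<longleftrightarrow> (\<forall>k\<in>GammaX.
   (\<forall>t\<in>C. norm (k t - h t) \<le> \<rho> \<and> (\<forall>j<\<nu>. norm (pderiv k j t - pderiv h j t) \<le> \<rho>)) \<longrightarrow>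
   \<kappa> * measure lebN C \<le> measure lebN {t\<in>C. \<exists>v\<in>V. k t \<in> big f \<epsilon> v})"

lemma big_union_sets:
 assumes "continuous_on UNIV f" "k \<in> GammaX" "finite V" "C \<in> sets lebN" "C \<subseteq> cubeT"
 shows "{t\<in>C. \<exists>v\<in>V. k t \<in> big f \<epsilon> v} \<in> sets lebN"
proof -
 have "C \<inter> (\<Union>v\<in>V. {t\<in>cubeT. k t \<in> big f \<epsilon> v}) \<in> sets lebN"
  using assms(3,4) big_vimage_sets[OF assms(1,2)] by (intro sets.Int sets.finite_UN) auto
 moreover have "C \<inter> (\<Union>v\<in>V. {t\<in>cubeT. k t \<in> big f \<epsilon> v}) = {t\<in>C. \<exists>v\<in>V. k t \<in> big f \<epsilon> v}" using assms(5) by blast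
 ultimately show ?thesis by simp
qed

lemma robust_shift:
 assumes "robust f \<epsilon> \<kappa> V \<nu> \<rho> h C" "\<nu> \<le> \<nu>'" "\<rho>' + \<delta> \<le> \<rho>"
  and "\<And>t. t \<in> C \<Longrightarrow> norm (h' t - h t) \<le> \<delta>" "\<And>t j. t \<in> C \<Longrightarrow> j < \<nu> \<Longrightarrow> norm (pderiv h' j t - pderiv h j t) \<le> \<delta>"
 shows "robust f \<epsilon> \<kappa> V \<nu>' \<rho>' h' C"
 unfolding robust_def
proof (intro ballI impI)
 have tri: "norm (x - z) \<le> \<rho>" if "norm (x - y) \<le> \<rho>'" "norm (y - z) \<le> \<delta>" for x y z :: 'a
  using norm_diff_triangle_le[OF that] assms(3) by linarith
 fix k assume k: "k \<in> GammaX" and c: "\<forall>t\<in>C. norm (k t - h' t) \<le> \<rho>' \<and> (\<forall>j<\<nu>'. norm (pderiv k j t - pderiv h' j t) \<le> \<rho>')"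
 have "norm (k t - h t) \<le> \<rho>" if t: "t \<in> C" for t
  using c t by (intro tri[OF _ assms(4)[OF t]]) auto
 moreover have "norm (pderiv k j t - pderiv h j t) \<le> \<rho>" if t: "t \<in> C" "j < \<nu>" for t j
  using c t assms(2) by (intro tri[OF _ assms(5)[OF t]]) auto
 ultimately show "\<kappa> * measure lebN C \<le> measure lebN {t\<in>C. \<exists>v\<in>V. k t \<in> big f \<epsilon> v}"
  using assms(1) k unfolding robust_def by blast
qed

lemma robust_Un:
 assumes fc: "continuous_on UNIV f"
  and 1: "robust f \<epsilon> \<kappa> V \<nu> \<rho> h C" "finite V" "C \<in> sets lebN" "C \<subseteq> cubeT"
  and 2: "robust f \<epsilon> \<kappa> V' \<nu>' \<rho>' h C'" "finite V'" "C' \<in> sets lebN" "C' \<subseteq> cubeT" and disj: "C \<inter> C' = {}"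
 shows "robust f \<epsilon> \<kappa> (V \<union> V') (max \<nu> \<nu>') (min \<rho> \<rho>') h (C \<union> C')"
 unfolding robust_def
proof (intro ballI impI)
 fix k assume k: "k \<in> GammaX"
  and c: "\<forall>t\<in>C \<union> C'. norm (k t - h t) \<le> min \<rho> \<rho>' \<and> (\<forall>j<max \<nu> \<nu>'. norm (pderiv k j t - pderiv h j t) \<le> min \<rho> \<rho>')"
 let ?A = "{t\<in>C. \<exists>v\<in>V. k t \<in> big f \<epsilon> v}" and ?B = "{t\<in>C'. \<exists>v\<in>V'. k t \<in> big f \<epsilon> v}"
 have m: "?A \<in> sets lebN" "?B \<in> sets lebN" using big_union_sets[OF fc k] 1 2 by auto
 have "\<kappa> * measure lebN C \<le> measure lebN ?A" using 1(1) k c unfolding robust_def by auto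
 moreover have "\<kappa> * measure lebN C' \<le> measure lebN ?B" using 2(1) k c unfolding robust_def by auto
 moreover have "measure lebN (C \<union> C') = measure lebN C + measure lebN C'"
  using 1 2 disj by (intro lebN.finite_measure_Union) auto
 moreover have "measure lebN (?A \<union> ?B) = measure lebN ?A + measure lebN ?B"
  using m disj by (intro lebN.finite_measure_Union) auto
 moreover have "measure lebN (?A \<union> ?B) \<le> measure lebN {t\<in>C \<union> C'. \<exists>v\<in>V \<union> V'. k t \<in> big f \<epsilon> v}"
  using 1 2 by (intro lebN.finite_measure_mono big_union_sets[OF fc k]) auto
 ultimately show "\<kappa> * measure lebN (C \<union> C') \<le> measure lebN {t\<in>C \<union> C'. \<exists>v\<in>V \<union> V'. k t \<in> big f \<epsilon> v}"
  by (simp add: distrib_left)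
qed

lemma robust_UN:
 fixes f :: "'x::real_normed_vector \<Rightarrow> 'y::real_normed_vector"
 assumes fc: "continuous_on UNIV f" and F: "finite F"
  and K: "\<And>q. q \<in> F \<Longrightarrow> \<exists>\<rho>>0. robust f \<epsilon> \<kappa> {v q} \<nu> \<rho> h (K q)" "\<And>q. q \<in> F \<Longrightarrow> K q \<in> sets lebN" "\<And>q. q \<in> F \<Longrightarrow> K q \<subseteq> cubeT"
  and disj: "\<And>q q'. q \<in> F \<Longrightarrow> q' \<in> F \<Longrightarrow> q \<noteq> q' \<Longrightarrow> K q \<inter> K q' = {}"
 shows "\<exists>\<rho>>0. robust f \<epsilon> \<kappa> (v ` F) \<nu> \<rho> h (\<Union>q\<in>F. K q)"
 using F K disj
proof (induction F rule: finite_induct)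
 case empty
 show ?case by (intro exI[of _ 1]) (auto simp: robust_def)
next
 case (insert q F)
 then obtain \<rho> where \<rho>: "\<rho> > 0" "robust f \<epsilon> \<kappa> (v ` F) \<nu> \<rho> h (\<Union>q\<in>F. K q)" by auto
 obtain \<rho>' where \<rho>': "\<rho>' > 0" "robust f \<epsilon> \<kappa> {v q} \<nu> \<rho>' h (K q)" using insert.prems(1) by blast
 have "robust f \<epsilon> \<kappa> ({v q} \<union> v ` F) (max \<nu> \<nu>) (min \<rho>' \<rho>) h (K q \<union> (\<Union>q\<in>F. K q))"
 proof (rule robust_Un[OF fc \<rho>'(2) _ _ _ \<rho>(2)])
  show "K q \<inter> (\<Union>q\<in>F. K q) = {}" using insert.hyps(2) insert.prems(4) by blast
  show "(\<Union>q\<in>F. K q) \<in> sets lebN" using insert.hyps(1) insert.prems(2) by (intro sets.finite_UN) auto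
 qed (use insert in auto)
 then show ?case using \<rho>(1) \<rho>'(1) by (intro exI[of _ "min \<rho>' \<rho>"]) auto
qed

text \<open>A nearby surface changes the increment \<open>2 * b * r\<close> over the coordinate
  \<open>m\<close> and the slope \<open>r *\<^sub>R v\<close> by a small fraction only, so
  \<open>big_measure\<close> applies to it with \<open>b\<close>.\<close>

lemma robust_bump:
 fixes f :: "'x::real_normed_vector \<Rightarrow> 'y::banach"
 assumes f: "C-lipschitz_on UNIV f" and K: "K \<in> sets lebN" "K \<subseteq> cubeT"
  and inv: "\<And>s \<tau>. s \<in> K \<Longrightarrow> \<tau> \<in> {0..1} \<Longrightarrow> s(m := \<tau>) \<in> K"
  and r: "r > 0" and b: "b > 0" and v: "norm v \<le> M"
  and inc: "\<And>s. s \<in> K \<Longrightarrow> norm (f (h (s(m := 1))) - f (h (s(m := 0)))) \<ge> 2 * b * r"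
  and der: "\<And>s. s \<in> K \<Longrightarrow> pderiv h m s = r *\<^sub>R v"
 shows "\<exists>\<rho>>0. robust f (b/16) (b / (4 * (C * (M + 1) + 1))) {v} (Suc m) \<rho> h K"
proof -
 have C: "0 \<le> C" using f by (rule lipschitz_on_nonneg)
 have fl: "norm (f x - f y) \<le> C * norm (x - y)" for x y
  using lipschitz_onD[OF f, of x y] by (simp add: dist_norm)
 define \<zeta> where "\<zeta> = min 1 (b / (8 * (C + 1)))"
 have \<zeta>: "\<zeta> > 0" "\<zeta> \<le> 1" using b C by (auto simp: \<zeta>_def)
 have C\<zeta>: "C * \<zeta> \<le> b / 8"
 proof -
  have "C * \<zeta> \<le> (C + 1) * (b / (8 * (C + 1)))" using C \<zeta>(1) by (intro mult_mono) (auto simp: \<zeta>_def)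
  also have "\<dots> = b / 8" using C by (simp add: field_simps)
  finally show ?thesis .
 qed
 have "robust f (b/16) (b / (4 * (C * (M + 1) + 1))) {v} (Suc m) (\<zeta> * r) h K"
  unfolding robust_def
 proof (intro ballI impI)
  fix k assume k: "k \<in> GammaX"
   and c: "\<forall>t\<in>K. norm (k t - h t) \<le> \<zeta> * r \<and> (\<forall>j<Suc m. norm (pderiv k j t - pderiv h j t) \<le> \<zeta> * r)"
  have fk: "norm (f (k t) - f (h t)) \<le> b / 8 * r" if "t \<in> K" for t
  proof -
   have "norm (f (k t) - f (h t)) \<le> C * (\<zeta> * r)"
    using fl[of "k t" "h t"] c that C by (meson mult_left_mono order_trans)
   also have "\<dots> \<le> b / 8 * r" using mult_right_mono[OF C\<zeta>, of r] r by (simp add: mult.assoc)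
   finally show ?thesis .
  qed
  have "b / (4 * (C * (M + 1) + 1)) * measure lebN K \<le> measure lebN {t\<in>K. k t \<in> big f (b/16) v}"
  proof (rule big_measure[OF f k K inv r b \<zeta>(2) C\<zeta> v])
   fix s assume s: "s \<in> K"
   let ?a = "s(m := 1)" and ?b = "s(m := 0)"
   have "?a \<in> K" "?b \<in> K" using inv[OF s] by auto
   note ab = fk[OF this(1)] fk[OF this(2)]
   have "f (h ?a) - f (h ?b) = (f (k ?a) - f (k ?b)) - (f (k ?a) - f (h ?a)) + (f (k ?b) - f (h ?b))" by simp
   then have "norm (f (h ?a) - f (h ?b)) \<le> norm (f (k ?a) - f (k ?b)) + b / 8 * r + b / 8 * r"
    using norm_diff_add_le[OF order_refl ab, of "f (k ?a) - f (k ?b)"] by (simp only:)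
   moreover have "b / 8 * r + b / 8 * r \<le> b * r" using b r by simp
   ultimately show "b * r \<le> norm (f (k ?a) - f (k ?b))" using inc[OF s] by linarith
   show "norm (pderiv k m s - r *\<^sub>R v) \<le> \<zeta> * r" using c s der[OF s] by (metis lessI)
  qed
  then show "b / (4 * (C * (M + 1) + 1)) * measure lebN K \<le> measure lebN {t\<in>K. \<exists>v\<in>{v}. k t \<in> big f (b/16) v}" by simp
 qed
 then show ?thesis using \<zeta> r by (intro exI[of _ "\<zeta> * r"]) auto
qed

text \<open>In contrast to porosity, the bumps are multiplied by a fresh coordinate
  \<open>t m\<close>, freed by truncation. On a core this coordinate sweeps a translate of the
  segment from 0 to \<open>r q *\<^sub>R v q\<close>, over which \<open>f\<close> has a large
  increment; hence large quotients at small scales occur on a definite proportion of the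
  core.\<close>

lemma bump_substage:
 fixes f :: "'x::banach \<Rightarrow> 'y::banach" and \<epsilon> :: real
 defines "b \<equiv> \<epsilon> / 4"
 assumes \<Phi>: "norming \<Phi>" and \<S>: "directed \<S>" and M: "0 \<le> M" and f: "A-lipschitz_on UNIV f"
  and g: "g \<in> GammaX" and S: "S \<in> \<S>" and con: "controlled \<Phi> n S a H g0 g"
  and Lg: "\<And>t j. t \<in> cubeT \<Longrightarrow> j < n \<Longrightarrow> norm (pderiv g j t) \<le> L" and L: "L \<ge> 0"
  and B: "B \<subseteq> cubeT" "\<tau> < oT B" and C: "compact C" "C \<subseteq> cubeT" and BC: "B \<inter> C = {}"
  and P: "\<And>t d. t \<in> B \<Longrightarrow> d > 0 \<Longrightarrow> \<exists>r v. 0 < r \<and> r < d \<and> (v \<in> Tail \<Phi> \<S> S \<theta> M \<and> norm (f (g t + r *\<^sub>R v) - f (g t)) \<ge> \<epsilon> * r)"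
  and \<epsilon>: "\<epsilon> > 0" and \<eta>: "\<eta> > 0" "\<eta> * M \<le> H" and \<theta>: "\<theta> > 0" and \<delta>: "\<delta> > 0"
  and rob: "robust f (b/16) (b / (4 * (A * (M + 1) + 1))) V \<nu> \<rho> g C" "finite V" "\<rho> > 0"
 shows "\<exists>h S' V' C' \<nu>' \<rho>'. h \<in> GammaX \<and> S' \<in> \<S> \<and> S \<subseteq> S' \<and> controlled \<Phi> n S' (a + \<delta> + \<eta> * \<theta>) H g0 h \<and>
  finite V' \<and> V \<subseteq> V' \<and> V' - V \<subseteq> Tail \<Phi> \<S> S \<theta> M \<and> (\<forall>v\<in>V' - V. \<forall>\<phi>\<in>\<Phi> - S'. \<bar>\<phi> v\<bar> \<le> \<theta>) \<and>
  compact C' \<and> C' \<subseteq> cubeT \<and> \<rho>' > 0 \<and> robust f (b/16) (b / (4 * (A * (M + 1) + 1))) V' \<nu>' \<rho>' h C' \<and>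
  measure lebN C + stage_ratio n L (\<epsilon> / (4 * (A + 1))) \<eta> * \<tau> \<le> measure lebN C'"
proof -
 have A: "0 \<le> A" using f by (rule lipschitz_on_nonneg)
 have fl: "norm (f x - f y) \<le> A * norm (x - y)" for x y
  using lipschitz_onD[OF f, of x y] by (simp add: dist_norm)
 have fc: "continuous_on UNIV f" using f by (rule lipschitz_on_continuous_on)
 \<comment> \<open>Replacing the centre by a point of the core changes each end of the increment by
   at most \<open>\<epsilon> / 4 * r\<close>, so \<open>\<epsilon> / 2 * r = 2 * b * r\<close> is
   left.\<close>
 define \<kappa> where "\<kappa> = \<epsilon> / (4 * (A + 1))"
 have \<kappa>: "\<kappa> > 0" using \<epsilon> A by (simp add: \<kappa>_def)
 have A\<kappa>: "A * \<kappa> \<le> \<epsilon> / 4"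
 proof -
  have "A * \<kappa> \<le> (A + 1) * \<kappa>" using \<kappa> by (intro mult_right_mono) auto
  also have "\<dots> = \<epsilon> / 4" using A by (simp add: \<kappa>_def field_simps)
  finally show ?thesis .
 qed
 define T where "T = Tail \<Phi> \<S> S \<theta> M"
 have "\<exists>F v r \<phi> K Sp m. stage_data g n B C (\<lambda>t v r. v \<in> T \<and> norm (f (g t + r *\<^sub>R v) - f (g t)) \<ge> \<epsilon> * r) \<kappa> \<eta> \<eta>
   (stage_ratio n L \<kappa> \<eta> * \<tau>) F v r \<phi> K Sp m"
  by (rule stage[OF g Lg L B compact_imp_closed[OF C(1)] BC P[folded T_def] \<kappa> \<eta>(1) \<eta>(1)])
 then obtain F v r \<phi> K Sp m0 where "stage_data g n B C (\<lambda>t v r. v \<in> T \<and> norm (f (g t + r *\<^sub>R v) - f (g t)) \<ge> \<epsilon> * r) \<kappa> \<eta> \<eta>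
   (stage_ratio n L \<kappa> \<eta> * \<tau>) F v r \<phi> K Sp m0"
  by blast
 note sd = stage_dataD[OF this]
 have F: "finite F" "F \<subseteq> B" by (rule sd(1), rule sd(2))
 have F1: "\<forall>q\<in>F. v q \<in> T \<and> norm (f (g q + r q *\<^sub>R v q) - f (g q)) \<ge> \<epsilon> * r q \<and> 0 < r q \<and> r q < \<eta> \<and> \<phi> q \<in> GammaX \<and>
   K q \<in> sets lebN \<and> closed (K q) \<and> K q \<subseteq> Sp q \<inter> cubeT \<and> Sp q \<inter> C = {}"
  using sd(4-12) by blast
 have F2: "\<forall>q\<in>F. \<forall>s\<in>cubeT. 0 \<le> \<phi> q s \<and> \<phi> q s \<le> 1 \<and> (\<forall>j<n. \<bar>pderiv (\<phi> q) j s\<bar> * r q \<le> \<eta>) \<and>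
   (\<forall>j\<ge>m0. pderiv (\<phi> q) j s = 0) \<and> (s \<notin> Sp q \<longrightarrow> \<phi> q s = 0 \<and> (\<forall>j. pderiv (\<phi> q) j s = 0))"
  using sd(13-17) by blast
 have F3: "\<forall>q\<in>F. \<forall>s\<in>K q. \<phi> q s = 1 \<and> norm (g s - g q) \<le> \<kappa> * r q" using sd(18,19) by blast
 have F4: "\<forall>q\<in>F. \<forall>q'\<in>F. q \<noteq> q' \<longrightarrow> Sp q \<inter> Sp q' = {}" using sd(20) by blast
 note F5 = sd(3) and F6 = sd(22)
 \<comment> \<open>Half of the tolerance \<open>\<rho>\<close> is spent on truncation; robustness on
   \<open>C\<close> survives with the other half.\<close>
 define \<delta>' where "\<delta>' = min \<delta> (\<rho> / 2)"
 have \<delta>': "\<delta>' > 0" "\<delta>' \<le> \<delta>" "\<delta>' \<le> \<rho> / 2" using \<delta> rob(3) by (auto simp: \<delta>'_def)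
 obtain N where N: "\<And>m. m \<ge> N \<Longrightarrow> close (max n \<nu>) \<delta>' g (trunc m g)" using trunc_close[OF g \<delta>'(1)] by blast
 \<comment> \<open>Beyond \<open>n\<close>, so the new derivative is not among those watched, and
   beyond \<open>m0\<close>, so bumps and cores ignore this coordinate.\<close>
 define m where "m = max N (max n m0)"
 define G where "G = trunc m g"
 have GG: "G \<in> GammaX" unfolding G_def by (rule trunc_GammaX(1)[OF g])
 have Gcl: "close (max n \<nu>) \<delta>' g G" unfolding G_def by (rule N) (simp add: m_def)
 have conG: "controlled \<Phi> n S (a + \<delta>) H g0 G"
  by (rule controlled_adjust[OF \<Phi> con close_mono[OF Gcl]]) (use \<delta>' in auto)
 have mm: "n \<le> m" "m0 \<le> m" by (auto simp: m_def)
 define c where "c = ext (\<lambda>t :: nat \<Rightarrow> real. t m *\<^sub>R (1::real))"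
 have cG: "c \<in> GammaX" unfolding c_def by (rule GammaX_coord_scaleR(1))
 have cv: "c t = t m" "pderiv c j t = (if j = m then 1 else 0)" if "t \<in> cubeT" for t j
  using that by (simp add: c_def ext_def, simp only: c_def GammaX_coord_scaleR(2)[OF that])
 have c01: "0 \<le> t m" "t m \<le> 1" if "t \<in> cubeT" for t :: "nat \<Rightarrow> real" using that by (auto simp: cubeT_def)
 define \<psi> where "\<psi> q = (\<lambda>t. \<phi> q t * c t)" for q
 have \<psi>G: "\<psi> q \<in> GammaX" if "q \<in> F" for q unfolding \<psi>_def by (rule GammaX_mult(1)[OF _ cG]) (use F1 that in blast)
 have \<psi>: "\<psi> q t = \<phi> q t * t m" "pderiv (\<psi> q) j t = (if j = m then \<phi> q t else pderiv (\<phi> q) j t * t m)" if "q \<in> F" "t \<in> cubeT" for q t j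
 proof -
  show "\<psi> q t = \<phi> q t * t m" using that by (simp add: \<psi>_def cv)
  have "\<phi> q \<in> GammaX" "\<forall>j\<ge>m0. pderiv (\<phi> q) j t = 0" using F1 F2 that by blast+
  then show "pderiv (\<psi> q) j t = (if j = m then \<phi> q t else pderiv (\<phi> q) j t * t m)"
   using GammaX_mult(2)[OF _ cG that(2), of "\<phi> q" j] that(2) mm(2) unfolding \<psi>_def by (simp add: cv)
 qed
 have zero: "\<phi> q s = 0 \<and> (\<forall>j. pderiv (\<phi> q) j s = 0)" if "q \<in> F" "s \<in> cubeT" "s \<notin> Sp q" for q s
  using F2 that by blast
 have zero': "\<psi> q s = 0 \<and> (\<forall>j. pderiv (\<psi> q) j s = 0)" if "q \<in> F" "s \<in> cubeT" "s \<notin> Sp q" for q s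
  using zero[OF that] \<psi>[OF that(1,2)] by simp
 define h where "h = (\<lambda>t. G t + (\<Sum>q\<in>F. \<psi> q t *\<^sub>R (r q *\<^sub>R v q)))"
 have hG: "h \<in> GammaX" unfolding h_def by (rule GammaX_add_sum(1)[OF F(1) \<psi>G GG])
 have hd: "pderiv h j t = pderiv G j t + (\<Sum>q\<in>F. pderiv (\<psi> q) j t *\<^sub>R (r q *\<^sub>R v q))" if "t \<in> cubeT" for t j
  unfolding h_def by (rule GammaX_add_sum(2)[OF F(1) \<psi>G GG that])
 obtain S' where S': "S' \<in> \<S>" "S \<subseteq> S'" "\<And>q \<phi>. q \<in> F \<Longrightarrow> \<phi> \<in> \<Phi> - S' \<Longrightarrow> \<bar>\<phi> (v q)\<bar> \<le> \<theta>"
  using Tail_absorb[OF \<S> S F(1), of v \<Phi> \<theta> M \<theta>] F1 \<theta>(1) unfolding T_def by blast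
 have conh: "controlled \<Phi> n S' (a + \<delta> + \<eta> * \<theta>) H g0 h"
  unfolding h_def
 proof (rule controlled_bumps[OF \<Phi> conG GG F(1)])
  show "\<psi> q \<in> GammaX" if "q \<in> F" for q by (rule \<psi>G[OF that])
  show "(\<psi> q t = 0 \<and> (\<forall>j. pderiv (\<psi> q) j t = 0)) \<or> (\<psi> q' t = 0 \<and> (\<forall>j. pderiv (\<psi> q') j t = 0))"
   if "q \<in> F" "q' \<in> F" "q \<noteq> q'" "t \<in> cubeT" for q q' t
   using zero'[OF that(1,4)] zero'[OF that(2,4)] F4 that by blast
  show "\<bar>\<psi> q t\<bar> * r q \<le> \<eta>" if q: "q \<in> F" "t \<in> cubeT" for q t
  proof -
   have r: "0 \<le> \<phi> q t" "\<phi> q t \<le> 1" "0 < r q" "r q < \<eta>" using F1 F2 q by blast+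
   have "\<phi> q t * t m \<le> 1" using r c01[OF q(2)] by (simp add: mult_le_one)
   then have "\<bar>\<psi> q t\<bar> * r q \<le> 1 * \<eta>" using r c01[OF q(2)] unfolding \<psi>(1)[OF q] by (intro mult_mono) auto
   then show ?thesis by simp
  qed
  show "\<bar>pderiv (\<psi> q) j t\<bar> * r q \<le> \<eta>" if q: "q \<in> F" "t \<in> cubeT" "j < n" for q t j
  proof -
   have 1: "\<bar>pderiv (\<phi> q) j t\<bar> * r q \<le> \<eta>" "0 < r q" using F1 F2 q by blast+
   have "j \<noteq> m" using q(3) mm by simp
   then have "\<bar>pderiv (\<psi> q) j t\<bar> * r q = t m * (\<bar>pderiv (\<phi> q) j t\<bar> * r q)"
    using c01[OF q(2)] by (simp add: \<psi>(2)[OF q(1,2)] abs_mult)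
   also have "\<dots> \<le> 1 * \<eta>" using 1 c01[OF q(2)] \<eta>(1) by (intro mult_mono) auto
   finally show ?thesis by simp
  qed
  show "v q \<in> Tail \<Phi> \<S> S \<theta> M" if "q \<in> F" for q using F1 that unfolding T_def by blast
  show "0 \<le> r q" if "q \<in> F" for q using F1 that by (meson less_imp_le)
  show "\<eta> * M \<le> H" "0 \<le> \<theta>" "0 \<le> \<eta>" "0 \<le> M" using \<eta> \<theta> M by auto
 qed (use S' in auto)
 have single: "(\<Sum>q'\<in>F. z q' *\<^sub>R (r q' *\<^sub>R v q')) = z q *\<^sub>R (r q *\<^sub>R v q)"
  if "q \<in> F" "\<And>q'. q' \<in> F \<Longrightarrow> q' \<noteq> q \<Longrightarrow> z q' = 0" for q and z :: "_ \<Rightarrow> real"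
  using sum.remove[OF F(1) that(1), of "\<lambda>q'. z q' *\<^sub>R (r q' *\<^sub>R v q')"] that(2) by simp
 have other: "\<psi> q' t = 0" "pderiv (\<psi> q') j t = 0" if "q \<in> F" "t \<in> K q" "q' \<in> F" "q' \<noteq> q" for q q' t j
 proof -
  have "t \<in> cubeT" "t \<notin> Sp q'" using F1 F4 that by blast+
  then show "\<psi> q' t = 0" "pderiv (\<psi> q') j t = 0" using zero'[OF that(3)] by auto
 qed
 have Kinv: "s(m := \<tau>) \<in> K q" if q: "q \<in> F" and s: "s \<in> K q" and \<tau>: "\<tau> \<in> {0..1}" for q s \<tau>
 proof (rule F6[OF q _ _ _ s])
  have "s \<in> cubeT" using F1 q s by blast
  then show "s \<in> cubeT" "s(m := \<tau>) \<in> cubeT" using \<tau> by (auto simp: cubeT_def)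
 qed (use mm in auto)
 \<comment> \<open>At \<open>s\<close> the truncated surface takes the value of \<open>g\<close> at
   \<open>cut m s\<close>, which lies in the same core, so the estimates of the stage apply to
   it.\<close>
 have Kcut: "cut m s \<in> K q" if q: "q \<in> F" and s: "s \<in> K q" for q s
 proof (rule F6[OF q _ _ _ s])
  have "s \<in> cubeT" using F1 q s by blast
  then show "s \<in> cubeT" "cut m s \<in> cubeT" by (auto intro: cut_in_cubeT)
 qed (use mm in \<open>auto simp: cut_def\<close>)
 have robK: "\<exists>\<rho>>0. robust f (b/16) (b / (4 * (A * (M + 1) + 1))) {v q} (Suc m) \<rho> h (K q)" if q: "q \<in> F" for q
 proof (rule robust_bump[OF f])
  show "K q \<in> sets lebN" "K q \<subseteq> cubeT" "r q > 0" using F1 q by blast+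
  show "s(m := \<tau>) \<in> K q" if "s \<in> K q" "\<tau> \<in> {0..1}" for s \<tau> by (rule Kinv[OF q that])
  show "b > 0" using \<epsilon> by (simp add: b_def)
  have "v q \<in> T" using F1 q by blast
  then show "norm (v q) \<le> M" unfolding T_def Tail_def by blast
  fix s assume s: "s \<in> K q"
  have sc: "s \<in> cubeT" using F1 q s by blast
  have "pderiv G m s = 0" using trunc_GammaX(2)[OF g sc, of m m] by (simp add: G_def)
  moreover have "(\<Sum>q'\<in>F. pderiv (\<psi> q') m s *\<^sub>R (r q' *\<^sub>R v q')) = pderiv (\<psi> q) m s *\<^sub>R (r q *\<^sub>R v q)"
   by (rule single[OF q]) (rule other(2)[OF q s])
  moreover have "pderiv (\<psi> q) m s = 1" using \<psi>(2)[OF q sc, of m] F3 q s by simp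
  ultimately show "pderiv h m s = r q *\<^sub>R v q" unfolding hd[OF sc] by simp
  have hv: "h (s(m := \<tau>)) = g (cut m s) + \<tau> *\<^sub>R (r q *\<^sub>R v q)" if \<tau>: "\<tau> \<in> {0..1}" for \<tau>
  proof -
   let ?s = "s(m := \<tau>)"
   have sK: "?s \<in> K q" by (rule Kinv[OF q s \<tau>])
   then have sc': "?s \<in> cubeT" using F1 q by blast
   have "(\<Sum>q'\<in>F. \<psi> q' ?s *\<^sub>R (r q' *\<^sub>R v q')) = \<psi> q ?s *\<^sub>R (r q *\<^sub>R v q)"
    by (rule single[OF q]) (rule other(1)[OF q sK])
   moreover have "\<psi> q ?s = \<tau>" using \<psi>(1)[OF q sc'] F3 q sK by simp
   moreover have "cut m ?s = cut m s" by (auto simp: cut_def fun_eq_iff)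
   moreover have "G ?s = g (cut m ?s)" unfolding G_def by (rule trunc_eq[OF sc'])
   ultimately show ?thesis by (simp add: h_def)
  qed
  let ?x = "g (cut m s)" and ?v = "r q *\<^sub>R v q"
  have nx: "norm (?x - g q) \<le> \<kappa> * r q" using F3 q Kcut[OF q s] by blast
  have fe: "norm (f (?x + w) - f (g q + w)) \<le> \<epsilon> / 4 * r q" for w
  proof -
   have "norm (f (?x + w) - f (g q + w)) \<le> A * (\<kappa> * r q)"
    using fl[of "?x + w" "g q + w"] mult_left_mono[OF nx A] by simp
   also have "\<dots> \<le> \<epsilon> / 4 * r q" using mult_right_mono[OF A\<kappa>, of "r q"] F1 q by (auto simp: mult.assoc less_imp_le)
   finally show ?thesis .
  qed
  have "f (g q + ?v) - f (g q) = (f (?x + ?v) - f ?x) - (f (?x + ?v) - f (g q + ?v)) + (f (?x + 0) - f (g q + 0))" by simp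
  then have "norm (f (g q + ?v) - f (g q)) \<le> norm (f (?x + ?v) - f ?x) + \<epsilon> / 4 * r q + \<epsilon> / 4 * r q"
   using norm_diff_add_le[OF order_refl fe fe, of "f (?x + ?v) - f ?x" ?v 0] by (simp only:)
  moreover have "norm (f (g q + ?v) - f (g q)) \<ge> \<epsilon> * r q" using F1 q by blast
  moreover have "2 * b * r q = \<epsilon> * r q - \<epsilon> / 4 * r q - \<epsilon> / 4 * r q" by (simp add: b_def)
  ultimately have "2 * b * r q \<le> norm (f (?x + ?v) - f ?x)" by linarith
  then show "2 * b * r q \<le> norm (f (h (s(m := 1))) - f (h (s(m := 0))))" using hv[of 1] hv[of 0] by simp
 qed
 have Ks: "K q \<in> sets lebN" "K q \<subseteq> cubeT" if "q \<in> F" for q using F1 that by blast+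
 have Kdisj: "K q \<inter> K q' = {}" if "q \<in> F" "q' \<in> F" "q \<noteq> q'" for q q' using F1 F4 that by blast
 have "\<exists>\<rho>>0. robust f (b/16) (b / (4 * (A * (M + 1) + 1))) (v ` F) (Suc m) \<rho> h (\<Union>q\<in>F. K q)"
  by (rule robust_UN[OF fc F(1), where K = K and v = v]) (fact robK, fact Ks(1), fact Ks(2), fact Kdisj)
 then obtain \<rho>1 where \<rho>1: "\<rho>1 > 0" "robust f (b/16) (b / (4 * (A * (M + 1) + 1))) (v ` F) (Suc m) \<rho>1 h (\<Union>q\<in>F. K q)" by blast
 \<comment> \<open>The new bumps vanish on \<open>C\<close> with all derivatives, so there the
   surface has changed by truncation only.\<close>
 have hC: "h t = G t" "pderiv h j t = pderiv G j t" if t: "t \<in> C" for t j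
 proof -
  have tc: "t \<in> cubeT" using C(2) t by blast
  have "\<psi> q t = 0 \<and> (\<forall>j. pderiv (\<psi> q) j t = 0)" if "q \<in> F" for q
   by (rule zero'[OF that tc]) (use F1 that t in blast)
  then show "h t = G t" "pderiv h j t = pderiv G j t" unfolding hd[OF tc] by (auto simp: h_def)
 qed
 have robC: "robust f (b/16) (b / (4 * (A * (M + 1) + 1))) V \<nu> (\<rho> / 2) h C"
 proof (rule robust_shift[OF rob(1) order_refl, where \<delta> = "\<rho> / 2"])
  show "norm (h t - g t) \<le> \<rho> / 2" if "t \<in> C" for t
   using Gcl \<delta>'(3) that C(2) unfolding hC(1)[OF that] close_def by fastforce
  show "norm (pderiv h j t - pderiv g j t) \<le> \<rho> / 2" if "t \<in> C" "j < \<nu>" for t j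
  proof -
   have "t \<in> cubeT" "j < max n \<nu>" using that C(2) by auto
   then have "norm (pderiv G j t - pderiv g j t) \<le> \<delta>'" using Gcl unfolding close_def by blast
   then show ?thesis unfolding hC(2)[OF that(1)] using \<delta>'(3) by linarith
  qed
 qed simp
 define C' where "C' = C \<union> (\<Union>q\<in>F. K q)"
 have Cs: "C \<in> sets lebN" by (rule sets_lebN_compact[OF C(1,2)])
 have Us: "(\<Union>q\<in>F. K q) \<in> sets lebN" using Ks(1) F(1) by (intro sets.finite_UN) auto
 have Uc: "(\<Union>q\<in>F. K q) \<subseteq> cubeT" using Ks(2) by blast
 have CU: "C \<inter> (\<Union>q\<in>F. K q) = {}" using F1 by blast
 have robC': "robust f (b/16) (b / (4 * (A * (M + 1) + 1))) (V \<union> v ` F) (max \<nu> (Suc m)) (min (\<rho> / 2) \<rho>1) h C'"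
  unfolding C'_def by (rule robust_Un[OF fc robC rob(2) Cs C(2) \<rho>1(2) finite_imageI[OF F(1)] Us Uc CU])
 have Kc: "compact (K q)" if "q \<in> F" for q
 proof -
  have "closed (K q)" "K q \<subseteq> cubeT" using F1 that by blast+
  then show ?thesis using compact_Int_closed[OF compact_cubeT, of "K q"] by (simp add: Int_absorb1)
 qed
 have C'c: "compact C'" "C' \<subseteq> cubeT" unfolding C'_def using C F(1) Kc Uc by (auto intro!: compact_Un compact_UN)
 have meas: "measure lebN C + stage_ratio n L \<kappa> \<eta> * \<tau> \<le> measure lebN C'"
 proof -
  have "measure lebN C' = measure lebN C + measure lebN (\<Union>q\<in>F. K q)"
   unfolding C'_def using Cs Us CU by (intro lebN.finite_measure_Union) auto
  also have "measure lebN (\<Union>q\<in>F. K q) = (\<Sum>q\<in>F. measure lebN (K q))"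
  proof (rule lebN.finite_measure_finite_Union[OF F(1)])
   show "K ` F \<subseteq> sets lebN" using Ks by blast
   show "disjoint_family_on K F" unfolding disjoint_family_on_def using Kdisj by blast
  qed
  finally show ?thesis using F5 by linarith
 qed
 have vT: "v ` F \<subseteq> T" "\<forall>w\<in>v ` F. \<forall>\<phi>\<in>\<Phi> - S'. \<bar>\<phi> w\<bar> \<le> \<theta>" using F1 S'(3) by blast+
 show ?thesis
 proof (intro exI conjI)
  show "h \<in> GammaX" "S' \<in> \<S>" "S \<subseteq> S'" "controlled \<Phi> n S' (a + \<delta> + \<eta> * \<theta>) H g0 h" by fact+
  show "finite (V \<union> v ` F)" using rob(2) F(1) by simp
  show "V \<union> v ` F - V \<subseteq> Tail \<Phi> \<S> S \<theta> M" using vT(1) unfolding T_def by blast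
  show "\<forall>w\<in>V \<union> v ` F - V. \<forall>\<phi>\<in>\<Phi> - S'. \<bar>\<phi> w\<bar> \<le> \<theta>" using vT(2) by blast
  show "compact C'" "C' \<subseteq> cubeT" by fact+
  show "min (\<rho> / 2) \<rho>1 > 0" using rob(3) \<rho>1(1) by simp
  show "robust f (b/16) (b / (4 * (A * (M + 1) + 1))) (V \<union> v ` F) (max \<nu> (Suc m)) (min (\<rho> / 2) \<rho>1) h C'" by fact
  show "measure lebN C + stage_ratio n L (\<epsilon> / (4 * (A + 1))) \<eta> * \<tau> \<le> measure lebN C'" using meas unfolding \<kappa>_def .
 qed simp
qed


lemma Tail_mono: "S \<subseteq> S' \<Longrightarrow> \<theta>' \<le> \<theta> \<Longrightarrow> Tail \<Phi> \<S> S' \<theta>' M \<subseteq> Tail \<Phi> \<S> S \<theta> M"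
 unfolding Tail_def by (intro Collect_mono impI conjI) (blast intro: order_trans)+

lemma controlled_mono:
 assumes "norming \<Phi>" "controlled \<Phi> n S a H g0 g" "a \<le> a'"
 shows "controlled \<Phi> n S a' H g0 g"
 using controlled_adjust[OF assms(1,2) close_refl[of "a' - a"]] assms(3) by simp

text \<open>Iterates the previous step until the treated set \<open>C\<close> has measure
  \<open>\<tau>/2\<close>. As long as it has not, the points of failure outside \<open>C\<close>
  still have outer measure above \<open>\<tau>/2\<close>, so each step gains at least
  \<open>\<rho> * (\<tau>/2)\<close> and \<open>I\<close> steps suffice.\<close>

lemma bump_stage:
 fixes f :: "'x::banach \<Rightarrow> 'y::banach"
 assumes \<Phi>: "norming \<Phi>" and \<S>: "directed \<S>" and M: "0 \<le> M" and f: "A-lipschitz_on UNIV f"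
  and \<epsilon>: "\<epsilon> > 0" and \<tau>: "\<tau> > 0"
  and nm: "\<And>W' G. gamma_open W' \<Longrightarrow> W' \<noteq> {} \<Longrightarrow> W' \<subseteq> W \<Longrightarrow> gamma_residual G \<Longrightarrow>
   \<exists>g\<in>W' \<inter> G. om g {x. \<not> fdq f Q (8 * \<epsilon>) x} > \<tau>"
  and Q: "\<And>S \<theta>. S \<in> \<S> \<Longrightarrow> \<theta> > 0 \<Longrightarrow> \<exists>Q'. Gnull (- Reg f Q') \<and> (\<forall>u\<in>Q. \<exists>z\<in>Q'. u - z \<in> Tail \<Phi> \<S> S \<theta> M)"
  and g0: "g0 \<in> GammaX" and e0: "e0 > 0" and inW: "\<And>h. h \<in> GammaX \<Longrightarrow> close n e0 g0 h \<Longrightarrow> h \<in> W"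
  and S0: "S0 \<in> \<S>" and \<theta>0: "\<theta>0 > 0"
 shows "\<exists>h S V \<nu> \<rho>. h \<in> GammaX \<and> close n (e0/2) g0 h \<and> S \<in> \<S> \<and> S0 \<subseteq> S \<and> finite V \<and>
  V \<subseteq> Tail \<Phi> \<S> S0 \<theta>0 M \<and> (\<forall>v\<in>V. \<forall>\<phi>\<in>\<Phi> - S. \<bar>\<phi> v\<bar> \<le> \<theta>0) \<and> \<rho> > 0 \<and>
  (\<forall>k\<in>GammaX. close \<nu> \<rho> h k \<longrightarrow>
   \<epsilon>/4 / (4 * (A * (M + 1) + 1)) * (\<tau>/2) \<le> measure lebN {t\<in>cubeT. \<exists>v\<in>V. k t \<in> big f (\<epsilon>/4/16) v})"
proof -
 have A: "0 \<le> A" using f by (rule lipschitz_on_nonneg)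
 have fc: "continuous_on UNIV f" using f by (rule lipschitz_on_continuous_on)
 obtain L where L: "L \<ge> 0" "\<And>g t j. close n e0 g0 g \<Longrightarrow> t \<in> cubeT \<Longrightarrow> j < n \<Longrightarrow> norm (pderiv g j t) \<le> L"
  using pderiv_uniform_bound[OF g0 less_imp_le[OF e0], of n] by blast
 define E where "E = {x. \<not> fdq f Q (8 * \<epsilon>) x}"
 define H where "H = e0 / 8"
 define \<eta> where "\<eta> = H / (M + 1)"
 define \<kappa> where "\<kappa> = \<epsilon> / (4 * (A + 1))"
 define \<beta> where "\<beta> = \<epsilon>/4 / (4 * (A * (M + 1) + 1))"
 have H: "H > 0" using e0 by (simp add: H_def)
 have \<eta>: "\<eta> > 0" "\<eta> * M \<le> H" using H M by (auto simp: \<eta>_def field_simps)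
 have \<kappa>: "\<kappa> > 0" using \<epsilon> A by (simp add: \<kappa>_def)
 have \<beta>: "\<beta> > 0" using \<epsilon> A M by (simp add: \<beta>_def add_nonneg_pos)
 define \<rho> where "\<rho> = stage_ratio n L \<kappa> \<eta>"
 have \<rho>: "\<rho> > 0" unfolding \<rho>_def by (rule stage_ratio_pos[OF L(1) \<kappa> \<eta>(1)])
 have "\<rho> * (\<tau>/2) > 0" using \<rho> \<tau> by simp
 from reals_Archimedean3[OF this] obtain I :: nat where I: "1 < real I * (\<rho> * (\<tau>/2))" by blast
 then have I0: "real I > 0" using \<rho> \<tau> by (cases I) auto
 define \<delta> where "\<delta> = H / real I"
 have \<delta>: "\<delta> > 0" using H I0 by (simp add: \<delta>_def)
 \<comment> \<open>\<open>\<theta>0\<close> is prescribed for the new directions,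
   \<open>\<delta> / (2 * \<eta>)\<close> comes from the error budget of one step.\<close>
 define \<theta> where "\<theta> = min \<theta>0 (\<delta> / (2 * \<eta>))"
 have \<theta>: "\<theta> > 0" "\<theta> \<le> \<theta>0" using \<delta> \<eta> \<theta>0 by (auto simp: \<theta>_def)
 have \<eta>\<theta>: "\<eta> * \<theta> \<le> \<delta> / 2"
 proof -
  have "\<eta> * \<theta> \<le> \<eta> * (\<delta> / (2 * \<eta>))" using \<eta> by (intro mult_left_mono) (auto simp: \<theta>_def)
  then show ?thesis using \<eta> by simp
 qed
 \<comment> \<open>The disjunction lets the construction idle once \<open>\<tau>/2\<close> is
   reached.\<close>
 have "\<exists>g S V C \<nu> r. g \<in> GammaX \<and> S \<in> \<S> \<and> S0 \<subseteq> S \<and> controlled \<Phi> n S (real i * \<delta>) H g0 g \<and> finite V \<and>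
   V \<subseteq> Tail \<Phi> \<S> S0 \<theta>0 M \<and> (\<forall>v\<in>V. \<forall>\<phi>\<in>\<Phi> - S. \<bar>\<phi> v\<bar> \<le> \<theta>0) \<and> compact C \<and> C \<subseteq> cubeT \<and> r > 0 \<and>
   robust f (\<epsilon>/4/16) \<beta> V \<nu> r g C \<and> (real i * (\<rho> * (\<tau>/2)) \<le> measure lebN C \<or> \<tau>/2 \<le> measure lebN C)" if "i \<le> I" for i
  using that
 proof (induction i)
  case 0
  have "robust f (\<epsilon>/4/16) \<beta> {} 0 1 g0 {}" by (simp add: robust_def)
  then show ?case
   using g0 S0 controlled_refl[OF \<Phi> less_imp_le[OF H], of n S0 g0]
   by (intro exI[of _ g0] exI[of _ S0] exI[of _ "{}"] exI[of _ 0] exI[of _ 1]) auto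
 next
  case (Suc i)
  have "i \<le> I" using Suc.prems by simp
  from Suc.IH[OF this] obtain g S V C \<nu> r where g: "g \<in> GammaX" and S: "S \<in> \<S>" "S0 \<subseteq> S" and con: "controlled \<Phi> n S (real i * \<delta>) H g0 g"
   and V: "finite V" "V \<subseteq> Tail \<Phi> \<S> S0 \<theta>0 M" "\<forall>v\<in>V. \<forall>\<phi>\<in>\<Phi> - S. \<bar>\<phi> v\<bar> \<le> \<theta>0"
   and C: "compact C" "C \<subseteq> cubeT" and r: "r > 0" and rob: "robust f (\<epsilon>/4/16) \<beta> V \<nu> r g C"
   and mC: "real i * (\<rho> * (\<tau>/2)) \<le> measure lebN C \<or> \<tau>/2 \<le> measure lebN C"
   by (elim exE conjE) (rule that; assumption)
  show ?case
  proof (cases "\<tau>/2 \<le> measure lebN C")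
   case True
   have "controlled \<Phi> n S (real (Suc i) * \<delta>) H g0 g"
    by (rule controlled_mono[OF \<Phi> con]) (use \<delta> in \<open>simp add: mult_right_mono\<close>)
   then show ?thesis using g S V C r rob True by (intro exI conjI) (assumption | rule disjI2)+
  next
   case False
   have i\<delta>: "real i * \<delta> + \<delta> \<le> H"
   proof -
    have "(real i + 1) * \<delta> \<le> real I * \<delta>" using Suc.prems \<delta> by (intro mult_right_mono) auto
    then show ?thesis using I0 by (simp add: \<delta>_def field_simps)
   qed
   define \<delta>' where "\<delta>' = min (\<delta> / 4) (r / 2)"
   have \<delta>': "\<delta>' > 0" "\<delta>' \<le> \<delta> / 4" "\<delta>' \<le> r / 2" using \<delta> r by (auto simp: \<delta>'_def)
   have cl0: "close n (real i * \<delta> + H) g0 g"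
    using controlled_close[OF \<Phi> con] H \<delta> by simp
   have clh: "close n e0 g0 h" if h: "h \<in> gball g (max n \<nu>) \<delta>'" for h
   proof -
    obtain e' where e': "e' < \<delta>'" "close (max n \<nu>) e' g h" using h by (auto simp: gball_def)
    then have "close n (real i * \<delta> + H + e') g0 h" using close_trans[OF cl0 close_mono[OF e'(2)]] by simp
    then show ?thesis using e'(1) \<delta>' i\<delta> \<delta> e0 by (elim close_mono) (auto simp: H_def)
   qed
   then have sub: "gball g (max n \<nu>) \<delta>' \<subseteq> W" using inW by (auto simp: gball_def)
   obtain Q' where Q': "Gnull (- Reg f Q')" "\<And>u. u \<in> Q \<Longrightarrow> \<exists>z\<in>Q'. u - z \<in> Tail \<Phi> \<S> S \<theta> M"
    using Q[OF S(1) \<theta>(1)] by blast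
   define T where "T = Tail \<Phi> \<S> S \<theta> M"
   from Gnull_diff_residual[OF nm[folded E_def] Q'(1) gamma_open_gball _ sub gamma_residual_UNIV] center_gball[OF g \<delta>'(1)]
   obtain g' where g': "g' \<in> gball g (max n \<nu>) \<delta>'" "om g' (E - - Reg f Q') > \<tau>" by blast
   have g'G: "g' \<in> GammaX" using g' by (auto simp: gball_def)
   obtain e' where e': "e' < \<delta>'" "close (max n \<nu>) e' g g'" using g'(1) by (auto simp: gball_def)
   have con': "controlled \<Phi> n S (real i * \<delta> + \<delta> / 4) H g0 g'"
    using controlled_adjust[OF \<Phi> con close_mono[OF e'(2)]] e'(1) \<delta>'(2) by simp
   define B where "B = g' -` (E - - Reg f Q') \<inter> cubeT - C"
   have Cs: "C \<in> sets lebN" by (rule sets_lebN_compact[OF C(1,2)])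
   have B: "B \<subseteq> cubeT" "B \<inter> C = {}" by (auto simp: B_def)
   have B2: "\<tau>/2 < oT B"
   proof -
    have "oT (g' -` (E - - Reg f Q')) = oT (g' -` (E - - Reg f Q') \<inter> cubeT)" by (simp add: oT_def Int_assoc)
    also have "\<dots> \<le> oT (B \<union> C)" by (rule oT_mono) (auto simp: B_def)
    also have "\<dots> \<le> oT B + oT C" by (rule oT_Un)
    also have "oT C = measure lebN C" by (rule oT_measure[OF Cs])
    finally show ?thesis using g'(2) False by linarith
   qed
   have P: "\<exists>r v. 0 < r \<and> r < d \<and> (v \<in> T \<and> norm (f (g' t + r *\<^sub>R v) - f (g' t)) \<ge> \<epsilon> * r)" if t: "t \<in> B" "d > 0" for t d
   proof -
    have x: "\<not> fdq f Q (8 * \<epsilon>) (g' t)" "g' t \<in> Reg f Q'" using t(1) by (auto simp: B_def E_def)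
    have "\<exists>r v. 0 < r \<and> r < d \<and> v \<in> T \<and> norm (f (g' t + r *\<^sub>R v) - f (g' t)) \<ge> 8 * \<epsilon> / 8 * r"
     by (rule fd_failure_tail[OF x _ M Q'(2)[folded T_def] _ t(2)]) (use \<epsilon> in \<open>auto simp: T_def Tail_def\<close>)
    then show ?thesis by simp
   qed
   have Lg: "norm (pderiv g' j t) \<le> L" if "t \<in> cubeT" "j < n" for t j by (rule L(2)[OF clh[OF g'(1)] that])
   have rob': "robust f (\<epsilon>/4/16) \<beta> V \<nu> (r/2) g' C"
   proof (rule robust_shift[OF rob order_refl, where \<delta> = "r / 2"])
    show "norm (g' t - g t) \<le> r / 2" if "t \<in> C" for t
    proof -
     have "norm (g' t - g t) \<le> e'" using e'(2) that C(2) unfolding close_def by blast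
     then show ?thesis using e'(1) \<delta>'(3) by linarith
    qed
    show "norm (pderiv g' j t - pderiv g j t) \<le> r / 2" if "t \<in> C" "j < \<nu>" for t j
    proof -
     have "t \<in> cubeT" "j < max n \<nu>" using that C(2) by auto
     then have "norm (pderiv g' j t - pderiv g j t) \<le> e'" using e'(2) unfolding close_def by blast
     then show ?thesis using e'(1) \<delta>'(3) by linarith
    qed
   qed simp
   have "\<exists>h S' V' C' \<nu>' r'. h \<in> GammaX \<and> S' \<in> \<S> \<and> S \<subseteq> S' \<and>
     controlled \<Phi> n S' (real i * \<delta> + \<delta> / 4 + \<delta> / 4 + \<eta> * \<theta>) H g0 h \<and>
     finite V' \<and> V \<subseteq> V' \<and> V' - V \<subseteq> Tail \<Phi> \<S> S \<theta> M \<and> (\<forall>v\<in>V' - V. \<forall>\<phi>\<in>\<Phi> - S'. \<bar>\<phi> v\<bar> \<le> \<theta>) \<and>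
     compact C' \<and> C' \<subseteq> cubeT \<and> r' > 0 \<and> robust f (\<epsilon>/4/16) \<beta> V' \<nu>' r' h C' \<and>
     measure lebN C + \<rho> * (\<tau>/2) \<le> measure lebN C'"
    unfolding \<beta>_def \<rho>_def \<kappa>_def
   proof (rule bump_substage[OF \<Phi> \<S> M f g'G S(1) con' _ L(1) B(1) B2 C B(2) _ \<epsilon> \<eta> \<theta>(1) _ rob'[unfolded \<beta>_def] V(1)])
    show "norm (pderiv g' j t) \<le> L" if "t \<in> cubeT" "j < n" for t j by (rule Lg[OF that])
    show "\<exists>r v. 0 < r \<and> r < d \<and> (v \<in> Tail \<Phi> \<S> S \<theta> M \<and> norm (f (g' t + r *\<^sub>R v) - f (g' t)) \<ge> \<epsilon> * r)" if "t \<in> B" "d > 0" for t d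
     using P[OF that] unfolding T_def .
   qed (use \<delta> r in auto)
   then obtain h S' V' C' \<nu>' r' where h: "h \<in> GammaX" "S' \<in> \<S>" "S \<subseteq> S'"
     "controlled \<Phi> n S' (real i * \<delta> + \<delta> / 4 + \<delta> / 4 + \<eta> * \<theta>) H g0 h"
     "finite V'" "V \<subseteq> V'" "V' - V \<subseteq> Tail \<Phi> \<S> S \<theta> M" "\<forall>v\<in>V' - V. \<forall>\<phi>\<in>\<Phi> - S'. \<bar>\<phi> v\<bar> \<le> \<theta>"
     "compact C'" "C' \<subseteq> cubeT" "r' > 0" "robust f (\<epsilon>/4/16) \<beta> V' \<nu>' r' h C'"
     "measure lebN C + \<rho> * (\<tau>/2) \<le> measure lebN C'"
    by (elim exE conjE) (rule that; assumption)
   have "V' \<subseteq> Tail \<Phi> \<S> S0 \<theta>0 M" using h(7) V(2) Tail_mono[OF S(2) \<theta>(2), of \<Phi> \<S> M] by blast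
   moreover have "\<bar>\<phi> v\<bar> \<le> \<theta>0" if "v \<in> V'" "\<phi> \<in> \<Phi> - S'" for v \<phi>
   proof (cases "v \<in> V")
    case True
    then show ?thesis using V(3) h(3) that by blast
   next
    case False
    then have "\<bar>\<phi> v\<bar> \<le> \<theta>" using h(8) that by blast
    then show ?thesis using \<theta>(2) by linarith
   qed
   moreover have "controlled \<Phi> n S' (real (Suc i) * \<delta>) H g0 h"
    by (rule controlled_mono[OF \<Phi> h(4)]) (use \<eta>\<theta> in \<open>simp add: algebra_simps\<close>)
   moreover have "real (Suc i) * (\<rho> * (\<tau>/2)) \<le> measure lebN C'"
    using mC False h(13) by (simp add: algebra_simps)
   moreover have "S0 \<subseteq> S'" using S(2) h(3) by blast
   ultimately show ?thesis using h by (intro exI conjI) (assumption | rule disjI1 | blast)+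
  qed
 qed
 from this[OF order_refl] obtain h S V C \<nu> r where h: "h \<in> GammaX" "S \<in> \<S>" "S0 \<subseteq> S" "controlled \<Phi> n S (real I * \<delta>) H g0 h"
   "finite V" "V \<subseteq> Tail \<Phi> \<S> S0 \<theta>0 M" "\<forall>v\<in>V. \<forall>\<phi>\<in>\<Phi> - S. \<bar>\<phi> v\<bar> \<le> \<theta>0"
   and C: "compact C" "C \<subseteq> cubeT" and r: "r > 0" and rob: "robust f (\<epsilon>/4/16) \<beta> V \<nu> r h C"
   and mC: "real I * (\<rho> * (\<tau>/2)) \<le> measure lebN C \<or> \<tau>/2 \<le> measure lebN C"
  by (elim exE conjE) (rule that; assumption)
 have mC: "\<tau>/2 \<le> measure lebN C" using mC I lebN.prob_le_1[of C] by linarith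
 have Cs: "C \<in> sets lebN" by (rule sets_lebN_compact[OF C(1,2)])
 have "real I * \<delta> = H" using I0 by (simp add: \<delta>_def)
 then have "close n (H + H) g0 h" using controlled_close[OF \<Phi> h(4)] H by simp
 then have cl: "close n (e0/2) g0 h" using e0 by (elim close_mono) (auto simp: H_def)
 have rb: "\<beta> * (\<tau>/2) \<le> measure lebN {t\<in>cubeT. \<exists>v\<in>V. k t \<in> big f (\<epsilon>/4/16) v}"
  if k: "k \<in> GammaX" "close \<nu> r h k" for k
 proof -
  have "\<beta> * (\<tau>/2) \<le> \<beta> * measure lebN C" using mC \<beta> by (intro mult_left_mono) auto
  also have "\<dots> \<le> measure lebN {t\<in>C. \<exists>v\<in>V. k t \<in> big f (\<epsilon>/4/16) v}"
   using rob k C(2) unfolding robust_def close_def by blast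
  also have "\<dots> \<le> measure lebN {t\<in>cubeT. \<exists>v\<in>V. k t \<in> big f (\<epsilon>/4/16) v}"
  proof (rule lebN.finite_measure_mono)
   have "cubeT \<in> sets lebN" using sets.top[of lebN] by simp
   then show "{t\<in>cubeT. \<exists>v\<in>V. k t \<in> big f (\<epsilon>/4/16) v} \<in> sets lebN" by (rule big_union_sets[OF fc k(1) h(5) _ order_refl])
  qed (use C(2) in blast)
  finally show ?thesis .
 qed
 show ?thesis
 proof (rule exI[of _ h], rule exI[of _ S], rule exI[of _ V], rule exI[of _ \<nu>], rule exI[of _ r], intro conjI)
  show "\<forall>k\<in>GammaX. close \<nu> r h k \<longrightarrow>
    \<epsilon>/4 / (4 * (A * (M + 1) + 1)) * (\<tau>/2) \<le> measure lebN {t\<in>cubeT. \<exists>v\<in>V. k t \<in> big f (\<epsilon>/4/16) v}"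
   using rb unfolding \<beta>_def by blast
 qed (fact cl h r)+
qed


section \<open>Limits of nested sequences of surfaces\<close>

lemma gball_into_dense:
 fixes g :: "(nat \<Rightarrow> real) \<Rightarrow> 'x::real_normed_vector"
 assumes "finite \<U>" "\<And>U. U \<in> \<U> \<Longrightarrow> gamma_open U \<and> gamma_dense U" "g \<in> GammaX" "e > 0"
 shows "\<exists>g' n' e'. g' \<in> GammaX \<and> e' > 0 \<and> (\<forall>h\<in>GammaX. close n' e' g' h \<longrightarrow> close n e g h \<and> (\<forall>U\<in>\<U>. h \<in> U))"
 using assms(1,2)
proof (induction \<U> rule: finite_induct)
 case empty
 show ?case using assms(3,4) by blast
next
 case (insert U \<U>)
 then obtain g' n' e' where g': "g' \<in> GammaX" "e' > 0" "\<forall>h\<in>GammaX. close n' e' g' h \<longrightarrow> close n e g h \<and> (\<forall>U\<in>\<U>. h \<in> U)"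
  by auto
 have U: "gamma_open U" "gamma_dense U" using insert.prems by auto
 have "gball g' n' e' \<inter> U \<noteq> {}"
  using U(2) gamma_open_gball[of g' n' e'] center_gball[OF g'(1,2), of n'] unfolding gamma_dense_iff by blast
 then obtain k where k: "k \<in> gball g' n' e' \<inter> U" by blast
 have "gamma_open (gball g' n' e' \<inter> U)" by (rule gamma_open_Int[OF gamma_open_gball U(1)])
 then obtain n'' e'' where e'': "e'' > 0" "\<forall>h\<in>GammaX. close n'' e'' k h \<longrightarrow> h \<in> gball g' n' e' \<inter> U"
  using k unfolding gamma_open_iff by meson
 have "close n' e' g' h" if "h \<in> gball g' n' e'" for h
  using that unfolding gball_def by (auto intro: close_mono)
 then have "\<forall>h\<in>GammaX. close n'' e'' k h \<longrightarrow> close n e g h \<and> (\<forall>U\<in>insert U \<U>. h \<in> U)"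
  using e''(2) g'(3) by blast
 moreover have "k \<in> GammaX" using k by (auto simp: gball_def)
 ultimately show ?case using e''(1) by blast
qed

lemma uniform_Cauchy_limit:
 fixes u :: "nat \<Rightarrow> 'a \<Rightarrow> 'b::banach"
 assumes c: "\<And>i j t. N \<le> i \<Longrightarrow> i \<le> j \<Longrightarrow> t \<in> X \<Longrightarrow> norm (u j t - u i t) \<le> e i" and e: "\<And>i. e i \<le> (1/2) ^ i"
 shows "\<exists>l. uniform_limit X u l sequentially \<and> (\<forall>i\<ge>N. \<forall>t\<in>X. norm (l t - u i t) \<le> e i)"
proof -
 have "uniformly_Cauchy_on X u"
 proof (rule uniformly_Cauchy_onI')
  fix \<epsilon> :: real assume "\<epsilon> > 0"
  then obtain p where p: "(1/2 :: real) ^ p < \<epsilon>" using real_arch_pow_inv[of \<epsilon> "1/2"] by auto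
  have "dist (u i t) (u j t) < \<epsilon>" if "t \<in> X" "max N p \<le> i" "i < j" for t i j
  proof -
   have "dist (u i t) (u j t) \<le> (1/2) ^ i"
    using c[of i j t] e[of i] that by (simp add: dist_norm norm_minus_commute)
   also have "\<dots> \<le> (1/2) ^ p" using that by (intro power_decreasing) auto
   finally show ?thesis using p by linarith
  qed
  then show "\<exists>M. \<forall>x\<in>X. \<forall>m\<ge>M. \<forall>n>m. dist (u m x) (u n x) < \<epsilon>" by blast
 qed
 then obtain l where l: "uniform_limit X u l sequentially"
  using Cauchy_uniformly_convergent uniformly_convergent_on_def by blast
 have "norm (l t - u i t) \<le> e i" if "i \<ge> N" "t \<in> X" for i t
 proof (rule Lim_norm_ubound)
  show "((\<lambda>j. u j t - u i t) \<longlongrightarrow> l t - u i t) sequentially"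
   by (intro tendsto_diff tendsto_uniform_limitI[OF l that(2)] tendsto_const)
  show "\<forall>\<^sub>F j in sequentially. norm (u j t - u i t) \<le> e i"
   using c[OF that(1) _ that(2)] by (auto simp: eventually_sequentially)
 qed simp
 then show ?thesis using l by blast
qed

text \<open>Completeness of the function space: because \<open>n i \<ge> i\<close>, each derivative
  is controlled from some index on with errors at most \<open>(1/2) ^ i\<close>, so values and
  derivatives converge uniformly. Non-strict inequalities pass to the limit, which thus lies in
  every neighbourhood.\<close>

lemma GammaX_nested_limit:
 fixes g :: "nat \<Rightarrow> (nat \<Rightarrow> real) \<Rightarrow> 'x::banach"
 assumes g: "\<And>i. g i \<in> GammaX" and e: "\<And>i. 0 \<le> e i" "\<And>i. e i \<le> (1/2) ^ i" and n: "\<And>i. i \<le> n i"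
  and nest: "\<And>i h. h \<in> GammaX \<Longrightarrow> close (n (Suc i)) (e (Suc i)) (g (Suc i)) h \<Longrightarrow> close (n i) (e i) (g i) h"
 shows "\<exists>k\<in>GammaX. \<forall>i. close (n i) (e i) (g i) k"
proof -
 have desc: "close (n i) (e i) (g i) h" if "h \<in> GammaX" "close (n (i + d)) (e (i + d)) (g (i + d)) h" for i d h
  using that(2)
 proof (induction d)
  case (Suc d)
  then show ?case using nest[OF that(1), of "i + d"] by simp
 qed simp
 have cl: "close (n i) (e i) (g i) (g j)" if "i \<le> j" for i j
 proof -
  have "close (n j) (e j) (g j) (g j)" by (rule close_refl[OF e(1)])
  then have "close (n (i + (j - i))) (e (i + (j - i))) (g (i + (j - i))) (g j)" using that by simp
  then show ?thesis by (rule desc[OF g])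
 qed
 have "\<exists>l. uniform_limit cubeT g l sequentially \<and> (\<forall>i\<ge>0. \<forall>t\<in>cubeT. norm (l t - g i t) \<le> e i)"
  by (rule uniform_Cauchy_limit[OF _ e(2)]) (use cl in \<open>auto simp: close_def\<close>)
 then obtain l where l: "uniform_limit cubeT g l sequentially" "\<And>i t. t \<in> cubeT \<Longrightarrow> norm (l t - g i t) \<le> e i"
  by auto
 have "\<exists>l. uniform_limit cubeT (\<lambda>i. pderiv (g i) j) l sequentially \<and> (\<forall>i\<ge>Suc j. \<forall>t\<in>cubeT. norm (l t - pderiv (g i) j t) \<le> e i)" for j
 proof (rule uniform_Cauchy_limit[OF _ e(2)])
  fix i i' t assume i: "Suc j \<le> i" "i \<le> i'" and t: "t \<in> cubeT"
  have "j < n i" using i(1) n[of i] by simp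
  then show "norm (pderiv (g i') j t - pderiv (g i) j t) \<le> e i" using cl[OF i(2)] t unfolding close_def by blast
 qed
 then obtain D where D: "\<And>j. uniform_limit cubeT (\<lambda>i. pderiv (g i) j) (D j) sequentially"
   "\<And>j i t. Suc j \<le> i \<Longrightarrow> t \<in> cubeT \<Longrightarrow> norm (D j t - pderiv (g i) j t) \<le> e i"
  by metis
 have lc: "continuous_on cubeT l"
  by (rule uniform_limit_theorem[OF _ l(1)]) (use GammaX_D(1)[OF g] in auto)
 have Dc: "continuous_on cubeT (D j)" for j
  by (rule uniform_limit_theorem[OF _ D(1)]) (use GammaX_D(3)[OF g] in auto)
 have der: "((\<lambda>s. l (t(j := s))) has_vector_derivative D j t) (at (t j) within {0..1})" if t: "t \<in> cubeT" for t j
 proof -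
  have tu: "t(j := s) \<in> cubeT" if "s \<in> {0..1}" for s using t that by (auto simp: cubeT_def)
  have tj: "t j \<in> {0..1}" using t by (auto simp: cubeT_def)
  have "\<exists>G. \<forall>s\<in>{0..1}. (\<lambda>i. g i (t(j := s))) \<longlonglongrightarrow> G s \<and> (G has_derivative (\<lambda>d. d *\<^sub>R D j (t(j := s)))) (at s within {0..1})"
  proof (rule has_derivative_sequence[where f' = "\<lambda>i s d. d *\<^sub>R pderiv (g i) j (t(j := s))"])
   show "((\<lambda>s. g i (t(j := s))) has_derivative (\<lambda>d. d *\<^sub>R pderiv (g i) j (t(j := s)))) (at s within {0..1})"
    if "s \<in> {0..1}" for i s
    using GammaX_D_at[OF g t that] by (simp add: has_vector_derivative_def)
   show "(\<lambda>i. g i (t(j := t j))) \<longlonglongrightarrow> l t" using tendsto_uniform_limitI[OF l(1) t] by simp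
   fix \<epsilon> :: real assume "\<epsilon> > 0"
   then have "\<forall>\<^sub>F i in sequentially. \<forall>t\<in>cubeT. dist (pderiv (g i) j t) (D j t) < \<epsilon>" by (rule uniform_limitD[OF D(1)])
   then show "\<forall>\<^sub>F i in sequentially. \<forall>s\<in>{0..1}. \<forall>d. norm (d *\<^sub>R pderiv (g i) j (t(j := s)) - d *\<^sub>R D j (t(j := s))) \<le> \<epsilon> * norm d"
   proof (rule eventually_mono, intro ballI allI)
    fix i and s d :: real assume i: "\<forall>t\<in>cubeT. dist (pderiv (g i) j t) (D j t) < \<epsilon>" and s: "s \<in> {0..1}"
    have "norm (d *\<^sub>R pderiv (g i) j (t(j := s)) - d *\<^sub>R D j (t(j := s))) = \<bar>d\<bar> * dist (pderiv (g i) j (t(j := s))) (D j (t(j := s)))"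
     by (simp add: dist_norm scaleR_right_diff_distrib[symmetric])
    also have "\<dots> \<le> \<bar>d\<bar> * \<epsilon>" using i tu[OF s] by (intro mult_left_mono) (auto simp: less_imp_le)
    finally show "norm (d *\<^sub>R pderiv (g i) j (t(j := s)) - d *\<^sub>R D j (t(j := s))) \<le> \<epsilon> * norm d" by (simp add: mult.commute)
   qed
  qed (use tj in auto)
  then obtain G where G: "\<And>s. s \<in> {0..1} \<Longrightarrow> (\<lambda>i. g i (t(j := s))) \<longlonglongrightarrow> G s"
    "\<And>s. s \<in> {0..1} \<Longrightarrow> (G has_derivative (\<lambda>d. d *\<^sub>R D j (t(j := s)))) (at s within {0..1})"
   by blast
  have "G s = l (t(j := s))" if "s \<in> {0..1}" for s
   using LIMSEQ_unique[OF G(1)[OF that] tendsto_uniform_limitI[OF l(1) tu[OF that]]] .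
  then have "((\<lambda>s. l (t(j := s))) has_derivative (\<lambda>d. d *\<^sub>R D j (t(j := t j)))) (at (t j) within {0..1})"
   by (intro has_derivative_transform[OF tj _ G(2)[OF tj]]) auto
  then show ?thesis by (simp add: has_vector_derivative_def)
 qed
 note E = GammaX_ext[OF lc Dc der]
 have "norm (D j t - pderiv (g i) j t) \<le> e i" if t: "t \<in> cubeT" and j: "j < n i" for t i j
 proof (rule Lim_norm_ubound)
  show "((\<lambda>i'. pderiv (g i') j t - pderiv (g i) j t) \<longlongrightarrow> D j t - pderiv (g i) j t) sequentially"
   by (intro tendsto_diff tendsto_uniform_limitI[OF D(1) t] tendsto_const)
  show "\<forall>\<^sub>F i' in sequentially. norm (pderiv (g i') j t - pderiv (g i) j t) \<le> e i"
   unfolding eventually_sequentially using cl t j unfolding close_def by blast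
 qed simp
 then have "close (n i) (e i) (g i) (ext l)" for i
  unfolding close_def using l(2) E(2) by (simp add: ext_def)
 then show ?thesis using E(1) by blast
qed

text \<open>Directions range over a possibly non-separable space, so the residual sets attached to
  all of them cannot be intersected. Only the countably many directions actually used get their
  dense open sets \<open>U v l\<close>, fed in while the neighbourhoods shrink.\<close>

lemma bump_sequence:
 fixes f :: "'x::banach \<Rightarrow> 'y::banach" and U :: "'x \<Rightarrow> nat \<Rightarrow> _"
 assumes \<Phi>: "norming \<Phi>" and \<S>: "directed \<S>" and M: "0 \<le> M" and f: "A-lipschitz_on UNIV f"
  and \<epsilon>: "\<epsilon> > 0" and \<tau>: "\<tau> > 0" and W: "gamma_open W" "W \<noteq> {}"
  and nm: "\<And>W' G. gamma_open W' \<Longrightarrow> W' \<noteq> {} \<Longrightarrow> W' \<subseteq> W \<Longrightarrow> gamma_residual G \<Longrightarrow>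
   \<exists>g\<in>W' \<inter> G. om g {x. \<not> fdq f Q (8 * \<epsilon>) x} > \<tau>"
  and Q: "\<And>S \<theta>. S \<in> \<S> \<Longrightarrow> \<theta> > 0 \<Longrightarrow> \<exists>Q'. Gnull (- Reg f Q') \<and> (\<forall>u\<in>Q. \<exists>z\<in>Q'. u - z \<in> Tail \<Phi> \<S> S \<theta> M)"
  and U: "\<And>v l. gamma_open (U v l) \<and> gamma_dense (U v l)"
 shows "\<exists>k\<in>GammaX. \<exists>S V. \<forall>i. S i \<subseteq> S (Suc i) \<and> finite (V i) \<and> V i \<subseteq> Tail \<Phi> \<S> (S i) ((1/2) ^ i) M \<and>
  (\<forall>v\<in>V i. \<forall>\<phi>\<in>\<Phi> - S (Suc i). \<bar>\<phi> v\<bar> \<le> (1/2) ^ i) \<and> (\<forall>v\<in>V i. \<forall>l. k \<in> U v l) \<and>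
  \<epsilon>/4 / (4 * (A * (M + 1) + 1)) * (\<tau>/2) \<le> measure lebN {t\<in>cubeT. \<exists>v\<in>V i. k t \<in> big f (\<epsilon>/4/16) v}"
proof -
 define \<sigma> where "\<sigma> = \<epsilon>/4 / (4 * (A * (M + 1) + 1)) * (\<tau>/2)"
 define P where "P i = (\<lambda>(g, n, e, S, F :: 'x set). g \<in> GammaX \<and> 0 < e \<and> e \<le> (1/2) ^ i \<and> i \<le> n \<and> S \<in> \<S> \<and> finite F \<and>
  (\<forall>h\<in>GammaX. close n e g h \<longrightarrow> h \<in> W))" for i :: nat
 \<comment> \<open>\<open>F\<close> collects the directions used so far. Step \<open>i\<close>
   secures the conditions \<open>U v l\<close> with \<open>l \<le> i\<close> for all of them, and
   largeness along \<open>V\<close>, on a whole neighbourhood that contains all later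
   surfaces.\<close>
 define R where "R i x y V = (case x of (g, n, e, S, F) \<Rightarrow> case y of (g', n', e', S', F') \<Rightarrow>
  (\<forall>h\<in>GammaX. close n' e' g' h \<longrightarrow> close n e g h) \<and> S \<subseteq> S' \<and> F \<subseteq> F' \<and> V \<subseteq> F' \<and> finite V \<and>
  V \<subseteq> Tail \<Phi> \<S> S ((1/2) ^ i) M \<and> (\<forall>v\<in>V. \<forall>\<phi>\<in>\<Phi> - S'. \<bar>\<phi> v\<bar> \<le> (1/2) ^ i) \<and>
  (\<forall>h\<in>GammaX. close n' e' g' h \<longrightarrow> \<sigma> \<le> measure lebN {t\<in>cubeT. \<exists>v\<in>V. h t \<in> big f (\<epsilon>/4/16) v}) \<and>
  (\<forall>h\<in>GammaX. close n' e' g' h \<longrightarrow> (\<forall>v\<in>F'. \<forall>l\<le>i. h \<in> U v l)))" for i :: nat and x y V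
 have "\<exists>X. \<forall>i. P i (X i) \<and> (\<exists>V. R i (X i) (X (Suc i)) V)"
 proof (rule dependent_nat_choice[where P = P and Q = "\<lambda>i x y. \<exists>V. R i x y V"])
  obtain g where g: "g \<in> W" using W(2) by blast
  then obtain n e where e: "e > 0" "\<forall>h\<in>GammaX. close n e g h \<longrightarrow> h \<in> W" using W(1) unfolding gamma_open_iff by meson
  obtain S where S: "S \<in> \<S>" using \<S> unfolding directed_def by blast
  have "\<forall>h\<in>GammaX. close n (min e 1) g h \<longrightarrow> h \<in> W" using e(2) close_mono[of n "min e 1" g _ n e] by simp
  moreover have "g \<in> GammaX" using g W(1) by (auto simp: gamma_open_def)
  ultimately have "P 0 (g, n, min e 1, S, {})" using e(1) S by (simp add: P_def)
  then show "\<exists>x. P 0 x" by blast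
 next
  fix x i assume x: "P i x"
  obtain g n e S F where xe: "x = (g, n, e, S, F)" by (cases x) auto
  have g: "g \<in> GammaX" and e: "0 < e" "e \<le> (1/2) ^ i" and n: "i \<le> n" and S: "S \<in> \<S>" and F: "finite F"
   and inW: "\<And>h. h \<in> GammaX \<Longrightarrow> close n e g h \<Longrightarrow> h \<in> W"
   using x unfolding xe P_def by auto
  have "(1/2 :: real) ^ i > 0" by simp
  have "\<exists>h S' V \<nu> \<rho>. h \<in> GammaX \<and> close n (e/2) g h \<and> S' \<in> \<S> \<and> S \<subseteq> S' \<and> finite V \<and>
    V \<subseteq> Tail \<Phi> \<S> S ((1/2) ^ i) M \<and> (\<forall>v\<in>V. \<forall>\<phi>\<in>\<Phi> - S'. \<bar>\<phi> v\<bar> \<le> (1/2) ^ i) \<and> \<rho> > 0 \<and>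
    (\<forall>k\<in>GammaX. close \<nu> \<rho> h k \<longrightarrow> \<sigma> \<le> measure lebN {t\<in>cubeT. \<exists>v\<in>V. k t \<in> big f (\<epsilon>/4/16) v})"
   unfolding \<sigma>_def
   by (rule bump_stage[OF \<Phi> \<S> M f \<epsilon> \<tau> _ _ g e(1) _ S \<open>(1/2 :: real) ^ i > 0\<close>]) (fact nm Q inW)+
  then obtain h S' V \<nu> \<rho> where h: "h \<in> GammaX" "close n (e/2) g h" "S' \<in> \<S>" "S \<subseteq> S'" "finite V"
    "V \<subseteq> Tail \<Phi> \<S> S ((1/2) ^ i) M" "\<forall>v\<in>V. \<forall>\<phi>\<in>\<Phi> - S'. \<bar>\<phi> v\<bar> \<le> (1/2) ^ i" "\<rho> > 0"
    "\<forall>k\<in>GammaX. close \<nu> \<rho> h k \<longrightarrow> \<sigma> \<le> measure lebN {t\<in>cubeT. \<exists>v\<in>V. k t \<in> big f (\<epsilon>/4/16) v}"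
   by (elim exE conjE) (rule that; assumption)
  define F' where "F' = F \<union> V"
  have F': "finite F'" using F h(5) by (simp add: F'_def)
  have "\<exists>g' n' e'. g' \<in> GammaX \<and> e' > 0 \<and> (\<forall>k\<in>GammaX. close n' e' g' k \<longrightarrow>
    close (max n \<nu>) (min (e/2) \<rho>) h k \<and> (\<forall>Z\<in>(\<lambda>(v, l). U v l) ` (F' \<times> {..i}). k \<in> Z))"
  proof (rule gball_into_dense[OF _ _ h(1)])
   show "finite ((\<lambda>(v, l). U v l) ` (F' \<times> {..i}))" using F' by simp
   show "gamma_open Z \<and> gamma_dense Z" if "Z \<in> (\<lambda>(v, l). U v l) ` (F' \<times> {..i})" for Z
    using that U by auto
   show "min (e/2) \<rho> > 0" using e(1) h(8) by simp
  qed
  then obtain g' n' e' where g': "g' \<in> GammaX" "e' > 0"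
   "\<forall>k\<in>GammaX. close n' e' g' k \<longrightarrow> close (max n \<nu>) (min (e/2) \<rho>) h k \<and> (\<forall>Z\<in>(\<lambda>(v, l). U v l) ` (F' \<times> {..i}). k \<in> Z)"
   by blast
  define n'' where "n'' = max n' (Suc i)"
  define e'' where "e'' = min e' ((1/2) ^ Suc i)"
  have sub: "close n e g k \<and> close \<nu> \<rho> h k \<and> (\<forall>v\<in>F'. \<forall>l\<le>i. k \<in> U v l)" if k: "k \<in> GammaX" "close n'' e'' g' k" for k
  proof -
   have "close n' e' g' k" using k(2) by (rule close_mono) (auto simp: n''_def e''_def)
   then have 1: "close (max n \<nu>) (min (e/2) \<rho>) h k" "\<forall>Z\<in>(\<lambda>(v, l). U v l) ` (F' \<times> {..i}). k \<in> Z" using g'(3) k(1) by auto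
   have "close n (e/2) h k" "close \<nu> \<rho> h k" using 1(1) by (auto elim: close_mono)
   moreover have "close n e g k" using close_trans[OF h(2) \<open>close n (e/2) h k\<close>] by simp
   ultimately show ?thesis using 1(2) by fastforce
  qed
  have "P (Suc i) (g', n'', e'', S', F')"
   unfolding P_def using g'(1,2) h(3) F' sub inW by (auto simp: n''_def e''_def)
  moreover have "R i x (g', n'', e'', S', F') V"
   unfolding R_def xe using h sub by (auto simp: F'_def)
  ultimately show "\<exists>y. P (Suc i) y \<and> (\<exists>V. R i x y V)" by blast
 qed
 then obtain X where X: "\<And>i. P i (X i)" and RV: "\<forall>i. \<exists>V. R i (X i) (X (Suc i)) V" by blast
 from choice[OF RV] obtain V where XV: "\<And>i. R i (X i) (X (Suc i)) (V i)" by blast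
 define g where "g i = fst (X i)" for i
 define n where "n i = fst (snd (X i))" for i
 define e where "e i = fst (snd (snd (X i)))" for i
 define S where "S i = fst (snd (snd (snd (X i))))" for i
 define F where "F i = snd (snd (snd (snd (X i))))" for i
 have Xe: "X i = (g i, n i, e i, S i, F i)" for i by (simp add: g_def n_def e_def S_def F_def)
 have PX: "g i \<in> GammaX" "0 < e i" "e i \<le> (1/2) ^ i" "i \<le> n i" for i
  using X[of i] unfolding Xe P_def by (simp_all only: prod.case)
 have RX: "\<forall>h\<in>GammaX. close (n (Suc i)) (e (Suc i)) (g (Suc i)) h \<longrightarrow> close (n i) (e i) (g i) h"
   "S i \<subseteq> S (Suc i)" "F i \<subseteq> F (Suc i)" "V i \<subseteq> F (Suc i)" "finite (V i)"
   "V i \<subseteq> Tail \<Phi> \<S> (S i) ((1/2) ^ i) M" "\<forall>v\<in>V i. \<forall>\<phi>\<in>\<Phi> - S (Suc i). \<bar>\<phi> v\<bar> \<le> (1/2) ^ i"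
   "\<forall>h\<in>GammaX. close (n (Suc i)) (e (Suc i)) (g (Suc i)) h \<longrightarrow> \<sigma> \<le> measure lebN {t\<in>cubeT. \<exists>v\<in>V i. h t \<in> big f (\<epsilon>/4/16) v}"
   "\<forall>h\<in>GammaX. close (n (Suc i)) (e (Suc i)) (g (Suc i)) h \<longrightarrow> (\<forall>v\<in>F (Suc i). \<forall>l\<le>i. h \<in> U v l)" for i
  using XV[of i] unfolding Xe R_def prod.case by blast+
 have "\<exists>k\<in>GammaX. \<forall>i. close (n i) (e i) (g i) k"
 proof (rule GammaX_nested_limit)
  show "g i \<in> GammaX" "e i \<le> (1/2) ^ i" "i \<le> n i" for i by (rule PX)+
  show "0 \<le> e i" for i by (rule less_imp_le[OF PX(2)])
  show "close (n i) (e i) (g i) h" if "h \<in> GammaX" "close (n (Suc i)) (e (Suc i)) (g (Suc i)) h" for i h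
   by (rule RX(1)[rule_format, OF that])
 qed
 then obtain k where k: "k \<in> GammaX" "\<And>i. close (n i) (e i) (g i) k" by blast
 \<comment> \<open>A direction of step \<open>i\<close> is still collected at step
   \<open>max i l\<close>, where its \<open>l\<close>-th condition is secured.\<close>
 have kU: "k \<in> U v l" if v: "v \<in> V i" for v i l
 proof -
  have "F (Suc i) \<subseteq> F (Suc (max i l))" by (rule lift_Suc_mono_le[of F, OF RX(3)]) simp
  then have vF: "v \<in> F (Suc (max i l))" using RX(4)[of i] v by (meson subsetD)
  show ?thesis by (rule RX(9)[rule_format, OF k vF]) simp
 qed
 have k\<sigma>: "\<sigma> \<le> measure lebN {t\<in>cubeT. \<exists>v\<in>V i. k t \<in> big f (\<epsilon>/4/16) v}" for i
  by (rule RX(8)[rule_format, OF k])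
 show ?thesis
 proof (rule bexI[OF _ k(1)], rule exI[of _ S], rule exI[of _ V], intro allI conjI)
  fix i
  show "S i \<subseteq> S (Suc i)" "finite (V i)" "V i \<subseteq> Tail \<Phi> \<S> (S i) ((1/2) ^ i) M"
   "\<forall>v\<in>V i. \<forall>\<phi>\<in>\<Phi> - S (Suc i). \<bar>\<phi> v\<bar> \<le> (1/2) ^ i" by (rule RX)+
  show "\<forall>v\<in>V i. \<forall>l. k \<in> U v l" using kU by blast
  show "\<epsilon>/4 / (4 * (A * (M + 1) + 1)) * (\<tau>/2) \<le> measure lebN {t\<in>cubeT. \<exists>v\<in>V i. k t \<in> big f (\<epsilon>/4/16) v}"
   using k\<sigma>[of i] unfolding \<sigma>_def .
 qed
qed

text \<open>The functionals of \<open>S (i+1) - S i\<close> are the only ones that see the \<open>i\<close>-th direction with full strength.\<close>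

lemma norm_block_sum_le:
 fixes v :: "nat \<Rightarrow> 'x::real_normed_vector"
 assumes \<Phi>: "norming \<Phi>" and M: "0 \<le> M" and S: "\<And>i. S i \<subseteq> S (Suc i)" and I: "strict_mono I"
  and v: "\<And>p. v p \<in> Tail \<Phi> \<S> (S (I p)) ((1/2) ^ I p) M" "\<And>p \<phi>. \<phi> \<in> \<Phi> - S (Suc (I p)) \<Longrightarrow> \<bar>\<phi> (v p)\<bar> \<le> (1/2) ^ I p"
  and a: "\<And>p. \<bar>a p\<bar> \<le> 1"
 shows "norm (\<Sum>p<N. a p *\<^sub>R v p) \<le> M + 2"
proof -
 have Smono: "S i \<subseteq> S j" if "i \<le> j" for i j using lift_Suc_mono_le[of S, OF S that] .
 have "\<bar>\<phi> (\<Sum>p<N. a p *\<^sub>R v p)\<bar> \<le> M + 2" if \<phi>: "\<phi> \<in> \<Phi>" for \<phi>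
 proof -
  have lin: "linear \<phi>" and le: "\<And>x. \<bar>\<phi> x\<bar> \<le> norm x" using \<Phi> \<phi> unfolding norming_def by auto
  \<comment> \<open>\<open>w p\<close> is nonzero for at most one \<open>p\<close>, since the
    differences \<open>S (Suc i) - S i\<close> of an increasing sequence are disjoint.\<close>
  define w where "w p = (if \<phi> \<in> S (Suc (I p)) - S (I p) then M else 0)" for p
  have "\<bar>a p * \<phi> (v p)\<bar> \<le> (1/2) ^ p + w p" for p
  proof -
   have "(1/2 :: real) ^ I p \<le> (1/2) ^ p" using strict_mono_imp_increasing[OF I, of p] by (intro power_decreasing) auto
   moreover have "\<bar>\<phi> (v p)\<bar> \<le> (1/2) ^ I p + w p"
   proof (cases "\<phi> \<in> S (Suc (I p)) - S (I p)")
    case True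
    have "norm (v p) \<le> M" using v(1)[of p] unfolding Tail_def by blast
    then have "\<bar>\<phi> (v p)\<bar> \<le> M" using le[of "v p"] by linarith
    then show ?thesis using True by (simp add: w_def add_increasing)
   next
    case False
    then have "\<bar>\<phi> (v p)\<bar> \<le> (1/2) ^ I p" using v(1)[of p] v(2)[of \<phi> p] \<phi> unfolding Tail_def by blast
    moreover have "w p = 0" using False unfolding w_def by (rule if_not_P)
    ultimately show ?thesis by simp
   qed
   moreover have "\<bar>a p * \<phi> (v p)\<bar> \<le> 1 * \<bar>\<phi> (v p)\<bar>" unfolding abs_mult using a by (intro mult_right_mono) auto
   ultimately show ?thesis by linarith
  qed
  then have "(\<Sum>p<N. \<bar>a p * \<phi> (v p)\<bar>) \<le> (\<Sum>p<N. (1/2) ^ p + w p)" by (intro sum_mono)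
  also have "\<dots> = (\<Sum>p<N. (1/2) ^ p) + sum w {..<N}" by (rule sum.distrib)
  also have "(\<Sum>p<N. (1/2 :: real) ^ p) \<le> 2" by (simp add: sum_gp_strict)
  also have "sum w {..<N} \<le> M"
  proof -
   have "w p = 0 \<or> w q = 0" if "p < q" for p q
   proof -
    have "S (Suc (I p)) \<subseteq> S (I q)" using strict_monoD[OF I that] by (intro Smono) simp
    then show ?thesis unfolding w_def by auto
   qed
   then have "w p = 0 \<or> w q = 0" if "p \<noteq> q" for p q using that by (metis linorder_neqE_nat)
   then have "\<bar>sum w {..<N}\<bar> \<le> M" using M by (intro abs_sum_disjoint_le) (auto simp: w_def)
   then show ?thesis by simp
  qed
  finally have bd: "(\<Sum>p<N. \<bar>a p * \<phi> (v p)\<bar>) \<le> M + 2" by simp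
  have eq: "\<phi> (\<Sum>p<N. a p *\<^sub>R v p) = (\<Sum>p<N. a p * \<phi> (v p))" by (simp add: linear_sum[OF lin] linear_cmul[OF lin])
  show ?thesis unfolding eq by (rule order_trans[OF sum_abs bd])
 qed
 then show ?thesis using \<Phi> M unfolding norming_def by (meson add_nonneg_nonneg zero_le_numeral)
qed


section \<open>One-sided directional derivatives at regular points\<close>

text \<open>One-sided derivatives are positively homogeneous without further assumptions; additivity
  and oddness come from regularity.\<close>

definition dlim :: "('x::real_normed_vector \<Rightarrow> 'y::real_normed_vector) \<Rightarrow> 'x \<Rightarrow> 'x \<Rightarrow> 'y \<Rightarrow> bool" where
 "dlim f x u y \<longleftrightarrow> (quot f x u \<longlongrightarrow> y) (at_right 0)"

lemma tendsto_at_right_0_iff: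
 fixes g :: "real \<Rightarrow> 'y::real_normed_vector"
 shows "(g \<longlongrightarrow> l) (at_right 0) \<longleftrightarrow> (\<forall>e>0. \<exists>d>0. \<forall>s. 0 < s \<and> s < d \<longrightarrow> norm (g s - l) < e)"
 unfolding tendsto_iff eventually_at_right_field dist_norm by meson

lemmas dlim_iff = dlim_def[unfolded tendsto_at_right_0_iff]

lemma dlim_unique: "dlim f x u y \<Longrightarrow> dlim f x u y' \<Longrightarrow> y = y'"
 unfolding dlim_def by (rule tendsto_unique[OF trivial_limit_at_right_real])

lemma dlim_norm_le:
 assumes "dlim f x u y" "C-lipschitz_on UNIV f"
 shows "norm y \<le> C * norm u"
proof (rule tendsto_upperbound[OF tendsto_norm[OF assms(1)[unfolded dlim_def]] _ trivial_limit_at_right_real])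
 have "norm (quot f x u s) \<le> C * norm u" if s: "0 < s" for s
 proof -
  have "norm (f (x + s *\<^sub>R u) - f x) \<le> C * (s * norm u)"
   using lipschitz_onD[OF assms(2), of "x + s *\<^sub>R u" x] s by (simp add: dist_norm)
  then have "inverse s * norm (f (x + s *\<^sub>R u) - f x) \<le> inverse s * (C * (s * norm u))"
   using s by (intro mult_left_mono) auto
  moreover have "inverse s * (C * (s * norm u)) = C * norm u" using s by (simp add: field_simps)
  moreover have "norm (quot f x u s) = inverse s * norm (f (x + s *\<^sub>R u) - f x)" using s by (simp add: quot_def)
  ultimately show ?thesis by simp
 qed
 then show "\<forall>\<^sub>F s in at_right 0. norm (quot f x u s) \<le> C * norm u"
  unfolding eventually_at_right_field by (intro exI[of _ 1]) auto
qed

lemma dlim_ge: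
 assumes "dlim f x u y" "x \<in> big f e u" shows "e \<le> norm y"
proof (rule field_le_epsilon)
 fix \<delta> :: real assume "\<delta> > 0"
 then obtain d where d: "d > 0" "\<And>s. 0 < s \<Longrightarrow> s < d \<Longrightarrow> norm (quot f x u s - y) < \<delta>"
  using assms(1) unfolding dlim_iff by meson
 obtain s where s: "0 < s" "s < d" "norm (quot f x u s) > e" using assms(2) d(1) unfolding big_def by blast
 then show "e \<le> norm y + \<delta>" using d(2)[OF s(1,2)] norm_triangle_ineq2[of "quot f x u s" y] by linarith
qed

lemma dlim_exists:
 fixes f :: "'x::real_normed_vector \<Rightarrow> 'y::banach"
 assumes x: "x \<in> Fd f Q" and u: "u \<in> Q"
 shows "\<exists>y. dlim f x u y"
proof -
 define q where "q n = quot f x u (inverse (real (Suc n)))" for n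
 have fd: "\<exists>d>0. \<forall>s s'. 0 < s \<and> s < d \<and> 0 < s' \<and> s' < d \<longrightarrow> norm (quot f x u s - quot f x u s') < e" if "e > 0" for e
 proof -
  have "fdq f Q (e/2) x" using x that by (auto simp: Fd_def)
  then obtain d where d: "d > 0" "\<And>s s' u. 0 < s \<Longrightarrow> s < d \<Longrightarrow> 0 < s' \<Longrightarrow> s' < d \<Longrightarrow> u \<in> Q \<Longrightarrow>
   norm (quot f x u s - quot f x u s') \<le> e/2" by (elim fdqE) blast
  have "norm (quot f x u s - quot f x u s') < e" if "0 < s" "s < d" "0 < s'" "s' < d" for s s'
   using d(2)[OF that u] \<open>e > 0\<close> by linarith
  then show ?thesis using d(1) by blast
 qed
 have small: "\<exists>N. \<forall>n\<ge>N. inverse (real (Suc n)) < d" if d: "d > 0" for d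
 proof -
  obtain N where "inverse (real (Suc N)) < d" using reals_Archimedean[OF d] by blast
  moreover have "inverse (real (Suc n)) \<le> inverse (real (Suc N))" if "n \<ge> N" for n
   using that by (intro le_imp_inverse_le) auto
  ultimately show ?thesis by (meson le_less_trans)
 qed
 have "Cauchy q"
 proof (rule metric_CauchyI)
  fix e :: real assume "e > 0"
  then obtain d where d: "d > 0" "\<And>s s'. 0 < s \<Longrightarrow> s < d \<Longrightarrow> 0 < s' \<Longrightarrow> s' < d \<Longrightarrow> norm (quot f x u s - quot f x u s') < e"
   using fd by meson
  obtain N where "\<And>n. n \<ge> N \<Longrightarrow> inverse (real (Suc n)) < d" using small[OF d(1)] by blast
  then show "\<exists>M. \<forall>m\<ge>M. \<forall>n\<ge>M. dist (q m) (q n) < e" unfolding q_def dist_norm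
   by (intro exI[of _ N] allI impI d(2)) auto
 qed
 then obtain y where y: "q \<longlonglongrightarrow> y" using Cauchy_convergent convergent_def by blast
 have "dlim f x u y"
  unfolding dlim_iff
 proof (intro allI impI)
  fix e :: real assume "e > 0"
  then have e: "e/2 > 0" by simp
  then obtain d where d: "d > 0" "\<And>s s'. 0 < s \<Longrightarrow> s < d \<Longrightarrow> 0 < s' \<Longrightarrow> s' < d \<Longrightarrow> norm (quot f x u s - quot f x u s') < e/2"
   using fd by meson
  obtain N where N: "\<And>n. n \<ge> N \<Longrightarrow> inverse (real (Suc n)) < d" using small[OF d(1)] by blast
  obtain N' where N': "\<And>n. n \<ge> N' \<Longrightarrow> norm (q n - y) < e/2" using LIMSEQ_D[OF y e] by blast
  have "norm (quot f x u s - y) < e" if s: "0 < s" "s < d" for s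
  proof -
   have "norm (quot f x u s - q (max N N')) < e/2" unfolding q_def by (rule d(2)) (use s N[of "max N N'"] in auto)
   moreover have "norm (q (max N N') - y) < e/2" by (rule N') simp
   ultimately show ?thesis using norm_triangle_ineq[of "quot f x u s - q (max N N')" "q (max N N') - y"] by simp
  qed
  then show "\<exists>d>0. \<forall>s. 0 < s \<and> s < d \<longrightarrow> norm (quot f x u s - y) < e" using d(1) by blast
 qed
 then show ?thesis ..
qed

text \<open>With the displacement \<open>s *\<^sub>R w\<close> the regularity error is a small
  multiple of \<open>s\<close>, so after division the base point may be moved without changing the
  limit.\<close>

lemma regq_quot:
 assumes x: "x \<in> Reg f Q" and u: "u \<in> Q" and e: "e > 0"
 shows "\<exists>d>0. \<forall>s. 0 < s \<and> s < d \<longrightarrow>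
  norm ((f (x + s *\<^sub>R w + s *\<^sub>R u) - f (x + s *\<^sub>R w)) /\<^sub>R s - quot f x u s) < e"
proof -
 define \<epsilon> where "\<epsilon> = e / (2 * (1 + norm w))"
 have w0: "1 + norm w > 0" using norm_ge_zero[of w] by linarith
 have \<epsilon>: "\<epsilon> > 0" "\<epsilon> * (1 + norm w) < e"
 proof -
  show "\<epsilon> > 0" using e w0 by (simp add: \<epsilon>_def)
  have "\<epsilon> * (1 + norm w) = e / 2" using w0 unfolding \<epsilon>_def by (simp add: field_simps)
  then show "\<epsilon> * (1 + norm w) < e" using e by simp
 qed
 have "regq f Q \<epsilon> x" using x \<epsilon>(1) by (auto simp: Reg_def)
 then obtain d where d: "d > 0" "\<And>s w u. 0 < s \<Longrightarrow> s < d \<Longrightarrow> norm w < d \<Longrightarrow> u \<in> Q \<Longrightarrow>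
   norm (f (x + w + s *\<^sub>R u) - f (x + w) - (f (x + s *\<^sub>R u) - f x)) \<le> \<epsilon> * (s + norm w)" by (elim regqE) blast
 have "norm ((f (x + s *\<^sub>R w + s *\<^sub>R u) - f (x + s *\<^sub>R w)) /\<^sub>R s - quot f x u s) < e" if s: "0 < s" "s < d / (1 + norm w)" for s
 proof -
  have "s * (1 + norm w) < d" using s w0 by (simp add: pos_less_divide_eq)
  then have sw: "s + s * norm w < d" by (simp add: distrib_left)
  have "0 \<le> s * norm w" "norm (s *\<^sub>R w) = s * norm w" using s by auto
  then have sd: "s < d" "norm (s *\<^sub>R w) < d" using s(1) sw by linarith+
  have "(f (x + s *\<^sub>R w + s *\<^sub>R u) - f (x + s *\<^sub>R w)) /\<^sub>R s - quot f x u s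
    = (f (x + s *\<^sub>R w + s *\<^sub>R u) - f (x + s *\<^sub>R w) - (f (x + s *\<^sub>R u) - f x)) /\<^sub>R s"
   unfolding quot_def by (simp only: scaleR_right_diff_distrib)
  then have "norm ((f (x + s *\<^sub>R w + s *\<^sub>R u) - f (x + s *\<^sub>R w)) /\<^sub>R s - quot f x u s)
    = norm (f (x + s *\<^sub>R w + s *\<^sub>R u) - f (x + s *\<^sub>R w) - (f (x + s *\<^sub>R u) - f x)) / s"
   using s by (simp only: norm_scaleR) (simp add: divide_inverse mult.commute)
  also have "\<dots> \<le> (\<epsilon> * (s + norm (s *\<^sub>R w))) / s" using d(2)[OF s(1) sd u] s by (intro divide_right_mono) auto
  also have "\<dots> = \<epsilon> * (1 + norm w)" using s by (simp add: field_simps)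
  finally show ?thesis using \<epsilon>(2) by linarith
 qed
 then show ?thesis using d(1) w0 by (intro exI[of _ "d / (1 + norm w)"]) auto
qed

lemma dlim_add:
 assumes x: "x \<in> Reg f Q" and v: "v \<in> Q" and y: "dlim f x u y" and z: "dlim f x v z"
 shows "dlim f x (u + v) (y + z)"
proof -
 have "((\<lambda>s. (f (x + s *\<^sub>R u + s *\<^sub>R v) - f (x + s *\<^sub>R u)) /\<^sub>R s - quot f x v s) \<longlongrightarrow> 0) (at_right 0)"
  unfolding tendsto_at_right_0_iff diff_zero by (intro allI impI regq_quot[OF x v])
 then have "((\<lambda>s. quot f x u s + ((f (x + s *\<^sub>R u + s *\<^sub>R v) - f (x + s *\<^sub>R u)) /\<^sub>R s - quot f x v s) + quot f x v s) \<longlongrightarrow> y + 0 + z) (at_right 0)"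
  using y z unfolding dlim_def by (intro tendsto_add)
 moreover have "quot f x u s + ((f (x + s *\<^sub>R u + s *\<^sub>R v) - f (x + s *\<^sub>R u)) /\<^sub>R s - quot f x v s) + quot f x v s = quot f x (u + v) s" for s
  unfolding quot_def by (simp add: scaleR_right_diff_distrib scaleR_right_distrib add.assoc)
 ultimately show ?thesis unfolding dlim_def by simp
qed

lemma dlim_zero: "dlim f x 0 0"
 unfolding dlim_def quot_zero[abs_def] by (rule tendsto_const)

lemma dlim_scale:
 assumes y: "dlim f x u y" and a: "a \<ge> 0" shows "dlim f x (a *\<^sub>R u) (a *\<^sub>R y)"
proof (cases "a = 0")
 case False
 then have a: "a > 0" using a by simp
 have fl: "filterlim (\<lambda>s. a * s) (at_right 0) (at_right 0)"
  unfolding filterlim_at using a by (auto intro!: tendsto_eq_intros simp: eventually_at_right_field intro: exI[of _ 1])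
 have "((\<lambda>s. a *\<^sub>R quot f x u (a * s)) \<longlongrightarrow> a *\<^sub>R y) (at_right 0)"
  by (rule tendsto_scaleR[OF tendsto_const filterlim_compose[OF y[unfolded dlim_def] fl]])
 moreover have "a *\<^sub>R quot f x u (a * s) = quot f x (a *\<^sub>R u) s" for s
  unfolding quot_def using a by (simp add: mult.commute)
 ultimately show ?thesis unfolding dlim_def by simp
qed (simp add: dlim_zero)

text \<open>Regularity at the base point \<open>x - s *\<^sub>R u\<close>: stepping back along
  \<open>u\<close> reverses the increment up to an error of smaller order.\<close>

lemma dlim_uminus:
 assumes x: "x \<in> Reg f Q" and u: "u \<in> Q" and y: "dlim f x u y"
 shows "dlim f x (- u) (- y)"
proof -
 have "((\<lambda>s. (f (x + s *\<^sub>R (- u) + s *\<^sub>R u) - f (x + s *\<^sub>R (- u))) /\<^sub>R s - quot f x u s) \<longlongrightarrow> 0) (at_right 0)"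
  unfolding tendsto_at_right_0_iff diff_zero by (intro allI impI regq_quot[OF x u])
 then have "((\<lambda>s. - ((f (x + s *\<^sub>R (- u) + s *\<^sub>R u) - f (x + s *\<^sub>R (- u))) /\<^sub>R s - quot f x u s) - quot f x u s) \<longlongrightarrow> - 0 - y) (at_right 0)"
  using y unfolding dlim_def by (intro tendsto_intros)
 moreover have "- ((f (x + s *\<^sub>R (- u) + s *\<^sub>R u) - f (x + s *\<^sub>R (- u))) /\<^sub>R s - quot f x u s) - quot f x u s = quot f x (- u) s" for s
  unfolding quot_def by (simp add: scaleR_right_diff_distrib)
 ultimately show ?thesis unfolding dlim_def by simp
qed

text \<open>By \<open>Gnull_Reg\<close> it suffices to treat \<open>Fd\<close>. A surface with large
  quotients along directions from \<open>V i\<close> on sets of measure at least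
  \<open>\<sigma>\<close>, for every \<open>i\<close>, has a point in infinitely many of these sets
  at which all directions used are regular. The derivatives there have norms bounded below and
  bounded signed sums, which \<open>RNP_no_c0\<close> excludes.\<close>

theorem Gnull_Reg_tail:
 fixes f :: "'x::banach \<Rightarrow> 'y::banach"
 assumes f: "C-lipschitz_on UNIV f" and Y: "RNP TYPE('y)" and PN: "porous_null (cball (0::'x) 1)"
  and \<Phi>: "norming \<Phi>" and \<S>: "directed \<S>" and M: "0 \<le> M"
  and Q: "\<And>S \<theta>. S \<in> \<S> \<Longrightarrow> \<theta> > 0 \<Longrightarrow> \<exists>Q'. Gnull (- Reg f Q') \<and> (\<forall>u\<in>Q. \<exists>z\<in>Q'. u - z \<in> Tail \<Phi> \<S> S \<theta> M)"
 shows "Gnull (- Reg f Q)"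
proof (rule Gnull_Reg[OF f PN], rule ccontr)
 have fc: "continuous_on UNIV f" using f by (rule lipschitz_on_continuous_on)
 assume nn: "\<not> Gnull (- Fd f Q)"
 have "- Fd f Q \<subseteq> (\<Union>n. {x. \<not> fdq f Q (inverse (real (Suc n))) x})"
 proof
  fix x assume "x \<in> - Fd f Q"
  then obtain e where e: "e > 0" "\<not> fdq f Q e x" unfolding Fd_def by blast
  obtain n where n: "inverse (real (Suc n)) < e" using reals_Archimedean[OF e(1)] by blast
  have "\<not> fdq f Q (inverse (real (Suc n))) x" using e(2) n unfolding fdq_def by (meson less_imp_le order_trans)
  then show "x \<in> (\<Union>n. {x. \<not> fdq f Q (inverse (real (Suc n))) x})" by blast
 qed
 then obtain n where n: "\<not> Gnull {x. \<not> fdq f Q (inverse (real (Suc n))) x}"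
  using nn Gnull_mono Gnull_UN[of "\<lambda>n. {x. \<not> fdq f Q (inverse (real (Suc n))) x}"] by blast
 define \<epsilon> where "\<epsilon> = inverse (real (Suc n)) / 8"
 have \<epsilon>: "\<epsilon> > 0" "inverse (real (Suc n)) = 8 * \<epsilon>" by (auto simp: \<epsilon>_def)
 from not_Gnull_imp[OF n[unfolded \<epsilon>(2)]] obtain \<tau> W where \<tau>: "\<tau> > 0" and W: "gamma_open W" "W \<noteq> {}"
  and nm: "\<And>W' G. gamma_open W' \<Longrightarrow> W' \<noteq> {} \<Longrightarrow> W' \<subseteq> W \<Longrightarrow> gamma_residual G \<Longrightarrow> \<exists>g\<in>W' \<inter> G. om g {x. \<not> fdq f Q (8 * \<epsilon>) x} > \<tau>"
  by blast
 \<comment> \<open>Dense open sets for each direction; a surface in all of them is regular along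
   \<open>seg v\<close> at almost every parameter.\<close>
 have "\<forall>v. \<exists>U :: nat \<Rightarrow> _. (\<forall>l. gamma_open (U l) \<and> gamma_dense (U l)) \<and> (\<Inter>l. U l) \<subseteq> {g\<in>GammaX. om g (- Reg f (seg v)) = 0}"
  using Gnull_Reg[OF f PN Gnull_Fd_seg[OF f Y]] unfolding Gnull_def gamma_residual_def by blast
 from choice[OF this] obtain U :: "'x \<Rightarrow> nat \<Rightarrow> _" where U: "\<And>v l. gamma_open (U v l) \<and> gamma_dense (U v l)" "\<And>v. (\<Inter>l. U v l) \<subseteq> {g\<in>GammaX. om g (- Reg f (seg v)) = 0}"
  by blast
 define \<sigma> where "\<sigma> = \<epsilon>/4 / (4 * (C * (M + 1) + 1)) * (\<tau>/2)"
 have C0: "0 \<le> C" using f by (rule lipschitz_on_nonneg)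
 have \<sigma>: "\<sigma> > 0" using \<epsilon>(1) \<tau> C0 M by (simp add: \<sigma>_def add_nonneg_pos)
 have "\<exists>k\<in>GammaX. \<exists>S V. \<forall>i. S i \<subseteq> S (Suc i) \<and> finite (V i) \<and> V i \<subseteq> Tail \<Phi> \<S> (S i) ((1/2) ^ i) M \<and>
   (\<forall>v\<in>V i. \<forall>\<phi>\<in>\<Phi> - S (Suc i). \<bar>\<phi> v\<bar> \<le> (1/2) ^ i) \<and> (\<forall>v\<in>V i. \<forall>l. k \<in> U v l) \<and>
   \<sigma> \<le> measure lebN {t\<in>cubeT. \<exists>v\<in>V i. k t \<in> big f (\<epsilon>/4/16) v}"
  unfolding \<sigma>_def by (rule bump_sequence[OF \<Phi> \<S> M f \<epsilon>(1) \<tau> W]) (fact nm Q U(1))+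
 then obtain k S V where k: "k \<in> GammaX" and SV: "\<forall>i. S i \<subseteq> S (Suc i) \<and> finite (V i) \<and> V i \<subseteq> Tail \<Phi> \<S> (S i) ((1/2) ^ i) M \<and>
   (\<forall>v\<in>V i. \<forall>\<phi>\<in>\<Phi> - S (Suc i). \<bar>\<phi> v\<bar> \<le> (1/2) ^ i) \<and> (\<forall>v\<in>V i. \<forall>l. k \<in> U v l) \<and>
   \<sigma> \<le> measure lebN {t\<in>cubeT. \<exists>v\<in>V i. k t \<in> big f (\<epsilon>/4/16) v}"
  by (elim bexE exE) (rule that; assumption)
 have SV: "S i \<subseteq> S (Suc i)" "finite (V i)" "V i \<subseteq> Tail \<Phi> \<S> (S i) ((1/2) ^ i) M"
   "v \<in> V i \<Longrightarrow> \<phi> \<in> \<Phi> - S (Suc i) \<Longrightarrow> \<bar>\<phi> v\<bar> \<le> (1/2) ^ i" "v \<in> V i \<Longrightarrow> k \<in> U v l"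
   "\<sigma> \<le> measure lebN {t\<in>cubeT. \<exists>v\<in>V i. k t \<in> big f (\<epsilon>/4/16) v}" for i v \<phi> l
  using SV by blast+
 define E where "E i = {t\<in>cubeT. \<exists>v\<in>V i. k t \<in> big f (\<epsilon>/4/16) v}" for i
 have cs: "cubeT \<in> sets lebN" using sets.top[of lebN] by simp
 have Es: "E i \<in> sets lebN" for i unfolding E_def by (rule big_union_sets[OF fc k SV(2) cs order_refl])
 define B where "B n = (\<Union>i\<in>{n..}. E i)" for n
 have Bs: "B n \<in> sets lebN" for n unfolding B_def using Es by (intro sets.countable_UN'') auto
 have Bm: "\<sigma> \<le> measure lebN (\<Inter>n. B n)"
  unfolding B_def by (rule measure_limsup_ge[OF Es]) (use SV(6) in \<open>simp add: E_def\<close>)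
 define N where "N = (\<Union>i. \<Union>v\<in>V i. k -` (- Reg f (seg v)))"
 have N0: "oT N = 0"
  unfolding N_def
 proof (rule oT_UN_zero)
  fix i
  have "oT (k -` (- Reg f (seg v))) = 0" if "v \<in> V i" for v
   using U(2)[of v] SV(5)[OF that] by blast
  then have "(\<Sum>v\<in>V i. oT (k -` (- Reg f (seg v)))) = 0" by simp
  moreover have "oT (\<Union>v\<in>V i. k -` (- Reg f (seg v))) \<le> (\<Sum>v\<in>V i. oT (k -` (- Reg f (seg v))))"
   by (rule oT_UN_finite[OF SV(2)])
  moreover have "0 \<le> oT (\<Union>v\<in>V i. k -` (- Reg f (seg v)))" by (simp add: oT_def)
  ultimately show "oT (\<Union>v\<in>V i. k -` (- Reg f (seg v))) = 0" by linarith
 qed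
 have "\<not> (\<Inter>n. B n) \<subseteq> N"
 proof
  assume "(\<Inter>n. B n) \<subseteq> N"
  then have "oT (\<Inter>n. B n) \<le> oT N" by (intro oT_mono) blast
  moreover have "oT (\<Inter>n. B n) = measure lebN (\<Inter>n. B n)" using Bs by (intro oT_measure) auto
  ultimately show False using Bm \<sigma> N0 by linarith
 qed
 then obtain t where t: "t \<in> (\<Inter>n. B n)" "t \<notin> N" by blast
 define x where "x = k t"
 define J where "J = {i. t \<in> E i}"
 have "\<exists>i\<ge>n. i \<in> J" for n
 proof -
  have "t \<in> B n" using t(1) by blast
  then show ?thesis unfolding B_def J_def by auto
 qed
 then have "infinite J" by (simp add: infinite_nat_iff_unbounded_le)
 then obtain I :: "nat \<Rightarrow> nat" where I: "strict_mono I" "\<And>p. I p \<in> J" using infinite_enumerate by blast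
 have "\<exists>v. v \<in> V (I p) \<and> x \<in> big f (\<epsilon>/4/16) v" for p using I(2)[of p] unfolding J_def E_def x_def by blast
 then obtain v where v: "\<And>p. v p \<in> V (I p)" "\<And>p. x \<in> big f (\<epsilon>/4/16) (v p)" by metis
 have reg: "x \<in> Reg f (seg (v p))" for p using t(2) v(1)[of p] unfolding N_def x_def by blast
 have inseg: "a *\<^sub>R v p \<in> seg (v p)" if "\<bar>a\<bar> \<le> 1" for a p using that unfolding seg_def by blast
 have "\<exists>y. dlim f x (v p) y" for p
  using dlim_exists[of x f "seg (v p)" "v p"] reg[of p] Reg_Fd[of f "seg (v p)"] inseg[of 1 p] by auto
 then obtain y where y: "\<And>p. dlim f x (v p) (y p)" by metis
 \<comment> \<open>The signed sums need coefficients of either sign; regularity along the segment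
   makes the one-sided derivative odd.\<close>
 have ya: "dlim f x (a *\<^sub>R v p) (a *\<^sub>R y p)" if a: "\<bar>a\<bar> \<le> 1" for a p
 proof (cases "a \<ge> 0")
  case True
  then show ?thesis by (rule dlim_scale[OF y])
 next
  case False
  then have "dlim f x (\<bar>a\<bar> *\<^sub>R v p) (\<bar>a\<bar> *\<^sub>R y p)" by (intro dlim_scale[OF y]) auto
  from dlim_uminus[OF reg inseg this] a show ?thesis using False by simp
 qed
 have sum: "dlim f x (\<Sum>p<n. a p *\<^sub>R v p) (\<Sum>p<n. a p *\<^sub>R y p)" if a: "\<And>p. \<bar>a p\<bar> \<le> 1" for a :: "nat \<Rightarrow> real" and n
 proof (induction n)
  case (Suc n)
  show ?case using dlim_add[OF reg inseg[OF a] Suc ya[OF a], of n n] by simp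
 qed (simp add: dlim_zero)
 have "norm (\<Sum>p<n. a p *\<^sub>R y p) \<le> C * (M + 2)" if a: "\<And>p. \<bar>a p\<bar> \<le> 1" for a :: "nat \<Rightarrow> real" and n
 proof -
  have "norm (\<Sum>p<n. a p *\<^sub>R v p) \<le> M + 2"
  proof (rule norm_block_sum_le[OF \<Phi> M, where S = S and I = I])
   show "S i \<subseteq> S (Suc i)" "\<bar>a p\<bar> \<le> 1" for i p by (rule SV(1), rule a)
   show "v p \<in> Tail \<Phi> \<S> (S (I p)) ((1/2) ^ I p) M" for p using SV(3) v(1) by blast
   show "\<bar>\<phi> (v p)\<bar> \<le> (1/2) ^ I p" if "\<phi> \<in> \<Phi> - S (Suc (I p))" for p \<phi> by (rule SV(4)[OF v(1) that])
  qed (rule I(1))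
  then have "C * norm (\<Sum>p<n. a p *\<^sub>R v p) \<le> C * (M + 2)" using C0 by (rule mult_left_mono)
  moreover have "norm (\<Sum>p<n. a p *\<^sub>R y p) \<le> C * norm (\<Sum>p<n. a p *\<^sub>R v p)"
   by (rule dlim_norm_le[OF sum f]) (rule a)
  ultimately show ?thesis by linarith
 qed
 moreover have "\<epsilon>/4/16 \<le> norm (y p)" for p by (rule dlim_ge[OF y v(2)])
 ultimately show False using RNP_no_c0[OF Y, of "\<epsilon>/4/16" y "C * (M + 2)"] \<epsilon>(1) by simp
qed


section \<open>Direction sets generated from segments by sums and tails\<close>

text \<open>The closure properties shared by the small and by the good sets, isolated so that the
  geometry of the space is used once, for an arbitrary such class, and then applied to both.\<close>

definition tail_closed :: "('x::real_normed_vector set \<Rightarrow> bool) \<Rightarrow> bool" where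
 "tail_closed P \<longleftrightarrow> (\<forall>Q Q'. P Q \<longrightarrow> Q' \<subseteq> Q \<longrightarrow> P Q') \<and> (\<forall>v. P (seg v)) \<and>
  (\<forall>Q Q1 Q2. P Q1 \<longrightarrow> P Q2 \<longrightarrow> (\<forall>u\<in>Q. \<exists>z\<in>Q1. u - z \<in> Q2) \<longrightarrow> P Q) \<and>
  (\<forall>Q \<Phi> \<S> M. norming \<Phi> \<longrightarrow> directed \<S> \<longrightarrow> 0 \<le> M \<longrightarrow>
   (\<forall>S\<in>\<S>. \<forall>\<theta>>0. \<exists>Q'. P Q' \<and> (\<forall>u\<in>Q. \<exists>z\<in>Q'. u - z \<in> Tail \<Phi> \<S> S \<theta> M)) \<longrightarrow> P Q)"

lemma tail_closedD:
 assumes "tail_closed P"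
 shows "P Q \<Longrightarrow> Q' \<subseteq> Q \<Longrightarrow> P Q'" "P (seg v)" "P Q1 \<Longrightarrow> P Q2 \<Longrightarrow> (\<And>u. u \<in> Q \<Longrightarrow> \<exists>z\<in>Q1. u - z \<in> Q2) \<Longrightarrow> P Q"
  "norming \<Phi> \<Longrightarrow> directed \<S> \<Longrightarrow> 0 \<le> M \<Longrightarrow>
   (\<And>S \<theta>. S \<in> \<S> \<Longrightarrow> \<theta> > 0 \<Longrightarrow> \<exists>Q'. P Q' \<and> (\<forall>u\<in>Q. \<exists>z\<in>Q'. u - z \<in> Tail \<Phi> \<S> S \<theta> M)) \<Longrightarrow> P Q"
proof -
 note a = assms[unfolded tail_closed_def]
 show "P Q \<Longrightarrow> Q' \<subseteq> Q \<Longrightarrow> P Q'" using a by blast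
 show "P (seg v)" using a by blast
 show "P Q1 \<Longrightarrow> P Q2 \<Longrightarrow> (\<And>u. u \<in> Q \<Longrightarrow> \<exists>z\<in>Q1. u - z \<in> Q2) \<Longrightarrow> P Q"
  using a[THEN conjunct2, THEN conjunct2, THEN conjunct1] by blast
 show "norming \<Phi> \<Longrightarrow> directed \<S> \<Longrightarrow> 0 \<le> M \<Longrightarrow>
   (\<And>S \<theta>. S \<in> \<S> \<Longrightarrow> \<theta> > 0 \<Longrightarrow> \<exists>Q'. P Q' \<and> (\<forall>u\<in>Q. \<exists>z\<in>Q'. u - z \<in> Tail \<Phi> \<S> S \<theta> M)) \<Longrightarrow> P Q"
  by (rule a[THEN conjunct2, THEN conjunct2, THEN conjunct2, rule_format])
qed

text \<open>A finite set lies in a sum of segments; 0 is included so that each segment can be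
  skipped.\<close>

lemma tail_closed_finite:
 assumes P: "tail_closed P" and "finite N" shows "P N"
proof -
 have "P (insert 0 N)"
  using assms(2)
 proof (induction N rule: finite_induct)
  case empty
  show ?case by (rule tail_closedD(1)[OF P tail_closedD(2)[OF P, of 0]]) (auto simp: seg_def intro: exI[of _ 0])
 next
  case (insert z N)
  show ?case
  proof (rule tail_closedD(3)[OF P tail_closedD(2)[OF P, of z] insert.IH])
   have z: "z \<in> seg z" "0 \<in> seg z" by (auto simp: seg_def intro: exI[of _ 1] exI[of _ 0])
   fix u assume "u \<in> insert 0 (insert z N)"
   then show "\<exists>a\<in>seg z. u - a \<in> insert 0 N" using z by (cases "u = z") (auto intro: bexI[of _ z] bexI[of _ 0])
  qed
 qed
 then show ?thesis by (rule tail_closedD(1)[OF P]) auto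
qed

text \<open>Pigeonhole on the integer parts of \<open>\<phi> x / \<theta>\<close>: finitely many
  patterns occur, and points with the same pattern are within \<open>\<theta>\<close> on all of
  \<open>S\<close>.\<close>

lemma finite_functional_net:
 fixes S :: "('x \<Rightarrow> real) set"
 assumes S: "finite S" and B: "\<And>\<phi> x. \<phi> \<in> S \<Longrightarrow> x \<in> B \<Longrightarrow> \<bar>\<phi> x\<bar> \<le> K" and \<theta>: "\<theta> > 0"
 shows "\<exists>N. finite N \<and> N \<subseteq> B \<and> (\<forall>x\<in>B. \<exists>z\<in>N. \<forall>\<phi>\<in>S. \<bar>\<phi> x - \<phi> z\<bar> \<le> \<theta>)"
proof -
 define F where "F x = restrict (\<lambda>\<phi>. \<lfloor>\<phi> x / \<theta>\<rfloor>) S" for x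
 have "F ` B \<subseteq> S \<rightarrow>\<^sub>E {\<lfloor>- K / \<theta>\<rfloor>..\<lfloor>K / \<theta>\<rfloor>}"
 proof (rule image_subsetI, rule PiE_I)
  fix x \<phi> assume x: "x \<in> B" "\<phi> \<in> S"
  have "- K / \<theta> \<le> \<phi> x / \<theta>" "\<phi> x / \<theta> \<le> K / \<theta>" using B[OF x(2,1)] \<theta>
   by (simp_all only: divide_right_mono abs_le_iff minus_le_iff less_imp_le)
  then show "F x \<phi> \<in> {\<lfloor>- K / \<theta>\<rfloor>..\<lfloor>K / \<theta>\<rfloor>}" using x(2) by (auto simp: F_def intro: floor_mono)
 qed (auto simp: F_def)
 moreover have "finite (S \<rightarrow>\<^sub>E {\<lfloor>- K / \<theta>\<rfloor>..\<lfloor>K / \<theta>\<rfloor>})" using S by (intro finite_PiE) auto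
 ultimately have "finite (F ` B)" by (rule finite_subset)
 then obtain N where N: "N \<subseteq> B" "finite N" "F ` B = F ` N" using finite_subset_image[of "F ` B" F B] by blast
 have "\<exists>z\<in>N. \<forall>\<phi>\<in>S. \<bar>\<phi> x - \<phi> z\<bar> \<le> \<theta>" if x: "x \<in> B" for x
 proof -
  obtain z where z: "z \<in> N" "F x = F z" using N(3) x by blast
  have "\<bar>\<phi> x - \<phi> z\<bar> \<le> \<theta>" if \<phi>: "\<phi> \<in> S" for \<phi>
  proof -
   have "\<lfloor>\<phi> x / \<theta>\<rfloor> = \<lfloor>\<phi> z / \<theta>\<rfloor>" using fun_cong[OF z(2), of \<phi>] \<phi> by (simp add: F_def)
   then have "\<bar>\<phi> x / \<theta> - \<phi> z / \<theta>\<bar> < 1" by linarith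
   then have "\<bar>\<phi> x / \<theta> - \<phi> z / \<theta>\<bar> * \<theta> \<le> 1 * \<theta>" using \<theta> by (intro mult_right_mono) auto
   moreover have "\<bar>\<phi> x / \<theta> - \<phi> z / \<theta>\<bar> * \<theta> = \<bar>\<phi> x - \<phi> z\<bar>" using \<theta> by (simp add: diff_divide_distrib[symmetric])
   ultimately show ?thesis by simp
  qed
  then show ?thesis using z(1) by blast
 qed
 then show ?thesis using N by blast
qed

text \<open>Every vector vanishes at infinity of the coordinate functionals. Hence a finite net with
  respect to finitely many coordinates leaves differences that are tails, of norm at most 2.\<close>

theorem c0_ball_tail_closed:
 fixes P :: "'x::real_normed_vector set \<Rightarrow> bool"
 assumes X: "is_c0_subspace TYPE('x) TYPE('g)" and P: "tail_closed P"
 shows "P (cball 0 1)"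
proof -
 obtain J :: "'x \<Rightarrow> 'g \<Rightarrow> real" where J: "\<And>x y i. J (x + y) i = J x i + J y i" "\<And>c x i. J (c *\<^sub>R x) i = c * J x i"
   "\<And>x. J x \<in> c0_space" "\<And>x. c0_norm (J x) = norm x"
  using X unfolding is_c0_subspace_def by blast
 have fin: "finite {i. \<bar>J x i\<bar> \<ge> e}" if "e > 0" for x e using J(3)[of x] that unfolding c0_space_def by blast
 have bdd: "bdd_above (range (\<lambda>i. \<bar>J x i\<bar>))" for x
 proof (rule bdd_aboveI2)
  let ?A = "insert 1 ((\<lambda>i. \<bar>J x i\<bar>) ` {i. \<bar>J x i\<bar> \<ge> 1})"
  have A: "finite ?A" using fin[of 1 x] by simp
  fix i show "\<bar>J x i\<bar> \<le> Max ?A"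
  proof (cases "\<bar>J x i\<bar> \<ge> 1")
   case True
   then show ?thesis using A by (intro Max_ge) auto
  next
   case False
   moreover have "1 \<le> Max ?A" using A by (intro Max_ge) auto
   ultimately show ?thesis by linarith
  qed
 qed
 have le: "\<bar>J x i\<bar> \<le> norm x" for x i
  using cSUP_upper[OF UNIV_I bdd, of x i] J(4)[of x] by (simp add: c0_norm_def)
 have ge: "norm x \<le> M" if "\<And>i. \<bar>J x i\<bar> \<le> M" for x M
  using cSUP_least[of UNIV "\<lambda>i. \<bar>J x i\<bar>" M] that J(4)[of x] by (simp add: c0_norm_def)
 define \<Phi> where "\<Phi> = range (\<lambda>i x. J x i)"
 define \<S> where "\<S> = {S. S \<subseteq> \<Phi> \<and> finite S}"
 have \<Phi>: "norming \<Phi>"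
  unfolding norming_def \<Phi>_def using le ge J(1,2) by (auto intro!: linearI)
 have "directed \<S>" unfolding directed_def
 proof (intro conjI ballI)
  show "\<S> \<noteq> {}" unfolding \<S>_def by blast
  show "\<exists>S''\<in>\<S>. S \<union> S' \<subseteq> S''" if "S \<in> \<S>" "S' \<in> \<S>" for S S'
   using that unfolding \<S>_def by (intro bexI[of _ "S \<union> S'"]) auto
 qed
 have dif: "J (x - y) i = J x i - J y i" for x y i
  using J(1)[of "x - y" y i] by simp
 show ?thesis
 proof (rule tail_closedD(4)[OF P \<Phi> \<open>directed \<S>\<close>, of 2])
  fix S \<theta> assume S: "S \<in> \<S>" and \<theta>: "(\<theta> :: real) > 0"
  have "\<bar>\<phi> x\<bar> \<le> 1" if "\<phi> \<in> S" "x \<in> cball 0 1" for \<phi> and x :: 'x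
  proof -
   obtain i where "\<phi> = (\<lambda>x. J x i)" using \<open>\<phi> \<in> S\<close> S unfolding \<S>_def \<Phi>_def by blast
   then show ?thesis using le[of x i] that(2) by simp
  qed
  then have "\<exists>N. finite N \<and> N \<subseteq> cball 0 1 \<and> (\<forall>x\<in>cball 0 1. \<exists>z\<in>N. \<forall>\<phi>\<in>S. \<bar>\<phi> x - \<phi> z\<bar> \<le> \<theta>)"
   using S \<theta> by (intro finite_functional_net[of S _ 1]) (simp_all add: \<S>_def)
  then obtain N where N: "finite N" "N \<subseteq> cball 0 1" "\<And>x. x \<in> cball 0 1 \<Longrightarrow> \<exists>z\<in>N. \<forall>\<phi>\<in>S. \<bar>\<phi> x - \<phi> z\<bar> \<le> \<theta>"
   by blast
  have "\<exists>z\<in>N. u - z \<in> Tail \<Phi> \<S> S \<theta> 2" if u: "u \<in> cball 0 1" for u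
  proof -
   obtain z where z: "z \<in> N" "\<And>\<phi>. \<phi> \<in> S \<Longrightarrow> \<bar>\<phi> u - \<phi> z\<bar> \<le> \<theta>" using N(3)[OF u] by blast
   have "norm z \<le> 1" using z(1) N(2) by auto
   then have "norm (u - z) \<le> 2" using u norm_triangle_ineq4[of u z] by simp
   moreover have "\<bar>\<phi> (u - z)\<bar> \<le> \<theta>" if \<phi>: "\<phi> \<in> S" for \<phi>
   proof -
    obtain i where "\<phi> = (\<lambda>x. J x i)" using \<phi> S unfolding \<S>_def \<Phi>_def by blast
    then show ?thesis using z(2)[OF \<phi>] by (simp add: dif)
   qed
   moreover have "\<exists>S'\<in>\<S>. \<forall>\<phi>\<in>\<Phi> - S'. \<bar>\<phi> (u - z)\<bar> \<le> e" if e: "e > 0" for e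
   proof (rule bexI)
    show "(\<lambda>i x. J x i) ` {i. \<bar>J (u - z) i\<bar> \<ge> e} \<in> \<S>" unfolding \<S>_def \<Phi>_def using fin[OF e] by auto
    show "\<forall>\<phi>\<in>\<Phi> - (\<lambda>i x. J x i) ` {i. \<bar>J (u - z) i\<bar> \<ge> e}. \<bar>\<phi> (u - z)\<bar> \<le> e"
    proof
     fix \<phi> assume \<phi>: "\<phi> \<in> \<Phi> - (\<lambda>i x. J x i) ` {i. \<bar>J (u - z) i\<bar> \<ge> e}"
     then obtain i where i: "\<phi> = (\<lambda>x. J x i)" unfolding \<Phi>_def by blast
     then have "\<not> \<bar>J (u - z) i\<bar> \<ge> e" using \<phi> by blast
     then show "\<bar>\<phi> (u - z)\<bar> \<le> e" using i by simp
    qed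
   qed
   ultimately show ?thesis using z(1) unfolding Tail_def by blast
  qed
  then show "\<exists>Q'. P Q' \<and> (\<forall>u\<in>cball 0 1. \<exists>z\<in>Q'. u - z \<in> Tail \<Phi> \<S> S \<theta> 2)"
   using tail_closed_finite[OF P N(1)] by blast
 qed simp
qed

section \<open>The unit ball of C(K) for scattered K\<close>

definition mult_dirs :: "('x \<Rightarrow> 'k::topological_space \<Rightarrow> real) \<Rightarrow> ('k \<Rightarrow> real) \<Rightarrow> real \<Rightarrow> 'x set" where
 "mult_dirs evl \<psi> a = {x. \<exists>w. continuous_on UNIV w \<and> (\<forall>s. \<bar>w s\<bar> \<le> a) \<and> evl x = (\<lambda>s. \<psi> s * w s)}"

text \<open>A multiplier equal to 1 on a set stands for localisation to that set: the continuous
  multiples of \<open>\<psi>\<close> with factor bounded by 1 form a set of the class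
  \<open>P\<close>.\<close>

definition good_mult :: "('x::real_normed_vector set \<Rightarrow> bool) \<Rightarrow> ('x \<Rightarrow> 'k::topological_space \<Rightarrow> real) \<Rightarrow> ('k \<Rightarrow> real) \<Rightarrow> bool" where
 "good_mult P evl \<psi> \<longleftrightarrow> continuous_on UNIV \<psi> \<and> (\<forall>s. 0 \<le> \<psi> s \<and> \<psi> s \<le> 1) \<and> P (mult_dirs evl \<psi> 1)"

text \<open>The new multiplier is \<open>1 - (1 - \<psi>1) * (1 - \<psi>2)\<close>, which is 1
  wherever one of the two is 1. Its multiple by \<open>w\<close> splits into
  \<open>\<psi>1 * w\<close> and \<open>\<psi>2\<close> times the bounded function
  \<open>(1 - \<psi>1) * w\<close>.\<close>

lemma good_mult_join:
 assumes P: "tail_closed P" and evl: "\<And>x y. evl (x - y) = (\<lambda>s. evl x s - evl y s)" "\<And>g. continuous_on UNIV g \<Longrightarrow> \<exists>x. evl x = g"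
  and g: "good_mult P evl \<psi>1" "good_mult P evl \<psi>2"
 shows "good_mult P evl (\<lambda>s. \<psi>1 s + (1 - \<psi>1 s) * \<psi>2 s)"
proof -
 have c: "continuous_on UNIV \<psi>1" "continuous_on UNIV \<psi>2" and b: "\<And>s. 0 \<le> \<psi>1 s" "\<And>s. \<psi>1 s \<le> 1" "\<And>s. 0 \<le> \<psi>2 s" "\<And>s. \<psi>2 s \<le> 1"
  and P1: "P (mult_dirs evl \<psi>1 1)" and P2: "P (mult_dirs evl \<psi>2 1)"
  using g unfolding good_mult_def by auto
 have "P (mult_dirs evl (\<lambda>s. \<psi>1 s + (1 - \<psi>1 s) * \<psi>2 s) 1)"
 proof (rule tail_closedD(3)[OF P P1 P2])
  fix u assume "u \<in> mult_dirs evl (\<lambda>s. \<psi>1 s + (1 - \<psi>1 s) * \<psi>2 s) 1"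
  then obtain w where w: "continuous_on UNIV w" "\<And>s. \<bar>w s\<bar> \<le> 1" "evl u = (\<lambda>s. (\<psi>1 s + (1 - \<psi>1 s) * \<psi>2 s) * w s)"
   unfolding mult_dirs_def by blast
  obtain z where z: "evl z = (\<lambda>s. \<psi>1 s * w s)" using evl(2)[of "\<lambda>s. \<psi>1 s * w s"] c w(1) by (auto intro: continuous_on_mult)
  have "z \<in> mult_dirs evl \<psi>1 1" unfolding mult_dirs_def using w z by blast
  moreover have "evl (u - z) = (\<lambda>s. \<psi>2 s * ((1 - \<psi>1 s) * w s))" unfolding evl(1) w(3) z by (simp add: algebra_simps)
  moreover have "continuous_on UNIV (\<lambda>s. (1 - \<psi>1 s) * w s)" using c w(1) by (intro continuous_intros)
  moreover have "\<bar>(1 - \<psi>1 s) * w s\<bar> \<le> 1" for s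
   unfolding abs_mult using b(1,2)[of s] w(2)[of s] by (intro mult_le_one) auto
  ultimately show "\<exists>z\<in>mult_dirs evl \<psi>1 1. u - z \<in> mult_dirs evl \<psi>2 1" unfolding mult_dirs_def by blast
 qed
 moreover have "\<psi>1 s + (1 - \<psi>1 s) * \<psi>2 s \<le> 1" for s
  using mult_left_mono[of "\<psi>2 s" 1 "1 - \<psi>1 s"] b[of s] by simp
 ultimately show ?thesis unfolding good_mult_def using c b by (auto intro!: continuous_intros)
qed

text \<open>Let \<open>U\<close> be the open set on which good multipliers are locally 1. If
  \<open>U\<close> were not everything, scatteredness would give a point \<open>p\<close> isolated
  in the complement. A bump at \<open>p\<close> is good, since modulo its own segment its multiples
  vanish at \<open>p\<close> and thus at infinity of \<open>U\<close>; this would put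
  \<open>p\<close> into \<open>U\<close>. Compactness then yields one good multiplier equal to
  1.\<close>

theorem CK_ball_tail_closed:
 fixes P :: "'x::real_normed_vector set \<Rightarrow> bool"
 assumes K: "compact (UNIV :: 'k::t2_space set)" "scattered_space TYPE('k)" "is_CK_space TYPE('x) TYPE('k)"
  and P: "tail_closed P"
 shows "P (cball 0 1)"
proof -
 obtain J :: "'x \<Rightarrow> ('k \<Rightarrow>\<^sub>C real)" where J: "linear J" "bij J" "\<And>x. norm (J x) = norm x"
  using K(3) unfolding is_CK_space_def by blast
 define evl where "evl x = apply_bcontfun (J x)" for x
 have evl_diff: "evl (x - y) = (\<lambda>s. evl x s - evl y s)" for x y
  by (simp add: evl_def linear_diff[OF J(1)] fun_eq_iff)
 have evl_lin: "linear (\<lambda>x. evl x s)" for s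
  by (rule linearI) (simp_all add: evl_def linear_add[OF J(1)] linear_cmul[OF J(1)])
 have evl_cont: "continuous_on UNIV (evl x)" for x
  unfolding evl_def by (rule continuous_on_apply_bcontfun)
 have evl_ex: "\<exists>x. evl x = g" if g: "continuous_on UNIV g" for g :: "'k \<Rightarrow> real"
 proof -
  have "bounded (range g)" by (rule compact_imp_bounded[OF compact_continuous_image[OF g K(1)]])
  then have "g \<in> bcontfun" using g by (simp add: bcontfun_def)
  then have "apply_bcontfun (Bcontfun g) = g" by (rule Bcontfun_inverse)
  moreover obtain x where "J x = Bcontfun g" using J(2) unfolding bij_def surj_def by metis
  ultimately show ?thesis unfolding evl_def by metis
 qed
 have le: "\<bar>evl x s\<bar> \<le> norm x" for x s using norm_bounded[of "J x" s] J(3)[of x] by (simp add: evl_def)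
 have ge: "norm x \<le> M" if "\<And>s. \<bar>evl x s\<bar> \<le> M" for x M
  using norm_bound[of "J x" M] that J(3)[of x] by (simp add: evl_def)
 have closed_compact: "compact C" if "closed C" for C :: "'k set"
  using compact_Int_closed[OF K(1) that] by simp
 define \<Phi> where "\<Phi> = range (\<lambda>s x. evl x s)"
 have \<Phi>: "norming \<Phi>" unfolding norming_def \<Phi>_def using le ge evl_lin by auto
 define U where "U = \<Union>{G. open G \<and> (\<exists>\<psi>. good_mult P evl \<psi> \<and> (\<forall>s\<in>G. \<psi> s = 1))}"
 have good0: "good_mult P evl (\<lambda>_. 0)"
 proof -
  have "x = 0" if "x \<in> mult_dirs evl (\<lambda>_. 0) 1" for x
  proof -
   have "evl x = (\<lambda>_. 0)" using that unfolding mult_dirs_def by auto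
   then have "norm x \<le> 0" by (intro ge) simp
   then show ?thesis by simp
  qed
  then have "P (mult_dirs evl (\<lambda>_. 0) 1)" by (intro tail_closedD(1)[OF P tail_closed_finite[OF P, of "{0}"]]) auto
  then show ?thesis unfolding good_mult_def by simp
 qed
 have cover: "\<exists>\<psi>. good_mult P evl \<psi> \<and> (\<forall>s\<in>C. \<psi> s = 1)" if C: "closed C" "C \<subseteq> U" for C
 proof -
  obtain \<G> where \<G>: "\<G> \<subseteq> {G. open G \<and> (\<exists>\<psi>. good_mult P evl \<psi> \<and> (\<forall>s\<in>G. \<psi> s = 1))}" "finite \<G>" "C \<subseteq> \<Union>\<G>"
   using compactE[OF closed_compact[OF C(1)] C(2)[unfolded U_def]] by blast
  from \<G>(2,1) have "\<exists>\<psi>. good_mult P evl \<psi> \<and> (\<forall>s\<in>\<Union>\<G>. \<psi> s = 1)"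
  proof (induction \<G> rule: finite_induct)
   case empty
   then show ?case using good0 by auto
  next
   case (insert G \<G>)
   then obtain \<psi>1 \<psi>2 where \<psi>: "good_mult P evl \<psi>1" "\<forall>s\<in>G. \<psi>1 s = 1" "good_mult P evl \<psi>2" "\<forall>s\<in>\<Union>\<G>. \<psi>2 s = 1" by auto
   have "\<psi>1 s + (1 - \<psi>1 s) * \<psi>2 s = 1" if "s \<in> \<Union>(insert G \<G>)" for s
   proof (cases "s \<in> G")
    case True
    then show ?thesis using \<psi>(2) by simp
   next
    case False
    then have "\<psi>2 s = 1" using \<psi>(4) that by blast
    then show ?thesis by simp
   qed
   then show ?case using good_mult_join[OF P evl_diff evl_ex \<psi>(1,3)] by blast
  qed
  then show ?thesis using \<G>(3) by blast
 qed
 have "U = UNIV"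
 proof (rule ccontr)
  assume "U \<noteq> UNIV"
  then have "- U \<noteq> {}" by blast
  from K(2)[unfolded scattered_space_def, rule_format, OF this]
  obtain p G where p: "open G" "G \<inter> - U = {p}" by blast
  have "Hausdorff_space (euclidean :: 'k topology)"
   unfolding Hausdorff_space_def disjnt_def using hausdorff by (simp add: open_openin[symmetric]) blast
  then have "normal_space (euclidean :: 'k topology)"
   using K(1) by (intro compact_Hausdorff_or_regular_imp_normal_space) (auto simp: compact_space_def)
  moreover have "closedin euclidean {p}" "closedin euclidean (- G)" "disjnt {p} (- G)"
   using p by (auto simp: disjnt_def closed_Compl)
  ultimately obtain f where f: "continuous_map euclidean (top_of_set {0..1}) f" "f ` {p} \<subseteq> {0 :: real}" "f ` (- G) \<subseteq> {1}"
   using Urysohn_lemma[of euclidean "{p}" "- G" 0 1] by auto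
  have fc: "continuous_on UNIV f" and f01: "\<And>s. 0 \<le> f s" "\<And>s. f s \<le> 1"
   using f(1) by (auto simp: continuous_map_in_subtopology image_subset_iff)
  \<comment> \<open>Cutting off at 1 makes \<open>h\<close> equal to 1 on the neighbourhood
    \<open>f < 1/2\<close> of \<open>p\<close>, not merely at \<open>p\<close>.\<close>
  define h where "h s = min 1 (2 * (1 - f s))" for s
  have hc: "continuous_on UNIV h" unfolding h_def by (intro continuous_intros fc)
  have h01: "0 \<le> h s" "h s \<le> 1" for s using f01[of s] by (auto simp: h_def)
  have hG: "h s = 0" if "s \<notin> G" for s using f(3) that by (auto simp: h_def)
  have good: "P (mult_dirs evl h 1)"
  proof -
   obtain xh where xh: "evl xh = h" using evl_ex[OF hc] by blast
   \<comment> \<open>What remains of the multiples \<open>h * w\<close> after subtracting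
     \<open>w p\<close> times \<open>h\<close>; the bound on the factor doubles.\<close>
   define Q where "Q = {x. \<exists>w. continuous_on UNIV w \<and> (\<forall>s. \<bar>w s\<bar> \<le> 2) \<and> w p = 0 \<and> evl x = (\<lambda>s. h s * w s)}"
   \<comment> \<open>Evaluations on closed subsets of \<open>U\<close>: by \<open>cover\<close>,
     good multipliers can be made equal to 1 there.\<close>
   define \<S> where "\<S> = (\<lambda>C. (\<lambda>s x. evl x s) ` C) ` {C. closed C \<and> C \<subseteq> U}"
   have dir: "directed \<S>" unfolding directed_def
   proof (intro conjI ballI)
    show "\<S> \<noteq> {}" unfolding \<S>_def by blast
    fix S S' assume "S \<in> \<S>" "S' \<in> \<S>"
    then obtain C C' where C: "closed C" "C \<subseteq> U" "S = (\<lambda>s x. evl x s) ` C" "closed C'" "C' \<subseteq> U" "S' = (\<lambda>s x. evl x s) ` C'"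
     unfolding \<S>_def by blast
    then have "(\<lambda>s x. evl x s) ` (C \<union> C') \<in> \<S>" unfolding \<S>_def by (intro imageI) auto
    then show "\<exists>S''\<in>\<S>. S \<union> S' \<subseteq> S''" using C by (intro bexI[of _ "(\<lambda>s x. evl x s) ` (C \<union> C')"]) auto
   qed
   have PQ: "P Q"
   proof (rule tail_closedD(4)[OF P \<Phi> dir, of 2])
    fix S \<theta> assume S: "S \<in> \<S>" and \<theta>: "(\<theta> :: real) > 0"
    then obtain C where C: "closed C" "C \<subseteq> U" "S = (\<lambda>s x. evl x s) ` C" unfolding \<S>_def by blast
    obtain \<psi> where \<psi>: "good_mult P evl \<psi>" "\<And>s. s \<in> C \<Longrightarrow> \<psi> s = 1" using cover[OF C(1,2)] by blast
    have \<psi>c: "continuous_on UNIV \<psi>" and \<psi>01: "\<And>s. 0 \<le> \<psi> s" "\<And>s. \<psi> s \<le> 1" and P\<psi>: "P (mult_dirs evl \<psi> 1)"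
     using \<psi>(1) unfolding good_mult_def by auto
    have "P (mult_dirs evl \<psi> 2)"
    proof (rule tail_closedD(3)[OF P P\<psi> P\<psi>])
     fix u assume "u \<in> mult_dirs evl \<psi> 2"
     then obtain w where w: "continuous_on UNIV w" "\<And>s. \<bar>w s\<bar> \<le> 2" "evl u = (\<lambda>s. \<psi> s * w s)" unfolding mult_dirs_def by blast
     have c2: "continuous_on UNIV (\<lambda>s. w s / 2)" and b2: "\<forall>s. \<bar>w s / 2\<bar> \<le> 1" using w(1,2) by (auto intro!: continuous_intros)
     obtain z where z: "evl z = (\<lambda>s. \<psi> s * (w s / 2))" using evl_ex[OF continuous_on_mult[OF \<psi>c c2]] by blast
     have "evl (u - z) = (\<lambda>s. \<psi> s * (w s / 2))" unfolding evl_diff w(3) z by (simp add: field_simps)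
     then have "z \<in> mult_dirs evl \<psi> 1" "u - z \<in> mult_dirs evl \<psi> 1" unfolding mult_dirs_def using z c2 b2 by blast+
     then show "\<exists>z\<in>mult_dirs evl \<psi> 1. u - z \<in> mult_dirs evl \<psi> 1" by blast
    qed
    moreover have "\<exists>z\<in>mult_dirs evl \<psi> 2. u - z \<in> Tail \<Phi> \<S> S \<theta> 2" if u: "u \<in> Q" for u
    proof -
     obtain w where w: "continuous_on UNIV w" "\<And>s. \<bar>w s\<bar> \<le> 2" "w p = 0" "evl u = (\<lambda>s. h s * w s)" using u unfolding Q_def by blast
     have hw: "\<bar>h s * w s\<bar> \<le> 2" for s using mult_mono[of "h s" 1 "\<bar>w s\<bar>" 2] h01[of s] w(2)[of s] by (simp add: abs_mult)
     have hwc: "continuous_on UNIV (\<lambda>s. h s * w s)" by (intro continuous_intros hc w(1))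
     obtain z where z: "evl z = (\<lambda>s. \<psi> s * (h s * w s))" using evl_ex[OF continuous_on_mult[OF \<psi>c hwc]] by blast
     have zD: "z \<in> mult_dirs evl \<psi> 2" unfolding mult_dirs_def using z hwc hw by blast
     have e: "evl (u - z) s = (1 - \<psi> s) * (h s * w s)" for s unfolding evl_diff w(4) z by (simp add: algebra_simps)
     have le2: "\<bar>evl (u - z) s\<bar> \<le> \<bar>h s * w s\<bar>" for s
      unfolding e abs_mult[of "1 - \<psi> s"] using \<psi>01[of s] mult_right_mono[of "1 - \<psi> s" 1 "\<bar>h s * w s\<bar>"] by simp
     have "norm (u - z) \<le> 2" using le2 hw order_trans by (intro ge) blast
     moreover have "\<forall>\<phi>\<in>S. \<bar>\<phi> (u - z)\<bar> \<le> \<theta>" unfolding C(3) using e \<psi>(2) \<theta> by auto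
     moreover have "\<exists>S'\<in>\<S>. \<forall>\<phi>\<in>\<Phi> - S'. \<bar>\<phi> (u - z)\<bar> \<le> \<epsilon>" if \<epsilon>: "\<epsilon> > 0" for \<epsilon>
     proof -
      define C' where "C' = {s. \<epsilon> \<le> \<bar>evl (u - z) s\<bar>}"
      have "closed C'" unfolding C'_def using evl_cont by (intro closed_Collect_le continuous_intros)
      \<comment> \<open>\<open>p\<close> is the only point of \<open>G\<close> outside
        \<open>U\<close>, and the function vanishes at \<open>p\<close> and off
        \<open>G\<close>.\<close>
      moreover have "C' \<subseteq> U"
      proof
       fix s assume s: "s \<in> C'"
       have "h s * w s \<noteq> 0" using s le2[of s] \<epsilon> unfolding C'_def by auto
       then have "s \<in> G" "s \<noteq> p" using hG w(3) by auto
       then show "s \<in> U" using p(2) by blast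
      qed
      ultimately have "(\<lambda>s x. evl x s) ` C' \<in> \<S>" unfolding \<S>_def by blast
      moreover have "\<bar>\<phi> (u - z)\<bar> \<le> \<epsilon>" if \<phi>: "\<phi> \<in> \<Phi> - (\<lambda>s x. evl x s) ` C'" for \<phi>
      proof -
       obtain s where s: "\<phi> = (\<lambda>x. evl x s)" using \<phi> unfolding \<Phi>_def by blast
       then have "s \<notin> C'" using \<phi> by blast
       then show ?thesis using s unfolding C'_def by simp
      qed
      ultimately show ?thesis by blast
     qed
     ultimately show ?thesis using zD unfolding Tail_def by blast
    qed
    ultimately show "\<exists>Q'. P Q' \<and> (\<forall>u\<in>Q. \<exists>z\<in>Q'. u - z \<in> Tail \<Phi> \<S> S \<theta> 2)" by blast
   qed simp
   show ?thesis
   proof (rule tail_closedD(3)[OF P tail_closedD(2)[OF P, of xh] PQ])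
    fix u assume "u \<in> mult_dirs evl h 1"
    then obtain w where w: "continuous_on UNIV w" "\<And>s. \<bar>w s\<bar> \<le> 1" "evl u = (\<lambda>s. h s * w s)" unfolding mult_dirs_def by blast
    have "w p *\<^sub>R xh \<in> seg xh" unfolding seg_def using w(2)[of p] by blast
    moreover have "evl (u - w p *\<^sub>R xh) = (\<lambda>s. h s * (w s - w p))"
     unfolding evl_diff w(3) using linear_cmul[OF evl_lin] xh by (simp add: fun_eq_iff algebra_simps)
    moreover have "\<bar>w s - w p\<bar> \<le> 2" for s using w(2)[of s] w(2)[of p] by linarith
    moreover have "continuous_on UNIV (\<lambda>s. w s - w p)" by (intro continuous_intros w(1))
    ultimately show "\<exists>z\<in>seg xh. u - z \<in> Q"
     unfolding Q_def by (intro bexI[of _ "w p *\<^sub>R xh"] CollectI exI[of _ "\<lambda>s. w s - w p"]) auto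
   qed
  qed
  have "open {s. f s < 1/2}" by (intro open_Collect_less continuous_intros fc)
  moreover have "good_mult P evl h" unfolding good_mult_def using hc h01 good by blast
  moreover have "\<forall>s\<in>{s. f s < 1/2}. h s = 1" by (auto simp: h_def)
  ultimately have "{s. f s < 1/2} \<subseteq> U" unfolding U_def by blast
  moreover have "p \<in> {s. f s < 1/2}" using f(2) by simp
  ultimately have "p \<in> U" by blast
  then show False using p(2) by blast
 qed
 then obtain \<psi> where \<psi>: "good_mult P evl \<psi>" "\<And>s. \<psi> s = 1" using cover[of UNIV] by auto
 show ?thesis
 proof (rule tail_closedD(1)[OF P])
  show "P (mult_dirs evl \<psi> 1)" using \<psi>(1) unfolding good_mult_def by blast
  show "cball 0 1 \<subseteq> mult_dirs evl \<psi> 1"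
  proof
   fix x :: 'x assume "x \<in> cball 0 1"
   then have "\<bar>evl x s\<bar> \<le> 1" for s using le[of x s] by simp
   then show "x \<in> mult_dirs evl \<psi> 1" unfolding mult_dirs_def using evl_cont[of x] \<psi>(2) by auto
  qed
 qed
qed


section \<open>Differentiability\<close>

text \<open>Differentiability through inequalities between values of \<open>f\<close>; for fixed
  parameters they are closed conditions on \<open>x\<close>. Additivity is included because
  convergence of the quotients, even uniform, does not make the limit linear.\<close>

definition diffq :: "('x::real_normed_vector \<Rightarrow> 'y::real_normed_vector) \<Rightarrow> real \<Rightarrow> real \<Rightarrow> 'x \<Rightarrow> bool" where
 "diffq f d e x \<longleftrightarrow> (\<forall>s s' u v. 0 < s \<and> s < d \<and> 0 < s' \<and> s' < d \<and> norm u \<le> 1 \<and> norm v \<le> 1 \<longrightarrow>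
   norm (quot f x u s - quot f x u s') \<le> e \<and> norm (quot f x (u + v) s - quot f x u s - quot f x v s) \<le> e)"

text \<open>Homogeneity for nonnegative scalars is automatic, so additivity, tested in the unit ball
  and extended by scaling, makes the limit linear; uniformity on the ball then turns it into a
  Frechet derivative.\<close>

lemma differentiable_additive:
 fixes f :: "'x::real_normed_vector \<Rightarrow> 'y::banach"
 assumes f: "C-lipschitz_on UNIV f" and x: "x \<in> Fd f (cball 0 1)"
  and add: "\<And>u v y z. norm u \<le> 1 \<Longrightarrow> norm v \<le> 1 \<Longrightarrow> dlim f x u y \<Longrightarrow> dlim f x v z \<Longrightarrow> dlim f x (u + v) (y + z)"
 shows "f differentiable (at x)"
proof -
 have "\<exists>y. dlim f x u y" for u
 proof (cases "u = 0")
  case False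
  have "\<exists>y. dlim f x (u /\<^sub>R norm u) y" by (rule dlim_exists[OF x]) (use False in simp)
  then obtain y where "dlim f x (u /\<^sub>R norm u) y" ..
  then have "dlim f x (norm u *\<^sub>R (u /\<^sub>R norm u)) (norm u *\<^sub>R y)" by (rule dlim_scale) simp
  then show ?thesis using False by auto
 qed (use dlim_zero in auto)
 then obtain D where D: "\<And>u. dlim f x u (D u)" by metis
 have sc: "D (a *\<^sub>R u) = a *\<^sub>R D u" if "a \<ge> 0" for a u
  by (rule dlim_unique[OF D dlim_scale[OF D that]])
 have Dadd: "D (u + v) = D u + D v" for u v
 proof -
  define a where "a = inverse (norm u + norm v + 1)"
  have p: "norm u + norm v + 1 > 0" using norm_ge_zero[of u] norm_ge_zero[of v] by linarith
  then have a: "a > 0" by (simp add: a_def)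
  have "norm (a *\<^sub>R u) \<le> 1" "norm (a *\<^sub>R v) \<le> 1"
   using a p by (simp_all add: a_def divide_inverse[symmetric] mult.commute[of "inverse _"])
  from dlim_unique[OF D add[OF this D D]] have "D (a *\<^sub>R (u + v)) = D (a *\<^sub>R u) + D (a *\<^sub>R v)"
   by (simp only: scaleR_right_distrib)
  then have "a *\<^sub>R D (u + v) = a *\<^sub>R (D u + D v)" unfolding sc[OF less_imp_le[OF a]] by (simp only: scaleR_right_distrib)
  then show ?thesis using a by simp
 qed
 have D0: "D 0 = 0" using sc[of 0 0] by simp
 have Dneg: "D (- u) = - D u" for u using Dadd[of u "- u"] D0 by (simp add: eq_neg_iff_add_eq_0 add.commute)
 have Dsc: "D (a *\<^sub>R u) = a *\<^sub>R D u" for a u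
  using sc[of a u] sc[of "- a" u] Dneg[of "a *\<^sub>R u"] by (cases "a \<ge> 0") simp_all
 have "bounded_linear D"
  using dlim_norm_le[OF D f] by (intro bounded_linear_intro[of _ C]) (auto simp: Dadd Dsc mult.commute)
 moreover have "(\<lambda>h. norm (f (x + h) - f x - D h) / norm h) \<midarrow>0\<rightarrow> 0"
 proof (rule LIM_I)
  fix e :: real assume e: "e > 0"
  have "fdq f (cball 0 1) (e/2) x" using x e by (auto simp: Fd_def)
  then obtain d where d: "d > 0" "\<And>s s' u. 0 < s \<Longrightarrow> s < d \<Longrightarrow> 0 < s' \<Longrightarrow> s' < d \<Longrightarrow> u \<in> cball 0 1 \<Longrightarrow>
    norm (quot f x u s - quot f x u s') \<le> e/2" by (elim fdqE) blast
  have "norm (norm (f (x + h) - f x - D h) / norm h - 0) < e" if h: "h \<noteq> 0" "norm h < d" for h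
  proof -
   define s where "s = norm h"
   define u where "u = h /\<^sub>R s"
   have s: "0 < s" "s < d" and u: "u \<in> cball 0 1" "h = s *\<^sub>R u" using h by (auto simp: s_def u_def)
   have "((\<lambda>s'. norm (quot f x u s - quot f x u s')) \<longlongrightarrow> norm (quot f x u s - D u)) (at_right 0)"
    using D[of u] unfolding dlim_def by (intro tendsto_intros)
   then have "norm (quot f x u s - D u) \<le> e/2"
   proof (rule tendsto_upperbound)
    show "\<forall>\<^sub>F s' in at_right 0. norm (quot f x u s - quot f x u s') \<le> e/2"
     unfolding eventually_at_right_field using d(1) d(2)[OF s _ _ u(1)] by blast
   qed simp
   moreover have "(f (x + h) - f x - D h) /\<^sub>R s = quot f x u s - D u"
    using s unfolding quot_def u(2) Dsc by (simp add: scaleR_right_diff_distrib)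
   then have "norm (f (x + h) - f x - D h) / norm h = norm (quot f x u s - D u)"
    using s by (metis divide_inverse mult.commute norm_scaleR s_def abs_inverse abs_norm_cancel)
   ultimately show ?thesis using e by simp
  qed
  then show "\<exists>r>0. \<forall>h. h \<noteq> 0 \<and> norm (h - 0) < r \<longrightarrow> norm (norm (f (x + h) - f x - D h) / norm h - 0) < e"
   using d(1) by (intro exI[of _ d]) simp
 qed
 ultimately have "(f has_derivative D) (at x)" by (simp add: has_derivative_at)
 then show ?thesis by (rule differentiableI)
qed

lemma Reg_ball_differentiable:
 fixes f :: "'x::real_normed_vector \<Rightarrow> 'y::banach"
 assumes "C-lipschitz_on UNIV f" "x \<in> Reg f (cball 0 1)"
 shows "f differentiable (at x)"
 using assms(2) Reg_Fd dlim_add[OF assms(2)] by (intro differentiable_additive[OF assms(1)]) auto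

lemma differentiable_iff_diffq:
 fixes f :: "'x::real_normed_vector \<Rightarrow> 'y::banach"
 assumes f: "C-lipschitz_on UNIV f"
 shows "f differentiable (at x) \<longleftrightarrow> (\<forall>e>0. \<exists>d>0. diffq f d e x)"
proof
 assume "f differentiable (at x)"
 then obtain D where D: "bounded_linear D" "\<And>e. e > 0 \<Longrightarrow> \<exists>d>0. \<forall>y. norm (y - x) < d \<longrightarrow> norm (f y - f x - D (y - x)) \<le> e * norm (y - x)"
  unfolding differentiable_def has_derivative_at_alt by blast
 interpret bounded_linear D by (rule D(1))
 show "\<forall>e>0. \<exists>d>0. diffq f d e x"
 proof (intro allI impI)
  fix e :: real assume e: "e > 0"
  then have "e/8 > 0" by simp
  from D(2)[OF this] obtain d where d: "d > 0" "\<And>y. norm (y - x) < d \<Longrightarrow> norm (f y - f x - D (y - x)) \<le> e/8 * norm (y - x)" by blast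
  have q: "norm (quot f x u s - D u) \<le> e/4" if s: "0 < s" "s < d/2" and u: "norm u \<le> 2" for s u
  proof -
   have su: "norm (s *\<^sub>R u) \<le> s * 2" using s u by simp
   then have "norm (s *\<^sub>R u) < d" using s by linarith
   then have "norm (f (x + s *\<^sub>R u) - f x - D (s *\<^sub>R u)) \<le> e/8 * norm (s *\<^sub>R u)"
    by (rule d(2)[of "x + s *\<^sub>R u", unfolded add_diff_cancel_left'])
   also have "\<dots> \<le> e/8 * (s * 2)" using su e by (intro mult_left_mono) auto
   finally have "norm (f (x + s *\<^sub>R u) - f x - D (s *\<^sub>R u)) / s \<le> e/8 * (s * 2) / s" using s by (intro divide_right_mono) auto
   moreover have "quot f x u s - D u = (f (x + s *\<^sub>R u) - f x - D (s *\<^sub>R u)) /\<^sub>R s"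
    unfolding quot_def scaleR using s by (simp add: scaleR_right_diff_distrib)
   then have "norm (quot f x u s - D u) = norm (f (x + s *\<^sub>R u) - f x - D (s *\<^sub>R u)) / s"
    by (simp only: norm_scaleR abs_inverse abs_of_pos[OF s(1)] divide_inverse mult.commute)
   ultimately show ?thesis using s by simp
  qed
  have "diffq f (d/2) e x"
   unfolding diffq_def
  proof (intro allI impI)
   fix s s' :: real and u v :: 'x
   assume a: "0 < s \<and> s < d/2 \<and> 0 < s' \<and> s' < d/2 \<and> norm u \<le> 1 \<and> norm v \<le> 1"
   then have u: "norm u \<le> 2" "norm v \<le> 2" "norm (u + v) \<le> 2" using norm_triangle_ineq[of u v] by auto
   have 1: "norm (quot f x u s - D u) \<le> e/4" and 2: "norm (quot f x u s' - D u) \<le> e/4"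
    and 3: "norm (quot f x v s - D v) \<le> e/4" and 4: "norm (quot f x (u + v) s - D (u + v)) \<le> e/4"
    using a u q by blast+
   have "norm ((quot f x u s - D u) - (quot f x u s' - D u)) \<le> e/4 + e/4"
    by (intro order_trans[OF norm_triangle_ineq4] add_mono 1 2)
   moreover have "norm ((quot f x (u + v) s - D (u + v)) - (quot f x u s - D u) - (quot f x v s - D v)) \<le> e/4 + e/4 + e/4"
    by (intro order_trans[OF norm_triangle_ineq4] add_mono 1 3 4)
   ultimately show "norm (quot f x u s - quot f x u s') \<le> e \<and> norm (quot f x (u + v) s - quot f x u s - quot f x v s) \<le> e"
    using e by (simp add: add algebra_simps)
  qed
  then show "\<exists>d>0. diffq f d e x" using d(1) by (intro exI[of _ "d/2"]) simp
 qed
next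
 assume a: "\<forall>e>0. \<exists>d>0. diffq f d e x"
 show "f differentiable (at x)"
 proof (rule differentiable_additive[OF f])
  have "fdq f (cball 0 1) e x" if "e > 0" for e
  proof -
   obtain d where d: "d > 0" "diffq f d e x" using a \<open>e > 0\<close> by blast
   have "norm (quot f x u s - quot f x u s') \<le> e" if "0 < s \<and> s < d \<and> 0 < s' \<and> s' < d" "u \<in> cball 0 1" for s s' u
    using d(2) that unfolding diffq_def by (metis mem_cball_0 norm_zero zero_le_one)
   then show ?thesis unfolding fdq_def using d(1) by blast
  qed
  then show "x \<in> Fd f (cball 0 1)" unfolding Fd_def by blast
  fix u v y z assume uv: "norm u \<le> 1" "norm v \<le> 1" and y: "dlim f x u y" and z: "dlim f x v z"
  have "((\<lambda>s. quot f x (u + v) s - quot f x u s - quot f x v s) \<longlongrightarrow> 0) (at_right 0)"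
   unfolding tendsto_at_right_0_iff
  proof (intro allI impI)
   fix e :: real assume "e > 0"
   then obtain d where d: "d > 0" "diffq f d (e/2) x" using a half_gt_zero by blast
   have "norm (quot f x (u + v) s - quot f x u s - quot f x v s) \<le> e/2" if "0 < s" "s < d" for s
    using d(2) that uv unfolding diffq_def by blast
   then show "\<exists>d>0. \<forall>s. 0 < s \<and> s < d \<longrightarrow> norm (quot f x (u + v) s - quot f x u s - quot f x v s - 0) < e"
    using d(1) \<open>e > 0\<close> by (intro exI[of _ d]) fastforce
  qed
  then have "((\<lambda>s. (quot f x (u + v) s - quot f x u s - quot f x v s) + (quot f x u s + quot f x v s)) \<longlongrightarrow> 0 + (y + z)) (at_right 0)"
   using y z unfolding dlim_def by (intro tendsto_add)
  then show "dlim f x (u + v) (y + z)" unfolding dlim_def by simp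
 qed
qed

section \<open>Borel measurability and the conclusion\<close>

lemma non_differentiable_borel:
 fixes f :: "'x::real_normed_vector \<Rightarrow> 'y::banach"
 assumes f: "C-lipschitz_on UNIV f"
 shows "{x. \<not> f differentiable (at x)} \<in> sets borel"
proof -
 have fc: "continuous_on UNIV f" using f by (rule lipschitz_on_continuous_on)
 have qc: "continuous_on UNIV (\<lambda>x. quot f x u s)" for u s
  unfolding quot_def by (intro continuous_intros continuous_on_compose2[OF fc]) auto
 have "closed {x. diffq f d e x}" for d e
  unfolding diffq_def
  by (intro closed_Collect_all closed_Collect_imp open_Collect_const closed_Collect_conj closed_Collect_le continuous_intros qc)
 then have "(\<Inter>n :: nat. \<Union>m :: nat. {x. diffq f (inverse (Suc m)) (inverse (Suc n)) x}) \<in> sets borel"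
  by (intro sets.countable_INT'' sets.countable_UN'' borel_closed) auto
 moreover have "{x. f differentiable (at x)} = (\<Inter>n :: nat. \<Union>m :: nat. {x. diffq f (inverse (Suc m)) (inverse (Suc n)) x})"
 proof -
  have mono: "diffq f d' e' x" if "diffq f d e x" "d' \<le> d" "e \<le> e'" for d e d' e' x
   using that unfolding diffq_def by (meson less_le_trans order_trans)
  have "(\<forall>e>0. \<exists>d>0. diffq f d e x) \<longleftrightarrow> (\<forall>n. \<exists>m. diffq f (inverse (real (Suc m))) (inverse (real (Suc n))) x)" for x
  proof (intro iffI allI impI)
   fix n assume "\<forall>e>0. \<exists>d>0. diffq f d e x"
   then obtain d where d: "d > 0" "diffq f d (inverse (real (Suc n))) x" by (metis inverse_positive_iff_positive of_nat_0_less_iff zero_less_Suc)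
   obtain m where "inverse (real (Suc m)) < d" using reals_Archimedean[OF d(1)] by blast
   then show "\<exists>m. diffq f (inverse (real (Suc m))) (inverse (real (Suc n))) x" using mono[OF d(2)] by (meson less_imp_le order_refl)
  next
   fix e :: real assume a: "\<forall>n. \<exists>m. diffq f (inverse (real (Suc m))) (inverse (real (Suc n))) x" and e: "e > 0"
   obtain n where n: "inverse (real (Suc n)) < e" using reals_Archimedean[OF e] by blast
   obtain m where m: "diffq f (inverse (real (Suc m))) (inverse (real (Suc n))) x" using a by blast
   have "diffq f (inverse (real (Suc m))) e x" by (rule mono[OF m order_refl less_imp_le[OF n]])
   then show "\<exists>d>0. diffq f d e x" by (intro exI[of _ "inverse (real (Suc m))"]) simp
  qed
  then show ?thesis unfolding differentiable_iff_diffq[OF f] by (intro set_eqI) simp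
 qed
 ultimately have "- {x. f differentiable (at x)} \<in> sets borel" by (metis sets.compl_sets space_borel Compl_eq_Diff_UNIV)
 then show ?thesis by (simp add: Collect_neg_eq)
qed

text \<open>Surfaces are Borel maps, so for Borel \<open>A\<close> the preimage is measurable, and a
  measurable set inside a null set is null.\<close>

lemma gamma_null_iff_Gnull:
 assumes A: "A \<in> sets borel" "Gnull A" shows "gamma_null A"
proof -
 have "{t\<in>space lebN. g t \<in> A} \<in> null_sets lebN" if g: "g \<in> GammaX" "om g A = 0" for g
 proof -
  have "g \<in> borel_measurable lebN"
  proof (rule borel_measurableI)
   fix S :: "'a set" assume "open S"
   then have "{t\<in>cubeT. g t \<in> S} \<in> sets lebN" by (rule GammaX_vimage_sets[OF g(1)])
   moreover have "g -` S \<inter> space lebN = {t\<in>cubeT. g t \<in> S}" by auto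
   ultimately show "g -` S \<inter> space lebN \<in> sets lebN" by simp
  qed
  then have "g -` A \<inter> space lebN \<in> sets lebN" using A(1) by (rule measurable_sets)
  moreover have "g -` A \<inter> space lebN = {t\<in>space lebN. g t \<in> A}" by auto
  moreover obtain N where "N \<in> null_sets lebN" "g -` A \<inter> cubeT \<subseteq> N" using g(2) unfolding oT_eq_0_iff by blast
  ultimately show ?thesis by (auto intro: null_sets_subset)
 qed
 then show ?thesis
  unfolding gamma_null_def using A(1) A(2)[unfolded Gnull_def]
  by (intro conjI) (assumption, elim gamma_residual_mono, auto)
qed

lemma tail_closed_porous_null: "tail_closed (porous_null :: 'x::banach set \<Rightarrow> bool)"
 unfolding tail_closed_def
proof (intro conjI allI impI)
 show "porous_null Q" if "norming \<Phi>" "directed \<S>" "0 \<le> M"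
   "\<forall>S\<in>\<S>. \<forall>\<theta>>0. \<exists>Q'. porous_null Q' \<and> (\<forall>u\<in>Q. \<exists>z\<in>Q'. u - z \<in> Tail \<Phi> \<S> S \<theta> M)" for Q :: "'x set" and \<Phi> \<S> M
  using porous_null_tail[OF that(1-3)] that(4) by blast
qed (use porous_null_mono porous_null_seg porous_null_sum in blast)+

text \<open>Boundedness is made part of the class because \<open>Reg_sum\<close> asks for a bound on
  the first summand.\<close>

lemma tail_closed_Gnull_Reg:
 fixes f :: "'x::banach \<Rightarrow> 'y::banach"
 assumes f: "C-lipschitz_on UNIV f" and Y: "RNP TYPE('y)" and PN: "porous_null (cball (0::'x) 1)"
 shows "tail_closed (\<lambda>Q. bounded Q \<and> Gnull (- Reg f Q))"
 unfolding tail_closed_def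
proof (intro conjI allI impI)
 show "bounded Q'" if "bounded Q \<and> Gnull (- Reg f Q)" "Q' \<subseteq> Q" for Q Q' :: "'x set"
  using that bounded_subset by blast
 show "Gnull (- Reg f Q')" if Q: "bounded Q \<and> Gnull (- Reg f Q)" "Q' \<subseteq> Q" for Q Q' :: "'x set"
  by (rule Gnull_mono[OF Q(1)[THEN conjunct2]]) (use Reg_antimono[OF Q(2), of f] in blast)
 show "Gnull (- Reg f (seg v))" for v by (rule Gnull_Reg[OF f PN Gnull_Fd_seg[OF f Y]])
 show "bounded (seg v)" for v :: 'x
  unfolding bounded_iff seg_def by (intro exI[of _ "norm v"]) (auto simp: mult_left_le_one_le)
 have bd: "bounded Q" if Q1: "bounded Q1" and Q2: "bounded Q2" and Q: "\<forall>u\<in>Q. \<exists>z\<in>Q1. u - z \<in> Q2" for Q Q1 Q2 :: "'x set"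
 proof -
  obtain B1 B2 where B: "\<forall>z\<in>Q1. norm z \<le> B1" "\<forall>z\<in>Q2. norm z \<le> B2" using Q1 Q2 unfolding bounded_iff by blast
  have "norm u \<le> B1 + B2" if u: "u \<in> Q" for u
  proof -
   obtain z where z: "z \<in> Q1" "u - z \<in> Q2" using Q u by blast
   have "norm u \<le> norm z + norm (u - z)" using norm_triangle_ineq[of z "u - z"] by simp
   also have "\<dots> \<le> B1 + B2" using B z by (intro add_mono) auto
   finally show ?thesis .
  qed
  then show ?thesis unfolding bounded_iff by blast
 qed
 show "bounded Q" if "bounded Q1 \<and> Gnull (- Reg f Q1)" "bounded Q2 \<and> Gnull (- Reg f Q2)" "\<forall>u\<in>Q. \<exists>z\<in>Q1. u - z \<in> Q2" for Q Q1 Q2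
  using bd[of Q1 Q2 Q] that by blast
 show "Gnull (- Reg f Q)" if Q1: "bounded Q1 \<and> Gnull (- Reg f Q1)" and Q2: "bounded Q2 \<and> Gnull (- Reg f Q2)"
   and Q: "\<forall>u\<in>Q. \<exists>z\<in>Q1. u - z \<in> Q2" for Q Q1 Q2
 proof -
  obtain M where M: "\<And>z. z \<in> Q1 \<Longrightarrow> norm z \<le> M" using Q1 unfolding bounded_iff by blast
  have "Reg f Q1 \<inter> Reg f Q2 \<subseteq> Reg f Q" using Reg_sum[of Q Q1 Q2 M _ f] Q M by blast
  moreover have "Gnull (- Reg f Q1 \<union> - Reg f Q2)" using Q1 Q2 Gnull_Un by blast
  ultimately show ?thesis by (elim Gnull_mono) blast
 qed
 fix Q :: "'x set" and \<Phi> \<S> M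
 assume a: "norming \<Phi>" "directed \<S>" "0 \<le> M"
  "\<forall>S\<in>\<S>. \<forall>\<theta>>0. \<exists>Q'. (bounded Q' \<and> Gnull (- Reg f Q')) \<and> (\<forall>u\<in>Q. \<exists>z\<in>Q'. u - z \<in> Tail \<Phi> \<S> S \<theta> M)"
 show "Gnull (- Reg f Q)" by (rule Gnull_Reg_tail[OF f Y PN a(1-3)]) (use a(4) in blast)
 obtain S where "S \<in> \<S>" using a(2) unfolding directed_def by blast
 then obtain Q' where Q': "bounded Q'" "\<forall>u\<in>Q. \<exists>z\<in>Q'. u - z \<in> Tail \<Phi> \<S> S 1 M" using a(4) zero_less_one by blast
 have "bounded (Tail \<Phi> \<S> S 1 M)" unfolding bounded_iff Tail_def by blast
 then show "bounded Q" using bd Q' by blast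
qed

theorem mainTheorem20:
 fixes f :: "'x::banach \<Rightarrow> 'y::banach"
 assumes X: "(compact (UNIV :: 'k::t2_space set) \<and> scattered_space TYPE('k)
        \<and> is_CK_space TYPE('x) TYPE('k))
       \<or> is_c0_subspace TYPE('x) TYPE('g)"
  and Y: "RNP TYPE('y)"
  and f: "\<exists>C. C-lipschitz_on UNIV f"
 shows "gamma_null {x. \<not> f differentiable (at x)}"
proof -
 obtain C where C: "C-lipschitz_on UNIV f" using f by blast
 have ball: "P (cball 0 1)" if "tail_closed P" for P :: "'x set \<Rightarrow> bool"
  using X CK_ball_tail_closed[OF _ _ _ that] c0_ball_tail_closed[OF _ that] by blast
 \<comment> \<open>The ball is reached twice: first for the class of small sets, which supplies the
   hypothesis \<open>PN\<close>, then for the class of good sets, which depends on it.\<close>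
 have "Gnull (- Reg f (cball 0 1))"
  using ball[OF tail_closed_Gnull_Reg[OF C Y ball[OF tail_closed_porous_null]]] by blast
 then have "Gnull {x. \<not> f differentiable (at x)}"
  using Reg_ball_differentiable[OF C] by (elim Gnull_mono) blast
 then show ?thesis by (rule gamma_null_iff_Gnull[OF non_differentiable_borel[OF C]])
qed

end
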